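(* Let $\mathcal{G}=(S,\mathcal{F},\mathcal{L})$ be a $p$-local compact group of rank $1$ (i.e. $S$ has rank $1$), and let $\Psi$ be an unstable Adams operation on $\mathcal{G}$ (of high enough degree, in the sense of the standing assumptions (a), (b) in the context). Then $\Psi$ induces an approximation of $\mathcal{G}$ by $p$-local finite groups, in the sense defined at the end of the context.
   Context: Fusion systems. Fix a prime $p$. A discrete $p$-toral group $P$ is a group with a normal subgroup $T_P\cong(\mathbb{Z}/p^\infty)^r$ (its maximal torus; $r=\mathrm{rk}(P)$ is its rank) of finite $p$-power index; orders $|P|=(\mathrm{rk}(P),|P/T_P|)$ are compared lexicographically. A fusion system $\mathcal{F}$ over a discrete $p$-toral group $S$ is a category whose objects are all subgroups of $S$, with $\mathrm{Hom}_S(P,Q)\subseteq\mathrm{Hom}_{\mathcal{F}}(P,Q)\subseteq\mathrm{Inj}(P,Q)$ ($\mathrm{Hom}_S$: maps $c_g:x\mapsto gxg^{-1}$ with $g\in N_S(P,Q)=\{g\in S: gPg^{-1}\le Q\}$), every morphism being an $\mathcal{F}$-isomorphism followed by an inclusion. $P^{\mathcal{F}}$ is the set of subgroups $\mathcal{F}$-isomorphic to $P$ (its $\mathcal{F}$-conjugates). $P$ is fully $\mathcal{F}$-normalized (resp. fully $\mathcal{F}$-centralized) if $|N_S(P)|$ (resp. $|C_S(P)|$) is maximal on $P^{\mathcal{F}}$. $\mathcal{F}$ is saturated if: (I) if $P$ is fully normalized then it is fully centralized, $\mathrm{Out}_{\mathcal{F}}(P)=\mathrm{Aut}_{\mathcal{F}}(P)/\mathrm{Inn}(P)$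 is finite and $\mathrm{Out}_S(P)\in\mathrm{Syl}_p(\mathrm{Out}_{\mathcal{F}}(P))$; (II) if $f\in\mathrm{Hom}_{\mathcal{F}}(P,S)$ has fully centralized image then $f$ extends in $\mathcal{F}$ to $N_f=\{g\in N_S(P): fc_gf^{-1}\in\mathrm{Aut}_S(f(P))\}$; (III) a homomorphism on an increasing union $\bigcup P_n\le S$ into $S$ whose restrictions to all $P_n$ are in $\mathcal{F}$ is in $\mathcal{F}$. $P$ is $\mathcal{F}$-centric if $C_S(P')=Z(P')$ for all $P'\in P^{\mathcal{F}}$; $\mathcal{F}^c$ is the full subcategory of $\mathcal{F}$-centric subgroups. Linking systems. A centric linking system associated to a saturated $\mathcal{F}$ is a category $\mathcal{L}$ with objects the $\mathcal{F}$-centric subgroups, a functor $\rho:\mathcal{L}\to\mathcal{F}^c$ and monomorphisms $\delta_P:P\to\mathrm{Aut}_{\mathcal{L}}(P)$ such that (A) $\rho$ is the identity on objects, $Z(P)$ acts freely on $\mathrm{Mor}_{\mathcal{L}}(P,Q)$ via $\delta_P$ and composition, and $\rho$ induces $\mathrm{Mor}_{\mathcal{L}}(P,Q)/Z(P)\cong\mathrm{Hom}_{\mathcal{F}}(P,Q)$; (B) $\rho(\delta_P(g))=c_g$; (C) $\varphi\circ\delta_P(g)=\delta_Q(\rho(\varphi)(g))\circ\varphi$. A $p$-local compact group is $\mathcal{G}=(S,\mathcal{F},\mathcal{L})$; $T=T_S$ is its maximal torus. Fix liftings $\iota_{P,S}\in\mathrm{Mor}_{\mathcal{L}}(P,S)$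 of the inclusions ($\iota_{S,S}=\mathrm{id}$); they determine unique compatible liftings $\iota_{P,Q}$ of inclusions and unique injections $\delta_{P,Q}:N_S(P,Q)\to\mathrm{Mor}_{\mathcal{L}}(P,Q)$ with $\iota_{Q,S}\circ\delta_{P,Q}(g)=\delta_S(g)\circ\iota_{P,S}$, extending the $\delta_P$. The functor $(-)^\bullet$. Let $W=\mathrm{Aut}_{\mathcal{F}}(T)$ and let $p^e$ be the exponent of $S/T$. For $A\le T$ let $I(A)=\{t\in T:\omega(t)=t\ \forall\omega\in W\text{ with }\omega|_A=\mathrm{id}\}$, with maximal torus $I(A)_0$. For $P\le S$ put $P^{[e]}=\{x^{p^e}:x\in P\}\subseteq T$ (or the subgroup it generates) and $P^\bullet=P\cdot I(P^{[e]})_0$. $\mathcal{F}^\bullet\subseteq\mathcal{F}$ (resp. $\mathcal{L}^\bullet\subseteq\mathcal{L}$) is the full subcategory on the ($\mathcal{F}$-centric) subgroups of the form $P^\bullet$. Every $f\in\mathrm{Hom}_{\mathcal{F}}(P,Q)$ extends uniquely to $f^\bullet\in\mathrm{Hom}_{\mathcal{F}}(P^\bullet,Q^\bullet)$, and there are finitely many $S$-conjugacy classes in $\mathcal{F}^\bullet$. Operations. An unstable Adams operation of degree $\zeta\in(\mathbb{Z}_p^\wedge)^\times$ on $\mathcal{G}$ is a pair $(\psi,\Psi)$ (written $\Psi$) with $\psi\in\mathrm{Aut}(S)$ fusion preserving ($\psi f\psi^{-1}\in\mathrm{Mor}(\mathcal{F})$ for $f\in\mathrm{Mor}(\mathcal{F})$)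 and $\Psi$ an automorphism of $\mathcal{L}$ such that $\psi$ is the $\zeta$-power map on $T$ and the identity on $S/T$; $\Psi(P)=\psi(P)$; $\rho(\Psi(\varphi))=\psi\rho(\varphi)\psi^{-1}$; $\Psi(\delta_{P,Q}(g))=\delta_{\psi(P),\psi(Q)}(\psi(g))$. Put $\Psi_0=\Psi$, $\Psi_{i+1}=(\Psi_i)^p$ ($p$-fold iterate), write $\Psi_i(x)$ also for the action on $x\in S$, $S_i=\{x\in S:\Psi_i(x)=x\}$, and $R_i=R\cap S_i$ for $R\le S$. A subgroup $P\in\mathrm{Ob}(\mathcal{F}^\bullet)$ is $S_i$-determined if $(P\cap S_i)^\bullet=P$. Standing assumptions on $\Psi$: (a) $T_i\subsetneq T_{i+1}$ for all $i$ and $T=\bigcup_iT_i$; (b) there are a (finite) set $\mathcal{H}$ of representatives of the $S$-conjugacy classes in $\mathrm{Ob}(\mathcal{L}^\bullet)$ and, for $P,R\in\mathcal{H}$, a set $\widehat{\mathcal{M}}_{P,R}\subseteq\mathrm{Iso}_{\mathcal{L}}(P,R)$ of representatives of the classes of isomorphisms in $\mathrm{Rep}_{\mathcal{F}}(P,R)=\mathrm{Inn}(R)\backslash\mathrm{Hom}_{\mathcal{F}}(P,R)$, such that $\Psi$ fixes every $P\in\mathcal{H}$ and every $\varphi\in\widehat{\mathcal{M}}_{P,R}$, and every $P\in\mathcal{H}$ is $S_i$-determined for all $i$. Strongly fixed points. $\mathcal{H}_i^\bullet=\{R\in\mathrm{Ob}(\mathcal{L}^\bullet):R\text{ is }S_i\text{-determined}\}$,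 $\mathcal{H}_i=\{R\cap S_i:R\in\mathcal{H}_i^\bullet\}$, $\widehat{\mathcal{H}}_i$ is the set of subgroups of $S_i$ containing a member of $\mathcal{H}_i$. For $P,R\in\mathcal{H}_i^\bullet$, $\mathrm{Mor}_{\mathcal{L},i}(P,R)=\{\varphi\in\mathrm{Mor}_{\mathcal{L}}(P,R):\Psi_i(\varphi)=\varphi\}$; for such $\varphi$, $\rho(\varphi)$ restricts to $P_i\to R_i$, and $A(P_i,R_i)$ is the set of these restrictions. $\mathcal{F}_i$ is the fusion system over $S_i$ whose morphisms are composites of restrictions of morphisms in the sets $A(P_i,R_i)$. $\mathcal{L}_i$ is the category with object set $\widehat{\mathcal{H}}_i$ and $\mathrm{Mor}_{\mathcal{L}_i}(H,K)=\{\varphi\in\mathrm{Mor}_{\mathcal{L},i}(H^\bullet,K^\bullet):\rho(\varphi)(H)\le K\}$, composition as in $\mathcal{L}$. Approximation. $\Psi$ approximates $\mathcal{G}$ by $p$-local finite groups (equivalently, induces an approximation of $\mathcal{G}$ by $p$-local finite groups) if there is $M'_\Psi$ such that for all $i\ge M'_\Psi$, every $\mathcal{F}_i$-centric subgroup $H\le S_i$ with $H\notin\mathrm{Ob}(\mathcal{L}_i)$ is $\mathcal{F}_i$-conjugate to some $K\le S_i$ with $\mathrm{Out}_{S_i}(K)\cap O_p(\mathrm{Out}_{\mathcal{F}_i}(K))\ne\{1\}$, where $O_p(G)$ is the largest normal $p$-subgroup of $G$. *)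

theory Defs
  imports Complex_Main "HOL-Algebra.Group_Action" "HOL-Algebra.Product_Groups" "HOL-Computational_Algebra.Primes"
begin

section \<open>Discrete p-toral groups\<close>

text \<open>The group \<open>\<int>/p\<^sup>\<infinity>\<close>, as the complex roots of unity of \<open>p\<close>-power order.\<close>

definition prufer_group :: "nat \<Rightarrow> complex monoid" where
  "prufer_group p = \<lparr>carrier = {z. \<exists>n. z ^ (p ^ n) = 1}, monoid.mult = (*), one = 1\<rparr>"

abbreviation sub_group :: "('a, 'b) monoid_scheme \<Rightarrow> 'a set \<Rightarrow> ('a, 'b) monoid_scheme"
    (infixl \<open>\<downharpoonright>\<close> 90) where
  "G \<downharpoonright> P \<equiv> G\<lparr>carrier := P\<rparr>"

definition is_max_torus :: "nat \<Rightarrow> ('a, 'b) monoid_scheme \<Rightarrow> 'a set \<Rightarrow> nat \<Rightarrow> bool" where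
  "is_max_torus p G T r \<longleftrightarrow>
     T \<lhd> G \<and> (G \<downharpoonright> T) \<cong> product_group {..<r} (\<lambda>_. prufer_group p) \<and>
     (\<exists>k. order (G Mod T) = p ^ k)"

definition discrete_p_toral :: "nat \<Rightarrow> ('a, 'b) monoid_scheme \<Rightarrow> bool" where
  "discrete_p_toral p G \<longleftrightarrow> group G \<and> (\<exists>T r. is_max_torus p G T r)"

text \<open>In a discrete \<open>p\<close>-toral group both the maximal torus and the rank are unique.\<close>

definition torus :: "nat \<Rightarrow> ('a, 'b) monoid_scheme \<Rightarrow> 'a set" where
  "torus p G = (THE T. \<exists>r. is_max_torus p G T r)"

definition rk :: "nat \<Rightarrow> ('a, 'b) monoid_scheme \<Rightarrow> nat" where
  "rk p G = (THE r. \<exists>T. is_max_torus p G T r)"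

definition toral_order :: "nat \<Rightarrow> ('a, 'b) monoid_scheme \<Rightarrow> nat \<times> nat" where
  "toral_order p G = (rk p G, order (G Mod torus p G))"

definition lex_le :: "nat \<times> nat \<Rightarrow> nat \<times> nat \<Rightarrow> bool" where
  "lex_le x y \<longleftrightarrow> x = y \<or> (x, y) \<in> less_than <*lex*> less_than"


section \<open>Fusion systems\<close>

text \<open>
  A fusion system over \<open>G\<close> is given by its morphism sets \<open>F P Q\<close>, for \<open>P\<close> and \<open>Q\<close> subgroups of
  \<open>G\<close>; the values of \<open>F\<close> at other sets play no role. A morphism \<open>P \<rightarrow> Q\<close> is a function that is
  \<^const>\<open>undefined\<close> outside \<open>P\<close>, so a morphism and its composite with an inclusion into a larger
  target are the same function.
\<close>

type_synonym 'a fusion = "'a set \<Rightarrow> 'a set \<Rightarrow> ('a \<Rightarrow> 'a) set"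

definition conj_map :: "('a, 'b) monoid_scheme \<Rightarrow> 'a set \<Rightarrow> 'a \<Rightarrow> 'a \<Rightarrow> 'a" where
  "conj_map G P g = (\<lambda>x\<in>P. g \<otimes>\<^bsub>G\<^esub> x \<otimes>\<^bsub>G\<^esub> inv\<^bsub>G\<^esub> g)"

text \<open>The map \<open>f h f\<inverse>\<close> on \<open>f(P)\<close>, for \<open>h\<close> defined on \<open>P\<close> and \<open>f\<close> injective on \<open>P\<close>.\<close>

definition conj_by :: "('a \<Rightarrow> 'a) \<Rightarrow> 'a set \<Rightarrow> ('a \<Rightarrow> 'a) \<Rightarrow> 'a \<Rightarrow> 'a" where
  "conj_by f P h = (\<lambda>y\<in>f ` P. f (h (inv_into P f y)))"

definition transporter :: "('a, 'b) monoid_scheme \<Rightarrow> 'a set \<Rightarrow> 'a set \<Rightarrow> 'a set" where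
  "transporter G P Q = {g \<in> carrier G. conj_map G P g ` P \<subseteq> Q}"

definition centralizer :: "('a, 'b) monoid_scheme \<Rightarrow> 'a set \<Rightarrow> 'a set" where
  "centralizer G P = {g \<in> carrier G. \<forall>x\<in>P. g \<otimes>\<^bsub>G\<^esub> x = x \<otimes>\<^bsub>G\<^esub> g}"

definition center :: "('a, 'b) monoid_scheme \<Rightarrow> 'a set \<Rightarrow> 'a set" where
  "center G P = centralizer (G \<downharpoonright> P) P"

definition hom_conj :: "('a, 'b) monoid_scheme \<Rightarrow> 'a fusion" where
  "hom_conj G P Q = conj_map G P ` transporter G P Q"

definition hom_inj :: "('a, 'b) monoid_scheme \<Rightarrow> 'a fusion" where
  "hom_inj G P Q = mon (G \<downharpoonright> P) (G \<downharpoonright> Q) \<inter> extensional P"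

definition fus_iso :: "'a fusion \<Rightarrow> 'a fusion" where
  "fus_iso F P Q =
     {f \<in> F P Q. \<exists>g\<in>F Q P. compose P g f = (\<lambda>x\<in>P. x) \<and> compose Q f g = (\<lambda>y\<in>Q. y)}"

locale fusion_system = group S for S (structure) +
  fixes F :: "'a fusion"
  assumes hom_conj_subset: "\<lbrakk>subgroup P S; subgroup Q S\<rbrakk> \<Longrightarrow> hom_conj S P Q \<subseteq> F P Q"
    and subset_hom_inj: "\<lbrakk>subgroup P S; subgroup Q S\<rbrakk> \<Longrightarrow> F P Q \<subseteq> hom_inj S P Q"
    and compose_closed: "\<lbrakk>subgroup P S; subgroup Q S; subgroup R S; f \<in> F P Q; g \<in> F Q R\<rbrakk>
           \<Longrightarrow> compose P g f \<in> F P R"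
    and factorization: "\<lbrakk>subgroup P S; subgroup Q S; f \<in> F P Q\<rbrakk>
           \<Longrightarrow> \<exists>R. subgroup R S \<and> R \<subseteq> Q \<and> f \<in> fus_iso F P R"

definition fus_conj :: "('a, 'b) monoid_scheme \<Rightarrow> 'a fusion \<Rightarrow> 'a set \<Rightarrow> 'a set set" where
  "fus_conj G F P = {Q. subgroup Q G \<and> fus_iso F P Q \<noteq> {}}"

definition centric :: "('a, 'b) monoid_scheme \<Rightarrow> 'a fusion \<Rightarrow> 'a set \<Rightarrow> bool" where
  "centric G F P \<longleftrightarrow> subgroup P G \<and> (\<forall>Q\<in>fus_conj G F P. centralizer G Q = center G Q)"

definition fully_normalized :: "nat \<Rightarrow> ('a, 'b) monoid_scheme \<Rightarrow> 'a fusion \<Rightarrow> 'a set \<Rightarrow> bool" where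
  "fully_normalized p G F P \<longleftrightarrow> subgroup P G \<and>
     (\<forall>Q\<in>fus_conj G F P.
        lex_le (toral_order p (G \<downharpoonright> normalizer G Q)) (toral_order p (G \<downharpoonright> normalizer G P)))"

definition fully_centralized :: "nat \<Rightarrow> ('a, 'b) monoid_scheme \<Rightarrow> 'a fusion \<Rightarrow> 'a set \<Rightarrow> bool" where
  "fully_centralized p G F P \<longleftrightarrow> subgroup P G \<and>
     (\<forall>Q\<in>fus_conj G F P.
        lex_le (toral_order p (G \<downharpoonright> centralizer G Q)) (toral_order p (G \<downharpoonright> centralizer G P)))"

definition fus_aut :: "'a fusion \<Rightarrow> 'a set \<Rightarrow> ('a \<Rightarrow> 'a) monoid" where
  "fus_aut F P =
     \<lparr>carrier = fus_iso F P P, monoid.mult = (\<lambda>g f. compose P g f), one = (\<lambda>x\<in>P. x)\<rparr>"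

definition inn :: "('a, 'b) monoid_scheme \<Rightarrow> 'a set \<Rightarrow> ('a \<Rightarrow> 'a) set" where
  "inn G P = conj_map G P ` P"

definition fus_out :: "('a, 'b) monoid_scheme \<Rightarrow> 'a fusion \<Rightarrow> 'a set \<Rightarrow> ('a \<Rightarrow> 'a) set monoid" where
  "fus_out G F P = fus_aut F P Mod inn G P"

definition aut_conj :: "('a, 'b) monoid_scheme \<Rightarrow> 'a set \<Rightarrow> ('a \<Rightarrow> 'a) set" where
  "aut_conj G P = conj_map G P ` normalizer G P"

text \<open>The image of \<open>Out\<^sub>G(P) = Aut\<^sub>G(P)/Inn(P)\<close> in \<^term>\<open>fus_out G F P\<close>.\<close>

definition out_conj :: "('a, 'b) monoid_scheme \<Rightarrow> 'a fusion \<Rightarrow> 'a set \<Rightarrow> ('a \<Rightarrow> 'a) set set" where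
  "out_conj G F P = (\<lambda>a. inn G P #>\<^bsub>fus_aut F P\<^esub> a) ` aut_conj G P"

definition sylow_subgroup :: "nat \<Rightarrow> ('a, 'b) monoid_scheme \<Rightarrow> 'a set \<Rightarrow> bool" where
  "sylow_subgroup p G H \<longleftrightarrow> subgroup H G \<and> card H = p ^ multiplicity p (order G)"

locale saturated_fusion_system = fusion_system S F
  for p :: nat and S (structure) and F +
  assumes prime: "prime p"
    and discrete_p_toral: "discrete_p_toral p S"
    and saturation_I: "fully_normalized p S F P
      \<Longrightarrow> fully_centralized p S F P \<and> finite (carrier (fus_out S F P)) \<and>
          sylow_subgroup p (fus_out S F P) (out_conj S F P)"
    and saturation_II: "\<lbrakk>subgroup P S; f \<in> F P (carrier S); fully_centralized p S F (f ` P);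
        N = {g \<in> normalizer S P. conj_by f P (conj_map S P g) \<in> aut_conj S (f ` P)}\<rbrakk>
      \<Longrightarrow> \<exists>f'\<in>F N (carrier S). restrict f' P = f"
    and saturation_III: "\<lbrakk>\<And>n::nat. subgroup (Q n) S; \<And>n. Q n \<subseteq> Q (Suc n);
        f \<in> hom (S \<downharpoonright> (\<Union>n. Q n)) S; f \<in> extensional (\<Union>n. Q n);
        \<And>n. restrict f (Q n) \<in> F (Q n) (carrier S)\<rbrakk>
      \<Longrightarrow> f \<in> F (\<Union>n. Q n) (carrier S)"


section \<open>Linking systems\<close>

text \<open>
  Composition is written in the order of functions: \<open>Comp C g f\<close> is \<open>g \<circ> f\<close>. The sets \<open>Mor C X Y\<close>
  are not required to be disjoint for different \<open>(X, Y)\<close>; every category has an isomorphic copy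
  for which they are.
\<close>

record ('o, 'm) category =
  Ob :: "'o set"
  Mor :: "'o \<Rightarrow> 'o \<Rightarrow> 'm set"
  Comp :: "'m \<Rightarrow> 'm \<Rightarrow> 'm"
  Idt :: "'o \<Rightarrow> 'm"

definition is_category :: "('o, 'm, 'z) category_scheme \<Rightarrow> bool" where
  "is_category C \<longleftrightarrow>
     (\<forall>X\<in>Ob C. Idt C X \<in> Mor C X X) \<and>
     (\<forall>X\<in>Ob C. \<forall>Y\<in>Ob C. \<forall>f\<in>Mor C X Y. Comp C f (Idt C X) = f \<and> Comp C (Idt C Y) f = f) \<and>
     (\<forall>X\<in>Ob C. \<forall>Y\<in>Ob C. \<forall>Z\<in>Ob C. \<forall>f\<in>Mor C X Y. \<forall>g\<in>Mor C Y Z. Comp C g f \<in> Mor C X Z) \<and>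
     (\<forall>W\<in>Ob C. \<forall>X\<in>Ob C. \<forall>Y\<in>Ob C. \<forall>Z\<in>Ob C. \<forall>f\<in>Mor C W X. \<forall>g\<in>Mor C X Y. \<forall>h\<in>Mor C Y Z.
        Comp C h (Comp C g f) = Comp C (Comp C h g) f)"

definition cat_iso :: "('o, 'm, 'z) category_scheme \<Rightarrow> 'o \<Rightarrow> 'o \<Rightarrow> 'm set" where
  "cat_iso C X Y =
     {f \<in> Mor C X Y. \<exists>g\<in>Mor C Y X. Comp C g f = Idt C X \<and> Comp C f g = Idt C Y}"

definition cat_aut :: "('o, 'm, 'z) category_scheme \<Rightarrow> 'o \<Rightarrow> 'm monoid" where
  "cat_aut C X = \<lparr>carrier = cat_iso C X X, monoid.mult = Comp C, one = Idt C X\<rparr>"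

definition cat_automorphism ::
    "('o, 'm, 'z) category_scheme \<Rightarrow> ('o \<Rightarrow> 'o) \<Rightarrow> ('m \<Rightarrow> 'm) \<Rightarrow> bool" where
  "cat_automorphism C \<Phi>o \<Phi>m \<longleftrightarrow>
     bij_betw \<Phi>o (Ob C) (Ob C) \<and>
     (\<forall>X\<in>Ob C. \<forall>Y\<in>Ob C. bij_betw \<Phi>m (Mor C X Y) (Mor C (\<Phi>o X) (\<Phi>o Y))) \<and>
     (\<forall>X\<in>Ob C. \<Phi>m (Idt C X) = Idt C (\<Phi>o X)) \<and>
     (\<forall>X\<in>Ob C. \<forall>Y\<in>Ob C. \<forall>Z\<in>Ob C. \<forall>f\<in>Mor C X Y. \<forall>g\<in>Mor C Y Z.
        \<Phi>m (Comp C g f) = Comp C (\<Phi>m g) (\<Phi>m f))"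

record ('a, 'm) linking_system = "('a set, 'm) category" +
  rho :: "'m \<Rightarrow> 'a \<Rightarrow> 'a"
  delta :: "'a set \<Rightarrow> 'a \<Rightarrow> 'm"

locale p_local_compact_group = saturated_fusion_system p S F
  for p and S (structure) and F +
  fixes L :: "('a, 'm) linking_system"
  assumes category: "is_category L"
    and objects: "Ob L = {P. centric S F P}"
    and rho_mor: "\<lbrakk>P \<in> Ob L; Q \<in> Ob L; \<phi> \<in> Mor L P Q\<rbrakk> \<Longrightarrow> rho L \<phi> \<in> F P Q"
    and rho_id: "P \<in> Ob L \<Longrightarrow> rho L (Idt L P) = (\<lambda>x\<in>P. x)"
    and rho_comp: "\<lbrakk>P \<in> Ob L; Q \<in> Ob L; R \<in> Ob L; \<phi> \<in> Mor L P Q; \<chi> \<in> Mor L Q R\<rbrakk>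
           \<Longrightarrow> rho L (Comp L \<chi> \<phi>) = compose P (rho L \<chi>) (rho L \<phi>)"
    and delta_mon: "P \<in> Ob L \<Longrightarrow> delta L P \<in> mon (S \<downharpoonright> P) (cat_aut L P)"
    and A_free: "\<lbrakk>P \<in> Ob L; Q \<in> Ob L; \<phi> \<in> Mor L P Q; z \<in> center S P;
           Comp L \<phi> (delta L P z) = \<phi>\<rbrakk> \<Longrightarrow> z = \<one>"
    and A_orbits: "\<lbrakk>P \<in> Ob L; Q \<in> Ob L; \<phi> \<in> Mor L P Q; \<chi> \<in> Mor L P Q\<rbrakk>
           \<Longrightarrow> rho L \<phi> = rho L \<chi> \<longleftrightarrow> (\<exists>z\<in>center S P. \<chi> = Comp L \<phi> (delta L P z))"
    and A_surj: "\<lbrakk>P \<in> Ob L; Q \<in> Ob L\<rbrakk> \<Longrightarrow> rho L ` Mor L P Q = F P Q"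
    and B: "\<lbrakk>P \<in> Ob L; g \<in> P\<rbrakk> \<Longrightarrow> rho L (delta L P g) = conj_map S P g"
    and C: "\<lbrakk>P \<in> Ob L; Q \<in> Ob L; \<phi> \<in> Mor L P Q; g \<in> P\<rbrakk>
           \<Longrightarrow> Comp L \<phi> (delta L P g) = Comp L (delta L Q (rho L \<phi> g)) \<phi>"

text \<open>\<open>\<iota> P\<close> is the chosen lifting \<open>\<iota>\<^bsub>P,S\<^esub>\<close> of the inclusion of \<open>P\<close> into \<open>S\<close>.\<close>

definition inclusion_liftings ::
    "('a, 'b) monoid_scheme \<Rightarrow> ('a, 'm) linking_system \<Rightarrow> ('a set \<Rightarrow> 'm) \<Rightarrow> bool" where
  "inclusion_liftings S L \<iota> \<longleftrightarrow>
     (\<forall>P\<in>Ob L. \<iota> P \<in> Mor L P (carrier S) \<and> rho L (\<iota> P) = (\<lambda>x\<in>P. x)) \<and>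
     \<iota> (carrier S) = Idt L (carrier S)"

text \<open>\<open>\<delta>\<^bsub>P,Q\<^esub>(g)\<close>, for \<open>g\<close> in \<^term>\<open>transporter S P Q\<close>.\<close>

definition delta_ext ::
    "('a, 'b) monoid_scheme \<Rightarrow> ('a, 'm) linking_system \<Rightarrow> ('a set \<Rightarrow> 'm)
      \<Rightarrow> 'a set \<Rightarrow> 'a set \<Rightarrow> 'a \<Rightarrow> 'm" where
  "delta_ext S L \<iota> P Q g =
     (THE \<phi>. \<phi> \<in> Mor L P Q \<and> Comp L (\<iota> Q) \<phi> = Comp L (delta L (carrier S) g) (\<iota> P))"


section \<open>The bullet functor\<close>

text \<open>The exponent of \<open>S/T\<close>, which is the number \<open>p\<^sup>e\<close>.\<close>

definition torus_exponent :: "nat \<Rightarrow> ('a, 'b) monoid_scheme \<Rightarrow> nat" where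
  "torus_exponent p S =
     (LEAST n. 0 < n \<and>
        (\<forall>x\<in>carrier (S Mod torus p S). x [^]\<^bsub>S Mod torus p S\<^esub> n = \<one>\<^bsub>S Mod torus p S\<^esub>))"

definition weyl_fix :: "nat \<Rightarrow> ('a, 'b) monoid_scheme \<Rightarrow> 'a fusion \<Rightarrow> 'a set \<Rightarrow> 'a set" where
  "weyl_fix p S F A =
     {t \<in> torus p S. \<forall>\<omega>\<in>carrier (fus_aut F (torus p S)). (\<forall>a\<in>A. \<omega> a = a) \<longrightarrow> \<omega> t = t}"

definition bullet :: "nat \<Rightarrow> ('a, 'b) monoid_scheme \<Rightarrow> 'a fusion \<Rightarrow> 'a set \<Rightarrow> 'a set" where
  "bullet p S F P =
     P <#>\<^bsub>S\<^esub> torus p (S \<downharpoonright> weyl_fix p S F ((\<lambda>x. x [^]\<^bsub>S\<^esub> torus_exponent p S) ` P))"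

definition fusion_bullet_ob :: "nat \<Rightarrow> ('a, 'b) monoid_scheme \<Rightarrow> 'a fusion \<Rightarrow> 'a set set" where
  "fusion_bullet_ob p S F = {bullet p S F P | P. subgroup P S}"

definition linking_bullet_ob :: "nat \<Rightarrow> ('a, 'b) monoid_scheme \<Rightarrow> 'a fusion \<Rightarrow> 'a set set" where
  "linking_bullet_ob p S F = {R \<in> fusion_bullet_ob p S F. centric S F R}"


section \<open>Unstable Adams operations\<close>

text \<open>
  Units of the ring of \<open>p\<close>-adic integers, as elements of the inverse limit of the rings
  \<open>\<int>/p\<^sup>n\<close>; \<open>\<zeta> n\<close> is the residue modulo \<open>p\<^sup>n\<close>.
\<close>

definition padic_units :: "nat \<Rightarrow> (nat \<Rightarrow> nat) set" where
  "padic_units p =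
     {\<zeta>. (\<forall>n. \<zeta> n < p ^ n \<and> \<zeta> (Suc n) mod p ^ n = \<zeta> n) \<and> coprime p (\<zeta> 1)}"

text \<open>The power \<open>t\<^sup>\<zeta>\<close> of an element of \<open>p\<close>-power order.\<close>

definition padic_pow ::
    "nat \<Rightarrow> ('a, 'b) monoid_scheme \<Rightarrow> 'a \<Rightarrow> (nat \<Rightarrow> nat) \<Rightarrow> 'a" where
  "padic_pow p G t \<zeta> = t [^]\<^bsub>G\<^esub> \<zeta> (LEAST n. t [^]\<^bsub>G\<^esub> (p ^ n) = \<one>\<^bsub>G\<^esub>)"

definition fusion_preserving ::
    "('a, 'b) monoid_scheme \<Rightarrow> 'a fusion \<Rightarrow> ('a \<Rightarrow> 'a) \<Rightarrow> bool" where
  "fusion_preserving S F \<psi> \<longleftrightarrow>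
     (\<forall>P Q. subgroup P S \<longrightarrow> subgroup Q S \<longrightarrow> (\<forall>f\<in>F P Q. conj_by \<psi> P f \<in> F (\<psi> ` P) (\<psi> ` Q)))"

definition unstable_adams_operation ::
    "nat \<Rightarrow> ('a, 'b) monoid_scheme \<Rightarrow> 'a fusion \<Rightarrow> ('a, 'm) linking_system \<Rightarrow> ('a set \<Rightarrow> 'm)
      \<Rightarrow> (nat \<Rightarrow> nat) \<Rightarrow> ('a \<Rightarrow> 'a) \<Rightarrow> ('m \<Rightarrow> 'm) \<Rightarrow> bool" where
  "unstable_adams_operation p S F L \<iota> \<zeta> \<psi> \<Psi> \<longleftrightarrow>
     \<zeta> \<in> padic_units p \<and>
     \<psi> \<in> iso S S \<and> fusion_preserving S F \<psi> \<and>
     cat_automorphism L (\<lambda>P. \<psi> ` P) \<Psi> \<and>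
     (\<forall>t\<in>torus p S. \<psi> t = padic_pow p S t \<zeta>) \<and>
     (\<forall>x\<in>carrier S. torus p S #>\<^bsub>S\<^esub> \<psi> x = torus p S #>\<^bsub>S\<^esub> x) \<and>
     (\<forall>P\<in>Ob L. \<forall>Q\<in>Ob L. \<forall>\<phi>\<in>Mor L P Q. rho L (\<Psi> \<phi>) = conj_by \<psi> P (rho L \<phi>)) \<and>
     (\<forall>P\<in>Ob L. \<forall>Q\<in>Ob L. \<forall>g\<in>transporter S P Q.
        \<Psi> (delta_ext S L \<iota> P Q g) = delta_ext S L \<iota> (\<psi> ` P) (\<psi> ` Q) (\<psi> g))"

primrec op_iter :: "nat \<Rightarrow> ('x \<Rightarrow> 'x) \<Rightarrow> nat \<Rightarrow> 'x \<Rightarrow> 'x" where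
  "op_iter p \<Psi> 0 = \<Psi>"
| "op_iter p \<Psi> (Suc i) = (op_iter p \<Psi> i) ^^ p"

definition fixed_pts :: "nat \<Rightarrow> ('a, 'b) monoid_scheme \<Rightarrow> ('a \<Rightarrow> 'a) \<Rightarrow> nat \<Rightarrow> 'a set" where
  "fixed_pts p S \<psi> i = {x \<in> carrier S. op_iter p \<psi> i x = x}"

definition determined ::
    "nat \<Rightarrow> ('a, 'b) monoid_scheme \<Rightarrow> 'a fusion \<Rightarrow> ('a \<Rightarrow> 'a) \<Rightarrow> nat \<Rightarrow> 'a set \<Rightarrow> bool" where
  "determined p S F \<psi> i P \<longleftrightarrow> bullet p S F (P \<inter> fixed_pts p S \<psi> i) = P"

definition torus_exhausted :: "nat \<Rightarrow> ('a, 'b) monoid_scheme \<Rightarrow> ('a \<Rightarrow> 'a) \<Rightarrow> bool" where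
  "torus_exhausted p S \<psi> \<longleftrightarrow>
     (\<forall>i. torus p S \<inter> fixed_pts p S \<psi> i \<subset> torus p S \<inter> fixed_pts p S \<psi> (Suc i)) \<and>
     torus p S = (\<Union>i. torus p S \<inter> fixed_pts p S \<psi> i)"

definition conj_class_reps ::
    "nat \<Rightarrow> ('a, 'b) monoid_scheme \<Rightarrow> 'a fusion \<Rightarrow> 'a set set \<Rightarrow> bool" where
  "conj_class_reps p S F \<H> \<longleftrightarrow>
     \<H> \<subseteq> linking_bullet_ob p S F \<and>
     (\<forall>R\<in>linking_bullet_ob p S F. \<exists>!P. P \<in> \<H> \<and> (\<exists>g\<in>carrier S. conj_map S P g ` P = R))"

text \<open>The class of \<open>f : P \<rightarrow> R\<close> in \<open>Rep\<^sub>F(P, R) = Inn(R)\<setminus>Hom\<^sub>F(P, R)\<close>.\<close>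

definition rep_class ::
    "('a, 'b) monoid_scheme \<Rightarrow> 'a set \<Rightarrow> 'a set \<Rightarrow> ('a \<Rightarrow> 'a) \<Rightarrow> ('a \<Rightarrow> 'a) set" where
  "rep_class S P R f = {compose P c f | c. c \<in> inn S R}"

definition iso_class_reps ::
    "('a, 'b) monoid_scheme \<Rightarrow> 'a fusion \<Rightarrow> ('a, 'm) linking_system
      \<Rightarrow> 'a set \<Rightarrow> 'a set \<Rightarrow> 'm set \<Rightarrow> bool" where
  "iso_class_reps S F L P R M \<longleftrightarrow>
     M \<subseteq> cat_iso L P R \<and>
     (\<forall>f\<in>fus_iso F P R. \<exists>!\<phi>. \<phi> \<in> M \<and> rho L \<phi> \<in> rep_class S P R f)"

definition fixes_representatives ::
    "nat \<Rightarrow> ('a, 'b) monoid_scheme \<Rightarrow> 'a fusion \<Rightarrow> ('a, 'm) linking_system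
      \<Rightarrow> ('a \<Rightarrow> 'a) \<Rightarrow> ('m \<Rightarrow> 'm) \<Rightarrow> bool" where
  "fixes_representatives p S F L \<psi> \<Psi> \<longleftrightarrow>
     (\<exists>\<H> M. finite \<H> \<and> conj_class_reps p S F \<H> \<and>
        (\<forall>P\<in>\<H>. \<forall>R\<in>\<H>. iso_class_reps S F L P R (M P R)) \<and>
        (\<forall>P\<in>\<H>. \<psi> ` P = P) \<and>
        (\<forall>P\<in>\<H>. \<forall>R\<in>\<H>. \<forall>\<phi>\<in>M P R. \<Psi> \<phi> = \<phi>) \<and>
        (\<forall>P\<in>\<H>. \<forall>i. determined p S F \<psi> i P))"


section \<open>Strongly fixed points\<close>

definition det_bullet_ob ::
    "nat \<Rightarrow> ('a, 'b) monoid_scheme \<Rightarrow> 'a fusion \<Rightarrow> ('a \<Rightarrow> 'a) \<Rightarrow> nat \<Rightarrow> 'a set set" where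
  "det_bullet_ob p S F \<psi> i = {R \<in> linking_bullet_ob p S F. determined p S F \<psi> i R}"

definition det_traces ::
    "nat \<Rightarrow> ('a, 'b) monoid_scheme \<Rightarrow> 'a fusion \<Rightarrow> ('a \<Rightarrow> 'a) \<Rightarrow> nat \<Rightarrow> 'a set set" where
  "det_traces p S F \<psi> i = {R \<inter> fixed_pts p S \<psi> i | R. R \<in> det_bullet_ob p S F \<psi> i}"

definition fixed_mor ::
    "nat \<Rightarrow> ('a, 'm) linking_system \<Rightarrow> ('m \<Rightarrow> 'm) \<Rightarrow> nat \<Rightarrow> 'a set \<Rightarrow> 'a set \<Rightarrow> 'm set" where
  "fixed_mor p L \<Psi> i P R = {\<phi> \<in> Mor L P R. op_iter p \<Psi> i \<phi> = \<phi>}"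

text \<open>
  All restrictions \<open>H \<rightarrow> K\<close> of maps \<open>P\<^sub>i \<rightarrow> R\<^sub>i\<close> that are themselves the restriction of some
  \<open>\<rho>(\<phi>)\<close> with \<open>\<phi> : P \<rightarrow> R\<close> fixed by \<open>\<Psi>\<^sub>i\<close>.
\<close>

definition fixed_restrictions ::
    "nat \<Rightarrow> ('a, 'b) monoid_scheme \<Rightarrow> 'a fusion \<Rightarrow> ('a, 'm) linking_system
      \<Rightarrow> ('a \<Rightarrow> 'a) \<Rightarrow> ('m \<Rightarrow> 'm) \<Rightarrow> nat \<Rightarrow> 'a fusion" where
  "fixed_restrictions p S F L \<psi> \<Psi> i H K =
     {restrict (rho L \<phi>) H | \<phi> P R.
        P \<in> det_bullet_ob p S F \<psi> i \<and> R \<in> det_bullet_ob p S F \<psi> i \<and> \<phi> \<in> fixed_mor p L \<Psi> i P R \<and>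
        subgroup H S \<and> H \<subseteq> P \<inter> fixed_pts p S \<psi> i \<and>
        subgroup K S \<and> K \<subseteq> R \<inter> fixed_pts p S \<psi> i \<and> rho L \<phi> ` H \<subseteq> K}"

inductive composite :: "'a fusion \<Rightarrow> 'a set \<Rightarrow> 'a set \<Rightarrow> ('a \<Rightarrow> 'a) \<Rightarrow> bool"
  for A :: "'a fusion" where
  base: "f \<in> A H K \<Longrightarrow> composite A H K f"
| step: "composite A H K f \<Longrightarrow> g \<in> A K J \<Longrightarrow> composite A H J (compose H g f)"

definition fusion_i ::
    "nat \<Rightarrow> ('a, 'b) monoid_scheme \<Rightarrow> 'a fusion \<Rightarrow> ('a, 'm) linking_system
      \<Rightarrow> ('a \<Rightarrow> 'a) \<Rightarrow> ('m \<Rightarrow> 'm) \<Rightarrow> nat \<Rightarrow> 'a fusion" where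
  "fusion_i p S F L \<psi> \<Psi> i H K = {f. composite (fixed_restrictions p S F L \<psi> \<Psi> i) H K f}"

definition linking_i ::
    "nat \<Rightarrow> ('a, 'b) monoid_scheme \<Rightarrow> 'a fusion \<Rightarrow> ('a, 'm) linking_system
      \<Rightarrow> ('a \<Rightarrow> 'a) \<Rightarrow> ('m \<Rightarrow> 'm) \<Rightarrow> nat \<Rightarrow> ('a set, 'm) category" where
  "linking_i p S F L \<psi> \<Psi> i =
     \<lparr>Ob = {H. subgroup H (S \<downharpoonright> fixed_pts p S \<psi> i) \<and> (\<exists>K\<in>det_traces p S F \<psi> i. K \<subseteq> H)},
      Mor = (\<lambda>H K. {\<phi> \<in> fixed_mor p L \<Psi> i (bullet p S F H) (bullet p S F K). rho L \<phi> ` H \<subseteq> K}),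
      Comp = Comp L,
      Idt = (\<lambda>H. Idt L (bullet p S F H))\<rparr>"


section \<open>Approximation by p-local finite groups\<close>

definition p_core :: "nat \<Rightarrow> ('a, 'b) monoid_scheme \<Rightarrow> 'a set" where
  "p_core p G = (GREATEST N. N \<lhd> G \<and> (\<exists>k. card N = p ^ k))"

definition approximates_by_finite ::
    "nat \<Rightarrow> ('a, 'b) monoid_scheme \<Rightarrow> 'a fusion \<Rightarrow> ('a, 'm) linking_system
      \<Rightarrow> ('a \<Rightarrow> 'a) \<Rightarrow> ('m \<Rightarrow> 'm) \<Rightarrow> bool" where
  "approximates_by_finite p S F L \<psi> \<Psi> \<longleftrightarrow>
     (\<exists>M. \<forall>i\<ge>M.
        let Si = S \<downharpoonright> fixed_pts p S \<psi> i;
            Fi = fusion_i p S F L \<psi> \<Psi> i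
        in \<forall>H. centric Si Fi H \<and> H \<notin> Ob (linking_i p S F L \<psi> \<Psi> i) \<longrightarrow>
             (\<exists>K\<in>fus_conj Si Fi H.
                out_conj Si Fi K \<inter> p_core p (fus_out Si Fi K) \<noteq> {\<one>\<^bsub>fus_out Si Fi K\<^esub>}))"

end

theory Submission
  imports Defs "HOL-Algebra.Sylow" "HOL-Algebra.SndIsomorphismGrp" "HOL-Number_Theory.Residues"
begin

text \<open>
  Let \<open>p\<^sup>e\<close> be the exponent of \<open>S/T\<close>. In rank one \<open>P\<^sup>\<bullet>\<close> is \<open>P\<close> or \<open>P T\<close>; call \<open>P\<close> small in the
  first case, when a nontrivial element of \<open>Aut\<^sub>F(T)\<close> fixes the \<open>p\<^sup>e\<close>-th powers of \<open>P\<close>. Let \<open>H\<close> be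
  \<open>F\<^sub>i\<close>-centric. If \<open>H\<close> is not small and does not contain \<open>T\<^sub>i\<close>, then all \<open>F\<^sub>i\<close>-automorphisms of
  \<open>H\<close> extend to \<open>H T\<close>, so that the elements of the normalizer of \<open>H\<close> in \<open>H T\<close> that induce \<open>F\<^sub>i\<close>-automorphisms form a
  normal \<open>p\<close>-subgroup of \<open>Out\<^bsub>F\<^sub>i\<^esub>(H)\<close>, and already \<open>K = H\<close> works.

  Otherwise it is shown that \<open>H\<close> is an object of \<open>L\<^sub>i\<close> when \<open>i\<close> is large. If \<open>H\<close> is not small, then it is the trace
  on \<open>S\<^sub>i\<close> of \<open>H T\<close>. If \<open>H\<close> is small, \<open>H \<inter> T\<close> is bounded, so \<open>T\<close> cannot be central,
  as \<open>H\<close> would contain \<open>T\<^sub>i\<close>; then \<open>p = 2\<close>, elements of \<open>S\<close> centralize or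
  invert \<open>T\<close>, and \<open>H\<close> is conjugate by some \<open>\<tau> \<in> T\<close> to one of finitely many subgroups.
  In both cases only finitely many subgroups \<open>P\<close> have to be excluded as not \<open>F\<close>-centric. For such a \<open>P\<close> choose an
  \<open>F\<close>-isomorphism to a fully normalized subgroup, which then has a centralizing element outside. By Alperin's
  fusion theorem the isomorphism is a composite of finitely many restrictions of automorphisms of members of
  \<open>F\<^sup>\<bullet>\<close>, whose lifts are products of elements of \<open>S\<close> and of fixed representatives. Hence it lies in \<open>F\<^sub>i\<close> for all large \<open>i\<close>,
  and the trace of \<open>P\<close> is not \<open>F\<^sub>i\<close>-centric. The element \<open>\<tau>\<close> need not be fixed by \<open>\<Psi>\<^sub>i\<close>, but
  \<open>\<Psi>\<^sub>i(\<tau>) = \<tau> z\<close> with \<open>z\<close> of order at most two, and the isomorphisms that occur fix \<open>z\<close>, so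
  conjugation by \<open>\<tau>\<close> still turns their \<open>\<Psi>\<^sub>i\<close>-fixed lifts into fixed ones.
\<close>

section \<open>Finite \<open>p\<close>-groups\<close>

text \<open>One bound on i has to serve all H, whereas the factorization of a single isomorphism of
  F gives a bound that depends on its source P; so a finite list of P must suffice. Subgroups
  containing T form such a list, S/T being finite. Small subgroups do not, as they can have
  infinitely many conjugates, and passing to a conjugate costs the element \<tau>. Hence eventual
  membership in F_i is stated for all \<tau> of a given type at once. Rank one enters because the
  subgroups of T form a chain: a subgroup of S contains T or is finite, and a proper subgroup of T
  has trivial maximal torus. An element of S acts on T by a p-adic unit of p-power order; such a
  unit is 1, or -1 if p = 2, which is how the prime 2 comes in. The involution z of T is central in
  S, so conjugation does not see a factor z introduced by \<open>\<Psi>\<^sub>i\<close>. The linking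
  system does see it, and there it cancels for isomorphisms that fix z. Morphisms defined on the
  normalizer of a subgroup containing z do fix it, because a square root of z in T lies in that
  normalizer.\<close>

lemma (in group) order_prime_power:
  assumes p: "prime p" and fin: "finite (carrier G)"
    and tors: "\<And>x. x \<in> carrier G \<Longrightarrow> \<exists>n. x [^] (p ^ n :: nat) = \<one>"
  shows "\<exists>k. order G = p ^ k"
proof -
  have pos: "order G > 0" using fin order_gt_0_iff_finite by blast
  have "q = p" if q: "prime q" "q dvd order G" for q
  proof -
    obtain m where m: "order G = q ^ 1 * m" using q by (auto elim: dvdE)
    obtain H where H: "subgroup H G" "card H = q ^ 1"
      using sylow_thm[OF q(1) is_group m fin] by blast
    have "H \<noteq> {\<one>}" using H(2) q(1) by (auto simp: prime_nat_iff)
    then obtain x where x: "x \<in> H" "x \<noteq> \<one>" using subgroup.one_closed[OF H(1)] by blast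
    have xG: "x \<in> carrier G" using x H subgroup.mem_carrier by fastforce
    interpret H: group "G\<lparr>carrier := H\<rparr>" using H(1) subgroup_imp_group by blast
    have "x [^]\<^bsub>G\<lparr>carrier := H\<rparr>\<^esub> (order (G\<lparr>carrier := H\<rparr>)) = \<one>"
      using H.pow_order_eq_1[of x] x(1) by simp
    then have "x [^] q = \<one>" using H(2) by (simp add: order_def nat_pow_consistent[symmetric])
    then have "ord x dvd q" using pow_eq_id xG by blast
    moreover have "ord x \<noteq> 1" using x xG ord_eq_1 by auto
    ultimately have oq: "ord x = q" using q(1) by (auto simp: prime_nat_iff)
    obtain n where "x [^] (p ^ n :: nat) = \<one>" using tors xG by blast
    then have "q dvd p ^ n" using oq pow_eq_id xG by blast
    then show "q = p" using q(1) p by (metis prime_dvd_power primes_dvd_imp_eq)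
  qed
  moreover obtain k n where n: "\<not> p dvd n" "order G = n * p ^ k"
    using prime_power_canonical[OF p pos] by blast
  ultimately have "n = 1"
    by (metis dvd_mult2 prime_factor_nat)
  then show ?thesis using n by auto
qed

text \<open>Orbits of size other than 1 have p-power size by the orbit-stabilizer theorem, so they
  do not count modulo p. The action is a plain function with its laws as hypotheses; the proof turns
  it into a homomorphism to permutations.\<close>

lemma (in group) card_fixed_points_cong:
  fixes E :: "'c set" and act :: "'a \<Rightarrow> 'c \<Rightarrow> 'c"
  assumes p: "prime p" and ord: "order G = p ^ k" and E: "finite E"
    and closed: "\<And>g x. g \<in> carrier G \<Longrightarrow> x \<in> E \<Longrightarrow> act g x \<in> E"
    and one: "\<And>x. x \<in> E \<Longrightarrow> act \<one> x = x"
    and mult: "\<And>g h x. g \<in> carrier G \<Longrightarrow> h \<in> carrier G \<Longrightarrow> x \<in> E \<Longrightarrow> act (g \<otimes> h) x = act g (act h x)"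
  shows "card {x \<in> E. \<forall>g\<in>carrier G. act g x = x} mod p = card E mod p"
proof -
  define \<phi> where "\<phi> = (\<lambda>g. \<lambda>x\<in>E. act g x)"
  have inv: "act (inv g) (act g x) = x" "act g (act (inv g) x) = x" if "g \<in> carrier G" "x \<in> E" for g x
    using mult[of "inv g" g x] mult[of g "inv g" x] one that by auto
  have bij: "\<phi> g \<in> Bij E" if "g \<in> carrier G" for g
    unfolding Bij_def \<phi>_def
    by (auto simp: closed that inv intro!: bij_betw_byWitness[where f' = "act (inv g)"])
  have hom: "\<phi> \<in> hom G (BijGroup E)"
    by (rule homI) (auto simp: BijGroup_def bij, auto simp: \<phi>_def compose_def mult closed intro!: restrict_ext)
  interpret A: group_action G E \<phi>
    by (intro group_action.intro group_hom.intro group_hom_axioms.intro is_group group_BijGroup hom)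
  let ?F = "{x \<in> E. \<forall>g\<in>carrier G. act g x = x}"
  have "card E = (\<Sum>x\<in>E. 1)" by simp
  also have "\<dots> = (\<Sum>X\<in>orbits G E \<phi>. card X)"
    using A.disjoint_sum[OF E, of "\<lambda>_. 1::nat"] by simp
  finally have cE: "card E = (\<Sum>X\<in>orbits G E \<phi>. card X)" .
  have fo: "finite (orbits G E \<phi>)" using E unfolding orbits_def by simp
  have dv: "p dvd card X" if X: "X \<in> orbits G E \<phi>" "card X \<noteq> 1" for X
  proof -
    obtain x where x: "x \<in> E" "X = orbit G \<phi> x" using X unfolding orbits_def by blast
    have "card X dvd p ^ k" using A.orbit_stabilizer_theorem[OF x(1)] x(2) ord by (metis dvd_triv_left)
    then obtain j where "card X = p ^ j" using p divides_primepow_nat by blast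
    then show ?thesis using X(2) by (cases j) auto
  qed
  have card1: "card {X \<in> orbits G E \<phi>. card X = 1} = card ?F"
  proof (rule bij_betw_same_card[symmetric, where f = "\<lambda>x. {x}"], unfold bij_betw_def, intro conjI)
    show "inj_on (\<lambda>x. {x}) ?F" by simp
    show "(\<lambda>x. {x}) ` ?F = {X \<in> orbits G E \<phi>. card X = 1}"
    proof (intro equalityI subsetI)
      fix X assume "X \<in> (\<lambda>x. {x}) ` ?F"
      then obtain x where x: "x \<in> E" "\<forall>g\<in>carrier G. act g x = x" "X = {x}" by blast
      then have "\<phi> g x = x" if "g \<in> carrier G" for g using that by (simp add: \<phi>_def)
      then have "orbit G \<phi> x = {x}" using A.orbit_refl[OF x(1)] by (auto simp: orbit_def)
      then show "X \<in> {X \<in> orbits G E \<phi>. card X = 1}" using x unfolding orbits_def by auto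
    next
      fix X assume "X \<in> {X \<in> orbits G E \<phi>. card X = 1}"
      then obtain x where x: "x \<in> E" "X = orbit G \<phi> x" "card X = 1" unfolding orbits_def by blast
      then have "X = {x}" using A.orbit_refl[OF x(1)] by (metis card_1_singletonE singletonD)
      then have "\<phi> g x = x" if "g \<in> carrier G" for g using that x unfolding orbit_def by blast
      then show "X \<in> (\<lambda>x. {x}) ` ?F" using x \<open>X = {x}\<close> by (auto simp: \<phi>_def)
    qed
  qed
  have "(\<Sum>X\<in>orbits G E \<phi>. card X) = (\<Sum>X\<in>{X \<in> orbits G E \<phi>. card X = 1}. card X) + (\<Sum>X\<in>{X \<in> orbits G E \<phi>. card X \<noteq> 1}. card X)"
    using fo by (subst sum.union_disjoint[symmetric]) (auto intro!: sum.cong)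
  also have "(\<Sum>X\<in>{X \<in> orbits G E \<phi>. card X = 1}. card X) = card ?F" using card1 by simp
  finally have "card E = card ?F + (\<Sum>X\<in>{X \<in> orbits G E \<phi>. card X \<noteq> 1}. card X)" using cE by simp
  moreover have "p dvd (\<Sum>X\<in>{X \<in> orbits G E \<phi>. card X \<noteq> 1}. card X)"
    using dv by (intro dvd_sum) auto
  ultimately show ?thesis by (auto elim!: dvdE)
qed

text \<open>\<open>X\<close> acts on the right cosets of \<open>Q\<close> by right multiplication
  with inverses, and the coset of a is fixed exactly when a conjugates \<open>X\<close> into
  \<open>Q\<close>. Sylow conjugacy and the growth of normalizers both come from this count.\<close>

lemma (in group) card_fixed_rcosets_cong:
  assumes p: "prime p" and X: "subgroup X G" "card X = p ^ k" and Q: "subgroup Q G" "finite (rcosets Q)"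
  shows "card {C \<in> rcosets Q. \<exists>a\<in>carrier G. C = Q #> a \<and> (\<forall>x\<in>X. a \<otimes> x \<otimes> inv a \<in> Q)} mod p = card (rcosets Q) mod p"
proof -
  interpret X: group "G\<lparr>carrier := X\<rparr>" using X(1) subgroup_imp_group by blast
  have QG: "Q \<subseteq> carrier G" and XG: "X \<subseteq> carrier G" using Q X subgroup.subset by auto
  have XG': "x \<in> carrier G" if "x \<in> X" for x using that XG by blast
  have cong: "card {C \<in> rcosets Q. \<forall>x\<in>carrier (G\<lparr>carrier := X\<rparr>). C #> inv x = C} mod p = card (rcosets Q) mod p"
  proof (rule X.card_fixed_points_cong[OF p, where act = "\<lambda>x C. C #> inv x"])
    show "order (G\<lparr>carrier := X\<rparr>) = p ^ k" using X by (simp add: order_def)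
    show "finite (rcosets Q)" by (rule Q(2))
    fix C assume "C \<in> rcosets Q"
    then obtain a where a: "a \<in> carrier G" "C = Q #> a" unfolding RCOSETS_def by blast
    show "C #> inv \<one>\<^bsub>G\<lparr>carrier := X\<rparr>\<^esub> = C" using a QG by (simp add: coset_mult_assoc)
    fix g assume g: "g \<in> carrier (G\<lparr>carrier := X\<rparr>)"
    then have gG: "g \<in> carrier G" using XG' by simp
    show "C #> inv g \<in> rcosets Q" using a gG QG by (auto simp: RCOSETS_def coset_mult_assoc)
    fix h assume "h \<in> carrier (G\<lparr>carrier := X\<rparr>)"
    then have hG: "h \<in> carrier G" using XG' by simp
    show "C #> inv (g \<otimes>\<^bsub>G\<lparr>carrier := X\<rparr>\<^esub> h) = C #> inv h #> inv g"
      using a gG hG QG by (simp add: coset_mult_assoc inv_mult_group m_assoc)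
  qed
  have iff0: "(\<forall>x\<in>X. C #> inv x = C) \<longleftrightarrow> (\<exists>a\<in>carrier G. C = Q #> a \<and> (\<forall>x\<in>X. a \<otimes> x \<otimes> inv a \<in> Q))"
    if C: "C \<in> rcosets Q" for C
  proof -
    have iff: "C #> inv x = C \<longleftrightarrow> a \<otimes> x \<otimes> inv a \<in> Q" if a: "a \<in> carrier G" "C = Q #> a" and x: "x \<in> X" for a x
    proof -
      have "C #> inv x = Q #> (a \<otimes> inv x)" using a XG'[OF x] QG by (simp add: coset_mult_assoc)
      moreover have "Q #> (a \<otimes> inv x) = Q #> a \<longleftrightarrow> a \<otimes> inv (a \<otimes> inv x) \<in> Q"
        using a XG'[OF x] Q(1) subgroup.rcos_module[OF Q(1) is_group, of "a \<otimes> inv x" a]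
          repr_independence[of a Q "a \<otimes> inv x"] rcos_self[of a Q] by auto
      ultimately show ?thesis using a XG'[OF x] by (simp add: inv_mult_group m_assoc)
    qed
    show ?thesis using C iff unfolding RCOSETS_def by blast
  qed
  have "{C \<in> rcosets Q. \<forall>x\<in>X. C #> inv x = C} =
      {C \<in> rcosets Q. \<exists>a\<in>carrier G. C = Q #> a \<and> (\<forall>x\<in>X. a \<otimes> x \<otimes> inv a \<in> Q)}"
    by (intro Collect_cong conj_cong refl iff0)
  with cong show ?thesis by simp
qed

text \<open>\<open>X\<close> fixes one of the cosets of \<open>Q\<close>, whose number is prime to \<open>p\<close>.\<close>

lemma (in group) p_subgroup_conj_into_sylow:
  assumes p: "prime p" and fin: "finite (carrier G)" and X: "subgroup X G" "card X = p ^ k"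
    and Q: "subgroup Q G" "card Q = p ^ multiplicity p (order G)"
  shows "\<exists>a\<in>carrier G. \<forall>x\<in>X. a \<otimes> x \<otimes> inv a \<in> Q"
proof -
  have co: "card (rcosets Q) * p ^ multiplicity p (order G) = order G" using lagrange Q by metis
  have "\<not> p dvd card (rcosets Q)"
  proof
    assume "p dvd card (rcosets Q)"
    then have "p ^ Suc (multiplicity p (order G)) dvd order G" using co by (metis mult_dvd_mono dvd_refl power_Suc)
    moreover have "order G \<noteq> 0" using fin order_gt_0_iff_finite by auto
    ultimately show False using p
      by (metis Suc_n_not_le_n not_prime_unit power_dvd_iff_le_multiplicity)
  qed
  moreover have "finite (rcosets Q)" using fin by (simp add: RCOSETS_def)
  ultimately have "card {C \<in> rcosets Q. \<exists>a\<in>carrier G. C = Q #> a \<and> (\<forall>x\<in>X. a \<otimes> x \<otimes> inv a \<in> Q)} mod p \<noteq> 0"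
    using card_fixed_rcosets_cong[OF p X Q(1)] by (auto simp: dvd_eq_mod_eq_0)
  then have "{C \<in> rcosets Q. \<exists>a\<in>carrier G. C = Q #> a \<and> (\<forall>x\<in>X. a \<otimes> x \<otimes> inv a \<in> Q)} \<noteq> {}"
    by (metis card.empty mod_0)
  then show ?thesis by blast
qed

text \<open>Here \<open>Q\<close> acts on its own cosets, fixing the coset \<open>Q\<close> and hence another one.\<close>

lemma (in group) p_group_normalizer_grows:
  assumes p: "prime p" and G: "order G = p ^ k" and Q: "subgroup Q G" "Q \<noteq> carrier G"
  shows "\<exists>g\<in>carrier G - Q. \<forall>x\<in>Q. g \<otimes> x \<otimes> inv g \<in> Q"
proof -
  have "p ^ k > 0" using p by (simp add: prime_gt_0_nat)
  then have fin: "finite (carrier G)" using G order_gt_0_iff_finite by metis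
  have QG: "Q \<subseteq> carrier G" using Q subgroup.subset by auto
  have l: "card (rcosets Q) * card Q = p ^ k" using lagrange Q(1) G by metis
  obtain j where j: "card Q = p ^ j" using l p divides_primepow_nat by (metis dvd_triv_right)
  obtain r where r: "card (rcosets Q) = p ^ r" using l p divides_primepow_nat by (metis dvd_triv_left)
  have "r \<noteq> 0"
  proof
    assume "r = 0"
    then have "card Q = card (carrier G)" using l r G by (simp add: order_def)
    then show False using Q(2) QG fin card_subset_eq by blast
  qed
  let ?F = "{C \<in> rcosets Q. \<exists>a\<in>carrier G. C = Q #> a \<and> (\<forall>x\<in>Q. a \<otimes> x \<otimes> inv a \<in> Q)}"
  have "finite (rcosets Q)" using fin by (simp add: RCOSETS_def)
  then have "card ?F mod p = 0" using card_fixed_rcosets_cong[OF p Q(1) j Q(1)] r \<open>r \<noteq> 0\<close> by simp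
  then have "?F \<noteq> {Q}" using p by (metis One_nat_def card.empty card.insert empty_iff finite.emptyI mod_less not_prime_1 one_neq_zero prime_gt_1_nat)
  moreover have "Q \<in> ?F"
  proof -
    have "\<forall>x\<in>Q. \<one> \<otimes> x \<otimes> inv \<one> \<in> Q" using QG by (simp add: subset_eq)
    moreover have "Q = Q #> \<one>" using QG by simp
    ultimately show ?thesis using subgroup.subgroup_in_rcosets[OF Q(1) is_group] by blast
  qed
  ultimately obtain C where "C \<in> ?F" "C \<noteq> Q" by blast
  then obtain g where g: "g \<in> carrier G" "C = Q #> g" "\<forall>x\<in>Q. g \<otimes> x \<otimes> inv g \<in> Q" "C \<noteq> Q" by blast
  moreover have "g \<notin> Q" using g coset_join2[OF g(1) Q(1)] by auto
  ultimately show ?thesis by blast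
qed

text \<open>\<open>GREATEST\<close> in \<open>p_core\<close> refers to inclusion, so a greatest
  normal p-subgroup has to be produced. One of maximal cardinality contains every other, because the
  product of two normal p-subgroups is again one.\<close>

lemma (in group) normal_p_subgroup_in_p_core:
  assumes p: "prime p" and fin: "finite (carrier G)" and N: "N \<lhd> G" "card N = p ^ k"
  shows "N \<subseteq> p_core p G"
proof -
  let ?P = "\<lambda>N. N \<lhd> G \<and> (\<exists>k. card N = p ^ k)"
  have fP: "finite {N. ?P N}"
    by (rule finite_subset[of _ "Pow (carrier G)"]) (use fin in \<open>auto dest: normal_imp_subgroup subgroup.subset\<close>)
  have join: "?P (M <#> N)" if M: "?P M" and N: "?P N" for M N
  proof
    have sM: "subgroup M G" and sN: "subgroup N G" using M N normal_imp_subgroup by auto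
    show nor: "M <#> N \<lhd> G" using M N normal_subgroup_set_mult_closed by blast
    interpret MN: group "G\<lparr>carrier := M <#> N\<rparr>" using nor normal_imp_subgroup subgroup_imp_group by blast
    have "\<exists>k. order (G\<lparr>carrier := M <#> N\<rparr>) = p ^ k"
    proof (rule MN.order_prime_power[OF p])
      show "finite (carrier (G\<lparr>carrier := M <#> N\<rparr>))"
        using fin normal_imp_subgroup[OF nor] by (auto dest: subgroup.subset intro: finite_subset)
      fix x assume "x \<in> carrier (G\<lparr>carrier := M <#> N\<rparr>)"
      then obtain m n where mn: "m \<in> M" "n \<in> N" "x = m \<otimes> n" unfolding set_mult_def by auto
      have mG: "m \<in> carrier G" "n \<in> carrier G" using mn sM sN subgroup.mem_carrier by fastforce+
      obtain j i where ji: "card M = p ^ j" "card N = p ^ i" using M N by blast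
      \<comment> \<open>Modulo \<open>N\<close> the powers of m n are those of m; hence the power
        with exponent \<open>p ^ j\<close> lies in \<open>N\<close>, and raising it further to
        \<open>p ^ i\<close> gives \<one>.\<close>
      have pw: "(m \<otimes> n) [^] (r::nat) \<in> (m [^] r) <# N" for r
      proof (induction r)
        case 0 then show ?case using sN subgroup.one_closed by (force simp: l_coset_def)
      next
        case (Suc r)
        then obtain n' where n': "n' \<in> N" "(m \<otimes> n) [^] r = m [^] r \<otimes> n'" unfolding l_coset_def by blast
        have n'G: "n' \<in> carrier G" using n' sN subgroup.mem_carrier by fastforce
        have c: "inv m \<otimes> n' \<otimes> m \<in> N" using N n' mG normal.inv_op_closed1 by metis
        then have c2: "inv m \<otimes> n' \<otimes> m \<otimes> n \<in> N" using mn(2) sN subgroup.m_closed by metis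
        have "(m \<otimes> n) [^] Suc r = m [^] r \<otimes> n' \<otimes> (m \<otimes> n)" using n' by simp
        also have "\<dots> = m [^] Suc r \<otimes> (inv m \<otimes> n' \<otimes> m \<otimes> n)"
          using mG n'G by (simp add: m_assoc) (simp add: m_assoc[symmetric])
        finally show ?case using c2 unfolding l_coset_def by blast
      qed
      interpret Mg: group "G\<lparr>carrier := M\<rparr>" using sM subgroup_imp_group by blast
      interpret Ng: group "G\<lparr>carrier := N\<rparr>" using sN subgroup_imp_group by blast
      have "m [^] (p ^ j) = \<one>"
        using Mg.pow_order_eq_1[of m] mn(1) ji by (simp add: order_def nat_pow_consistent[symmetric])
      then have "(m \<otimes> n) [^] (p ^ j) \<in> N" using pw[of "p ^ j"] sN by (auto simp: l_coset_def subgroup.mem_carrier)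
      then have "((m \<otimes> n) [^] (p ^ j)) [^] (p ^ i) = \<one>"
        using Ng.pow_order_eq_1[of "(m \<otimes> n) [^] (p ^ j)"] ji by (simp add: order_def nat_pow_consistent[symmetric])
      then have "x [^] (p ^ (j + i)) = \<one>" using mn mG by (simp add: nat_pow_pow power_add)
      then show "\<exists>n. x [^]\<^bsub>G\<lparr>carrier := M <#> N\<rparr>\<^esub> p ^ n = \<one>\<^bsub>G\<lparr>carrier := M <#> N\<rparr>\<^esub>"
        by (auto simp: nat_pow_consistent[symmetric])
    qed
    then show "\<exists>k. card (M <#> N) = p ^ k" by (simp add: order_def)
  qed
  obtain M where M: "?P M" and max: "\<And>M'. ?P M' \<Longrightarrow> card M' \<le> card M"
    using ex_has_greatest_nat[of ?P N card "Suc (card (carrier G))"] N fin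
    by (auto simp: less_Suc_eq_le) (metis card_mono normal_imp_subgroup subgroup.subset)
  have great: "N' \<subseteq> M" if N': "?P N'" for N'
  proof -
    have sM: "subgroup M G" and sN: "subgroup N' G" using M N' normal_imp_subgroup by auto
    have 1: "M \<subseteq> M <#> N'" "N' \<subseteq> M <#> N'"
      using sM sN subgroup.one_closed unfolding set_mult_def
      by (force simp: subgroup.mem_carrier)+
    have "finite (M <#> N')" using join[OF M N'] fin by (meson finite_subset normal_imp_subgroup subgroup.subset)
    then have "M = M <#> N'" using 1 max[OF join[OF M N']] by (simp add: card_seteq)
    then show ?thesis using 1 by simp
  qed
  have "p_core p G = M" unfolding p_core_def
    by (rule Greatest_equality) (use M great in auto)
  then show ?thesis using great N by auto
qed

section \<open>Maximal tori\<close>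

lemma prufer_group_simps [simp]:
  "carrier (prufer_group p) = {z. \<exists>n. z ^ (p ^ n) = 1}"
  "monoid.mult (prufer_group p) = (*)" "\<one>\<^bsub>prufer_group p\<^esub> = 1"
  by (simp_all add: prufer_group_def)

lemma group_prufer_group:
  assumes p: "p > 0" shows "group (prufer_group p)"
proof (rule groupI; simp)
  fix x y :: complex assume "\<exists>n. x ^ p ^ n = 1" "\<exists>n. y ^ p ^ n = 1"
  then obtain n m where "x ^ p ^ n = 1" "y ^ p ^ m = 1" by blast
  moreover have "(x * y) ^ p ^ (n + m) = (x ^ p ^ n) ^ p ^ m * (y ^ p ^ m) ^ p ^ n"
    by (simp add: power_add power_mult_distrib flip: power_mult) (simp add: mult.commute)
  ultimately show "\<exists>n. (x * y) ^ p ^ n = 1" by auto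
next
  fix x :: complex assume "\<exists>n. x ^ p ^ n = 1"
  then obtain n where n: "x ^ p ^ n = 1" by blast
  have "x \<noteq> 0" using n p by (auto simp: power_0_left)
  then show "\<exists>y. (\<exists>n. y ^ p ^ n = 1) \<and> y * x = 1"
    using n by (intro exI[of _ "inverse x"]) (auto simp: power_inverse)
qed

lemma pow_prufer_group: "x [^]\<^bsub>prufer_group p\<^esub> (n::nat) = x ^ n"
  by (induction n) (simp_all add: nat_pow_def)

lemma pow_product_group:
  "x \<in> carrier (product_group I G) \<Longrightarrow> i \<in> I \<Longrightarrow> (x [^]\<^bsub>product_group I G\<^esub> (n::nat)) i = x i [^]\<^bsub>G i\<^esub> n"
  by (induction n) (auto simp: nat_pow_def)

lemma pow_product_group_eq:
  assumes x: "x \<in> carrier (product_group I G)" and G: "\<And>i. i \<in> I \<Longrightarrow> group (G i)"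
  shows "x [^]\<^bsub>product_group I G\<^esub> (n::nat) = (\<lambda>i\<in>I. x i [^]\<^bsub>G i\<^esub> n)"
proof -
  have "x [^]\<^bsub>product_group I G\<^esub> n \<in> carrier (product_group I G)"
    by (intro monoid.nat_pow_closed group.is_monoid product_group G x)
  then show ?thesis using pow_product_group[OF x] by (intro extensionalityI[of _ I]) (auto simp: PiE_iff)
qed

locale max_torus = group G for G (structure) + 
  fixes p T r
  assumes prime: "prime p" and max_torus: "is_max_torus p G T r"
begin

lemma torus_normal: "T \<lhd> G" using max_torus unfolding is_max_torus_def by blast

lemma torus_subgroup: "subgroup T G" using torus_normal normal_imp_subgroup by blast

lemma torus_in_carrier: "t \<in> T \<Longrightarrow> t \<in> carrier G"
  using torus_subgroup subgroup.mem_carrier by fastforce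

abbreviation "prufer_power \<equiv> product_group {..<r} (\<lambda>_. prufer_group p)"

lemma obtain_coordinates:
  obtains h where "bij_betw h T (carrier prufer_power)"
    "\<And>s t. s \<in> T \<Longrightarrow> t \<in> T \<Longrightarrow> h (s \<otimes> t) = h s \<otimes>\<^bsub>prufer_power\<^esub> h t"
    "\<And>t (n::nat). t \<in> T \<Longrightarrow> h (t [^] n) = (\<lambda>i\<in>{..<r}. h t i ^ n)"
    "h \<one> = (\<lambda>i\<in>{..<r}. 1)"
proof -
  obtain h where h: "h \<in> iso (G \<downharpoonright> T) prufer_power"
    using max_torus unfolding is_max_torus_def is_iso_def by blast
  have gT: "group (G \<downharpoonright> T)" using torus_subgroup subgroup_imp_group by blast
  have gP: "group prufer_power" using prime by (intro product_group group_prufer_group) (simp add: prime_gt_0_nat)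
  interpret h: group_hom "G \<downharpoonright> T" prufer_power h
    using h gT gP by (auto simp: group_hom_def group_hom_axioms_def iso_def)
  have bij: "bij_betw h T (carrier prufer_power)" using h by (simp add: iso_def)
  show ?thesis
  proof (rule that[of h])
    show "bij_betw h T (carrier prufer_power)" by (rule bij)
    show "h (s \<otimes> t) = h s \<otimes>\<^bsub>prufer_power\<^esub> h t" if "s \<in> T" "t \<in> T" for s t
      using h.hom_mult[of s t] that by simp
    show "h (t [^] n) = (\<lambda>i\<in>{..<r}. h t i ^ n)" if "t \<in> T" for t and n :: nat
    proof -
      have "h t \<in> carrier prufer_power" using that bij by (auto simp: bij_betw_def)
      then have "h t [^]\<^bsub>prufer_power\<^esub> n = (\<lambda>i\<in>{..<r}. h t i ^ n)"
        using pow_product_group_eq[of "h t" "{..<r}" "\<lambda>_. prufer_group p" n]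
          group_prufer_group[OF prime_gt_0_nat[OF prime]] by (simp add: pow_prufer_group)
      then show ?thesis using h.hom_nat_pow[of t n] that by (simp add: nat_pow_consistent[symmetric])
    qed
    show "h \<one> = (\<lambda>i\<in>{..<r}. 1)" using h.hom_one by simp
  qed
qed

lemma torus_commute: "s \<in> T \<Longrightarrow> t \<in> T \<Longrightarrow> s \<otimes> t = t \<otimes> s"
proof -
  assume st: "s \<in> T" "t \<in> T"
  obtain h where h: "bij_betw h T (carrier prufer_power)" 
    "\<And>s t. s \<in> T \<Longrightarrow> t \<in> T \<Longrightarrow> h (s \<otimes> t) = h s \<otimes>\<^bsub>prufer_power\<^esub> h t" by (rule obtain_coordinates) blast
  have "h (s \<otimes> t) = h (t \<otimes> s)" using h(2) st by (auto simp: mult.commute)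
  moreover have "s \<otimes> t \<in> T" "t \<otimes> s \<in> T" using st torus_subgroup subgroup.m_closed by metis+
  ultimately show ?thesis using h(1) unfolding bij_betw_def inj_on_def by blast
qed

lemma torus_nat_pow_closed: "t \<in> T \<Longrightarrow> t [^] (n::nat) \<in> T"
  using torus_subgroup by (induction n) (auto simp: subgroup.one_closed subgroup.m_closed)

lemma torus_p_divisible1: "t \<in> T \<Longrightarrow> \<exists>s\<in>T. s [^] p = t"
proof -
  assume t: "t \<in> T"
  obtain h where h: "bij_betw h T (carrier prufer_power)" 
    "\<And>t (n::nat). t \<in> T \<Longrightarrow> h (t [^] n) = (\<lambda>i\<in>{..<r}. h t i ^ n)" by (rule obtain_coordinates) blast
  have ht: "h t \<in> carrier prufer_power" using t h(1) by (auto simp: bij_betw_def)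
  have "\<exists>w. w \<in> carrier (prufer_group p) \<and> w ^ p = h t i" if i: "i < r" for i
  proof -
    have p0: "p > 0" using prime by (simp add: prime_gt_0_nat)
    have "h t i \<in> carrier (prufer_group p)" using ht i by auto
    then obtain n where n: "h t i ^ p ^ n = 1" by auto
    then have "h t i \<noteq> 0" using p0 by (auto simp: power_0_left)
    then have "card {w. w ^ p = h t i} \<noteq> 0" using card_nth_roots[of "h t i" p] p0 by simp
    then have "{w. w ^ p = h t i} \<noteq> {}" by (metis card.empty)
    then obtain w where w: "w ^ p = h t i" by auto
    then have "w ^ p ^ Suc n = 1" using n by (metis power_Suc power_mult)
    then show ?thesis using w by (auto simp del: power_Suc)
  qed
  then obtain w where w: "\<And>i. i < r \<Longrightarrow> w i \<in> carrier (prufer_group p) \<and> w i ^ p = h t i" by metis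
  have "(\<lambda>i\<in>{..<r}. w i) \<in> carrier prufer_power" using w by auto
  then obtain s where s: "s \<in> T" "h s = (\<lambda>i\<in>{..<r}. w i)" using h(1) unfolding bij_betw_def by (metis imageE)
  have "h (s [^] p) = (\<lambda>i\<in>{..<r}. h t i)" using h(2)[OF s(1)] s(2) w by (auto intro!: restrict_ext)
  also have "\<dots> = h t" using ht by (auto simp: PiE_iff intro!: extensionalityI[of _ "{..<r}"])
  finally have "s [^] p = t" using h(1) s(1) t torus_nat_pow_closed
    by (metis bij_betw_def inj_on_eq_iff)
  then show ?thesis using s(1) by blast
qed

lemma torus_divisible: "t \<in> T \<Longrightarrow> \<exists>s\<in>T. s [^] (p ^ n) = t"
proof (induction n arbitrary: t)
  case 0 then show ?case using torus_in_carrier by auto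
next
  case (Suc n)
  then obtain s where s: "s \<in> T" "s [^] (p ^ n) = t" by blast
  obtain u where u: "u \<in> T" "u [^] p = s" using torus_p_divisible1[OF s(1)] by blast
  have "u [^] (p ^ Suc n) = t" using u s torus_in_carrier by (simp add: nat_pow_pow[symmetric])
  then show ?case using u by blast
qed

lemma torus_torsion: "t \<in> T \<Longrightarrow> \<exists>n. t [^] (p ^ n) = \<one>"
proof -
  assume t: "t \<in> T"
  obtain h where h: "bij_betw h T (carrier prufer_power)" 
    "\<And>t (n::nat). t \<in> T \<Longrightarrow> h (t [^] n) = (\<lambda>i\<in>{..<r}. h t i ^ n)" "h \<one> = (\<lambda>i\<in>{..<r}. 1)"
    by (rule obtain_coordinates) blast
  have ht: "h t \<in> carrier prufer_power" using t h(1) by (auto simp: bij_betw_def)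
  then have "\<forall>i\<in>{..<r}. \<exists>n. h t i ^ p ^ n = 1" by auto
  then obtain m where m: "\<And>i. i < r \<Longrightarrow> h t i ^ p ^ m i = 1" by (metis lessThan_iff)
  have "h t i ^ p ^ (\<Sum>j<r. m j) = 1" if i: "i < r" for i
  proof -
    have "m i \<le> (\<Sum>j<r. m j)" using i by (intro member_le_sum) auto
    then obtain d where "(\<Sum>j<r. m j) = m i + d" using le_Suc_ex by blast
    then show ?thesis using m[OF i] by (simp add: power_add power_mult)
  qed
  then have "h (t [^] (p ^ (\<Sum>j<r. m j))) = h \<one>" using h(2,3) t by (auto intro!: restrict_ext)
  then have "t [^] (p ^ (\<Sum>j<r. m j)) = \<one>"
    using h(1) t torus_nat_pow_closed subgroup.one_closed[OF torus_subgroup] by (metis bij_betw_def inj_on_eq_iff)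
  then show ?thesis by blast
qed

text \<open>This count recovers the rank from the torus, shows that a torus of positive rank is
  infinite, and leaves exactly one involution when p = 2 and the rank is one.\<close>

lemma card_torus_p_torsion: "card {t \<in> T. t [^] p = \<one>} = p ^ r"
proof -
  obtain h where h: "bij_betw h T (carrier prufer_power)" 
    "\<And>t (n::nat). t \<in> T \<Longrightarrow> h (t [^] n) = (\<lambda>i\<in>{..<r}. h t i ^ n)" "h \<one> = (\<lambda>i\<in>{..<r}. 1)"
    by (rule obtain_coordinates) blast
  have one: "\<one> \<in> T" by (rule subgroup.one_closed[OF torus_subgroup])
  have p0: "p > 0" using prime by (simp add: prime_gt_0_nat)
  let ?R = "\<Pi>\<^sub>E i\<in>{..<r}. {z::complex. z ^ p = 1}"
  have "bij_betw h {t \<in> T. t [^] p = \<one>} ?R"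
    unfolding bij_betw_def
  proof
    show "inj_on h {t \<in> T. t [^] p = \<one>}" using h(1) by (auto simp: bij_betw_def inj_on_def)
    have iff: "t [^] p = \<one> \<longleftrightarrow> (\<forall>i<r. h t i ^ p = 1)" if t: "t \<in> T" for t
    proof -
      have "t [^] p = \<one> \<longleftrightarrow> h (t [^] p) = h \<one>"
        using h(1) t torus_nat_pow_closed one by (metis bij_betw_def inj_on_eq_iff)
      then show ?thesis using h(2)[OF t, of p] h(3) by (auto simp: fun_eq_iff restrict_def)
    qed
    show "h ` {t \<in> T. t [^] p = \<one>} = ?R"
    proof (intro equalityI subsetI)
      fix f assume "f \<in> h ` {t \<in> T. t [^] p = \<one>}"
      then obtain t where t: "t \<in> T" "f = h t" "t [^] p = \<one>" by blast
      have "h t \<in> carrier prufer_power" using t h(1) by (auto simp: bij_betw_def)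
      then show "f \<in> ?R" using iff t by (auto simp: PiE_iff)
    next
      fix f assume f: "f \<in> ?R"
      then have "f \<in> carrier prufer_power" by (auto simp: PiE_iff intro: exI[of _ 1])
      then obtain t where "t \<in> T" "h t = f" using h(1) unfolding bij_betw_def by (metis imageE)
      then show "f \<in> h ` {t \<in> T. t [^] p = \<one>}" using iff f by (force simp: PiE_iff)
    qed
  qed
  then have "card {t \<in> T. t [^] p = \<one>} = card ?R" by (rule bij_betw_same_card)
  also have "\<dots> = p ^ r" using p0 by (simp add: card_PiE card_roots_unity_eq)
  finally show ?thesis .
qed

lemma pow_index_in_torus:
  assumes "order (G Mod T) = p ^ k" "x \<in> carrier G"
  shows "x [^] (p ^ k) \<in> T"
proof -
  interpret T: normal T G by (rule torus_normal)
  interpret Q: group "G Mod T" by (rule T.factorgroup_is_group)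
  have "T #> x \<in> carrier (G Mod T)" using assms(2) by (auto simp: carrier_FactGroup)
  then have "(T #> x) [^]\<^bsub>G Mod T\<^esub> (p ^ k) = \<one>\<^bsub>G Mod T\<^esub>" using Q.pow_order_eq_1 assms(1) by metis
  then have "T #> (x [^] (p ^ k)) = T" using T.FactGroup_pow[OF assms(2)] by simp
  then show ?thesis using rcos_self[OF _ torus_subgroup, of "x [^] (p ^ k)"] assms(2) by simp
qed

end

text \<open>By divisibility every element of \<open>T\<close> is a power whose exponent is the index
  of \<open>T'\<close>, and such powers lie in \<open>T'\<close>.\<close>

lemma max_torus_subset:
  assumes "max_torus G p T r" "max_torus G p T' r'"
  shows "T \<subseteq> T'"
proof
  interpret A: max_torus G p T r by fact
  interpret B: max_torus G p T' r' by fact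
  fix t assume t: "t \<in> T"
  obtain k where k: "order (G Mod T') = p ^ k" using B.max_torus unfolding is_max_torus_def by blast
  obtain s where "s \<in> T" "s [^]\<^bsub>G\<^esub> (p ^ k) = t" using A.torus_divisible[OF t] by blast
  then show "t \<in> T'" using B.pow_index_in_torus[OF k] A.torus_in_carrier by blast
qed

lemma max_torus_unique:
  assumes "max_torus G p T r" "max_torus G p T' r'"
  shows "T' = T \<and> r' = r"
proof -
  have T: "T' = T" using max_torus_subset assms by blast
  interpret A: max_torus G p T r by fact
  interpret B: max_torus G p T' r' by fact
  have "p ^ r = p ^ r'" using A.card_torus_p_torsion B.card_torus_p_torsion T by simp
  then have "r' = r" using A.prime by (metis power_inject_exp prime_gt_1_nat)
  with T show ?thesis by simp
qed

context max_torus
begin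

lemma torus_eq: "torus p G = T" and rk_eq: "rk p G = r"
proof -
  have u: "T' = T \<and> r' = r" if "is_max_torus p G T' r'" for T' r'
  proof -
    have "max_torus G p T' r'" by unfold_locales (use that prime in auto)
    then show ?thesis using max_torus_unique max_torus_axioms by blast
  qed
  show "torus p G = T" unfolding torus_def using max_torus u by (intro the_equality) blast+
  show "rk p G = r" unfolding rk_def using max_torus u by (intro the_equality) blast+
qed

text \<open>In the single coordinate the powers of t provide \<open>ord t\<close> distinct solutions
  of \<open>z ^ ord t = 1\<close>, hence all of them, and s is among them.\<close>

lemma torus_power_of:
  assumes r: "r = 1" and s: "s \<in> T" and t: "t \<in> T" and dv: "ord s dvd ord t"
  shows "\<exists>k::nat. s = t [^] k"
proof -
  obtain h where h: "bij_betw h T (carrier prufer_power)" 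
    "\<And>t (n::nat). t \<in> T \<Longrightarrow> h (t [^] n) = (\<lambda>i\<in>{..<r}. h t i ^ n)" "h \<one> = (\<lambda>i\<in>{..<r}. 1)"
    by (rule obtain_coordinates) blast
  define e where "e t = h t 0" for t
  have e_inj: "x = y" if "x \<in> T" "y \<in> T" "e x = e y" for x y
  proof -
    have "h x \<in> carrier prufer_power" "h y \<in> carrier prufer_power" using that h(1) by (auto simp: bij_betw_def)
    then have "h x = h y" using that(3) r by (intro PiE_ext) (auto simp: e_def)
    then show ?thesis using h(1) that by (auto simp: bij_betw_def inj_on_def)
  qed
  have e_pow: "e (t [^] n) = e t ^ n" if "t \<in> T" for t and n :: nat using h(2)[OF that] r by (simp add: e_def)
  have e_one: "e \<one> = 1" using h(3) r by (simp add: e_def)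
  obtain n where "t [^] (p ^ n) = \<one>" using torus_torsion t by blast
  then have "ord t dvd p ^ n" using pow_eq_id torus_in_carrier t by blast
  then have o0: "ord t > 0" using prime by (auto intro: Nat.gr0I)
  let ?P = "(\<lambda>k. e t ^ k) ` {..<ord t}"
  have inj: "inj_on (\<lambda>k. e t ^ k) {..<ord t}"
  proof (rule inj_onI)
    fix j k assume jk: "j \<in> {..<ord t}" "k \<in> {..<ord t}" "e t ^ j = e t ^ k"
    then have "t [^] j = t [^] k" using e_pow[OF t] e_inj torus_nat_pow_closed t by metis
    then show "j = k" using jk ord_inj[OF torus_in_carrier[OF t]] o0 by (auto simp: inj_on_def)
  qed
  have sub: "?P \<subseteq> {z. z ^ ord t = 1}"
  proof -
    have "(e t ^ k) ^ ord t = 1" for k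
      using e_pow[OF t, of "ord t"] e_one pow_ord_eq_1 torus_in_carrier[OF t]
      by (metis mult.commute power_mult power_one)
    then show ?thesis by auto
  qed
  have "?P = {z. z ^ ord t = 1}"
    by (rule card_subset_eq) (use inj sub o0 in \<open>auto simp: card_image card_roots_unity_eq finite_roots_unity\<close>)
  moreover have "s [^] ord t = \<one>" using dv pow_eq_id torus_in_carrier s by blast
  then have "e s ^ ord t = 1" using e_pow[OF s] e_one by metis
  ultimately obtain k where "e s = e t ^ k" by (metis (mono_tags, lifting) imageE mem_Collect_eq)
  then show ?thesis using e_inj e_pow torus_nat_pow_closed s t by metis
qed

lemma torus_ord:
  assumes "t \<in> T" shows "\<exists>a. ord t = p ^ a"
proof -
  obtain n where "t [^] (p ^ n) = \<one>" using torus_torsion assms by blast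
  then have "ord t dvd p ^ n" using pow_eq_id torus_in_carrier assms by blast
  then show ?thesis using prime divides_primepow_nat by blast
qed

text \<open>Orders in T are powers of p, so one of the two divides the other. This is the chain
  property of Z/p^infinity.\<close>

lemma torus_uniserial:
  assumes r: "r = 1" and s: "s \<in> T" and t: "t \<in> T"
  shows "(\<exists>k::nat. s = t [^] k) \<or> (\<exists>k::nat. t = s [^] k)"
proof -
  obtain a b where "ord t = p ^ a" "ord s = p ^ b" using torus_ord s t by metis
  then show ?thesis using torus_power_of[OF r] s t by (metis le_cases le_imp_power_dvd)
qed

text \<open>Taking p-th powers is surjective on T; on a finite set it would be injective and leave
  no p-torsion.\<close>

lemma torus_infinite:
  assumes "r \<noteq> 0" shows "infinite T"
proof
  assume fin: "finite T"
  have surj: "(\<lambda>t. t [^] p) ` T = T" using torus_p_divisible1 torus_nat_pow_closed by blast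
  then have inj: "inj_on (\<lambda>t. t [^] p) T" using fin by (metis eq_card_imp_inj_on)
  have one: "\<one> \<in> T" by (rule subgroup.one_closed[OF torus_subgroup])
  have "{t \<in> T. t [^] p = \<one>} = {\<one>}"
    using inj one by (auto simp: inj_on_def)
  then have "p ^ r = 1" using card_torus_p_torsion by simp
  then show False using prime assms by (simp add: prime_nat_iff)
qed

end

section \<open>Conjugation and fusion systems\<close>

text \<open>A total function, in contrast to \<open>conj_map\<close>, so that composites and
  inverses of conjugations can be computed without reference to a domain.\<close>

definition conjugate :: "('a, 'b) monoid_scheme \<Rightarrow> 'a \<Rightarrow> 'a \<Rightarrow> 'a" where
  "conjugate G g x = g \<otimes>\<^bsub>G\<^esub> x \<otimes>\<^bsub>G\<^esub> inv\<^bsub>G\<^esub> g"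

lemma conj_map_apply: "x \<in> P \<Longrightarrow> conj_map G P g x = conjugate G g x"
  by (simp add: conj_map_def conjugate_def)

context group
begin

lemma conjugate_closed [simp]:
  "g \<in> carrier G \<Longrightarrow> x \<in> carrier G \<Longrightarrow> conjugate G g x \<in> carrier G"
  by (simp add: conjugate_def)

lemma conjugate_mult:
  "g \<in> carrier G \<Longrightarrow> x \<in> carrier G \<Longrightarrow> y \<in> carrier G \<Longrightarrow>
    conjugate G g (x \<otimes> y) = conjugate G g x \<otimes> conjugate G g y"
  by (simp add: conjugate_def m_assoc inv_solve_left)

lemma conjugate_comp:
  "g \<in> carrier G \<Longrightarrow> h \<in> carrier G \<Longrightarrow> x \<in> carrier G \<Longrightarrow>
    conjugate G (g \<otimes> h) x = conjugate G g (conjugate G h x)"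
  by (simp add: conjugate_def m_assoc inv_mult_group)

lemma conjugate_one [simp]:
  "x \<in> carrier G \<Longrightarrow> conjugate G \<one> x = x" "g \<in> carrier G \<Longrightarrow> conjugate G g \<one> = \<one>"
  by (simp_all add: conjugate_def)

lemma conjugate_cancel [simp]:
  assumes "g \<in> carrier G" "x \<in> carrier G"
  shows "conjugate G (inv g) (conjugate G g x) = x" "conjugate G g (conjugate G (inv g) x) = x"
  using assms conjugate_comp[of "inv g" g x] conjugate_comp[of g "inv g" x] by simp_all

lemma conjugate_inv:
  "g \<in> carrier G \<Longrightarrow> x \<in> carrier G \<Longrightarrow> conjugate G g (inv x) = inv (conjugate G g x)"
  by (simp add: conjugate_def m_assoc inv_mult_group)

lemma conjugate_pow:
  "g \<in> carrier G \<Longrightarrow> x \<in> carrier G \<Longrightarrow> conjugate G g (x [^] (n::nat)) = conjugate G g x [^] n"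
  by (induction n) (simp_all add: conjugate_mult)

lemma conjugate_eq_iff [simp]:
  "g \<in> carrier G \<Longrightarrow> x \<in> carrier G \<Longrightarrow> y \<in> carrier G \<Longrightarrow> conjugate G g x = conjugate G g y \<longleftrightarrow> x = y"
  by (metis conjugate_cancel(1))

lemma conjugate_fix_iff:
  "g \<in> carrier G \<Longrightarrow> x \<in> carrier G \<Longrightarrow> conjugate G g x = x \<longleftrightarrow> g \<otimes> x = x \<otimes> g"
  by (simp add: conjugate_def inv_solve_right')

lemma inj_on_conjugate: "g \<in> carrier G \<Longrightarrow> P \<subseteq> carrier G \<Longrightarrow> inj_on (conjugate G g) P"
  by (auto simp: inj_on_def subset_eq)

lemma subgroup_conjugate:
  assumes "subgroup P G" "g \<in> carrier G" shows "subgroup (conjugate G g ` P) G"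
proof (rule subgroupI)
  have PG: "\<And>x. x \<in> P \<Longrightarrow> x \<in> carrier G" using assms(1) subgroup.mem_carrier by fastforce
  show "conjugate G g ` P \<subseteq> carrier G" using PG assms(2) by auto
  show "conjugate G g ` P \<noteq> {}" using subgroup.one_closed[OF assms(1)] by blast
  show "inv a \<in> conjugate G g ` P" if a: "a \<in> conjugate G g ` P" for a
  proof -
    obtain x where x: "x \<in> P" "a = conjugate G g x" using a by blast
    then have "inv a = conjugate G g (inv x)" using PG assms(2) by (simp add: conjugate_inv)
    then show ?thesis using subgroup.m_inv_closed[OF assms(1) x(1)] by blast
  qed
  show "a \<otimes> b \<in> conjugate G g ` P" if ab: "a \<in> conjugate G g ` P" "b \<in> conjugate G g ` P" for a b
  proof -
    obtain x y where x: "x \<in> P" "a = conjugate G g x" "y \<in> P" "b = conjugate G g y" using ab by blast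
    then have "a \<otimes> b = conjugate G g (x \<otimes> y)" using PG assms(2) by (simp add: conjugate_mult)
    then show ?thesis using subgroup.m_closed[OF assms(1) x(1,3)] by blast
  qed
qed

lemma normalizer_iff:
  assumes "P \<subseteq> carrier G"
  shows "g \<in> normalizer G P \<longleftrightarrow> g \<in> carrier G \<and> conjugate G g ` P = P"
proof -
  have "g <# P #> inv g = conjugate G g ` P"
    by (auto simp: l_coset_def r_coset_def conjugate_def)
  then show ?thesis using assms by (auto simp: normalizer_def stabilizer_def)
qed

lemma centralizer_iff:
  assumes "P \<subseteq> carrier G"
  shows "g \<in> centralizer G P \<longleftrightarrow> g \<in> carrier G \<and> (\<forall>x\<in>P. conjugate G g x = x)"
  using assms by (auto simp: centralizer_def conjugate_fix_iff subset_eq)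

lemma subgroup_centralizer:
  assumes "P \<subseteq> carrier G" shows "subgroup (centralizer G P) G"
proof (rule subgroupI)
  show "centralizer G P \<subseteq> carrier G" by (auto simp: centralizer_def)
  have "\<one> \<in> centralizer G P" using assms by (auto simp: centralizer_iff)
  then show "centralizer G P \<noteq> {}" by blast
  show "inv a \<in> centralizer G P" if "a \<in> centralizer G P" for a
    using that assms by (auto simp: centralizer_iff) (metis conjugate_cancel(1) subsetD)
  show "a \<otimes> b \<in> centralizer G P" if "a \<in> centralizer G P" "b \<in> centralizer G P" for a b
    using that assms by (auto simp: centralizer_iff) (metis conjugate_comp subsetD)
qed

lemma center_eq: "P \<subseteq> carrier G \<Longrightarrow> center G P = centralizer G P \<inter> P"
  by (auto simp: center_def centralizer_def)

lemma subgroup_normalizer: "P \<subseteq> carrier G \<Longrightarrow> subgroup (normalizer G P) G"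
  by (rule normalizer_imp_subgroup)

lemma subgroup_subset_normalizer:
  assumes "subgroup P G" shows "P \<subseteq> normalizer G P"
proof
  fix g assume g: "g \<in> P"
  have PG: "\<And>x. x \<in> P \<Longrightarrow> x \<in> carrier G" using assms subgroup.mem_carrier by fastforce
  have *: "conjugate G h ` P \<subseteq> P" if "h \<in> P" for h
    using that assms by (auto simp: conjugate_def subgroup.m_closed subgroup.m_inv_closed)
  have "x \<in> conjugate G g ` P" if "x \<in> P" for x
  proof -
    have "x = conjugate G g (conjugate G (inv g) x)" using PG g that by simp
    then show ?thesis using *[of "inv g"] subgroup.m_inv_closed[OF assms g] that by blast
  qed
  then show "g \<in> normalizer G P" using * g PG by (auto simp: normalizer_iff subset_eq)
qed

lemma normalizerI:
  assumes "subgroup P G" "g \<in> carrier G" "\<And>x. x \<in> P \<Longrightarrow> conjugate G g x \<in> P"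
    "\<And>x. x \<in> P \<Longrightarrow> conjugate G (inv g) x \<in> P"
  shows "g \<in> normalizer G P"
proof -
  have PG: "\<And>x. x \<in> P \<Longrightarrow> x \<in> carrier G" using assms subgroup.mem_carrier by fastforce
  have "x \<in> conjugate G g ` P" if "x \<in> P" for x
    using assms(4)[OF that] PG[OF that] assms(2) by (metis conjugate_cancel(2) imageI)
  then show ?thesis using assms(2,3) PG by (auto simp: normalizer_iff subset_eq)
qed

lemma centralizer_subset_normalizer:
  "P \<subseteq> carrier G \<Longrightarrow> centralizer G P \<subseteq> normalizer G P"
  by (auto simp: centralizer_iff normalizer_iff)

end

section \<open>Calculus of morphisms into S\<close>

context fusion_system
begin

abbreviation E :: "'a set \<Rightarrow> ('a \<Rightarrow> 'a) set" where "E P \<equiv> F P (carrier S)"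

abbreviation cj :: "'a \<Rightarrow> 'a \<Rightarrow> 'a" where "cj \<equiv> conjugate S"

lemma sub_mem: "subgroup P S \<Longrightarrow> x \<in> P \<Longrightarrow> x \<in> carrier S"
  using subgroup.mem_carrier by fastforce

lemma F_hom:
  assumes "subgroup P S" "subgroup Q S" "f \<in> F P Q"
  shows "x \<in> P \<Longrightarrow> f x \<in> Q" "x \<in> P \<Longrightarrow> y \<in> P \<Longrightarrow> f (x \<otimes> y) = f x \<otimes> f y"
    "inj_on f P" "f \<in> extensional P"
proof -
  have "f \<in> hom_inj S P Q" using subset_hom_inj assms by blast
  then show "x \<in> P \<Longrightarrow> f x \<in> Q" "x \<in> P \<Longrightarrow> y \<in> P \<Longrightarrow> f (x \<otimes> y) = f x \<otimes> f y"
    "inj_on f P" "f \<in> extensional P" by (auto simp: hom_inj_def mon_def hom_def)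
qed

lemmas E_hom = F_hom[OF _ subgroup_self]

lemma E_one: "subgroup P S \<Longrightarrow> f \<in> E P \<Longrightarrow> f \<one> = \<one>"
  by (metis E_hom(1,2) l_cancel_one' one_closed r_one subgroup.one_closed)

lemma E_inv: "subgroup P S \<Longrightarrow> f \<in> E P \<Longrightarrow> x \<in> P \<Longrightarrow> f (inv x) = inv (f x)"
  by (metis E_hom(1,2) E_one inv_equality sub_mem l_inv subgroup.m_inv_closed)

lemma E_pow: "subgroup P S \<Longrightarrow> f \<in> E P \<Longrightarrow> x \<in> P \<Longrightarrow> x [^] (n::nat) \<in> P \<and> f (x [^] n) = f x [^] n"
proof (induction n)
  case 0 then show ?case by (simp add: E_one subgroup.one_closed)
next
  case (Suc n) then show ?case by (simp add: E_hom(2) subgroup.m_closed)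
qed

lemma E_conjugate:
  assumes "subgroup P S" "f \<in> E P" "x \<in> P" "y \<in> P"
  shows "cj x y \<in> P" "f (cj x y) = cj (f x) (f y)"
  using assms by (auto simp: conjugate_def E_hom(2) E_inv subgroup.m_closed subgroup.m_inv_closed)

lemma E_image_subgroup:
  assumes "subgroup P S" "f \<in> E P" shows "subgroup (f ` P) S"
proof (rule subgroupI)
  show "f ` P \<subseteq> carrier S" using E_hom(1)[OF assms] by blast
  show "f ` P \<noteq> {}" using subgroup.one_closed[OF assms(1)] by blast
  show "inv a \<in> f ` P" if "a \<in> f ` P" for a
    using that by (auto simp flip: E_inv[OF assms] simp: subgroup.m_inv_closed[OF assms(1)])
  show "a \<otimes> b \<in> f ` P" if "a \<in> f ` P" "b \<in> f ` P" for a b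
    using that by (auto simp flip: E_hom(2)[OF assms] simp: subgroup.m_closed[OF assms(1)])
qed

lemma inclusion_in_F:
  assumes "subgroup P S" "subgroup Q S" "P \<subseteq> Q" shows "(\<lambda>x\<in>P. x) \<in> F P Q"
proof -
  have "(\<lambda>x\<in>P. x) = conj_map S P \<one>"
    using sub_mem[OF assms(1)] by (auto simp: conj_map_def)
  moreover have "\<one> \<in> transporter S P Q"
    using sub_mem[OF assms(1)] assms(3) by (auto simp: transporter_def conj_map_def)
  ultimately show ?thesis using hom_conj_subset[OF assms(1,2)] unfolding hom_conj_def by blast
qed

lemma fus_iso_image:
  assumes "subgroup P S" "subgroup Q S" "f \<in> fus_iso F P Q"
  shows "f ` P = Q"
proof -
  obtain g where g: "f \<in> F P Q" "g \<in> F Q P" "compose Q f g = (\<lambda>y\<in>Q. y)"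
    using assms(3) unfolding fus_iso_def by blast
  have "y \<in> f ` P" if "y \<in> Q" for y
  proof -
    have "f (g y) = y" using g(3) that by (metis compose_eq restrict_apply')
    then show ?thesis using F_hom(1)[OF assms(2,1) g(2) that] by force
  qed
  then show ?thesis using F_hom(1)[OF assms(1,2) g(1)] by blast
qed

text \<open>Morphisms do not record their target, so the sets \<open>E P\<close> determine all of F.
  For the converse, factorization makes f an isomorphism onto f(P), which is then included into
  \<open>Q\<close>.\<close>

lemma F_iff:
  assumes "subgroup P S" "subgroup Q S"
  shows "f \<in> F P Q \<longleftrightarrow> f \<in> E P \<and> f ` P \<subseteq> Q"
proof
  assume f: "f \<in> F P Q"
  have "compose P (\<lambda>x\<in>Q. x) f \<in> E P"
    by (rule compose_closed[OF assms subgroup_self f inclusion_in_F[OF assms(2) subgroup_self]])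
      (use assms(2) in \<open>auto dest: sub_mem\<close>)
  moreover have "compose P (\<lambda>x\<in>Q. x) f = f"
    using F_hom(1,4)[OF assms f] by (auto simp: compose_def extensional_def)
  ultimately show "f \<in> E P \<and> f ` P \<subseteq> Q" using F_hom(1)[OF assms f] by auto
next
  assume f: "f \<in> E P \<and> f ` P \<subseteq> Q"
  then obtain R where R: "subgroup R S" "f \<in> fus_iso F P R" using factorization[OF assms(1) subgroup_self] by blast
  then have im: "f ` P = R" "f \<in> F P R" using fus_iso_image[OF assms(1)] by (auto simp: fus_iso_def)
  have "compose P (\<lambda>x\<in>R. x) f \<in> F P Q"
    using compose_closed[OF assms(1) R(1) assms(2) im(2) inclusion_in_F[OF R(1) assms(2)]] f im by auto
  moreover have "compose P (\<lambda>x\<in>R. x) f = f"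
    using F_hom(1,4)[OF assms(1) R(1) im(2)] by (auto simp: compose_def extensional_def)
  ultimately show "f \<in> F P Q" by simp
qed

lemma E_fus_iso:
  assumes "subgroup P S" "f \<in> E P" shows "f \<in> fus_iso F P (f ` P)"
  using factorization[OF assms(1) subgroup_self assms(2)] fus_iso_image[OF assms(1)] by metis

lemma E_restrict:
  assumes "subgroup P S" "f \<in> E P" "subgroup Q S" "Q \<subseteq> P" shows "restrict f Q \<in> E Q"
proof -
  have "compose Q f (\<lambda>x\<in>Q. x) \<in> E Q"
    by (rule compose_closed[OF assms(3,1) subgroup_self inclusion_in_F[OF assms(3,1,4)] assms(2)])
  moreover have "compose Q f (\<lambda>x\<in>Q. x) = restrict f Q" by (auto simp: compose_def)
  ultimately show ?thesis by simp
qed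

lemma E_compose:
  assumes "subgroup P S" "f \<in> E P" "subgroup Q S" "g \<in> E Q" "f ` P \<subseteq> Q"
  shows "compose P g f \<in> E P"
  using compose_closed[OF assms(1,3) subgroup_self _ assms(4)] F_iff[OF assms(1,3)] assms(2,5) by blast

lemma E_inverse:
  assumes "subgroup P S" "f \<in> E P"
  shows "restrict (inv_into P f) (f ` P) \<in> E (f ` P)"
proof -
  have im: "subgroup (f ` P) S" by (rule E_image_subgroup[OF assms])
  obtain g where g: "g \<in> F (f ` P) P" "compose P g f = (\<lambda>x\<in>P. x)"
    using E_fus_iso[OF assms] unfolding fus_iso_def by blast
  have "g (f x) = x" if "x \<in> P" for x using g(2) that by (metis compose_eq restrict_apply')
  then have "g = restrict (inv_into P f) (f ` P)"
    using F_hom(4)[OF im assms(1) g(1)] E_hom(3)[OF assms]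
    by (intro extensionalityI[of _ "f ` P"]) auto
  then show ?thesis using g(1) F_iff[OF im assms(1)] by blast
qed

lemma fus_iso_iff:
  assumes "subgroup P S" "subgroup Q S"
  shows "f \<in> fus_iso F P Q \<longleftrightarrow> f \<in> E P \<and> f ` P = Q"
proof
  assume f: "f \<in> fus_iso F P Q"
  then have "f \<in> F P Q" unfolding fus_iso_def by blast
  then show "f \<in> E P \<and> f ` P = Q" using fus_iso_image[OF assms f] F_iff[OF assms] by blast
next
  assume "f \<in> E P \<and> f ` P = Q"
  then show "f \<in> fus_iso F P Q" using E_fus_iso[OF assms(1)] by blast
qed

lemma fus_conj_iff:
  assumes "subgroup P S" shows "Q \<in> fus_conj S F P \<longleftrightarrow> (\<exists>f\<in>E P. f ` P = Q)"
  using fus_iso_iff[OF assms] E_image_subgroup[OF assms] by (auto simp: fus_conj_def)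

lemma conj_map_in_E:
  assumes "subgroup P S" "g \<in> carrier S" shows "conj_map S P g \<in> E P"
proof -
  have "g \<in> transporter S P (carrier S)"
    using assms sub_mem[OF assms(1)] by (auto simp: transporter_def conj_map_def)
  then show ?thesis using hom_conj_subset[OF assms(1) subgroup_self] unfolding hom_conj_def by blast
qed

end

text \<open>The group N_f of axiom (II), with the condition on f c_g f^-1 unfolded into an equation
  between elements. It is returned in full, because Alperin's theorem extends an automorphism to the
  whole of N_f.\<close>

lemma (in saturated_fusion_system) E_extension_domain:
  assumes P: "subgroup P S" and f: "f \<in> E P" and fc: "fully_centralized p S F (f ` P)"
  shows "\<exists>N. subgroup N S \<and>
    (\<forall>g. g \<in> N \<longleftrightarrow> g \<in> normalizer S P \<and> (\<exists>y\<in>normalizer S (f ` P). \<forall>u\<in>P. f (cj g u) = cj y (f u))) \<and>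
    (\<exists>f'\<in>E N. \<forall>u\<in>P. f' u = f u)"
proof -
  let ?N = "{g \<in> normalizer S P. conj_by f P (conj_map S P g) \<in> aut_conj S (f ` P)}"
  have Q: "subgroup (f ` P) S" by (rule E_image_subgroup[OF P f])
  have PS: "P \<subseteq> carrier S" "f ` P \<subseteq> carrier S" using P Q by (auto dest: sub_mem)
  have iff: "g \<in> ?N \<longleftrightarrow> g \<in> normalizer S P \<and> (\<exists>y\<in>normalizer S (f ` P). \<forall>u\<in>P. f (cj g u) = cj y (f u))" for g
  proof -
    have "conj_by f P (conj_map S P g) = conj_map S (f ` P) y \<longleftrightarrow> (\<forall>u\<in>P. f (cj g u) = cj y (f u))" for y
      using E_hom(3)[OF P f]
      by (auto simp: conj_by_def conj_map_def conjugate_def fun_eq_iff restrict_def)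
    then show ?thesis by (auto simp: aut_conj_def image_iff)
  qed
  have N: "subgroup ?N S"
  proof (rule subgroupI)
    have mem: "g \<in> carrier S" "u \<in> P \<Longrightarrow> cj g u \<in> P" if "g \<in> normalizer S P" for g u
      using that normalizer_iff[OF PS(1)] by auto
    show "?N \<subseteq> carrier S" using mem by blast
    have "\<one> \<in> normalizer S P" "\<one> \<in> normalizer S (f ` P)"
      using subgroup.one_closed subgroup_normalizer PS by metis+
    then have "\<one> \<in> ?N" unfolding iff using PS by (auto intro!: bexI[of _ \<one>] simp: subset_eq)
    then show "?N \<noteq> {}" by blast
    show "inv g \<in> ?N" if "g \<in> ?N" for g
    proof -
      obtain y where y: "g \<in> normalizer S P" "y \<in> normalizer S (f ` P)" "\<And>u. u \<in> P \<Longrightarrow> f (cj g u) = cj y (f u)"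
        using \<open>g \<in> ?N\<close> iff by blast
      have i: "inv g \<in> normalizer S P" "inv y \<in> normalizer S (f ` P)" 
        using y subgroup_normalizer[OF PS(1)] subgroup_normalizer[OF PS(2)] by (auto intro: subgroup.m_inv_closed)
      have "f (cj (inv g) u) = cj (inv y) (f u)" if u: "u \<in> P" for u
      proof -
        have "cj (inv g) u \<in> P" using mem i(1) u by blast
        then have "f u = cj y (f (cj (inv g) u))" using y(3)[of "cj (inv g) u"] mem[OF y(1)] u PS by (simp add: subset_eq)
        moreover have "y \<in> carrier S" using y(2) normalizer_iff[OF PS(2)] by blast
        moreover have "f (cj (inv g) u) \<in> carrier S" using E_hom(1)[OF P f] \<open>cj (inv g) u \<in> P\<close> by blast
        ultimately show ?thesis by simp
      qed
      then show ?thesis using iff i by blast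
    qed
    show "g \<otimes> h \<in> ?N" if "g \<in> ?N" "h \<in> ?N" for g h
    proof -
      obtain y where y: "g \<in> normalizer S P" "y \<in> normalizer S (f ` P)" "\<And>u. u \<in> P \<Longrightarrow> f (cj g u) = cj y (f u)"
        using \<open>g \<in> ?N\<close> iff by blast
      obtain z where z: "h \<in> normalizer S P" "z \<in> normalizer S (f ` P)" "\<And>u. u \<in> P \<Longrightarrow> f (cj h u) = cj z (f u)"
        using \<open>h \<in> ?N\<close> iff by blast
      have "f (cj (g \<otimes> h) u) = cj (y \<otimes> z) (f u)" if u: "u \<in> P" for u
      proof -
        have c: "y \<in> carrier S" "z \<in> carrier S" "f u \<in> carrier S" "u \<in> carrier S"
          using y z u PS E_hom(1)[OF P f] normalizer_iff[OF PS(2)] by auto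
        have "f (cj (g \<otimes> h) u) = f (cj g (cj h u))" using mem y(1) z(1) c by (simp add: conjugate_comp)
        then show ?thesis using y(3)[of "cj h u"] z(3)[OF u] mem(2)[OF z(1) u] c by (simp add: conjugate_comp)
      qed
      moreover have "g \<otimes> h \<in> normalizer S P" "y \<otimes> z \<in> normalizer S (f ` P)"
        using y z subgroup_normalizer[OF PS(1)] subgroup_normalizer[OF PS(2)] by (auto intro: subgroup.m_closed)
      ultimately show ?thesis using iff by blast
    qed
  qed
  obtain f' where f': "f' \<in> E ?N" "restrict f' P = f" using saturation_II[OF P f fc refl] by blast
  have "f' u = f u" if "u \<in> P" for u using that f'(2) by (metis restrict_apply')
  then show ?thesis using N iff f'(1) by (intro exI[of _ ?N]) blast
qed

text \<open>For a prescribed part \<open>X\<close> of N_f. As \<open>X\<close> need not contain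
  \<open>P\<close>, agreement is claimed on the intersection.\<close>

lemma (in saturated_fusion_system) E_extend:
  assumes P: "subgroup P S" and f: "f \<in> E P" and fc: "fully_centralized p S F (f ` P)"
    and X: "subgroup X S" "X \<subseteq> normalizer S P"
    and ext: "\<And>x. x \<in> X \<Longrightarrow> \<exists>y\<in>normalizer S (f ` P). \<forall>u\<in>P. f (cj x u) = cj y (f u)"
  shows "\<exists>f'\<in>E X. \<forall>u\<in>P \<inter> X. f' u = f u"
proof -
  obtain N f' where N: "subgroup N S" "X \<subseteq> N" and f': "f' \<in> E N" "\<forall>u\<in>P. f' u = f u"
    using E_extension_domain[OF P f fc] X(2) ext by blast
  have "restrict f' X \<in> E X" by (rule E_restrict[OF N(1) f'(1) X(1) N(2)])
  then show ?thesis using f'(2) by (intro bexI[of _ "restrict f' X"]) auto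
qed

section \<open>Saturated fusion systems of rank one\<close>

lemma card_image_eq_if_iff:
  assumes "\<And>x y. x \<in> N \<Longrightarrow> y \<in> N \<Longrightarrow> g x = g y \<longleftrightarrow> h x = h y"
  shows "card (g ` N) = card (h ` N)"
proof -
  have "bij_betw (\<lambda>C. h (inv_into N g C)) (g ` N) (h ` N)"
  proof (rule bij_betw_byWitness[where f' = "\<lambda>C. g (inv_into N h C)"])
    have 1: "h (inv_into N g (g x)) = h x" if "x \<in> N" for x
      using that assms[of "inv_into N g (g x)" x] by (simp add: f_inv_into_f inv_into_into)
    have 2: "g (inv_into N h (h x)) = g x" if "x \<in> N" for x
      using that assms[of "inv_into N h (h x)" x] by (simp add: f_inv_into_f inv_into_into)
    show "\<forall>C\<in>g ` N. g (inv_into N h (h (inv_into N g C))) = C" using 1 2 by auto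
    show "\<forall>C\<in>h ` N. h (inv_into N g (g (inv_into N h C))) = C" using 1 2 by auto
    show "(\<lambda>C. h (inv_into N g C)) ` g ` N \<subseteq> h ` N" using 1 by auto
    show "(\<lambda>C. g (inv_into N h C)) ` h ` N \<subseteq> g ` N" using 2 by auto
  qed
  then show ?thesis by (rule bij_betw_same_card)
qed

locale rank_one = saturated_fusion_system p S F for p and S (structure) and F +
  assumes rank: "rk p S = 1"
begin

abbreviation T :: "'a set" where "T \<equiv> torus p S"

sublocale max_torus S p T 1
proof -
  obtain T0 r where T0: "is_max_torus p S T0 r" using discrete_p_toral unfolding discrete_p_toral_def by blast
  interpret M: max_torus S p T0 r by unfold_locales (use prime T0 in auto)
  have "r = 1" "T = T0" using M.rk_eq M.torus_eq rank by auto
  then show "max_torus S p T 1" using M.max_torus_axioms by simp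
qed

lemma p_pos: "p > 0" and p_gt_1: "p > 1"
  using prime using prime_gt_0_nat prime_gt_1_nat by blast+

lemma T_infinite: "infinite T" using torus_infinite by simp

lemma index_prime_power: "\<exists>k. order (S Mod T) = p ^ k"
  using max_torus unfolding is_max_torus_def by blast

lemma T_coset_eq_iff:
  assumes "x \<in> carrier S" "y \<in> carrier S"
  shows "T #> x = T #> y \<longleftrightarrow> x \<otimes> inv y \<in> T"
proof
  assume "T #> x = T #> y"
  then have "x \<in> T #> y" using rcos_self[OF assms(1) torus_subgroup] by simp
  then show "x \<otimes> inv y \<in> T" using subgroup.rcos_module_imp[OF torus_subgroup is_group assms(2)] by blast
next
  assume "x \<otimes> inv y \<in> T"
  then have "x \<in> T #> y" using subgroup.rcos_module_rev[OF torus_subgroup is_group assms(2,1)] by blast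
  then show "T #> x = T #> y" using repr_independence[OF _ assms(2) torus_subgroup] by simp
qed

lemma T_conjugate: "t \<in> T \<Longrightarrow> g \<in> carrier S \<Longrightarrow> cj g t \<in> T"
  unfolding conjugate_def by (rule normal.inv_op_closed2[OF torus_normal])

lemma T_conj_trivial: "s \<in> T \<Longrightarrow> t \<in> T \<Longrightarrow> cj s t = t"
  using conjugate_fix_iff torus_in_carrier torus_commute by metis

lemma finite_T_cosets: "finite ((\<lambda>x. T #> x) ` carrier S)"
proof -
  obtain k where k: "order (S Mod T) = p ^ k" using index_prime_power by blast
  then have "card ((\<lambda>x. T #> x) ` carrier S) \<noteq> 0"
    using p_pos by (simp add: order_def carrier_FactGroup)
  then show ?thesis by (metis card.infinite)
qed

definition torus_index :: nat where "torus_index = card ((\<lambda>x. T #> x) ` carrier S)"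

lemma card_T_cosets_le: "P \<subseteq> carrier S \<Longrightarrow> card ((\<lambda>x. T #> x) ` P) \<le> torus_index"
  unfolding torus_index_def by (intro card_mono finite_T_cosets image_mono)

lemma pow_in_T: "\<exists>k. \<forall>x\<in>carrier S. x [^] (p ^ k) \<in> T"
  using index_prime_power pow_index_in_torus by metis

abbreviation q :: nat where "q \<equiv> torus_exponent p S"

lemma T_coset_pow: "x \<in> carrier S \<Longrightarrow> (T #> x) [^]\<^bsub>S Mod T\<^esub> (n::nat) = \<one>\<^bsub>S Mod T\<^esub> \<longleftrightarrow> x [^] n \<in> T"
  using normal.FactGroup_pow[OF torus_normal, of x n] T_coset_eq_iff[of "x [^] n" \<one>]
    coset_mult_one[of T] torus_in_carrier by (simp add: subset_eq)

lemma q_props: "q > 0" "x \<in> carrier S \<Longrightarrow> x [^] q \<in> T" "\<exists>j. q = p ^ j"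
proof -
  let ?A = "\<lambda>n. 0 < n \<and> (\<forall>x\<in>carrier S. x [^] (n::nat) \<in> T)"
  obtain k where k: "\<forall>x\<in>carrier S. x [^] (p ^ k) \<in> T" using pow_in_T by blast
  have q: "q = (LEAST n. ?A n)"
    unfolding torus_exponent_def by (auto simp: carrier_FactGroup T_coset_pow simp del: one_FactGroup)
  have A: "?A q" unfolding q by (rule LeastI[of ?A "p ^ k"]) (use k p_pos in auto)
  then show "q > 0" "x \<in> carrier S \<Longrightarrow> x [^] q \<in> T" by auto
  \<comment> \<open>That q is a power of p does not follow from minimality at once; but the gcd with
    the exponent \<open>p ^ k\<close> is again an exponent, so q divides
    \<open>p ^ k\<close>.\<close>
  have "?A (gcd q (p ^ k))"
  proof -
    interpret Q: group "S Mod T" by (rule normal.factorgroup_is_group[OF torus_normal])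
    have "x [^] gcd q (p ^ k) \<in> T" if x: "x \<in> carrier S" for x
    proof -
      have c: "T #> x \<in> carrier (S Mod T)" using x by (auto simp: carrier_FactGroup)
      have "Q.ord (T #> x) dvd q" "Q.ord (T #> x) dvd p ^ k"
        using A k x T_coset_pow[OF x] Q.pow_eq_id[OF c] by metis+
      then show ?thesis using T_coset_pow[OF x] Q.pow_eq_id[OF c] by (metis gcd_greatest)
    qed
    then show ?thesis using A by auto
  qed
  then have "q \<le> gcd q (p ^ k)" unfolding q by (rule Least_le)
  then have "q dvd p ^ k" using p_pos A by (metis dvd_refl gcd_dvd2 gcd_le1_nat le_antisym less_not_refl2)
  then show "\<exists>j. q = p ^ j" using prime divides_primepow_nat by blast
qed

lemma T_pow_q_surj: "t \<in> T \<Longrightarrow> \<exists>s\<in>T. s [^] q = t"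
  using q_props(3) torus_divisible by metis

lemma S_torsion: "x \<in> carrier S \<Longrightarrow> \<exists>n. x [^] (p ^ n) = \<one>"
proof -
  assume x: "x \<in> carrier S"
  obtain k where k: "x [^] (p ^ k) \<in> T" using pow_in_T x by blast
  then obtain n where "(x [^] (p ^ k)) [^] (p ^ n) = \<one>" using torus_torsion by blast
  then show ?thesis using x by (metis nat_pow_pow power_add)
qed

lemma card_finite_subgroup:
  assumes "subgroup P S" "finite P" shows "\<exists>k. card P = p ^ k"
proof -
  interpret P: group "S \<downharpoonright> P" using assms(1) subgroup_imp_group by blast
  have "\<exists>k. order (S \<downharpoonright> P) = p ^ k"
    by (rule P.order_prime_power[OF prime])
      (use assms S_torsion sub_mem[OF assms(1)] in \<open>auto simp: nat_pow_consistent[symmetric]\<close>)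
  then show ?thesis by (simp add: order_def)
qed

text \<open>If t in T lies outside \<open>A\<close>, no element of \<open>A\<close> has t among its
  powers, so by the chain property every element of \<open>A\<close> is a power of t.\<close>

lemma proper_subgroup_T_finite:
  assumes A: "subgroup A S" "A \<subseteq> T" "A \<noteq> T" shows "finite A"
proof -
  obtain t where t: "t \<in> T" "t \<notin> A" using A by blast
  obtain n where n: "t [^] (p ^ n) = \<one>" using torus_torsion t by blast
  have "A \<subseteq> (\<lambda>k. t [^] k) ` {..<p ^ n}"
  proof
    fix s assume s: "s \<in> A"
    have spow: "s [^] (k::nat) \<in> A" for k
      using s A(1) by (induction k) (auto simp: subgroup.one_closed subgroup.m_closed)
    then obtain k :: nat where "s = t [^] k" using torus_uniserial[OF refl, of s t] s A(2) t by blast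
    also have "\<dots> = t [^] (p ^ n * (k div p ^ n) + k mod p ^ n)" by simp
    also have "\<dots> = (t [^] (p ^ n)) [^] (k div p ^ n) \<otimes> t [^] (k mod p ^ n)"
      using torus_in_carrier[OF t(1)] by (simp add: nat_pow_mult nat_pow_pow)
    also have "\<dots> = t [^] (k mod p ^ n)" using n torus_in_carrier[OF t(1)] by simp
    finally show "s \<in> (\<lambda>k. t [^] k) ` {..<p ^ n}" using p_pos by auto
  qed
  then show ?thesis using finite_subset by blast
qed

text \<open>An element of \<open>P\<close> is determined by its T-coset and its quotient by a
  representative of that coset chosen inside \<open>P\<close>; the quotient lies in
  \<open>P \<inter> T\<close>.\<close>

lemma card_subgroup_le:
  assumes P: "subgroup P S" and fin: "finite (P \<inter> T)"
  shows "finite P" "card P \<le> card (P \<inter> T) * torus_index"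
proof -
  have PS: "\<And>x. x \<in> P \<Longrightarrow> x \<in> carrier S" using sub_mem[OF P] by blast
  let ?g = "\<lambda>x. T #> x"
  let ?r = "\<lambda>C. inv_into P ?g C"
  have r: "?r (T #> x) \<in> P" "T #> ?r (T #> x) = T #> x" if "x \<in> P" for x
    using that by (auto simp: inv_into_into intro!: f_inv_into_f)
  have sub: "P \<subseteq> (\<lambda>(a, C). a \<otimes> ?r C) ` ((P \<inter> T) \<times> (?g ` P))"
  proof
    fix x assume x: "x \<in> P"
    have "x \<otimes> inv ?r (T #> x) \<in> T" using r[OF x] T_coset_eq_iff x PS by metis
    then have "x \<otimes> inv ?r (T #> x) \<in> P \<inter> T" using x r[OF x] P by (simp add: subgroup.m_closed subgroup.m_inv_closed)
    moreover have "x = (x \<otimes> inv ?r (T #> x)) \<otimes> ?r (T #> x)" using x r[OF x] PS by (simp add: m_assoc)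
    ultimately show "x \<in> (\<lambda>(a, C). a \<otimes> ?r C) ` ((P \<inter> T) \<times> (?g ` P))" using x by force
  qed
  have fg: "finite (?g ` P)" using finite_T_cosets PS by (meson finite_subset image_mono subsetI)
  then show "finite P" using finite_subset[OF sub] fin by blast
  have "card P \<le> card ((P \<inter> T) \<times> (?g ` P))" using surj_card_le[OF _ sub] fin fg by blast
  also have "\<dots> \<le> card (P \<inter> T) * torus_index" using card_T_cosets_le[of P] PS by (auto simp: card_cartesian_product)
  finally show "card P \<le> card (P \<inter> T) * torus_index" .
qed

lemma subgroup_dichotomy:
  assumes "subgroup P S" shows "T \<subseteq> P \<or> finite P"
  using card_subgroup_le(1)[OF assms] proper_subgroup_T_finite[of "P \<inter> T"]
    subgroups_Inter_pair[OF assms torus_subgroup] by blast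

text \<open>Divisibility puts the image into T, since powers with a suitable exponent
  \<open>p ^ k\<close> lie in T. Injectivity preserves orders, and elements of T of equal order are
  powers of each other. \<theta> is an arbitrary map so that morphisms of F, conjugations and
  iterates of \<psi> are all covered.\<close>

lemma T_hom:
  assumes cl: "\<And>s. s \<in> T \<Longrightarrow> \<theta> s \<in> carrier S" and hom: "\<And>s t. s \<in> T \<Longrightarrow> t \<in> T \<Longrightarrow> \<theta> (s \<otimes> t) = \<theta> s \<otimes> \<theta> t"
    and inj: "inj_on \<theta> T"
  shows "\<theta> ` T = T" "s \<in> T \<Longrightarrow> \<exists>k::nat. \<theta> s = s [^] k" "s \<in> T \<Longrightarrow> \<exists>k::nat. s = \<theta> s [^] k"
    "s \<in> T \<Longrightarrow> \<theta> (s [^] (n::nat)) = \<theta> s [^] n"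
proof -
  have one: "\<one> \<in> T" by (rule subgroup.one_closed[OF torus_subgroup])
  have \<theta>1: "\<theta> \<one> = \<one>" using hom[OF one one] cl[OF one] by (metis l_cancel_one' one_closed r_one)
  have pow: "\<theta> (s [^] (n::nat)) = \<theta> s [^] n" if "s \<in> T" for s n
    by (induction n) (simp_all add: \<theta>1 hom torus_nat_pow_closed that)
  then show "s \<in> T \<Longrightarrow> \<theta> (s [^] (n::nat)) = \<theta> s [^] n" by blast
  obtain k where k: "\<forall>x\<in>carrier S. x [^] (p ^ k) \<in> T" using pow_in_T by blast
  have inT: "\<theta> s \<in> T" if "s \<in> T" for s
  proof -
    obtain u where "u \<in> T" "u [^] (p ^ k) = s" using torus_divisible \<open>s \<in> T\<close> by blast
    then show ?thesis using pow k cl by metis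
  qed
  have "ord (\<theta> s) = ord s" if s: "s \<in> T" for s
  proof -
    have "\<theta> s [^] n = \<one> \<longleftrightarrow> s [^] n = \<one>" for n :: nat
      using pow[OF s] \<theta>1 inj torus_nat_pow_closed[OF s] one by (metis inj_on_eq_iff)
    then show ?thesis using pow_eq_id torus_in_carrier inT s by (metis dvd_antisym dvd_refl)
  qed
  then show a: "s \<in> T \<Longrightarrow> \<exists>k::nat. \<theta> s = s [^] k" and b: "s \<in> T \<Longrightarrow> \<exists>k::nat. s = \<theta> s [^] k" for s
    using torus_power_of[OF refl] inT by simp_all
  show "\<theta> ` T = T"
  proof
    show "T \<subseteq> \<theta> ` T"
    proof
      fix s assume s: "s \<in> T"
      obtain k :: nat where "s = \<theta> s [^] k" using b[OF s] by blast
      then have "s = \<theta> (s [^] k)" using pow[OF s] by simp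
      then show "s \<in> \<theta> ` T" using torus_nat_pow_closed[OF s] by blast
    qed
  qed (use inT in auto)
qed

lemma E_T:
  assumes "subgroup P S" "f \<in> E P" "T \<subseteq> P"
  shows "f ` T = T" "s \<in> T \<Longrightarrow> \<exists>k::nat. f s = s [^] k" "s \<in> T \<Longrightarrow> \<exists>k::nat. s = f s [^] k" "s \<in> T \<Longrightarrow> f s \<in> T"
proof -
  have h: "\<And>s. s \<in> T \<Longrightarrow> f s \<in> carrier S" "\<And>s t. s \<in> T \<Longrightarrow> t \<in> T \<Longrightarrow> f (s \<otimes> t) = f s \<otimes> f t" "inj_on f T"
    using E_hom[OF assms(1,2)] assms(3) by (auto intro: inj_on_subset)
  show "f ` T = T" "s \<in> T \<Longrightarrow> \<exists>k::nat. f s = s [^] k" "s \<in> T \<Longrightarrow> \<exists>k::nat. s = f s [^] k"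
    using T_hom[OF h] by blast+
  then show "s \<in> T \<Longrightarrow> f s \<in> T" by blast
qed

section \<open>Orders of the discrete p-toral subgroups of S\<close>

definition vol :: "'a set \<Rightarrow> nat \<times> nat" where "vol N = toral_order p (S \<downharpoonright> N)"

lemma vol_T:
  assumes N: "subgroup N S" "T \<subseteq> N"
  shows "torus p (S \<downharpoonright> N) = T" "vol N = (1, card ((\<lambda>x. T #> x) ` N))"
proof -
  interpret N: group "S \<downharpoonright> N" using N(1) subgroup_imp_group by blast
  have nor: "T \<lhd> S \<downharpoonright> N" using N torus_normal normal_restrict_supergroup by blast
  have cos: "r_coset (S \<downharpoonright> N) T x = T #> x" for x by (simp add: r_coset_def)
  have ord: "order ((S \<downharpoonright> N) Mod T) = card ((\<lambda>x. T #> x) ` N)"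
    by (simp add: order_def carrier_FactGroup cos)
  interpret Q: group "(S \<downharpoonright> N) Mod T" by (rule normal.factorgroup_is_group[OF nor])
  have "\<exists>k. order ((S \<downharpoonright> N) Mod T) = p ^ k"
  proof (rule Q.order_prime_power[OF prime])
    show "finite (carrier ((S \<downharpoonright> N) Mod T))"
      using finite_subset[OF image_mono[of N "carrier S" "\<lambda>x. T #> x"] finite_T_cosets] subgroup.subset[OF N(1)]
      by (simp add: carrier_FactGroup cos)
    fix C assume "C \<in> carrier ((S \<downharpoonright> N) Mod T)"
    then obtain x where x: "x \<in> N" "C = r_coset (S \<downharpoonright> N) T x" by (auto simp: carrier_FactGroup)
    obtain n where n: "x [^] (p ^ n) = \<one>" using S_torsion sub_mem[OF N(1) x(1)] by blast
    have "C [^]\<^bsub>(S \<downharpoonright> N) Mod T\<^esub> (p ^ n) = r_coset (S \<downharpoonright> N) T (x [^]\<^bsub>S \<downharpoonright> N\<^esub> (p ^ n))"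
      using normal.FactGroup_pow[OF nor] x by simp
    also have "\<dots> = T" using n torus_in_carrier by (simp add: cos nat_pow_consistent[symmetric] subset_eq)
    finally show "\<exists>n. C [^]\<^bsub>(S \<downharpoonright> N) Mod T\<^esub> (p ^ n) = \<one>\<^bsub>(S \<downharpoonright> N) Mod T\<^esub>" by auto
  qed
  then have "is_max_torus p (S \<downharpoonright> N) T 1"
    using max_torus nor by (simp add: is_max_torus_def)
  then interpret M: max_torus "S \<downharpoonright> N" p T 1 by unfold_locales (use prime in auto)
  show "torus p (S \<downharpoonright> N) = T" by (rule M.torus_eq)
  show "vol N = (1, card ((\<lambda>x. T #> x) ` N))"
    unfolding vol_def toral_order_def M.rk_eq M.torus_eq using ord by simp
qed

lemma vol_finite:
  assumes N: "subgroup N S" "finite N" shows "torus p (S \<downharpoonright> N) = {\<one>}" "vol N = (0, card N)"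
proof -
  interpret N: group "S \<downharpoonright> N" using N(1) subgroup_imp_group by blast
  have nor: "{\<one>} \<lhd> S \<downharpoonright> N" using N.one_is_normal by simp
  have sub: "subgroup {\<one>} (S \<downharpoonright> N)" using nor normal_imp_subgroup by blast
  have ord: "order ((S \<downharpoonright> N) Mod {\<one>}) = card N"
    using N.lagrange[OF sub] by (simp add: order_def FactGroup_def)
  have "(\<lambda>_ _. undefined) \<in> iso (S \<downharpoonright> N \<downharpoonright> {\<one>}) (product_group {..<0::nat} (\<lambda>_. prufer_group p))"
    by (auto simp: iso_def hom_def bij_betw_def)
  then have "is_max_torus p (S \<downharpoonright> N) {\<one>} 0"
    using nor ord card_finite_subgroup[OF N] by (auto simp: is_max_torus_def is_iso_def)
  then interpret M: max_torus "S \<downharpoonright> N" p "{\<one>}" 0 by unfold_locales (use prime in auto)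
  show "torus p (S \<downharpoonright> N) = {\<one>}" by (rule M.torus_eq)
  show "vol N = (0, card N)" unfolding vol_def toral_order_def M.rk_eq M.torus_eq using ord by simp
qed

text \<open>When the larger group is infinite it contains T, and equal rank forces T into the
  smaller one; then both are unions of equally many T-cosets.\<close>

lemma vol_strict:
  assumes N: "subgroup N S" "subgroup N' S" "N \<subseteq> N'" and le: "lex_le (vol N') (vol N)"
  shows "N = N'"
proof (cases "finite N'")
  case True
  then have "finite N" using N(3) finite_subset by blast
  then have "card N' \<le> card N" using le N True by (auto simp: vol_finite lex_le_def)
  then show ?thesis using True N(3) card_seteq by blast
next
  case False
  then have T': "T \<subseteq> N'" using subgroup_dichotomy N(2) by blast
  then have Tn: "T \<subseteq> N" using le N subgroup_dichotomy[OF N(1)] by (auto simp: vol_finite vol_T lex_le_def)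
  have fin: "finite ((\<lambda>x. T #> x) ` N')" using finite_T_cosets sub_mem[OF N(2)] by (meson finite_subset image_mono subsetI)
  have "card ((\<lambda>x. T #> x) ` N') \<le> card ((\<lambda>x. T #> x) ` N)"
    using le vol_T(2)[OF N(1) Tn] vol_T(2)[OF N(2) T'] by (auto simp: lex_le_def)
  then have eq: "(\<lambda>x. T #> x) ` N = (\<lambda>x. T #> x) ` N'" using fin N(3) by (intro card_seteq image_mono) auto
  have "x \<in> N" if x: "x \<in> N'" for x
  proof -
    obtain y where y: "y \<in> N" "T #> x = T #> y" using eq x by blast
    then have "x \<otimes> inv y \<in> N" using T_coset_eq_iff sub_mem N x Tn by (metis subsetD)
    then have "x \<otimes> inv y \<otimes> y \<in> N" using y N(1) by (simp add: subgroup.m_closed)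
    then show ?thesis using sub_mem[OF N(2) x] sub_mem[OF N(1) y(1)] by (simp add: m_assoc)
  qed
  then show ?thesis using N(3) by blast
qed

lemma vol_image:
  assumes N: "subgroup N S" and f: "f \<in> E N" shows "vol (f ` N) = vol N"
proof (cases "finite N")
  case True
  then show ?thesis using vol_finite[OF N] vol_finite[OF E_image_subgroup[OF N f]] E_hom(3)[OF N f]
    by (simp add: card_image)
next
  case False
  then have Tn: "T \<subseteq> N" using subgroup_dichotomy N by blast
  have Tf: "T \<subseteq> f ` N" using E_T(1)[OF N f Tn] Tn by blast
  have NS: "\<And>x. x \<in> N \<Longrightarrow> x \<in> carrier S" using sub_mem[OF N] by blast
  have "card ((\<lambda>x. T #> x) ` N) = card ((\<lambda>x. T #> f x) ` N)"
  proof (rule card_image_eq_if_iff)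
    fix x y assume xy: "x \<in> N" "y \<in> N"
    have c: "x \<otimes> inv y \<in> N" using xy N by (simp add: subgroup.m_closed subgroup.m_inv_closed)
    have "f (x \<otimes> inv y) = f x \<otimes> inv f y"
      using xy N by (simp add: E_hom(2)[OF N f] E_inv[OF N f] subgroup.m_inv_closed)
    moreover have "f (x \<otimes> inv y) \<in> T \<longleftrightarrow> x \<otimes> inv y \<in> T"
      using E_T(1)[OF N f Tn] E_hom(3)[OF N f] c Tn by (metis image_iff inj_on_image_mem_iff)
    ultimately show "T #> x = T #> y \<longleftrightarrow> T #> f x = T #> f y"
      using T_coset_eq_iff NS xy E_hom(1)[OF N f] by simp
  qed
  then show ?thesis using vol_T[OF N Tn] vol_T[OF E_image_subgroup[OF N f] Tf] by (simp add: image_image)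
qed

lemma fus_conj_eq: "subgroup P S \<Longrightarrow> fus_conj S F P = (\<lambda>f. f ` P) ` E P"
  by (auto simp: fus_conj_iff intro: rev_bexI)

lemma fully_normalized_iff:
  assumes "subgroup P S"
  shows "fully_normalized p S F P \<longleftrightarrow>
    (\<forall>f\<in>E P. lex_le (vol (normalizer S (f ` P))) (vol (normalizer S P)))"
  using assms by (simp add: fully_normalized_def vol_def fus_conj_eq)

lemma fully_centralized_iff:
  assumes "subgroup P S"
  shows "fully_centralized p S F P \<longleftrightarrow>
    (\<forall>f\<in>E P. lex_le (vol (centralizer S (f ` P))) (vol (centralizer S P)))"
  using assms by (simp add: fully_centralized_def vol_def fus_conj_eq)

lemma centric_iff:
  "centric S F P \<longleftrightarrow> subgroup P S \<and> (\<forall>f\<in>E P. centralizer S (f ` P) \<subseteq> f ` P)"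
proof (cases "subgroup P S")
  case True
  have "centralizer S (f ` P) = center S (f ` P) \<longleftrightarrow> centralizer S (f ` P) \<subseteq> f ` P" if "f \<in> E P" for f
  proof -
    have "f ` P \<subseteq> carrier S" using sub_mem[OF E_image_subgroup[OF True that]] by blast
    then show ?thesis using center_eq by blast
  qed
  then show ?thesis using True by (simp add: centric_def fus_conj_eq)
qed (simp add: centric_def)

text \<open>If C_S(R) lay in R, any f on R would carry it into C_S(f(R)), whose order is no larger
  because R is fully centralized. The two would agree, so C_S(f(R)) would lie in f(R) for all f,
  making R centric.\<close>

lemma noncentric_fully_normalized:
  assumes R: "fully_normalized p S F R" and nc: "\<not> centric S F R"
  shows "\<not> centralizer S R \<subseteq> R"
proof
  assume sub: "centralizer S R \<subseteq> R"
  have sR: "subgroup R S" using R by (simp add: fully_normalized_def)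
  have RS: "R \<subseteq> carrier S" using sub_mem[OF sR] by blast
  have fc: "fully_centralized p S F R" using saturation_I[OF R] by blast
  have "centralizer S (f ` R) \<subseteq> f ` R" if f: "f \<in> E R" for f
  proof -
    have fR: "subgroup (f ` R) S" "f ` R \<subseteq> carrier S" using E_image_subgroup[OF sR f] sub_mem by blast+
    let ?C = "centralizer S R"
    have sC: "subgroup ?C S" by (rule subgroup_centralizer[OF RS])
    have rf: "restrict f ?C \<in> E ?C" by (rule E_restrict[OF sR f sC sub])
    have im: "restrict f ?C ` ?C = f ` ?C" by auto
    have "f ` ?C \<subseteq> centralizer S (f ` R)"
    proof
      fix y assume "y \<in> f ` ?C"
      then obtain c where c: "c \<in> ?C" "y = f c" by blast
      then have cR: "c \<in> R" using sub by blast
      have "cj (f c) (f x) = f x" if "x \<in> R" for x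
        using E_conjugate(2)[OF sR f cR that] c(1) that centralizer_iff[OF RS] by auto
      then show "y \<in> centralizer S (f ` R)"
        using c cR E_hom(1)[OF sR f] centralizer_iff[OF fR(2)] by auto
    qed
    moreover have "lex_le (vol (centralizer S (f ` R))) (vol (f ` ?C))"
      using vol_image[OF sC rf] im fc fully_centralized_iff[OF sR] f by simp
    moreover have "subgroup (f ` ?C) S" using E_image_subgroup[OF sC rf] im by simp
    ultimately have "f ` ?C = centralizer S (f ` R)"
      using vol_strict subgroup_centralizer[OF fR(2)] by blast
    then show ?thesis using sub by blast
  qed
  then show False using nc centric_iff sR by blast
qed

end

section \<open>Lifting exponents and outer automorphism groups\<close>

text \<open>The binomial expansion of (1 + (x - 1))^j to first order.\<close>

lemma power_cong_linear:
  fixes x :: int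
  shows "(x - 1)\<^sup>2 dvd x ^ j - (1 + int j * (x - 1))"
proof (induction j)
  case (Suc j)
  then obtain c where c: "x ^ j = (x - 1)\<^sup>2 * c + (1 + int j * (x - 1))" by (auto simp: dvd_def algebra_simps)
  have "x ^ Suc j - (1 + int (Suc j) * (x - 1)) = (x - 1)\<^sup>2 * (c * x + int j)"
    by (simp add: c algebra_simps power2_eq_square)
  then show ?case by simp
qed simp

text \<open>x^p - 1 is x - 1 times the sum of x^j over j < p, and that sum is p times a number prime
  to p. Modulo p^2 it equals p + (x - 1) p (p - 1) / 2, where the second summand vanishes for odd p.
  For p = 2 the sum is x + 1, and the hypothesis modulo 4 takes over.\<close>

lemma prime_power_dvd_power_minus_one_step:
  fixes x :: int
  assumes p: "prime p" and x: "int p dvd x - 1" "p = 2 \<Longrightarrow> 4 dvd x - 1" and dv: "int p ^ n dvd x ^ p - 1"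
  shows "int p ^ n dvd (x - 1) * int p"
proof -
  have pp: "int p ^ 2 dvd (\<Sum>j<p. x ^ j) - int p"
  proof (cases "p = 2")
    case True
    then have "(\<Sum>j<p. x ^ j) - int p = x - 1" by (simp add: numeral_2_eq_2 del: One_nat_def) 
    then show ?thesis using x(2) True by simp
  next
    case False
    then have odd: "odd p" using p primes_dvd_imp_eq two_is_prime_nat by blast
    then obtain r where r: "p = 2 * r + 1" by (auto elim: oddE)
    have sum: "(\<Sum>j<p. int j) = int p * int r"
    proof -
      have "2 * (\<Sum>j<p. int j) = int p * (int p - 1)" by (induction p) (auto simp: algebra_simps)
      then show ?thesis using r by simp
    qed
    have x2: "int p ^ 2 dvd (x - 1)\<^sup>2" using x(1) by simp
    have "int p ^ 2 dvd (\<Sum>j<p. x ^ j - (1 + int j * (x - 1)))"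
      by (intro dvd_sum dvd_trans[OF x2] power_cong_linear)
    moreover have "(\<Sum>j<p. x ^ j - (1 + int j * (x - 1))) = (\<Sum>j<p. x ^ j) - int p - (x - 1) * (int p * int r)"
      by (simp add: sum_subtractf sum.distrib sum_distrib_right[symmetric] sum)
    moreover have "int p ^ 2 dvd (x - 1) * (int p * int r)"
      using x(1) by (simp add: power2_eq_square mult_dvd_mono)
    ultimately show ?thesis by (metis diff_add_cancel dvd_add)
  qed
  then obtain w where w: "(\<Sum>j<p. x ^ j) = int p * (1 + int p * w)"
    by (auto simp: dvd_def algebra_simps power2_eq_square)
  have "x ^ p - 1 = (x - 1) * int p * (1 + int p * w)"
    using power_diff_1_eq[of x p] w by (simp add: mult.assoc)
  moreover have "coprime (int p ^ n) (1 + int p * w)"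
  proof -
    have "gcd (int p) (1 + int p * w) = 1"
      by (metis add.commute gcd_1_int gcd_add_mult mult.commute gcd.commute)
    then have "coprime (int p) (1 + int p * w)" by (simp add: coprime_iff_gcd_eq_1)
    then show ?thesis by simp
  qed
  ultimately show ?thesis using dv by (simp add: coprime_dvd_mult_left_iff)
qed

text \<open>Each of the m successive p-th powers contributes one factor p. In the p-adic limit: a
  unit of p-power order that is 1 modulo p, and modulo 4 if p = 2, is equal to 1.\<close>

lemma prime_power_dvd_power_minus_one:
  fixes c :: int
  assumes p: "prime p" and c: "int p dvd c - 1" "p = 2 \<Longrightarrow> 4 dvd c - 1"
  shows "int p ^ n dvd c ^ (p ^ m) - 1 \<Longrightarrow> int p ^ n dvd (c - 1) * int p ^ m"
proof (induction m arbitrary: n)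
  case (Suc m)
  have d: "c - 1 dvd c ^ (p ^ m) - 1" by (simp add: power_diff_1_eq)
  have "int p ^ n dvd (c ^ (p ^ m)) ^ p - 1" using Suc.prems by (simp add: power_mult[symmetric] mult.commute)
  then have s: "int p ^ n dvd (c ^ (p ^ m) - 1) * int p"
    by (intro prime_power_dvd_power_minus_one_step p) (use c d dvd_trans in blast)+
  show ?case
  proof (cases n)
    case (Suc n')
    then have "int p ^ n' dvd c ^ (p ^ m) - 1" using s p by (simp add: prime_gt_0_nat)
    then have "int p ^ n' dvd (c - 1) * int p ^ m" by (rule Suc.IH)
    then show ?thesis using Suc by (simp add: mult.left_commute)
  qed simp
qed simp

text \<open>What morphisms at a single object must satisfy for Out(P) to be a group. It applies to F
  over S as well as to F_i over the finite group S_i.\<close>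

locale aut_fusion = group G for G (structure) +
  fixes \<F> :: "'a fusion" and P :: "'a set"
  assumes P: "subgroup P G"
    and ext: "f \<in> \<F> P P \<Longrightarrow> f \<in> extensional P"
    and closed: "f \<in> \<F> P P \<Longrightarrow> x \<in> P \<Longrightarrow> f x \<in> P"
    and hom: "f \<in> \<F> P P \<Longrightarrow> x \<in> P \<Longrightarrow> y \<in> P \<Longrightarrow> f (x \<otimes> y) = f x \<otimes> f y"
    and comp: "f \<in> \<F> P P \<Longrightarrow> g \<in> \<F> P P \<Longrightarrow> compose P g f \<in> \<F> P P"
    and inner: "x \<in> P \<Longrightarrow> conj_map G P x \<in> \<F> P P"
begin

abbreviation "A \<equiv> fus_aut \<F> P"

lemma P_mem: "x \<in> P \<Longrightarrow> x \<in> carrier G" using P subgroup.mem_carrier by fastforce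

lemma id_in: "(\<lambda>x\<in>P. x) \<in> fus_iso \<F> P P"
proof -
  have "conj_map G P \<one> = (\<lambda>x\<in>P. x)" using P_mem by (auto simp: conj_map_def)
  then have "(\<lambda>x\<in>P. x) \<in> \<F> P P" using inner[OF subgroup.one_closed[OF P]] by simp
  then show ?thesis by (auto simp: fus_iso_def compose_def intro!: bexI[of _ "\<lambda>x\<in>P. x"])
qed

lemma group_fus_aut: "group A"
proof (rule groupI)
  fix f g assume "f \<in> carrier A" "g \<in> carrier A"
  then obtain f' g' where f: "f \<in> \<F> P P" "f' \<in> \<F> P P" "compose P f' f = (\<lambda>x\<in>P. x)" "compose P f f' = (\<lambda>x\<in>P. x)"
    and g: "g \<in> \<F> P P" "g' \<in> \<F> P P" "compose P g' g = (\<lambda>x\<in>P. x)" "compose P g g' = (\<lambda>x\<in>P. x)"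
    by (auto simp: fus_aut_def fus_iso_def)
  have ev: "f' (f x) = x" "f (f' x) = x" "g' (g x) = x" "g (g' x) = x" if "x \<in> P" for x
    using f g that by (metis compose_eq restrict_apply')+
  have "compose P f g \<in> \<F> P P" "compose P g' f' \<in> \<F> P P" using f g comp by blast+
  moreover have "compose P (compose P g' f') (compose P f g) = (\<lambda>x\<in>P. x)"
     "compose P (compose P f g) (compose P g' f') = (\<lambda>x\<in>P. x)"
    using f g closed ev by (auto simp: compose_def intro!: restrict_ext)
  ultimately show "f \<otimes>\<^bsub>A\<^esub> g \<in> carrier A" by (auto simp: fus_aut_def fus_iso_def)
next
  show "\<one>\<^bsub>A\<^esub> \<in> carrier A" using id_in by (simp add: fus_aut_def)
next
  fix f g h assume "f \<in> carrier A" "g \<in> carrier A" "h \<in> carrier A"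
  then show "f \<otimes>\<^bsub>A\<^esub> g \<otimes>\<^bsub>A\<^esub> h = f \<otimes>\<^bsub>A\<^esub> (g \<otimes>\<^bsub>A\<^esub> h)"
    using closed by (auto simp: fus_aut_def fus_iso_def compose_def intro!: restrict_ext)
next
  fix f assume "f \<in> carrier A"
  then have f: "f \<in> fus_iso \<F> P P" by (simp add: fus_aut_def)
  then have fe: "f \<in> extensional P" "\<And>x. x \<in> P \<Longrightarrow> f x \<in> P" using ext closed by (auto simp: fus_iso_def)
  then show "\<one>\<^bsub>A\<^esub> \<otimes>\<^bsub>A\<^esub> f = f" by (auto simp: fus_aut_def compose_def extensional_def)
  obtain f' where "f' \<in> \<F> P P" "compose P f' f = (\<lambda>x\<in>P. x)" "compose P f f' = (\<lambda>x\<in>P. x)" "f \<in> \<F> P P"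
    using f by (auto simp: fus_iso_def)
  then show "\<exists>g\<in>carrier A. g \<otimes>\<^bsub>A\<^esub> f = \<one>\<^bsub>A\<^esub>" by (auto simp: fus_aut_def fus_iso_def)
qed

sublocale A: group A by (rule group_fus_aut)

lemma A_mem:
  assumes "f \<in> carrier A"
  shows "f \<in> \<F> P P" "f \<in> extensional P" "x \<in> P \<Longrightarrow> f x \<in> P" "x \<in> P \<Longrightarrow> y \<in> P \<Longrightarrow> f (x \<otimes> y) = f x \<otimes> f y"
    "x \<in> P \<Longrightarrow> f ((inv\<^bsub>A\<^esub> f) x) = x" "x \<in> P \<Longrightarrow> (inv\<^bsub>A\<^esub> f) (f x) = x"
proof -
  show f: "f \<in> \<F> P P" using assms by (simp add: fus_aut_def fus_iso_def)
  show "f \<in> extensional P" "x \<in> P \<Longrightarrow> f x \<in> P" "x \<in> P \<Longrightarrow> y \<in> P \<Longrightarrow> f (x \<otimes> y) = f x \<otimes> f y"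
    using f ext closed hom by auto
  show "f ((inv\<^bsub>A\<^esub> f) x) = x" "(inv\<^bsub>A\<^esub> f) (f x) = x" if "x \<in> P"
    using A.r_inv[OF assms] A.l_inv[OF assms] that
    by (simp_all add: fus_aut_def) (metis compose_eq restrict_apply')+
qed

lemma A_mult: "x \<in> P \<Longrightarrow> (f \<otimes>\<^bsub>A\<^esub> g) x = f (g x)"
  by (simp add: fus_aut_def compose_eq)

lemma A_one: "x \<in> P \<Longrightarrow> \<one>\<^bsub>A\<^esub> x = x"
  by (simp add: fus_aut_def)

lemma A_eqI: "f \<in> carrier A \<Longrightarrow> g \<in> carrier A \<Longrightarrow> (\<And>x. x \<in> P \<Longrightarrow> f x = g x) \<Longrightarrow> f = g"
  using A_mem(2) extensionalityI by metis

lemma A_one_inv: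
  assumes "f \<in> carrier A" shows "f \<one> = \<one>" "x \<in> P \<Longrightarrow> f (inv x) = inv (f x)"
proof -
  have o: "\<one> \<in> P" by (rule subgroup.one_closed[OF P])
  have *: "f \<one> \<otimes> f \<one> = f \<one>" using A_mem(4)[OF assms o o] by simp
  then show 1: "f \<one> = \<one>" using A_mem(3)[OF assms o] P_mem by (metis l_cancel_one')
  show "f (inv x) = inv (f x)" if x: "x \<in> P"
  proof -
    have ix: "inv x \<in> P" by (rule subgroup.m_inv_closed[OF P x])
    have "f (inv x) \<otimes> f x = \<one>" using A_mem(4)[OF assms ix x] 1 x P_mem by simp
    then show ?thesis using A_mem(3)[OF assms] x ix P_mem by (metis inv_equality)
  qed
qed

lemma A_conjugate:
  assumes "f \<in> carrier A" "x \<in> P" "y \<in> P" 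
  shows "f (conjugate G x y) = conjugate G (f x) (f y)"
  using assms P by (auto simp: conjugate_def A_mem(4) A_one_inv subgroup.m_closed subgroup.m_inv_closed)

lemma conj_map_in_A:
  assumes x: "x \<in> P" shows "conj_map G P x \<in> carrier A"
proof -
  have ix: "inv x \<in> P" by (rule subgroup.m_inv_closed[OF P x])
  have cl: "conjugate G a y \<in> P" if "a \<in> P" "y \<in> P" for a y
    using that P by (simp add: conjugate_def subgroup.m_closed subgroup.m_inv_closed)
  have "compose P (conj_map G P (inv x)) (conj_map G P x) = (\<lambda>y\<in>P. y)"
    "compose P (conj_map G P x) (conj_map G P (inv x)) = (\<lambda>y\<in>P. y)"
    using x ix cl P_mem by (auto simp: compose_def conj_map_apply intro!: restrict_ext)
  then show ?thesis using inner[OF x] inner[OF ix] by (auto simp: fus_aut_def fus_iso_def)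
qed

text \<open>Conjugating c_x by an automorphism a gives conjugation by a(x).\<close>

lemma inn_normal: "inn G P \<lhd> A"
proof (rule A.normal_invI)
  show "subgroup (inn G P) A"
  proof (rule A.subgroupI)
    show "inn G P \<subseteq> carrier A" using conj_map_in_A by (auto simp: inn_def)
    show "inn G P \<noteq> {}" using subgroup.one_closed[OF P] by (auto simp: inn_def)
    show "inv\<^bsub>A\<^esub> a \<in> inn G P" if a: "a \<in> inn G P" for a
    proof -
      obtain x where x: "x \<in> P" "a = conj_map G P x" using a by (auto simp: inn_def)
      have ix: "inv x \<in> P" by (rule subgroup.m_inv_closed[OF P x(1)])
      have "inv\<^bsub>A\<^esub> a = conj_map G P (inv x)"
      proof (rule A.inv_equality)
        show "conj_map G P (inv x) \<otimes>\<^bsub>A\<^esub> a = \<one>\<^bsub>A\<^esub>"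
          by (rule A_eqI) (use x ix P_mem conj_map_in_A A_mem(3)[OF conj_map_in_A[OF x(1)]] in \<open>auto simp: A_mult A_one conj_map_apply\<close>)
      qed (use x ix conj_map_in_A in auto)
      then show ?thesis using ix by (auto simp: inn_def)
    qed
    show "a \<otimes>\<^bsub>A\<^esub> b \<in> inn G P" if "a \<in> inn G P" "b \<in> inn G P" for a b
    proof -
      obtain x y where x: "x \<in> P" "a = conj_map G P x" and y: "y \<in> P" "b = conj_map G P y" using \<open>a \<in> _\<close> \<open>b \<in> _\<close> by (auto simp: inn_def)
      have xy: "x \<otimes> y \<in> P" using x y P by (simp add: subgroup.m_closed)
      have "a \<otimes>\<^bsub>A\<^esub> b = conj_map G P (x \<otimes> y)"
        by (rule A_eqI) (use x y xy P_mem conj_map_in_A A_mem(3)[OF conj_map_in_A[OF y(1)]] in \<open>auto simp: A_mult conj_map_apply conjugate_comp\<close>)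
      then show ?thesis using xy by (auto simp: inn_def)
    qed
  qed
  fix a b assume "a \<in> carrier A" "b \<in> inn G P"
  then obtain x where x: "x \<in> P" "b = conj_map G P x" and a: "a \<in> carrier A" by (auto simp: inn_def)
  have b: "b \<in> carrier A" using x conj_map_in_A by simp
  have "a \<otimes>\<^bsub>A\<^esub> b \<otimes>\<^bsub>A\<^esub> inv\<^bsub>A\<^esub> a = conj_map G P (a x)"
  proof (rule A_eqI)
    show "conj_map G P (a x) \<in> carrier A" using A_mem(3)[OF a x(1)] conj_map_in_A by blast
    fix y assume y: "y \<in> P"
    have i: "(inv\<^bsub>A\<^esub> a) y \<in> P" using A_mem(3)[OF A.inv_closed[OF a] y] .
    have "(a \<otimes>\<^bsub>A\<^esub> b \<otimes>\<^bsub>A\<^esub> inv\<^bsub>A\<^esub> a) y = a (conjugate G x ((inv\<^bsub>A\<^esub> a) y))"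
      using x i y by (simp add: A_mult conj_map_apply)
    also have "\<dots> = conjugate G (a x) y" using A_conjugate[OF a x(1) i] A_mem(5)[OF a y] by simp
    finally show "(a \<otimes>\<^bsub>A\<^esub> b \<otimes>\<^bsub>A\<^esub> inv\<^bsub>A\<^esub> a) y = conj_map G P (a x) y" using y by (simp add: conj_map_apply)
  qed (use a b in auto)
  then show "a \<otimes>\<^bsub>A\<^esub> b \<otimes>\<^bsub>A\<^esub> inv\<^bsub>A\<^esub> a \<in> inn G P" using A_mem(3)[OF a x(1)] by (auto simp: inn_def)
qed

lemma group_fus_out: "group (fus_out G \<F> P)"
  unfolding fus_out_def by (rule normal.factorgroup_is_group[OF inn_normal])

text \<open>\<open>N\<close> may be infinite; the finiteness of Out(P) together with the p-power
  torsion of \<open>N\<close> makes the image a finite p-group. It is applied to normalizers acting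
  by conjugation, possibly transported along an isomorphism.\<close>

lemma image_in_fus_out:
  assumes p: "prime p" and fin: "finite (carrier (fus_out G \<F> P))" and N: "group N"
    and \<Phi>: "\<Phi> \<in> hom N A" and tors: "\<And>x. x \<in> carrier N \<Longrightarrow> \<exists>n. x [^]\<^bsub>N\<^esub> (p ^ n :: nat) = \<one>\<^bsub>N\<^esub>"
  shows "subgroup ((\<lambda>x. inn G P #>\<^bsub>A\<^esub> \<Phi> x) ` carrier N) (fus_out G \<F> P)"
    "\<exists>k. card ((\<lambda>x. inn G P #>\<^bsub>A\<^esub> \<Phi> x) ` carrier N) = p ^ k"
proof -
  interpret O: group "fus_out G \<F> P" by (rule group_fus_out)
  interpret N: group N by (rule N)
  let ?\<Theta> = "\<lambda>x. inn G P #>\<^bsub>A\<^esub> \<Phi> x"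
  have "(\<lambda>a. inn G P #>\<^bsub>A\<^esub> a) \<in> hom A (fus_out G \<F> P)"
    unfolding fus_out_def by (rule normal.r_coset_hom_Mod[OF inn_normal])
  then have "(\<lambda>a. inn G P #>\<^bsub>A\<^esub> a) \<circ> \<Phi> \<in> hom N (fus_out G \<F> P)" by (rule Group.hom_compose[OF \<Phi>])
  then interpret h: group_hom N "fus_out G \<F> P" ?\<Theta>
    by (simp add: group_hom_def group_hom_axioms_def N O.is_group comp_def)
  show sub: "subgroup (?\<Theta> ` carrier N) (fus_out G \<F> P)"
    using h.subgroup_img_is_subgroup[OF N.subgroup_self] .
  interpret X: group "fus_out G \<F> P \<downharpoonright> (?\<Theta> ` carrier N)" using O.subgroup_imp_group[OF sub] .
  have "\<exists>k. order (fus_out G \<F> P \<downharpoonright> (?\<Theta> ` carrier N)) = p ^ k"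
  proof (rule X.order_prime_power[OF p])
    show "finite (carrier (fus_out G \<F> P \<downharpoonright> (?\<Theta> ` carrier N)))"
      using fin subgroup.subset[OF sub] finite_subset by simp blast
    fix y assume "y \<in> carrier (fus_out G \<F> P \<downharpoonright> (?\<Theta> ` carrier N))"
    then obtain x where x: "x \<in> carrier N" "y = ?\<Theta> x" by auto
    obtain n where n: "x [^]\<^bsub>N\<^esub> (p ^ n) = \<one>\<^bsub>N\<^esub>" using tors[OF x(1)] by blast
    have "y [^]\<^bsub>fus_out G \<F> P\<^esub> (p ^ n) = \<one>\<^bsub>fus_out G \<F> P\<^esub>"
      using h.hom_nat_pow[OF x(1), of "p ^ n"] n h.hom_one x(2) by simp
    then show "\<exists>n. y [^]\<^bsub>fus_out G \<F> P \<downharpoonright> (?\<Theta> ` carrier N)\<^esub> (p ^ n) = \<one>\<^bsub>fus_out G \<F> P \<downharpoonright> (?\<Theta> ` carrier N)\<^esub>"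
      by (auto simp: O.nat_pow_consistent[symmetric])
  qed
  then show "\<exists>k. card (?\<Theta> ` carrier N) = p ^ k" by (simp add: order_def)
qed

end

section \<open>Conjugation on the torus, normalizers and their growth\<close>

context rank_one
begin

lemma T_mem [simp]: "t \<in> T \<Longrightarrow> t \<in> carrier S" by (rule torus_in_carrier)

lemma T_inv [simp]: "t \<in> T \<Longrightarrow> inv t \<in> T" and T_mult [simp]: "s \<in> T \<Longrightarrow> t \<in> T \<Longrightarrow> s \<otimes> t \<in> T"
  and T_one [simp]: "\<one> \<in> T"
  using torus_subgroup by (auto simp: subgroup.m_inv_closed subgroup.m_closed subgroup.one_closed)

lemma conj_on_T: "g \<in> carrier S \<Longrightarrow> t \<in> T \<Longrightarrow> \<exists>b::nat. cj g t = t [^] b"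
  by (rule T_hom(2)) (auto simp: conjugate_mult inj_on_def)

lemma conj_pow_iterate:
  assumes "g \<in> carrier S" "t \<in> T" "cj g t = t [^] (b::nat)"
  shows "cj (g [^] (n::nat)) t = t [^] (b ^ n)"
proof (induction n)
  case (Suc n)
  have "cj (g [^] Suc n) t = cj (g [^] n) (cj g t)" using assms by (simp add: conjugate_comp)
  also have "\<dots> = cj (g [^] n) t [^] b" using assms by (simp add: conjugate_pow)
  finally show ?case using Suc assms by (simp add: nat_pow_pow mult.commute)
qed (use assms in simp)

text \<open>On a large cyclic subgroup of T conjugation by g raises to some power b, and a p-power
  of g lies in T and acts trivially; so the power of b with exponent p^m is 1 modulo
  \<open>ord t\<close>. Lifting exponents gives b = 1 up to a factor p^m, unless p = 2 and b is 3
  modulo 4, when it applies to -b instead.\<close>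

lemma conj_T_dichotomy:
  assumes g: "g \<in> carrier S" and t0: "t0 \<in> T" "cj g t0 \<noteq> t0" and u: "u \<in> T"
  shows "p = 2 \<and> cj g u = inv u"
proof -
  obtain m0 where m0: "\<forall>x\<in>carrier S. x [^] (p ^ m0) \<in> T" using pow_in_T by blast
  \<comment> \<open>The additional 1 makes \<open>p ^ m\<close> even when p = 2, so that b and -b
    have the same power with this exponent.\<close>
  define m where "m = Suc m0"
  have gm: "g [^] (p ^ m) \<in> T"
    using torus_nat_pow_closed[of "g [^] (p ^ m0)" p] m0 g by (simp add: m_def nat_pow_pow mult.commute)
  \<comment> \<open>With t0 and u both powers of t1 it is enough to treat t1; its root t compensates
    for the factor \<open>p ^ m\<close> lost in lifting exponents.\<close>
  obtain t1 where t1: "t1 \<in> T" "\<exists>k::nat. t0 = t1 [^] k" "\<exists>k::nat. u = t1 [^] k"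
    using torus_uniserial[OF refl t0(1) u] t0 u by (metis nat_pow_eone T_mem)
  obtain t where t: "t \<in> T" "t [^] (p ^ m) = t1" using torus_divisible[OF t1(1)] by blast
  obtain b :: nat where b: "cj g t = t [^] b" using conj_on_T g t by blast
  obtain n where n: "ord t = p ^ n" using torus_ord t by blast
  have "n \<noteq> 0"
  proof
    assume "n = 0"
    then have "t = \<one>" using n t ord_eq_1[of t] by auto
    then have "t0 = \<one>" using t t1 by auto
    then show False using t0 g by simp
  qed
  have "t [^] (b ^ (p ^ m)) = t"
    using conj_pow_iterate[OF g t(1) b, of "p ^ m"] T_conj_trivial[OF gm t(1)] by simp
  then have "t [^] (int (b ^ (p ^ m)) - 1) = \<one>" using t by (simp add: int_pow_diff int_pow_int del: of_nat_power)
  then have dv: "int p ^ n dvd int b ^ (p ^ m) - 1" using int_pow_eq_id[of t] t n by simp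
  have fixed: "False" if "int p ^ n dvd (int b - 1) * int p ^ m"
  proof -
    have "t [^] ((int b - 1) * int (p ^ m)) = \<one>" using int_pow_eq_id[of t] that t n by simp
    then have "(t [^] (int b - 1)) [^] int (p ^ m) = \<one>" using t by (simp add: int_pow_pow)
    then have "(t [^] b \<otimes> inv t) [^] (p ^ m) = \<one>" using t by (simp add: int_pow_diff int_pow_int del: of_nat_power)
    moreover have "(t [^] b \<otimes> inv t) [^] (p ^ m) = (t [^] b) [^] (p ^ m) \<otimes> (inv t) [^] (p ^ m)"
      using t torus_commute[of "t [^] b" "inv t"] torus_nat_pow_closed by (intro pow_mult_distrib) auto
    moreover have "t [^] (b * p ^ m) = t1 [^] b" using t by (metis nat_pow_pow mult.commute T_mem)
    ultimately have "t1 [^] b \<otimes> inv t1 = \<one>" using t by (simp add: nat_pow_pow mult.commute nat_pow_inv)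
    then have "t1 [^] b = t1" using t1 by (metis inv_equality inv_inv inv_closed nat_pow_closed T_mem)
    then have "cj g t1 = t1" using b t g by (metis T_mem conjugate_pow nat_pow_pow mult.commute)
    then show False using t0 t1 g by (metis T_mem conjugate_pow)
  qed
  have cb: "int p dvd int b - 1" 
  proof -
    have "int p dvd int b ^ (p ^ m) - 1" using dv \<open>n \<noteq> 0\<close> by (meson dvd_power dvd_trans neq0_conv)
    then have c: "[int b ^ (p ^ m) = 1] (mod int p)" by (simp add: cong_iff_dvd_diff)
    \<comment> \<open>By Fermat b^p is b modulo p, so b is congruent to its own power with exponent
      \<open>p ^ m\<close>, which is 1.\<close>
    have fe: "[int b ^ p = int b] (mod int p)"
    proof (cases "p dvd b")
      case True
      then have "int p dvd int b ^ p" using p_pos by (metis dvd_power dvd_trans int_dvd_int_iff)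
      then show ?thesis using True by (simp add: cong_iff_dvd_diff)
    next
      case False
      then have "[b ^ (p - 1) * b = 1 * b] (mod p)" using fermat_theorem[OF prime] cong_scalar_right by blast
      then have "[b ^ p = b] (mod p)" using p_pos by (simp add: power_eq_if mult.commute)
      then show ?thesis using cong_int_iff by (metis of_nat_power)
    qed
    have "[int b ^ (p ^ j) = int b] (mod int p)" for j
    proof (induction j)
      case (Suc j)
      have "[(int b ^ (p ^ j)) ^ p = int b ^ p] (mod int p)" by (rule cong_pow[OF Suc])
      then show ?case using fe by (metis cong_trans mult.commute power_Suc power_mult)
    qed simp
    then have "[int b = 1] (mod int p)" using c cong_sym cong_trans by blast
    then show ?thesis by (simp add: cong_iff_dvd_diff)
  qed
  have p2: "p = 2"
    using fixed prime_power_dvd_power_minus_one[OF prime cb _ dv] by blast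
  have "\<not> 4 dvd int b - 1" using fixed prime_power_dvd_power_minus_one[OF prime cb _ dv] by blast
  \<comment> \<open>b is odd but not 1 modulo 4, so -b is 1 modulo 4.\<close>
  then have c: "4 dvd - int b - 1" "int p dvd - int b - 1" using cb p2 by presburger+
  have "int b ^ (p ^ m) = (- int b) ^ (p ^ m)" by (simp add: p2 m_def)
  then have "int p ^ n dvd (- int b - 1) * int p ^ m"
    using prime_power_dvd_power_minus_one[OF prime c(2) _, of n m] c(1) dv by simp
  then have "t [^] ((- int b - 1) * int (p ^ m)) = \<one>" using int_pow_eq_id[of t] t n by simp
  moreover have "(- int b - 1) * int (p ^ m) = - int ((b + 1) * p ^ m)" by (simp add: algebra_simps)
  ultimately have "inv (t [^] ((b + 1) * p ^ m)) = \<one>" 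
    using int_pow_neg_int[OF T_mem[OF t(1)], of "(b + 1) * p ^ m"] by metis
  then have "t [^] ((b + 1) * p ^ m) = \<one>" using t by (metis inv_inv inv_one nat_pow_closed T_mem)
  then have "t [^] (b * p ^ m) \<otimes> t [^] (p ^ m) = \<one>"
    using nat_pow_mult[OF T_mem[OF t(1)], of "b * p ^ m" "p ^ m"] by (simp add: add.commute)
  moreover have "t [^] (b * p ^ m) = cj g t1" using b t g by (metis T_mem conjugate_pow nat_pow_pow)
  ultimately have "cj g t1 = inv t1" using t t1 g by (metis T_mem conjugate_closed inv_equality)
  then have "cj g (t1 [^] k) = inv (t1 [^] k)" for k :: nat using t1 g by (simp add: conjugate_pow nat_pow_inv)
  then show ?thesis using t1(3) p2 by auto
qed

lemma T_torsion_finite: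
  assumes "n > 0" shows "finite {t \<in> T. t [^] (n::nat) = \<one>}"
proof -
  have sub: "subgroup {t \<in> T. t [^] n = \<one>} S"
    by (rule subgroupI) (auto simp: nat_pow_inv pow_mult_distrib torus_commute intro: exI[of _ \<one>])
  obtain t0 where t0: "t0 \<in> T" "t0 \<noteq> \<one>" using T_infinite by (metis T_one finite.emptyI finite.insertI finite_subset insertI1 subsetI)
  \<comment> \<open>Such a root of a nontrivial element has order p^b with b > n, which exceeds n;
    so the n-torsion is a proper subgroup of T.\<close>
  obtain t where t: "t \<in> T" "t [^] (p ^ n) = t0" using torus_divisible t0 by blast
  obtain b where b: "ord t = p ^ b" using torus_ord t by blast
  have "\<not> p ^ b dvd p ^ n" using t t0 b pow_eq_id[of t "p ^ n"] by simp
  then have "n < b" by (meson le_imp_power_dvd not_le)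
  then have "n < p ^ b" using p_gt_1 using power_gt_expt[of p b] p_gt_1 by simp
  then have "\<not> ord t dvd n" using assms b by (auto dest: dvd_imp_le)
  then have "t \<notin> {t \<in> T. t [^] n = \<one>}" using pow_eq_id[of t n] t by auto
  then show ?thesis using proper_subgroup_T_finite[OF sub] t by blast
qed

text \<open>As T does not normalize Q, some x in Q inverts T. If t in T normalizes Q, the commutator
  t x t^-1 x^-1 = t^2 lies in Q, which bounds the order of t. The bound involves only the
  cardinality of Q, hence is uniform over its conjugates.\<close>

lemma normalizer_bound:
  assumes Q: "subgroup Q S" "finite Q" and N: "\<not> T \<subseteq> normalizer S Q"
  shows "card (normalizer S Q) \<le> card {t \<in> T. t [^] (2 * card Q) = \<one>} * torus_index"
proof -
  have QS: "Q \<subseteq> carrier S" using Q(1) sub_mem by blast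
  let ?N = "normalizer S Q"
  have sN: "subgroup ?N S" by (rule subgroup_normalizer[OF QS])
  have "\<exists>x\<in>Q. \<exists>t\<in>T. cj x t \<noteq> t"
  proof (rule ccontr)
    assume "\<not> ?thesis"
    then have "cj t x = x" if "t \<in> T" "x \<in> Q" for t x
      using that QS conjugate_fix_iff[of x t] conjugate_fix_iff[of t x] by (auto simp: subset_eq)
    then have "T \<subseteq> centralizer S Q" using centralizer_iff[OF QS] by auto
    then show False using N centralizer_subset_normalizer[OF QS] by blast
  qed
  then obtain x t0 where x: "x \<in> Q" "t0 \<in> T" "cj x t0 \<noteq> t0" by blast
  have "t [^] (2 * card Q) = \<one>" if t: "t \<in> T" "t \<in> ?N" for t
  proof -
    have xS: "x \<in> carrier S" using x QS by blast
    have "cj t x \<in> Q" using t normalizer_iff[OF QS] x by blast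
    then have a: "cj t x \<otimes> inv x \<in> Q" using x Q by (simp add: subgroup.m_closed subgroup.m_inv_closed)
    have "cj t x \<otimes> inv x = t \<otimes> cj x (inv t)" using t xS by (simp add: conjugate_def m_assoc)
    also have "\<dots> = t \<otimes> t" using conj_T_dichotomy[OF xS x(2,3), of "inv t"] t by simp
    finally have tQ: "t \<otimes> t \<in> Q" using a by simp
    interpret Q: group "S \<downharpoonright> Q" using Q(1) subgroup_imp_group by blast
    have "(t \<otimes> t) [^] card Q = \<one>"
      using Q.pow_order_eq_1[of "t \<otimes> t"] tQ by (simp add: order_def nat_pow_consistent[symmetric])
    moreover have "t \<otimes> t = t [^] (2::nat)" using t by (simp add: numeral_2_eq_2)
    ultimately show ?thesis using t by (simp add: nat_pow_pow)
  qed
  then have sub: "?N \<inter> T \<subseteq> {t \<in> T. t [^] (2 * card Q) = \<one>}" by blast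
  have "card Q > 0" using Q subgroup.one_closed card_gt_0_iff by blast
  then have fin: "finite {t \<in> T. t [^] (2 * card Q) = \<one>}" by (intro T_torsion_finite) simp
  have "card ?N \<le> card (?N \<inter> T) * torus_index" using card_subgroup_le(2)[OF sN] finite_subset[OF sub fin] by blast
  also have "\<dots> \<le> card {t \<in> T. t [^] (2 * card Q) = \<one>} * torus_index" using card_mono[OF fin sub] by simp
  finally show ?thesis .
qed

text \<open>A conjugacy class may be infinite, so a largest normalizer exists only because the
  orders are bounded: by \<open>normalizer_bound\<close> for the finite ones and by the index of T
  for the others.\<close>

lemma fully_normalized_exists:
  assumes P: "subgroup P S" shows "\<exists>f\<in>E P. fully_normalized p S F (f ` P)"
proof -
  define B where "B = card {t \<in> T. t [^] (2 * card P) = \<one>} * torus_index"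
  \<comment> \<open>The lexicographic order expressed by one natural number: the offset
    \<open>Suc B\<close> puts normalizers containing T above all finite ones.\<close>
  define \<mu> where "\<mu> N = (if T \<subseteq> N then Suc B + card ((\<lambda>x. T #> x) ` N) else card N)" for N
  let ?N = "\<lambda>f. normalizer S (f ` P)"
  have sub: "subgroup (f ` P) S" "f ` P \<subseteq> carrier S" "subgroup (?N f) S" "?N f \<subseteq> carrier S" if "f \<in> E P" for f
    using E_image_subgroup[OF P that] sub_mem subgroup_normalizer by (blast, blast, blast, blast)
  have small: "card (?N f) \<le> B" if f: "f \<in> E P" "\<not> T \<subseteq> ?N f" for f
  proof -
    have "finite P"
    proof (rule ccontr)
      assume "infinite P"
      then have "T \<subseteq> P" using subgroup_dichotomy P by blast
      then have "T \<subseteq> f ` P" using E_T(1)[OF P f(1)] by blast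
      then show False using f subgroup_subset_normalizer[OF sub(1)[OF f(1)]] by blast
    qed
    then show ?thesis using normalizer_bound[OF sub(1)[OF f(1)] _ f(2)] E_hom(3)[OF P f(1)]
      by (simp add: B_def card_image)
  qed
  have id: "(\<lambda>x\<in>P. x) \<in> E P" by (rule inclusion_in_F[OF P subgroup_self]) (use sub_mem[OF P] in blast)
  have "\<forall>f. f \<in> E P \<longrightarrow> \<mu> (?N f) < Suc (Suc (B + torus_index))"
  proof (intro allI impI)
    fix f assume f: "f \<in> E P"
    show "\<mu> (?N f) < Suc (Suc (B + torus_index))"
      using card_T_cosets_le[OF sub(4)[OF f]] small[OF f] unfolding \<mu>_def by (cases "T \<subseteq> ?N f") simp_all
  qed
  then obtain f where f: "f \<in> E P" and max: "\<And>g. g \<in> E P \<Longrightarrow> \<mu> (?N g) \<le> \<mu> (?N f)"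
    using ex_has_greatest_nat[of "\<lambda>f. f \<in> E P" "\<lambda>x\<in>P. x" "\<lambda>f. \<mu> (?N f)" "Suc (Suc (B + torus_index))"] id by blast
  have "lex_le (vol (?N g)) (vol (?N f))" if g: "g \<in> E P" for g
  proof -
    have fin: "finite (?N h)" if "h \<in> E P" "\<not> T \<subseteq> ?N h" for h using subgroup_dichotomy sub(3) that by blast
    have v: "vol (?N h) = (if T \<subseteq> ?N h then (1, card ((\<lambda>x. T #> x) ` ?N h)) else (0, card (?N h)))" if "h \<in> E P" for h
      using vol_T[OF sub(3)[OF that]] vol_finite[OF sub(3)[OF that]] fin[OF that] by auto
    show ?thesis unfolding v[OF g] v[OF f] using max[OF g] small[OF g] small[OF f]
      by (auto simp: lex_le_def \<mu>_def split: if_splits)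
  qed
  moreover have "\<exists>g\<in>E P. h ` f ` P = g ` P" if "h \<in> E (f ` P)" for h
    using E_compose[OF P f sub(1)[OF f] that] by (intro bexI[of _ "compose P h f"]) (auto simp: compose_def)
  ultimately have "fully_normalized p S F (f ` P)"
    unfolding fully_normalized_iff[OF sub(1)[OF f]] by metis
  then show ?thesis using f by blast
qed

lemma aut_fusion_E: "subgroup P S \<Longrightarrow> aut_fusion S F P"
proof (intro aut_fusion.intro aut_fusion_axioms.intro is_group)
  assume P: "subgroup P S"
  show "subgroup P S" by (rule P)
  show "f \<in> extensional P" "x \<in> P \<Longrightarrow> f x \<in> P" if "f \<in> F P P" for f x
    using F_hom[OF P P that] by auto
  show "f (x \<otimes> y) = f x \<otimes> f y" if "f \<in> F P P" "x \<in> P" "y \<in> P" for f x y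
    using F_hom(2)[OF P P] that by auto
  show "compose P g f \<in> F P P" if "f \<in> F P P" "g \<in> F P P" for f g
    using compose_closed[OF P P P] that by blast
  show "conj_map S P x \<in> F P P" if x: "x \<in> P" for x
    unfolding F_iff[OF P P] using conj_map_in_E[OF P sub_mem[OF P x]] x P
    by (auto simp: conj_map_def subgroup.m_closed subgroup.m_inv_closed)
qed

text \<open>Transported by f, the group N_S(P) has as image in Out_F(f(P)) a p-group, so some
  automorphism \<alpha> conjugates it into the Sylow subgroup Out_S(f(P)). Then N_S(P) lies in the
  extension group of \<alpha> f, and axiom (II) applies. Passing from f to \<alpha> f preserves the
  image but changes the map.\<close>

lemma E_extend_normalizer:
  assumes P: "subgroup P S" and f: "f \<in> E P" and R: "fully_normalized p S F (f ` P)"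
  shows "\<exists>g\<in>E (normalizer S P). g ` P = f ` P"
proof -
  let ?R = "f ` P"
  have sR: "subgroup ?R S" by (rule E_image_subgroup[OF P f])
  have PS: "P \<subseteq> carrier S" and RS: "?R \<subseteq> carrier S" using sub_mem P sR by blast+
  let ?N = "normalizer S P"
  have sN: "subgroup ?N S" by (rule subgroup_normalizer[OF PS])
  have NS: "\<And>x. x \<in> ?N \<Longrightarrow> x \<in> carrier S" and NP: "\<And>x u. x \<in> ?N \<Longrightarrow> u \<in> P \<Longrightarrow> cj x u \<in> P"
    using normalizer_iff[OF PS] by auto
  interpret R: aut_fusion S F ?R by (rule aut_fusion_E[OF sR])
  interpret O: group "fus_out S F ?R" by (rule R.group_fus_out)
  interpret N: group "S \<downharpoonright> ?N" using sN subgroup_imp_group by blast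
  have fc: "fully_centralized p S F ?R" and finO: "finite (carrier (fus_out S F ?R))"
    and syl: "subgroup (out_conj S F ?R) (fus_out S F ?R)"
      "card (out_conj S F ?R) = p ^ multiplicity p (order (fus_out S F ?R))"
    using saturation_I[OF R] by (auto simp: sylow_subgroup_def)
  let ?fi = "restrict (inv_into P f) ?R"
  have fi: "?fi \<in> E ?R" by (rule E_inverse[OF P f])
  have fif: "inv_into P f (f u) = u" if "u \<in> P" for u using E_hom(3)[OF P f] that by simp
  define \<Phi> where "\<Phi> x = conj_by f P (conj_map S P x)" for x
  have \<Phi>_ap: "\<Phi> x (f u) = f (cj x u)" if "u \<in> P" for x u
    using that fif by (simp add: \<Phi>_def conj_by_def conj_map_apply)
  have \<Phi>_A: "\<Phi> x \<in> carrier R.A" if x: "x \<in> ?N" for x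
  proof -
    have c: "conj_map S P x \<in> E P" by (rule conj_map_in_E[OF P NS[OF x]])
    have im: "conj_map S P x ` P = P" using x normalizer_iff[OF PS] by (auto simp: conj_map_apply)
    have "compose ?R (compose P f (conj_map S P x)) ?fi \<in> E ?R"
      by (rule E_compose[OF sR fi P E_compose[OF P c P f]]) (use im fif in auto)
    moreover have "compose ?R (compose P f (conj_map S P x)) ?fi = \<Phi> x"
      by (auto simp: \<Phi>_def conj_by_def compose_def inv_into_into intro!: restrict_ext)
    moreover have "\<Phi> x ` ?R = ?R"
    proof -
      have "\<Phi> x ` ?R = f ` (cj x ` P)" using \<Phi>_ap by (auto simp: image_image)
      then show ?thesis using x normalizer_iff[OF PS] by simp
    qed
    ultimately show ?thesis using fus_iso_iff[OF sR sR] by (simp add: fus_aut_def)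
  qed
  have \<Phi>: "\<Phi> \<in> hom (S \<downharpoonright> ?N) R.A"
  proof (rule homI)
    fix x y assume xy: "x \<in> carrier (S \<downharpoonright> ?N)" "y \<in> carrier (S \<downharpoonright> ?N)"
    then have n: "x \<in> ?N" "y \<in> ?N" "x \<otimes> y \<in> ?N" using sN by (auto simp: subgroup.m_closed)
    have "\<Phi> (x \<otimes> y) = \<Phi> x \<otimes>\<^bsub>R.A\<^esub> \<Phi> y"
      by (rule R.A_eqI) (use \<Phi>_A n NS NP PS in \<open>auto simp: R.A_mult \<Phi>_ap conjugate_comp subset_eq\<close>)
    then show "\<Phi> (x \<otimes>\<^bsub>S \<downharpoonright> ?N\<^esub> y) = \<Phi> x \<otimes>\<^bsub>R.A\<^esub> \<Phi> y" by simp
  qed (use \<Phi>_A in simp)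
  let ?I = "inn S ?R"
  let ?X = "(\<lambda>x. ?I #>\<^bsub>R.A\<^esub> \<Phi> x) ` ?N"
  have tors: "\<exists>n. x [^]\<^bsub>S \<downharpoonright> ?N\<^esub> (p ^ n) = \<one>\<^bsub>S \<downharpoonright> ?N\<^esub>" if "x \<in> carrier (S \<downharpoonright> ?N)" for x
    using S_torsion NS that by (simp add: nat_pow_consistent[symmetric])
  obtain k where X: "subgroup ?X (fus_out S F ?R)" "card ?X = p ^ k"
    using R.image_in_fus_out[OF prime finO N.is_group \<Phi> tors] by auto
  obtain a where a: "a \<in> carrier (fus_out S F ?R)"
    "\<And>y. y \<in> ?X \<Longrightarrow> a \<otimes>\<^bsub>fus_out S F ?R\<^esub> y \<otimes>\<^bsub>fus_out S F ?R\<^esub> inv\<^bsub>fus_out S F ?R\<^esub> a \<in> out_conj S F ?R"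
    using O.p_subgroup_conj_into_sylow[OF prime finO X syl] by blast
  obtain \<alpha> where \<alpha>: "\<alpha> \<in> carrier R.A" "a = ?I #>\<^bsub>R.A\<^esub> \<alpha>"
    using a(1) by (auto simp: fus_out_def carrier_FactGroup)
  interpret I: normal ?I R.A by (rule R.inn_normal)
  have main: "\<exists>y\<in>normalizer S ?R. \<forall>u\<in>P. \<alpha> (f (cj x u)) = cj y (\<alpha> (f u))" if x: "x \<in> ?N" for x
  proof -
    let ?b = "\<alpha> \<otimes>\<^bsub>R.A\<^esub> \<Phi> x \<otimes>\<^bsub>R.A\<^esub> inv\<^bsub>R.A\<^esub> \<alpha>"
    have bA: "?b \<in> carrier R.A" using \<alpha>(1) \<Phi>_A[OF x] by simp
    have "?I #>\<^bsub>R.A\<^esub> ?b = a \<otimes>\<^bsub>fus_out S F ?R\<^esub> (?I #>\<^bsub>R.A\<^esub> \<Phi> x) \<otimes>\<^bsub>fus_out S F ?R\<^esub> inv\<^bsub>fus_out S F ?R\<^esub> a"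
      using \<alpha> \<Phi>_A[OF x] a(1) unfolding fus_out_def
      by (simp add: I.inv_FactGroup I.rcos_inv I.rcos_sum)
    then have "?I #>\<^bsub>R.A\<^esub> ?b \<in> out_conj S F ?R" using a(2) x by simp
    then obtain y where y: "y \<in> normalizer S ?R" "?I #>\<^bsub>R.A\<^esub> ?b = ?I #>\<^bsub>R.A\<^esub> conj_map S ?R y"
      by (auto simp: out_conj_def aut_conj_def)
    \<comment> \<open>Equal cosets in Out determine the conjugation only up to an inner automorphism
      c_w, so the element sought is w y rather than y.\<close>
    have "?b \<in> ?I #>\<^bsub>R.A\<^esub> conj_map S ?R y"
      using R.A.rcos_self[OF bA I.is_subgroup] y(2) by simp
    then obtain w where w: "w \<in> ?R" "?b = conj_map S ?R w \<otimes>\<^bsub>R.A\<^esub> conj_map S ?R y"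
      by (auto simp: r_coset_def inn_def)
    have yS: "y \<in> carrier S" "\<And>r. r \<in> ?R \<Longrightarrow> cj y r \<in> ?R" using y(1) normalizer_iff[OF RS] by auto
    have wN: "w \<otimes> y \<in> normalizer S ?R"
      using w(1) y(1) subgroup_subset_normalizer[OF sR] subgroup_normalizer[OF RS] by (auto intro: subgroup.m_closed)
    have wS: "w \<in> carrier S" using w RS by blast
    have "\<alpha> (f (cj x u)) = cj (w \<otimes> y) (\<alpha> (f u))" if u: "u \<in> P" for u
    proof -
      have r: "\<alpha> (f u) \<in> ?R" using R.A_mem(3)[OF \<alpha>(1)] u by blast
      have "\<alpha> (f (cj x u)) = ?b (\<alpha> (f u))"
        using r u R.A_mem(6)[OF \<alpha>(1)] by (simp add: R.A_mult \<Phi>_ap)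
      also have "\<dots> = cj w (cj y (\<alpha> (f u)))" using w(2) r yS by (simp add: R.A_mult conj_map_apply)
      finally show ?thesis using yS wS r RS by (auto simp: conjugate_comp)
    qed
    then show ?thesis using wN by blast
  qed
  let ?g = "compose P \<alpha> f"
  have \<alpha>E: "\<alpha> \<in> E ?R" "\<alpha> ` ?R = ?R" using \<alpha>(1) fus_iso_iff[OF sR sR] by (auto simp: fus_aut_def)
  have g: "?g \<in> E P" by (rule E_compose[OF P f sR \<alpha>E(1)]) auto
  have gim: "?g ` P = ?R" using \<alpha>E(2) by (auto simp: compose_def image_image)
  have "\<exists>f'\<in>E ?N. \<forall>u\<in>P \<inter> ?N. f' u = ?g u"
  proof (rule E_extend[OF P g _ sN])
    show "fully_centralized p S F (?g ` P)" using fc gim by simp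
    show "\<exists>y\<in>normalizer S (?g ` P). \<forall>u\<in>P. ?g (cj x u) = cj y (?g u)" if "x \<in> ?N" for x
      using main[OF that] gim NP[OF that] by (auto simp: compose_eq)
  qed simp
  then obtain f' where f': "f' \<in> E ?N" "\<And>u. u \<in> P \<Longrightarrow> f' u = ?g u"
    using subgroup_subset_normalizer[OF P] by blast
  then have "f' ` P = ?R" using gim by (metis image_cong)
  then show ?thesis using f'(1) by blast
qed

text \<open>If T is in P, pass to the finite p-group S/T. Otherwise suppose N_S(P) = P. Then T does
  not centralize P, so p = 2; any t in T with t^2 in P normalizes P, because conjugation by t fixes
  an element of P or multiplies it by t^2. So P would be closed under square roots in T and contain
  T.\<close>

lemma normalizer_grows:
  assumes P: "subgroup P S" "P \<noteq> carrier S" shows "normalizer S P \<noteq> P"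
proof (cases "T \<subseteq> P")
  case True
  obtain k where k: "order (S Mod T) = p ^ k" using index_prime_power by blast
  interpret TN: normal T S by (rule torus_normal)
  interpret Q: group "S Mod T" by (rule TN.factorgroup_is_group)
  have PS: "P \<subseteq> carrier S" using sub_mem[OF P(1)] by blast
  have mem: "x \<in> P" if "T #> x = T #> y" "y \<in> P" "x \<in> carrier S" for x y
  proof -
    have "x \<otimes> inv y \<in> P" using T_coset_eq_iff that PS True by blast
    then have "x \<otimes> inv y \<otimes> y \<in> P" using that P by (simp add: subgroup.m_closed)
    then show ?thesis using that PS by (auto simp: m_assoc)
  qed
  let ?P = "(\<lambda>x. T #> x) ` P"
  have hom: "(\<lambda>x. T #> x) \<in> hom S (S Mod T)" by (rule TN.r_coset_hom_Mod)
  then interpret h: group_hom S "S Mod T" "\<lambda>x. T #> x"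
    by (simp add: group_hom_def group_hom_axioms_def is_group Q.is_group)
  have "subgroup ?P (S Mod T)" by (rule h.subgroup_img_is_subgroup[OF P(1)])
  moreover have "?P \<noteq> carrier (S Mod T)"
  proof
    assume eq: "?P = carrier (S Mod T)"
    have "x \<in> P" if "x \<in> carrier S" for x
    proof -
      have "T #> x \<in> ?P" using eq that by (auto simp: carrier_FactGroup)
      then show ?thesis using mem that by blast
    qed
    then show False using P(2) PS by blast
  qed
  ultimately have "\<exists>C\<in>carrier (S Mod T) - ?P. \<forall>D\<in>?P. C \<otimes>\<^bsub>S Mod T\<^esub> D \<otimes>\<^bsub>S Mod T\<^esub> inv\<^bsub>S Mod T\<^esub> C \<in> ?P"
    by (rule Q.p_group_normalizer_grows[OF prime k])
  then obtain C where C: "C \<in> carrier (S Mod T) - ?P"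
    "\<And>D. D \<in> ?P \<Longrightarrow> C \<otimes>\<^bsub>S Mod T\<^esub> D \<otimes>\<^bsub>S Mod T\<^esub> inv\<^bsub>S Mod T\<^esub> C \<in> ?P" by metis
  then obtain g where g: "g \<in> carrier S" "C = T #> g" by (auto simp: carrier_FactGroup)
  have gP: "g \<notin> P" using C(1) g by blast
  have cjP: "cj g x \<in> P" if x: "x \<in> P" for x
  proof -
    have xS: "x \<in> carrier S" using x PS by blast
    have "T #> cj g x = C \<otimes>\<^bsub>S Mod T\<^esub> (T #> x) \<otimes>\<^bsub>S Mod T\<^esub> inv\<^bsub>S Mod T\<^esub> C"
      unfolding conjugate_def g(2) using g(1) xS h.hom_mult h.hom_inv by simp
    then have "T #> cj g x \<in> ?P" using C(2) x by simp
    then show ?thesis using mem g(1) xS by auto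
  qed
  \<comment> \<open>P may be infinite, so gPg^-1 \<subseteq> P does not yet mean that g normalizes
    P; but the inverse of the torsion element g is one of its positive powers.\<close>
  have pw: "cj (g [^] n) x \<in> P" if "x \<in> P" for x and n :: nat
    using that
  proof (induction n arbitrary: x)
    case 0 then show ?case using PS by auto
  next
    case (Suc n)
    have "cj (g [^] Suc n) x = cj (g [^] n) (cj g x)" using Suc.prems g PS by (auto simp: conjugate_comp)
    then show ?case using Suc cjP by simp
  qed
  obtain n where n: "g [^] (p ^ n) = \<one>" using S_torsion g by blast
  have "inv g = g [^] (p ^ n - 1)"
  proof (rule inv_equality)
    have "p ^ n = Suc (p ^ n - 1)" using p_pos by simp
    then show "g [^] (p ^ n - 1) \<otimes> g = \<one>" using n by (metis nat_pow_Suc)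
  qed (use g in auto)
  then have "g \<in> normalizer S P" using normalizerI[OF P(1) g(1) cjP] pw by simp
  then show ?thesis using gP by blast
next
  case False
  then have finP: "finite P" using subgroup_dichotomy P by blast
  have PS: "P \<subseteq> carrier S" using sub_mem[OF P(1)] by blast
  show ?thesis
  proof
    assume eq: "normalizer S P = P"
    then have "\<not> T \<subseteq> centralizer S P" using False centralizer_subset_normalizer[OF PS] by blast
    then obtain t0 where "t0 \<in> T" "t0 \<notin> centralizer S P" by blast
    then obtain x where x: "x \<in> P" "t0 \<in> T" "cj t0 x \<noteq> x" using centralizer_iff[OF PS] by auto
    have xS: "x \<in> carrier S" using x PS by blast
    then have "cj x t0 \<noteq> t0" using x conjugate_fix_iff[of x t0] conjugate_fix_iff[of t0 x] by auto
    then have p2: "p = 2" using conj_T_dichotomy[OF xS x(2)] x(2) by blast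
    have up: "t \<in> P" if t: "t \<in> T" "t [^] p \<in> P" for t
    proof -
      have tt: "t \<otimes> t \<in> P" "inv t \<otimes> inv t \<in> P"
        using t p2 subgroup.m_inv_closed[OF P(1) t(2)] by (auto simp: numeral_2_eq_2 inv_mult_group)
      have *: "cj s y \<in> P" if s: "s \<in> T" "s \<otimes> s \<in> P" "y \<in> P" for s y
      proof (cases "\<exists>u\<in>T. cj y u \<noteq> u")
        case True
        have yS: "y \<in> carrier S" using s PS by blast
        obtain u where "u \<in> T" "cj y u \<noteq> u" using True by blast
        then have "cj y (inv s) = s" using conj_T_dichotomy[OF yS, of u "inv s"] s by simp
        then have "y \<otimes> inv s = s \<otimes> y" using s yS inv_solve_right'[of s "y \<otimes> inv s" y] by (simp add: conjugate_def)
        then have "cj s y = s \<otimes> s \<otimes> y" using s yS by (simp add: conjugate_def m_assoc)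
        then show ?thesis using s P by (simp add: subgroup.m_closed)
      next
        case False
        have yS: "y \<in> carrier S" using s PS by blast
        then have "cj s y = y" using False s conjugate_fix_iff[of s y] conjugate_fix_iff[of y s] by auto
        then show ?thesis using s by simp
      qed
      have "t \<in> normalizer S P" using normalizerI[OF P(1), of t] *[of t] *[of "inv t"] t tt by auto
      then show "t \<in> P" using eq by simp
    qed
    have up2: "t \<in> P" if "t \<in> T" "t [^] (p ^ n) \<in> P" for t n
      using that
    proof (induction n arbitrary: t)
      case (Suc n)
      then have "(t [^] p) [^] (p ^ n) \<in> P" by (simp add: nat_pow_pow)
      then have "t [^] p \<in> P" using Suc.IH torus_nat_pow_closed Suc.prems(1) by blast
      then show ?case using up Suc.prems(1) by blast
    qed simp
    have "T \<subseteq> P" using up2 torus_torsion subgroup.one_closed[OF P(1)] by (metis subsetI)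
    then show False using False by blast
  qed
qed

section \<open>The bullet functor in rank one\<close>

lemma E_T_iff_W: "\<omega> \<in> carrier (fus_aut F T) \<longleftrightarrow> \<omega> \<in> E T"
  using fus_iso_iff[OF torus_subgroup torus_subgroup] E_T(1)[OF torus_subgroup] by (auto simp: fus_aut_def)

text \<open>T is its only F-conjugate, hence fully normalized, so Out_F(T) is finite; and since T is
  abelian, Out_F(T) is Aut_F(T).\<close>

lemma finite_E_T: "finite (E T)"
proof -
  interpret T: aut_fusion S F T by (rule aut_fusion_E[OF torus_subgroup])
  have "fully_normalized p S F T"
    unfolding fully_normalized_iff[OF torus_subgroup] using E_T(1)[OF torus_subgroup] by (auto simp: lex_le_def)
  then have fin: "finite (carrier (fus_out S F T))" using saturation_I by blast
  have inn: "inn S T = {\<one>\<^bsub>T.A\<^esub>}"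
  proof -
    have "conj_map S T s = \<one>\<^bsub>T.A\<^esub>" if "s \<in> T" for s
      using T_conj_trivial[OF that] by (auto simp: conj_map_def conjugate_def fus_aut_def intro!: restrict_ext)
    then have "conj_map S T ` T = (\<lambda>_. \<one>\<^bsub>T.A\<^esub>) ` T" by (rule image_cong[OF refl])
    then show ?thesis by (simp add: inn_def image_constant[OF T_one])
  qed
  have "inj_on (\<lambda>a. inn S T #>\<^bsub>T.A\<^esub> a) (carrier T.A)"
    by (rule inj_onI) (auto simp: inn r_coset_def)
  moreover have "(\<lambda>a. inn S T #>\<^bsub>T.A\<^esub> a) ` carrier T.A = carrier (fus_out S F T)"
    by (simp add: fus_out_def carrier_FactGroup)
  ultimately have "finite (carrier T.A)" using fin finite_imageD by metis
  moreover have "carrier T.A = E T" using E_T_iff_W by blast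
  ultimately show ?thesis by simp
qed

text \<open>In rank one \<^term>\<open>bullet p S F X\<close> is \<open>X\<close> when \<open>X\<close> is small in the following sense, and \<open>X T\<close> otherwise.\<close>

definition small :: "'a set \<Rightarrow> bool" where
  "small X \<longleftrightarrow> (\<exists>\<omega>\<in>E T. (\<exists>t\<in>T. \<omega> t \<noteq> t) \<and> (\<forall>x\<in>X. \<omega> (x [^] q) = x [^] q))"

lemma small_mono: "X \<subseteq> Y \<Longrightarrow> small Y \<Longrightarrow> small X"
  unfolding small_def by blast

text \<open>The fixed subgroup \<open>weyl_fix\<close> is either T or a proper subgroup of T, and in
  rank one the latter is finite with trivial maximal torus.\<close>

lemma bullet_eq:
  assumes X: "X \<subseteq> carrier S"
  shows "bullet p S F X = (if small X then X else X <#> T)"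
proof -
  let ?I = "weyl_fix p S F ((\<lambda>x. x [^] q) ` X)"
  have I: "?I = {t \<in> T. \<forall>\<omega>\<in>E T. (\<forall>x\<in>X. \<omega> (x [^] q) = x [^] q) \<longrightarrow> \<omega> t = t}"
    unfolding weyl_fix_def by (auto simp: E_T_iff_W)
  show ?thesis
  proof (cases "small X")
    case False
    then have "?I = T" unfolding I small_def by blast
    then show ?thesis using False vol_T(1)[OF torus_subgroup] by (simp add: bullet_def)
  next
    case True
    then obtain \<omega> t where \<omega>: "\<omega> \<in> E T" "t \<in> T" "\<omega> t \<noteq> t" "\<forall>x\<in>X. \<omega> (x [^] q) = x [^] q"
      unfolding small_def by blast
    have sub: "subgroup ?I S"
    proof (rule subgroupI)
      show "?I \<subseteq> carrier S" unfolding I by auto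
      have "\<one> \<in> ?I" unfolding I using E_one[OF torus_subgroup] by auto
      then show "?I \<noteq> {}" by blast
      show "inv a \<in> ?I" if "a \<in> ?I" for a
        using that unfolding I by (auto simp: E_inv[OF torus_subgroup])
      show "a \<otimes> b \<in> ?I" if "a \<in> ?I" "b \<in> ?I" for a b
        
      proof -
        have ab: "a \<in> T" "b \<in> T" using that unfolding I by auto
        moreover have "\<omega> (a \<otimes> b) = a \<otimes> b" if w: "\<omega> \<in> E T" "\<forall>x\<in>X. \<omega> (x [^] q) = x [^] q" for \<omega>
        proof -
          have "\<omega> a = a" "\<omega> b = b" using \<open>a \<in> ?I\<close> \<open>b \<in> ?I\<close> w unfolding I by blast+
          then show ?thesis using E_hom(2)[OF torus_subgroup w(1) ab] by simp
        qed
        ultimately show ?thesis unfolding I by simp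
      qed
    qed
    have "t \<notin> ?I" unfolding I using \<omega> by auto
    then have "finite ?I" using proper_subgroup_T_finite[OF sub] \<omega>(2) I by blast
    then have "bullet p S F X = X <#> {\<one>}" using vol_finite(1)[OF sub] by (simp add: bullet_def)
    also have "\<dots> = (\<lambda>x. x \<otimes> \<one>) ` X" by (auto simp: set_mult_def)
    also have "\<dots> = (\<lambda>x. x) ` X" by (rule image_cong) (use X in auto)
    also have "\<dots> = X" by simp
    finally show ?thesis using True by simp
  qed
qed

lemma XT_iff: "y \<in> X <#> T \<longleftrightarrow> (\<exists>x\<in>X. \<exists>t\<in>T. y = x \<otimes> t)"
  by (auto simp: set_mult_def)

lemma XT_subgroup:
  assumes "subgroup X S" shows "subgroup (X <#> T) S" "X \<subseteq> X <#> T" "T \<subseteq> X <#> T"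
proof -
  show "subgroup (X <#> T) S" unfolding commut_normal[OF assms torus_normal]
    by (intro second_isomorphism_grp.normal_set_mult_subgroup second_isomorphism_grp.intro
        second_isomorphism_grp_axioms.intro torus_normal assms)
  show "X \<subseteq> X <#> T"
  proof
    fix x assume "x \<in> X"
    then show "x \<in> X <#> T" using sub_mem[OF assms] T_one r_one XT_iff by metis
  qed
  show "T \<subseteq> X <#> T"
  proof
    fix t assume "t \<in> T"
    then show "t \<in> X <#> T" using subgroup.one_closed[OF assms] T_mem l_one XT_iff by metis
  qed
qed

lemma XT_eq: 
  assumes "subgroup X S" "T \<subseteq> X" shows "X <#> T = X"
  using XT_subgroup(2)[OF assms(1)] assms subgroup.m_closed[OF assms(1)] by (auto simp: XT_iff subset_eq)

lemma XT_least:
  assumes "subgroup Y S" "T \<subseteq> Y" "X \<subseteq> Y" shows "X <#> T \<subseteq> Y"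
  using assms subgroup.m_closed[OF assms(1)] by (auto simp: XT_iff subset_eq)

text \<open>For s in T each of s and \<theta>(s) is a power of the other, so an automorphism of T
  fixes both or neither.\<close>

lemma small_image_iff:
  assumes P: "subgroup P S" "T \<subseteq> P" and X: "X \<subseteq> P"
    and \<theta>: "\<And>x. x \<in> P \<Longrightarrow> \<theta> x \<in> carrier S" "\<And>x y. x \<in> P \<Longrightarrow> y \<in> P \<Longrightarrow> \<theta> (x \<otimes> y) = \<theta> x \<otimes> \<theta> y" "inj_on \<theta> P"
  shows "small (\<theta> ` X) \<longleftrightarrow> small X"
proof -
  have h: "\<And>s. s \<in> T \<Longrightarrow> \<theta> s \<in> carrier S" "\<And>s t. s \<in> T \<Longrightarrow> t \<in> T \<Longrightarrow> \<theta> (s \<otimes> t) = \<theta> s \<otimes> \<theta> t" "inj_on \<theta> T"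
    using \<theta> P(2) by (auto intro: inj_on_subset)
  have oP: "\<one> \<in> P" by (rule subgroup.one_closed[OF P(1)])
  have \<theta>1: "\<theta> \<one> = \<one>" using \<theta>(2)[OF oP oP] \<theta>(1)[OF oP] by (metis l_cancel_one' one_closed r_one)
  have pow: "x [^] (n::nat) \<in> P \<and> \<theta> (x [^] n) = \<theta> x [^] n" if "x \<in> P" for x n
    by (induction n) (use P \<theta> that \<theta>1 in \<open>auto simp: subgroup.one_closed subgroup.m_closed\<close>)
  have "\<omega> (\<theta> x [^] q) = \<theta> x [^] q \<longleftrightarrow> \<omega> (x [^] q) = x [^] q" if \<omega>: "\<omega> \<in> E T" and x: "x \<in> X" for \<omega> x
  proof -
    have s: "x [^] q \<in> T" "\<theta> (x [^] q) = \<theta> x [^] q" using q_props(2) sub_mem[OF P(1)] x X pow by (blast, blast)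
    obtain j k :: nat where jk: "\<theta> (x [^] q) = (x [^] q) [^] j" "x [^] q = \<theta> (x [^] q) [^] k"
      using T_hom(2,3)[OF h s(1)] by blast
    have t: "\<theta> (x [^] q) \<in> T" using T_hom(1)[OF h] s(1) by blast
    show ?thesis unfolding s(2)[symmetric]
      using jk E_pow[OF torus_subgroup \<omega> s(1), of j] E_pow[OF torus_subgroup \<omega> t, of k] by metis
  qed
  then show ?thesis unfolding small_def by auto
qed

section \<open>Cyclic subgroups of T and extension of morphisms to T\<close>

definition cyc :: "'a \<Rightarrow> 'a set" where "cyc x = range (\<lambda>n::nat. x [^] n)"

lemma cyc_subgroup:
  assumes x: "x \<in> carrier S" shows "subgroup (cyc x) S" "x \<in> cyc x" "finite (cyc x)"
proof -
  obtain m where m: "x [^] (p ^ m) = \<one>" using S_torsion x by blast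
  have red: "x [^] (n::nat) = x [^] (n mod p ^ m)" for n
  proof -
    have "x [^] n = x [^] (p ^ m * (n div p ^ m) + n mod p ^ m)" by simp
    also have "\<dots> = (x [^] (p ^ m)) [^] (n div p ^ m) \<otimes> x [^] (n mod p ^ m)"
      using x by (simp add: nat_pow_mult nat_pow_pow)
    finally show ?thesis using m x by simp
  qed
  have "cyc x \<subseteq> (\<lambda>n. x [^] n) ` {..<p ^ m}" using red p_pos by (force simp: cyc_def)
  then show "finite (cyc x)" using finite_subset by blast
  show "x \<in> cyc x" unfolding cyc_def using x by (metis nat_pow_eone rangeI)
  show "subgroup (cyc x) S"
  proof (rule subgroupI)
    show "cyc x \<subseteq> carrier S" using x by (auto simp: cyc_def)
    show "cyc x \<noteq> {}" by (auto simp: cyc_def)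
    show "inv a \<in> cyc x" if a: "a \<in> cyc x" for a
    proof -
      obtain n :: nat where n: "a = x [^] n" using a by (auto simp: cyc_def)
      have "inv a = x [^] (n * (p ^ m - 1))"
      proof (rule inv_equality)
        have "n * (p ^ m - 1) + n = n * p ^ m" using p_pos by (cases "p ^ m") auto
        then have "x [^] (n * (p ^ m - 1)) \<otimes> a = x [^] (p ^ m * n)" using n x by (simp add: nat_pow_mult mult.commute)
        then show "x [^] (n * (p ^ m - 1)) \<otimes> a = \<one>" using m x by (simp add: nat_pow_pow[symmetric])
      qed (use x n in auto)
      then show ?thesis by (auto simp: cyc_def)
    qed
    show "a \<otimes> b \<in> cyc x" if "a \<in> cyc x" "b \<in> cyc x" for a b
      using that x by (auto simp: cyc_def nat_pow_mult)
  qed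
qed

lemma cyc_subset: "subgroup P S \<Longrightarrow> x \<in> P \<Longrightarrow> cyc x \<subseteq> P"
proof -
  assume P: "subgroup P S" "x \<in> P"
  have "x [^] (n::nat) \<in> P" for n using P by (induction n) (auto simp: subgroup.one_closed subgroup.m_closed)
  then show ?thesis by (auto simp: cyc_def)
qed

lemma E_on_cyc:
  assumes "subgroup P S" "f \<in> E P" "x \<in> P"
  shows "restrict f (cyc x) \<in> E (cyc x)" "f ` cyc x = cyc (f x)"
proof -
  have s: "subgroup (cyc x) S" using cyc_subgroup sub_mem assms by blast
  show "restrict f (cyc x) \<in> E (cyc x)" by (rule E_restrict[OF assms(1,2) s cyc_subset[OF assms(1,3)]])
  show "f ` cyc x = cyc (f x)" using E_pow[OF assms] by (auto simp: cyc_def image_image)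
qed

lemma fully_normalized_imp_centralized: "fully_normalized p S F P \<Longrightarrow> fully_centralized p S F P"
  using saturation_I by blast

lemma vol_mono:
  assumes "subgroup N S" "subgroup N' S" "N \<subseteq> N'" shows "lex_le (vol N) (vol N')"
proof (rule ccontr)
  assume n: "\<not> lex_le (vol N) (vol N')"
  have "lex_le a b \<or> lex_le b a" for a b :: "nat \<times> nat" by (cases a; cases b) (auto simp: lex_le_def)
  then have "lex_le (vol N') (vol N)" using n by blast
  then have "N = N'" using vol_strict assms by blast
  then show False using n by (simp add: lex_le_def)
qed

lemma lex_le_trans: "lex_le a b \<Longrightarrow> lex_le b c \<Longrightarrow> lex_le a c"
  by (cases a; cases b; cases c) (auto simp: lex_le_def)

text \<open>A morphism from \<open>cyc x\<close> onto a fully normalized subgroup extends to the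
  centralizer of \<open>cyc x\<close>, which contains T. There it sends x to a power of x and
  conversely, so the image is \<open>cyc x\<close> again.\<close>

lemma cyc_fully_centralized:
  assumes x: "x \<in> T" shows "fully_centralized p S F (cyc x)"
proof -
  let ?A = "cyc x"
  have A: "subgroup ?A S" "x \<in> ?A" using cyc_subgroup x by auto
  have AS: "?A \<subseteq> carrier S" using sub_mem[OF A(1)] by blast
  have AT: "?A \<subseteq> T" using cyc_subset[OF torus_subgroup x] .
  obtain f where f: "f \<in> E ?A" "fully_normalized p S F (f ` ?A)" using fully_normalized_exists[OF A(1)] by blast
  let ?B = "f ` ?A"
  have B: "subgroup ?B S" by (rule E_image_subgroup[OF A(1) f(1)])
  have BS: "?B \<subseteq> carrier S" using sub_mem[OF B] by blast
  have fcB: "fully_centralized p S F ?B" by (rule fully_normalized_imp_centralized[OF f(2)])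
  let ?C = "centralizer S ?A"
  have sC: "subgroup ?C S" by (rule subgroup_centralizer[OF AS])
  have TC: "T \<subseteq> ?C" using T_conj_trivial AT centralizer_iff[OF AS] by (auto simp: subset_eq)
  have "\<exists>f'\<in>E ?C. \<forall>u\<in>?A \<inter> ?C. f' u = f u"
  proof (rule E_extend[OF A(1) f(1) fcB sC centralizer_subset_normalizer[OF AS]])
    fix c assume c: "c \<in> ?C"
    have "\<one> \<in> normalizer S ?B" by (rule subgroup.one_closed[OF subgroup_normalizer[OF BS]])
    then show "\<exists>y\<in>normalizer S ?B. \<forall>u\<in>?A. f (cj c u) = cj y (f u)"
      using c centralizer_iff[OF AS] E_hom(1)[OF A(1) f(1)] by (intro bexI[of _ \<one>]) auto
  qed
  then obtain f' where f': "f' \<in> E ?C" "\<And>u. u \<in> ?A \<Longrightarrow> f' u = f u" using AT TC by blast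
  obtain j k :: nat where jk: "f' x = x [^] j" "x = f' x [^] k" using E_T(2,3)[OF sC f'(1) TC x] by blast
  have "?B = cyc (f' x)" using E_on_cyc(2)[OF A(1) f(1) A(2)] f'(2)[OF A(2)] by simp
  moreover have "f' x \<in> ?A" using jk(1) by (auto simp: cyc_def)
  then have "cyc (f' x) \<subseteq> ?A" by (rule cyc_subset[OF A(1)])
  moreover have "x \<in> cyc (f' x)" unfolding cyc_def using jk(2) by blast
  then have "?A \<subseteq> cyc (f' x)" using cyc_subset[of "cyc (f' x)" x] cyc_subgroup(1)[of "f' x"] jk x by auto
  ultimately have "?B = ?A" by blast
  then show ?thesis using fcB by simp
qed

text \<open>As \<open>cyc x\<close> is fully centralized, the inverse of f extends to the
  centralizer of f x, which contains T. The extension maps T onto T and f x to an element of T, so f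
  x is in T by injectivity.\<close>

lemma E_into_T:
  assumes P: "subgroup P S" "f \<in> E P" and x: "x \<in> P" "x \<in> T" and c: "\<And>t. t \<in> T \<Longrightarrow> cj (f x) t = t"
  shows "f x \<in> T"
proof -
  let ?A = "cyc x"
  have A: "subgroup ?A S" "x \<in> ?A" using cyc_subgroup x by auto
  let ?f = "restrict f ?A"
  have f: "?f \<in> E ?A" "?f ` ?A = cyc (f x)" using E_on_cyc[OF P x(1)] by auto
  let ?B = "cyc (f x)"
  let ?g = "restrict (inv_into ?A ?f) ?B"
  have g: "?g \<in> E ?B" using E_inverse[OF A(1) f(1)] f(2) by simp
  have injA: "inj_on ?f ?A" by (rule E_hom(3)[OF A(1) f(1)])
  have gim: "?g ` ?B = ?A"
    using inv_into_image_cancel[OF injA, of ?A] f(2) by simp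
  have gfx: "?g (f x) = x" using inv_into_f_f[OF injA A(2)] A(2) cyc_subgroup(2)[OF E_hom(1)[OF P x(1)]] by simp
  have B: "subgroup ?B S" "f x \<in> ?B" using cyc_subgroup[OF E_hom(1)[OF P x(1)]] by auto
  have BS: "?B \<subseteq> carrier S" using sub_mem[OF B(1)] by blast
  have fxS: "f x \<in> carrier S" using B BS by blast
  let ?C = "centralizer S ?B"
  have sC: "subgroup ?C S" by (rule subgroup_centralizer[OF BS])
  have comm: "cj t (f x) = f x" if "t \<in> T" for t
    using c[OF that] conjugate_fix_iff[of "f x" t] conjugate_fix_iff[of t "f x"] that fxS by simp
  have "cj t u = u" if "t \<in> T" "u \<in> ?B" for t u
    using comm[OF that(1)] that fxS by (auto simp: cyc_def conjugate_pow)
  then have TC: "T \<subseteq> ?C" using centralizer_iff[OF BS] by auto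
  have fxC: "f x \<in> ?C"
  proof -
    have "cj (f x) (f x) = f x" using fxS by (simp add: conjugate_def m_assoc)
    then have "cj (f x) u = u" if "u \<in> ?B" for u using that fxS by (auto simp: cyc_def conjugate_pow)
    then show ?thesis using centralizer_iff[OF BS] fxS by auto
  qed
  have "\<exists>f'\<in>E ?C. \<forall>u\<in>?B \<inter> ?C. f' u = ?g u"
  proof (rule E_extend[OF B(1) g _ sC centralizer_subset_normalizer[OF BS]])
    show "fully_centralized p S F (?g ` ?B)" unfolding gim by (rule cyc_fully_centralized[OF x(2)])
    fix d assume d: "d \<in> ?C"
    have "\<one> \<in> normalizer S (?g ` ?B)" unfolding gim
      using sub_mem[OF A(1)] by (intro subgroup.one_closed[OF subgroup_normalizer]) blast
    then show "\<exists>y\<in>normalizer S (?g ` ?B). \<forall>u\<in>?B. ?g (cj d u) = cj y (?g u)"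
      using d centralizer_iff[OF BS] E_hom(1)[OF B(1) g] by (intro bexI[of _ \<one>]) auto
  qed
  then obtain f' where f': "f' \<in> E ?C" "f' (f x) = x" using gfx B(2) fxC by auto
  have "x \<in> f' ` T" using E_T(1)[OF sC f'(1) TC] x(2) by simp
  then obtain s where s: "s \<in> T" "f' s = x" by blast
  then have "f x = s" using E_hom(3)[OF sC f'(1)] f'(2) fxC TC by (metis inj_onD subsetD)
  then show ?thesis using s by simp
qed

text \<open>The order of f x divides that of x, so f maps \<open>cyc x\<close> to itself; as this
  subgroup is fully centralized, f extends from it to its centralizer, which contains T.\<close>

lemma E_extend_to_T:
  assumes P: "subgroup P S" "f \<in> E P" and x: "x \<in> P" "x \<in> T" "f x \<in> T"
  shows "\<exists>w\<in>E T. w x = f x"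
proof -
  let ?A = "cyc x"
  have A: "subgroup ?A S" "x \<in> ?A" "finite ?A" using cyc_subgroup x by auto
  have AS: "?A \<subseteq> carrier S" using sub_mem[OF A(1)] by blast
  have AT: "?A \<subseteq> T" using cyc_subset[OF torus_subgroup x(2)] .
  let ?f = "restrict f ?A"
  have f: "?f \<in> E ?A" "?f ` ?A = cyc (f x)" using E_on_cyc[OF P x(1)] by auto
  have "ord (f x) dvd ord x"
    using pow_eq_id[of "f x" "ord x"] pow_ord_eq_1[of x] E_pow[OF P x(1), of "ord x"] E_one[OF P] E_hom(1)[OF P x(1)] x(2) by simp
  then obtain k :: nat where "f x = x [^] k" using torus_power_of[OF refl x(3,2)] by blast
  then have "f x \<in> ?A" by (auto simp: cyc_def)
  then have "?f ` ?A \<subseteq> ?A" using f(2) cyc_subset[OF A(1)] by simp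
  then have fA: "?f ` ?A = ?A" using A(3) E_hom(3)[OF A(1) f(1)] by (metis endo_inj_surj)
  let ?C = "centralizer S ?A"
  have sC: "subgroup ?C S" by (rule subgroup_centralizer[OF AS])
  have TC: "T \<subseteq> ?C" using T_conj_trivial AT centralizer_iff[OF AS] by (auto simp: subset_eq)
  have "\<exists>f'\<in>E ?C. \<forall>u\<in>?A \<inter> ?C. f' u = ?f u"
  proof (rule E_extend[OF A(1) f(1) _ sC centralizer_subset_normalizer[OF AS]])
    show "fully_centralized p S F (?f ` ?A)" unfolding fA by (rule cyc_fully_centralized[OF x(2)])
    fix c assume c: "c \<in> ?C"
    have "\<one> \<in> normalizer S (?f ` ?A)" unfolding fA by (rule subgroup.one_closed[OF subgroup_normalizer[OF AS]])
    then show "\<exists>y\<in>normalizer S (?f ` ?A). \<forall>u\<in>?A. ?f (cj c u) = cj y (?f u)"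
      using c centralizer_iff[OF AS] E_hom(1)[OF A(1) f(1)] by (intro bexI[of _ \<one>]) auto
  qed
  then obtain f' where f': "f' \<in> E ?C" "f' x = f x" using A(2) AT TC by auto
  have "restrict f' T \<in> E T" by (rule E_restrict[OF sC f'(1) torus_subgroup TC])
  then show ?thesis using f'(2) x(2) by (intro bexI[of _ "restrict f' T"]) auto
qed

text \<open>For each nontrivial \<omega> in the finite group Aut_F(T) choose s in T whose q-th power
  is moved; this is possible because every element of T is a q-th power. A subgroup whose q-th
  powers are fixed by \<omega> does not contain s, so by the chain property it meets T inside
  \<open>cyc s\<close>.\<close>

lemma small_bounded: "\<exists>B. finite B \<and> B \<subseteq> T \<and> (\<forall>X. subgroup X S \<longrightarrow> small X \<longrightarrow> X \<inter> T \<subseteq> B)"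
proof -
  have "\<exists>s. s \<in> T \<and> ((\<exists>t\<in>T. \<omega> t \<noteq> t) \<longrightarrow> \<omega> (s [^] q) \<noteq> s [^] q)" for \<omega>
    using T_pow_q_surj T_one by metis
  then obtain s where s: "\<And>\<omega>. s \<omega> \<in> T" "\<And>\<omega>. \<exists>t\<in>T. \<omega> t \<noteq> t \<Longrightarrow> \<omega> (s \<omega> [^] q) \<noteq> s \<omega> [^] q" by metis
  let ?B = "\<Union>\<omega>\<in>E T. cyc (s \<omega>)"
  have "finite ?B" using finite_E_T cyc_subgroup(3) s(1) by simp
  moreover have "?B \<subseteq> T" using cyc_subset[OF torus_subgroup s(1)] by blast
  moreover have "X \<inter> T \<subseteq> ?B" if X: "subgroup X S" "small X" for X
  proof
    fix x assume x: "x \<in> X \<inter> T"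
    obtain \<omega> where \<omega>: "\<omega> \<in> E T" "\<exists>t\<in>T. \<omega> t \<noteq> t" "\<forall>x\<in>X. \<omega> (x [^] q) = x [^] q" using X(2) unfolding small_def by blast
    then have "s \<omega> \<notin> X" using s(2) by blast
    then have "s \<omega> \<notin> cyc x" using cyc_subset[OF X(1)] x by blast
    then have "x \<in> cyc (s \<omega>)" using torus_uniserial[OF refl, of x "s \<omega>"] x s(1) by (auto simp: cyc_def)
    then show "x \<in> ?B" using \<omega>(1) by blast
  qed
  ultimately show ?thesis by blast
qed

section \<open>Noncentral tori\<close>

definition centralizes_T :: "'a \<Rightarrow> bool" where "centralizes_T g \<longleftrightarrow> (\<forall>t\<in>T. cj g t = t)"

definition inverts_T :: "'a \<Rightarrow> bool" where "inverts_T g \<longleftrightarrow> (\<forall>t\<in>T. cj g t = inv t)"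

lemma centralizes_or_inverts: "g \<in> carrier S \<Longrightarrow> centralizes_T g \<or> p = 2 \<and> inverts_T g"
  using conj_T_dichotomy[of g] unfolding centralizes_T_def inverts_T_def by blast

lemma T_centralizes: "t \<in> T \<Longrightarrow> centralizes_T t"
  using T_conj_trivial by (simp add: centralizes_T_def)

lemma conj_by_T:
  assumes "t \<in> T" "x \<in> carrier S"
  shows "centralizes_T x \<Longrightarrow> cj t x = x" "inverts_T x \<Longrightarrow> cj t x = t \<otimes> t \<otimes> x"
proof -
  show "cj t x = x" if "centralizes_T x"
    using that assms conjugate_fix_iff[of x t] conjugate_fix_iff[of t x] by (simp add: centralizes_T_def)
  show "cj t x = t \<otimes> t \<otimes> x" if "inverts_T x"
  proof -
    have "cj x (inv t) = t" using that assms by (simp add: inverts_T_def)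
    then have "x \<otimes> inv t = t \<otimes> x" using assms inv_solve_right'[of t "x \<otimes> inv t" x] by (simp add: conjugate_def)
    then show ?thesis using assms by (simp add: conjugate_def m_assoc)
  qed
qed

lemma centralizes_square:
  assumes "g \<in> carrier S" shows "centralizes_T (g \<otimes> g)"
proof -
  have "centralizes_T g \<or> inverts_T g" using centralizes_or_inverts[OF assms] by blast
  then show ?thesis using assms by (auto simp: centralizes_T_def inverts_T_def conjugate_comp)
qed

lemma centralizes_mult:
  assumes "g \<in> carrier S" "h \<in> carrier S" "inverts_T g" "inverts_T h" shows "centralizes_T (g \<otimes> h)"
  using assms by (auto simp: centralizes_T_def inverts_T_def conjugate_comp)

text \<open>By the chain property an element of maximal order generates.\<close>

lemma finite_subgroup_T_cyclic:
  assumes P: "subgroup P S" "finite P" shows "\<exists>x\<in>P \<inter> T. P \<inter> T = cyc x"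
proof -
  have PT: "subgroup (P \<inter> T) S" by (rule subgroups_Inter_pair[OF P(1) torus_subgroup])
  have "finite (P \<inter> T)" "P \<inter> T \<noteq> {}" using P subgroup.one_closed[OF PT] by auto
  then have m: "Max (ord ` (P \<inter> T)) \<in> ord ` (P \<inter> T)" "\<And>y. y \<in> P \<inter> T \<Longrightarrow> ord y \<le> Max (ord ` (P \<inter> T))"
    using Max_in[of "ord ` (P \<inter> T)"] Max_ge[of "ord ` (P \<inter> T)"] by simp_all
  obtain x where "x \<in> P \<inter> T" "Max (ord ` (P \<inter> T)) = ord x" using m(1) by blast
  then have x: "x \<in> P \<inter> T" "\<And>y. y \<in> P \<inter> T \<Longrightarrow> ord y \<le> ord x" using m(2) by simp_all
  have "y \<in> cyc x" if y: "y \<in> P \<inter> T" for y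
  proof (cases "\<exists>k::nat. y = x [^] k")
    case True then show ?thesis by (auto simp: cyc_def)
  next
    case False
    then obtain k :: nat where k: "x = y [^] k" using torus_uniserial[OF refl, of y x] x y by blast
    have "x [^] ord y = \<one>"
      using y pow_ord_eq_1[of y] by (simp add: k nat_pow_pow mult.commute[of k]) (simp add: nat_pow_pow[symmetric])
    then have "ord x dvd ord y" using pow_eq_id[of x] x by simp
    moreover have "ord y > 0" using torus_ord[of y] y p_pos by auto
    ultimately have "ord x = ord y" using x(2)[OF y] by (simp add: dvd_imp_le le_antisym)
    then show ?thesis using torus_power_of[OF refl, of y x] x y by (auto simp: cyc_def)
  qed
  then show ?thesis using x cyc_subset[OF PT x(1)] by blast
qed

definition noncentral :: bool where "noncentral \<longleftrightarrow> (\<exists>g\<in>carrier S. \<not> centralizes_T g)"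

lemma noncentral_p: "noncentral \<Longrightarrow> p = 2"
  using centralizes_or_inverts unfolding noncentral_def by blast

lemma involution_exists:
  assumes "p = 2" shows "\<exists>z\<in>T. z \<noteq> \<one> \<and> (\<forall>t\<in>T. t \<otimes> t = \<one> \<longleftrightarrow> t = \<one> \<or> t = z)"
proof -
  let ?A = "{t \<in> T. t [^] p = \<one>}"
  have A: "?A = {t \<in> T. t \<otimes> t = \<one>}" using assms by (auto simp: numeral_2_eq_2)
  have "card ?A = 2" using card_torus_p_torsion assms by simp
  then obtain x y where xy: "?A = {x, y}" "x \<noteq> y" by (meson card_2_iff)
  have "\<one> \<in> ?A" by simp
  then have "\<one> = x \<or> \<one> = y" using xy by blast
  then obtain z where "?A = {\<one>, z}" "z \<noteq> \<one>" using xy by blast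
  then have z: "{t \<in> T. t \<otimes> t = \<one>} = {\<one>, z}" "z \<noteq> \<one>" using A by auto
  then have "z \<in> T" by blast
  moreover have "t \<otimes> t = \<one> \<longleftrightarrow> t = \<one> \<or> t = z" if "t \<in> T" for t using z that by blast
  ultimately show ?thesis using z(2) by blast
qed

definition invol :: 'a where
  "invol = (SOME z. z \<in> T \<and> z \<noteq> \<one> \<and> (\<forall>t\<in>T. t \<otimes> t = \<one> \<longleftrightarrow> t = \<one> \<or> t = z))"

lemma invol:
  assumes "p = 2"
  shows "invol \<in> T" "invol \<noteq> \<one>" "t \<in> T \<Longrightarrow> t \<otimes> t = \<one> \<longleftrightarrow> t = \<one> \<or> t = invol" "invol \<otimes> invol = \<one>"
    "inv invol = invol" "g \<in> carrier S \<Longrightarrow> cj g invol = invol"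
proof -
  have *: "invol \<in> T \<and> invol \<noteq> \<one> \<and> (\<forall>t\<in>T. t \<otimes> t = \<one> \<longleftrightarrow> t = \<one> \<or> t = invol)"
    unfolding invol_def by (rule someI_ex) (use involution_exists[OF assms] in blast)
  then show 1: "invol \<in> T" "invol \<noteq> \<one>" "t \<in> T \<Longrightarrow> t \<otimes> t = \<one> \<longleftrightarrow> t = \<one> \<or> t = invol" for t by blast+
  then show 2: "invol \<otimes> invol = \<one>" by blast
  show "inv invol = invol" using 1(1) 2 inv_equality by simp
  show "cj g invol = invol" if g: "g \<in> carrier S"
  proof -
    have "cj g invol \<otimes> cj g invol = cj g (invol \<otimes> invol)" using g 1(1) by (simp add: conjugate_mult)
    then have "cj g invol = \<one> \<or> cj g invol = invol" using 1(3) T_conjugate[OF 1(1) g] 2 g by simp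
    moreover have "cj g invol \<noteq> \<one>" using g 1(1,2) conjugate_eq_iff[of g invol \<one>] by simp
    ultimately show ?thesis by blast
  qed
qed

text \<open>A square root t of the involution in T need not lie in \<open>P\<close>, but it
  normalizes \<open>P\<close>, since conjugation by t multiplies by the involution or does nothing.
  So g t is defined, its square g(\<open>invol\<close>) centralizes T, and \<open>E_into_T\<close>
  puts it into T, which has only one involution.\<close>

lemma involution_fixed:
  assumes nc: "p = 2" and P: "subgroup P S" "invol \<in> P" and g: "g \<in> E (normalizer S P)"
  shows "g invol = invol"
proof -
  note iv = invol[OF nc]
  have PS: "P \<subseteq> carrier S" using sub_mem[OF P(1)] by blast
  have sN: "subgroup (normalizer S P) S" by (rule subgroup_normalizer[OF PS])
  obtain t where t: "t \<in> T" "t [^] p = invol" using torus_p_divisible1[OF iv(1)] by blast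
  then have tt: "t \<otimes> t = invol" using nc by (simp add: numeral_2_eq_2)
  then have itt: "inv t \<otimes> inv t = invol" using t iv(5) inv_mult_group[of t t] by simp
  have cjP: "cj s x \<in> P" if s: "s \<in> T" "s \<otimes> s = invol" and x: "x \<in> P" for s x
  proof -
    have xS: "x \<in> carrier S" using x PS by blast
    show ?thesis using centralizes_or_inverts[OF xS] conj_by_T[OF s(1) xS] s(2) x P
      by (auto simp: subgroup.m_closed)
  qed
  have tN: "t \<in> normalizer S P" by (rule normalizerI[OF P(1)]) (use t tt itt cjP in auto)
  have zN: "invol \<in> normalizer S P" using subgroup_subset_normalizer[OF P(1)] P(2) by blast
  have gS: "g t \<in> carrier S" using E_hom(1)[OF sN g tN] .
  have gz: "g invol = g t \<otimes> g t" using E_hom(2)[OF sN g tN tN] tt by simp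
  then have "centralizes_T (g invol)" using centralizes_square[OF gS] by simp
  then have gT: "g invol \<in> T" using E_into_T[OF sN g zN iv(1)] by (simp add: centralizes_T_def)
  have "g invol \<otimes> g invol = \<one>" using E_hom(2)[OF sN g zN zN] iv(4) E_one[OF sN g] by simp
  then have "g invol = \<one> \<or> g invol = invol" using iv(3)[OF gT] by simp
  moreover have "g invol \<noteq> \<one>"
    using E_hom(3)[OF sN g] zN subgroup.one_closed[OF sN] E_one[OF sN g] iv(2) by (metis inj_onD)
  ultimately show ?thesis by blast
qed

text \<open>Inversion is here a nontrivial element of Aut_F(T), so it moves some q-th power unless
  the set is small.\<close>

lemma not_small_element:
  assumes nc: "noncentral" and P: "P \<subseteq> carrier S" "\<not> small P"
  shows "\<exists>x\<in>P. inv (x [^] q) \<noteq> x [^] q"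
proof -
  obtain g where g: "g \<in> carrier S" "inverts_T g" "\<not> centralizes_T g"
    using nc centralizes_or_inverts unfolding noncentral_def by blast
  have \<omega>: "conj_map S T g \<in> E T" by (rule conj_map_in_E[OF torus_subgroup g(1)])
  have "\<exists>t\<in>T. conj_map S T g t \<noteq> t" using g(3) by (auto simp: centralizes_T_def conj_map_apply)
  then obtain x where x: "x \<in> P" "conj_map S T g (x [^] q) \<noteq> x [^] q" using P(2) \<omega> unfolding small_def by blast
  have "x [^] q \<in> T" using q_props(2) x P by blast
  then show ?thesis using x g(2) by (auto simp: conj_map_apply inverts_T_def)
qed

text \<open>An element of \<open>T\<close> of order at least four detects which elements invert \<open>T\<close>.\<close>

lemma not_small_E:
  assumes nc: "noncentral" and P: "subgroup P S" "finite P" "\<not> small P" and f: "f \<in> E P"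
  shows "y \<in> P \<Longrightarrow> centralizes_T y \<Longrightarrow> centralizes_T (f y)" "y \<in> P \<Longrightarrow> inverts_T y \<Longrightarrow> inverts_T (f y)"
    "y \<in> P \<Longrightarrow> y \<in> T \<Longrightarrow> f y \<in> T" "\<exists>w\<in>E T. \<forall>y\<in>P \<inter> T. f y = w y" 
    "c \<in> centralizer S (f ` P) \<Longrightarrow> centralizes_T c" "\<not> small (f ` P)"
proof -
  have PS: "P \<subseteq> carrier S" using sub_mem[OF P(1)] by blast
  have fS: "f y \<in> carrier S" if "y \<in> P" for y using E_hom(1)[OF P(1) f that] .
  obtain x where x: "x \<in> P" "inv (x [^] q) \<noteq> x [^] q" using not_small_element[OF nc PS P(3)] by blast
  let ?a = "x [^] q"
  have a: "?a \<in> T" "?a \<in> P" using q_props(2) x PS E_pow[OF P(1) f x(1)] by (blast, blast)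
  have fa: "f ?a \<in> T" using E_pow[OF P(1) f x(1)] q_props(2) fS[OF x(1)] by simp
  have fa': "inv (f ?a) \<noteq> f ?a"
    using E_inv[OF P(1) f a(2)] E_hom(3)[OF P(1) f] a(2) x(2) subgroup.m_inv_closed[OF P(1) a(2)] by (metis inj_onD)
  have not_both: "\<not> (cj g (f ?a) = f ?a \<and> inverts_T g)" for g using fa fa' unfolding inverts_T_def by metis
  have not_both': "\<not> (cj g ?a = inv ?a \<and> centralizes_T g)" for g using a x unfolding centralizes_T_def by metis
  show cen: "centralizes_T (f y)" if y: "y \<in> P" "centralizes_T y" for y
  proof -
    have "cj (f y) (f ?a) = f ?a" using E_conjugate(2)[OF P(1) f y(1) a(2)] y(2) a(1) by (simp add: centralizes_T_def)
    then show ?thesis using centralizes_or_inverts[OF fS[OF y(1)]] not_both by blast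
  qed
  show "inverts_T (f y)" if y: "y \<in> P" "inverts_T y" for y
  proof -
    have "cj (f y) (f ?a) = inv (f ?a)"
      using E_conjugate(2)[OF P(1) f y(1) a(2)] y(2) a E_inv[OF P(1) f a(2)] by (simp add: inverts_T_def)
    then show ?thesis using centralizes_or_inverts[OF fS[OF y(1)]] fa fa' by (auto simp: centralizes_T_def)
  qed
  show inT: "f y \<in> T" if y: "y \<in> P" "y \<in> T" for y
    using E_into_T[OF P(1) f y] cen[OF y(1) T_centralizes[OF y(2)]] by (simp add: centralizes_T_def)
  obtain x0 where x0: "x0 \<in> P \<inter> T" "P \<inter> T = cyc x0" using finite_subgroup_T_cyclic[OF P(1,2)] by blast
  obtain w where w: "w \<in> E T" "w x0 = f x0" using E_extend_to_T[OF P(1) f] x0 inT by blast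
  have fw: "f y = w y" if "y \<in> P \<inter> T" for y
  proof -
    have "y \<in> range (\<lambda>n::nat. x0 [^] n)" using that x0(2) by (simp add: cyc_def)
    then obtain n :: nat where n: "y = x0 [^] n" by (rule rangeE)
    have "x0 \<in> P" "x0 \<in> T" using x0(1) by blast+
    then show ?thesis using E_pow[OF P(1) f, of x0 n] E_pow[OF torus_subgroup w(1), of x0 n] w(2) n by simp
  qed
  then show "\<exists>w\<in>E T. \<forall>y\<in>P \<inter> T. f y = w y" using w(1) by blast
  show "centralizes_T c" if c: "c \<in> centralizer S (f ` P)"
  proof -
    have fPS: "f ` P \<subseteq> carrier S" using fS by blast
    have "c \<in> carrier S" "cj c (f ?a) = f ?a" using c centralizer_iff[OF fPS] a by auto
    then show ?thesis using centralizes_or_inverts not_both by blast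
  qed
  show "\<not> small (f ` P)"
  proof
    assume "small (f ` P)"
    then obtain \<omega> where \<omega>: "\<omega> \<in> E T" "\<exists>t\<in>T. \<omega> t \<noteq> t" "\<And>u. u \<in> P \<Longrightarrow> \<omega> (f u [^] q) = f u [^] q" unfolding small_def by auto
    have "\<omega> (u [^] q) = u [^] q" if u: "u \<in> P" for u
    proof -
      have s: "u [^] q \<in> P \<inter> T" "f (u [^] q) = f u [^] q" using q_props(2) u PS E_pow[OF P(1) f u] by auto
      then have ws: "w (u [^] q) = f u [^] q" using fw by simp
      \<comment> \<open>An automorphism of T that fixes f(u)^q also fixes u^q, because u^q is one of
        its powers.\<close>
      obtain k :: nat where k: "u [^] q = w (u [^] q) [^] k" using E_T(3)[OF torus_subgroup w(1)] s by blast
      have "f u [^] q \<in> T" using ws E_T(4)[OF torus_subgroup w(1), of "u [^] q"] s by simp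
      then show ?thesis using E_pow[OF torus_subgroup \<omega>(1), of "f u [^] q" k] \<omega>(3)[OF u] k ws by simp
    qed
    then show False using P(3) \<omega> unfolding small_def by blast
  qed
qed

text \<open>Adjoins elements t of T with t^2 in \<open>P\<close>. On \<open>P \<inter> T\<close> the
  map f agrees with some w in Aut_F(T), and f turns conjugation by t into conjugation by w t: either
  one fixes centralizing elements and multiplies inverting ones by the square. So \<open>X\<close>
  lies in the extension group. Full centralization passes to the new image, so that the step can be
  repeated.\<close>

lemma extension_step:
  assumes nc: "noncentral" and P: "subgroup P S" "finite P" "\<not> small P" and f: "f \<in> E P"
    and fc: "fully_centralized p S F (f ` P)"
    and X: "subgroup X S" "finite X" "P \<subseteq> X"
    and dec: "\<And>x. x \<in> X \<Longrightarrow> \<exists>u\<in>P. \<exists>t\<in>T. x = u \<otimes> t \<and> t \<in> X \<and> t \<otimes> t \<in> P"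
  shows "\<exists>f'\<in>E X. (\<forall>u\<in>P. f' u = f u) \<and> fully_centralized p S F (f' ` X)"
proof -
  have PS: "P \<subseteq> carrier S" using sub_mem[OF P(1)] by blast
  let ?Q = "f ` P"
  have Q: "subgroup ?Q S" by (rule E_image_subgroup[OF P(1) f])
  have QS: "?Q \<subseteq> carrier S" using sub_mem[OF Q] by blast
  obtain w where w: "w \<in> E T" "\<forall>y\<in>P \<inter> T. f y = w y" using not_small_E(4)[OF nc P f] by blast
  have wT: "w t \<in> T" if "t \<in> T" for t using E_T(4)[OF torus_subgroup w(1)] that by blast
  have cjt: "cj t u \<in> P \<and> f (cj t u) = cj (w t) (f u)" if t: "t \<in> T" "t \<otimes> t \<in> P" and u: "u \<in> P" for t u
  proof -
    have uS: "u \<in> carrier S" and fuS: "f u \<in> carrier S" using u PS E_hom(1)[OF P(1) f] by auto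
    consider "centralizes_T u" | "inverts_T u" using centralizes_or_inverts[OF uS] by blast
    then show ?thesis
    proof cases
      case 1
      then show ?thesis using conj_by_T(1)[OF t(1) uS] conj_by_T(1)[OF wT[OF t(1)] fuS] not_small_E(1)[OF nc P f u] u by simp
    next
      case 2
      have "f (t \<otimes> t) = w t \<otimes> w t" using w t E_hom(2)[OF torus_subgroup w(1) t(1) t(1)] by simp
      then have "f (t \<otimes> t \<otimes> u) = w t \<otimes> w t \<otimes> f u" using E_hom(2)[OF P(1) f t(2) u] by simp
      then show ?thesis
        using 2 conj_by_T(2)[OF t(1) uS] conj_by_T(2)[OF wT[OF t(1)] fuS] not_small_E(2)[OF nc P f u] t u P(1)
        by (simp add: subgroup.m_closed)
    qed
  qed
  have tN: "t \<in> normalizer S P" if t: "t \<in> T" "t \<otimes> t \<in> P" for t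
  proof -
    have "inv t \<otimes> inv t \<in> P" using t subgroup.m_inv_closed[OF P(1) t(2)] by (simp add: inv_mult_group)
    then show ?thesis using normalizerI[OF P(1), of t] cjt[of t] cjt[of "inv t"] t by simp
  qed
  have wN: "w t \<in> normalizer S ?Q" if t: "t \<in> T" "t \<otimes> t \<in> P" for t
  proof -
    have "cj (w t) ` ?Q = (\<lambda>u. f (cj t u)) ` P" using cjt[OF t] by (auto simp: image_image)
    also have "\<dots> = f ` (cj t ` P)" by (simp add: image_image)
    also have "\<dots> = ?Q" using tN[OF t] normalizer_iff[OF PS] by simp
    finally show ?thesis using normalizer_iff[OF QS] wT[OF t(1)] by simp
  qed
  have XN: "X \<subseteq> normalizer S P"
  proof
    fix x assume "x \<in> X"
    then obtain u t where ut: "u \<in> P" "t \<in> T" "x = u \<otimes> t" "t \<otimes> t \<in> P" using dec by blast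
    then show "x \<in> normalizer S P"
      using tN subgroup_subset_normalizer[OF P(1)] subgroup.m_closed[OF subgroup_normalizer[OF PS]] by blast
  qed
  have "\<exists>f'\<in>E X. \<forall>u\<in>P \<inter> X. f' u = f u"
  proof (rule E_extend[OF P(1) f fc X(1) XN])
    fix x assume "x \<in> X"
    then obtain u t where ut: "u \<in> P" "t \<in> T" "x = u \<otimes> t" "t \<otimes> t \<in> P" using dec by blast
    have N: "f u \<otimes> w t \<in> normalizer S ?Q"
      using wN[OF ut(2,4)] subgroup_subset_normalizer[OF Q] ut(1) subgroup.m_closed[OF subgroup_normalizer[OF QS]] by blast
    have "f (cj x v) = cj (f u \<otimes> w t) (f v)" if v: "v \<in> P" for v
    proof -
      have "cj x v = cj u (cj t v)" using ut v PS by (auto simp: conjugate_comp subset_eq)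
      then have "f (cj x v) = cj (f u) (f (cj t v))" using E_conjugate(2)[OF P(1) f ut(1)] cjt[OF ut(2,4) v] by simp
      then show ?thesis using cjt[OF ut(2,4) v] wT[OF ut(2)] E_hom(1)[OF P(1) f] ut(1) v by (simp add: conjugate_comp)
    qed
    then show "\<exists>y\<in>normalizer S ?Q. \<forall>v\<in>P. f (cj x v) = cj y (f v)" using N by blast
  qed
  then obtain f' where f': "f' \<in> E X" "\<And>u. u \<in> P \<Longrightarrow> f' u = f u" using X(3) by blast
  have nsX: "\<not> small X" using small_mono[OF X(3)] P(3) by blast
  let ?Q' = "f' ` X"
  have Q': "subgroup ?Q' S" by (rule E_image_subgroup[OF X(1) f'(1)])
  have Q'S: "?Q' \<subseteq> carrier S" using sub_mem[OF Q'] by blast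
  have QQ': "?Q \<subseteq> ?Q'" using f'(2) X(3) by force
  have sub: "centralizer S A \<subseteq> centralizer S B" if "B \<subseteq> A" for A B using that by (auto simp: centralizer_def)
  \<comment> \<open>The adjoined elements go to T, and whatever centralizes f(P) centralizes T,
    because f(P) contains an element of T of order above two.\<close>
  have "centralizer S ?Q \<subseteq> centralizer S ?Q'"
  proof
    fix c assume c: "c \<in> centralizer S ?Q"
    have cS: "c \<in> carrier S" using c centralizer_iff[OF QS] by blast
    have cT: "centralizes_T c" by (rule not_small_E(5)[OF nc P f c])
    have "cj c (f' x) = f' x" if x: "x \<in> X" for x
    proof -
      obtain u t where ut: "u \<in> P" "t \<in> T" "x = u \<otimes> t" "t \<in> X" using dec[OF x] by blast
      have ft: "f' t \<in> T" by (rule not_small_E(3)[OF nc X(1,2) nsX f'(1) ut(4,2)])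
      have "f' x = f u \<otimes> f' t" using E_hom(2)[OF X(1) f'(1), of u t] ut X(3) f'(2) by auto
      then show ?thesis using cS cT ft c centralizer_iff[OF QS] ut(1) QS
        by (auto simp: conjugate_mult centralizes_T_def subset_eq)
    qed
    then show "c \<in> centralizer S ?Q'" using cS centralizer_iff[OF Q'S] by auto
  qed
  then have Ceq: "centralizer S ?Q' = centralizer S ?Q" using sub[OF QQ'] by blast
  \<comment> \<open>The centralizer of the larger subgroup h(f'(X)) is contained in that of h(f(P)),
    whose order is bounded because f(P) is fully centralized.\<close>
  have "lex_le (vol (centralizer S (h ` ?Q'))) (vol (centralizer S ?Q'))" if h: "h \<in> E ?Q'" for h
  proof -
    have hQ: "restrict h ?Q \<in> E ?Q" by (rule E_restrict[OF Q' h Q QQ'])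
    have s1: "h ` ?Q' \<subseteq> carrier S" "h ` ?Q \<subseteq> carrier S" using E_hom(1)[OF Q' h] QQ' by auto
    have "lex_le (vol (centralizer S (h ` ?Q'))) (vol (centralizer S (h ` ?Q)))"
      using vol_mono[OF subgroup_centralizer[OF s1(1)] subgroup_centralizer[OF s1(2)] sub[OF image_mono[OF QQ']]] .
    moreover have "lex_le (vol (centralizer S (h ` ?Q))) (vol (centralizer S ?Q))"
      using fc fully_centralized_iff[OF Q] hQ by fastforce
    ultimately show ?thesis unfolding Ceq using lex_le_trans by blast
  qed
  then have "fully_centralized p S F ?Q'" unfolding fully_centralized_iff[OF Q'] by blast
  then show ?thesis using f' by blast
qed

definition T_tors :: "nat \<Rightarrow> 'a set" where "T_tors n = {t \<in> T. t [^] (p ^ n) = \<one>}"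

lemma T_tors: "subgroup (T_tors n) S" "finite (T_tors n)" "T_tors n \<subseteq> T" "T_tors n \<subseteq> T_tors (Suc n)"
  "T_tors n \<lhd> S"
proof -
  show sub: "subgroup (T_tors n) S" unfolding T_tors_def
    by (rule subgroupI) (auto simp: nat_pow_inv pow_mult_distrib torus_commute intro: exI[of _ \<one>])
  show "finite (T_tors n)" unfolding T_tors_def using T_torsion_finite p_pos by simp
  show "T_tors n \<subseteq> T" by (auto simp: T_tors_def)
  show "T_tors n \<subseteq> T_tors (Suc n)"
    by (auto simp: T_tors_def mult.commute[of p] simp flip: nat_pow_pow)
  show "T_tors n \<lhd> S"
  proof (rule normal_invI[OF sub])
    fix x h assume xh: "x \<in> carrier S" "h \<in> T_tors n"
    then have "cj x h [^] (p ^ n) = \<one>" "cj x h \<in> T"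
      by (auto simp: T_tors_def T_conjugate simp flip: conjugate_pow)
    then show "x \<otimes> h \<otimes> inv x \<in> T_tors n" by (simp add: T_tors_def conjugate_def)
  qed
qed

lemma union_T_tors: "(\<Union>n. T_tors n) = T"
  using torus_torsion by (auto simp: T_tors_def)

text \<open>P T is the increasing union of the groups P T_n, where T_n is the p^n-torsion of T.
  Since p = 2, squares from T_(n+1) lie in T_n, so \<open>extension_step\<close> climbs this chain,
  and axiom (III) gives the map on the union.\<close>

lemma extension_fully_centralized:
  assumes nc: "noncentral" and P: "subgroup P S" "finite P" "\<not> small P" and f: "f \<in> E P"
    and fc: "fully_centralized p S F (f ` P)"
  shows "\<exists>f'\<in>E (P <#> T). \<forall>u\<in>P. f' u = f u"
proof -
  have PS: "P \<subseteq> carrier S" using sub_mem[OF P(1)] by blast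
  define X where "X n = P <#> T_tors n" for n
  have X_iff: "x \<in> X n \<longleftrightarrow> (\<exists>u\<in>P. \<exists>t\<in>T_tors n. x = u \<otimes> t)" for x n by (auto simp: X_def set_mult_def)
  have one: "\<one> \<in> T_tors n" "\<one> \<in> P" for n using subgroup.one_closed T_tors(1) P(1) by (blast, blast)
  have X: "subgroup (X n) S" "finite (X n)" "X n \<subseteq> X (Suc n)" "P \<subseteq> X n" "T_tors n \<subseteq> X n" for n
  proof -
    show "subgroup (X n) S" unfolding X_def commut_normal[OF P(1) T_tors(5)]
      by (intro second_isomorphism_grp.normal_set_mult_subgroup second_isomorphism_grp.intro
        second_isomorphism_grp_axioms.intro T_tors(5) P(1))
    show "finite (X n)" unfolding X_def set_mult_def using P(2) T_tors(2) by simp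
    show "X n \<subseteq> X (Suc n)" using T_tors(4) X_iff by (meson subsetD subsetI)
    show "P \<subseteq> X n"
    proof
      fix u assume "u \<in> P"
      then show "u \<in> X n" using one(1) PS X_iff r_one by (metis subsetD)
    qed
    show "T_tors n \<subseteq> X n"
    proof
      fix t assume "t \<in> T_tors n"
      then show "t \<in> X n" using one(2) T_tors(3) T_mem X_iff l_one by (metis subsetD)
    qed
  qed
  have X0: "X 0 = P"
  proof -
    have "T_tors 0 = {\<one>}" by (auto simp: T_tors_def)
    then show ?thesis using PS by (auto simp: X_iff subset_eq)
  qed
  let ?ok = "\<lambda>n g. g \<in> E (X n) \<and> fully_centralized p S F (g ` X n) \<and> (\<forall>u\<in>P. g u = f u)"
  \<comment> \<open>The invariant includes full centralization of the image, as the next extension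
    relies on it.\<close>
  have "\<exists>g. \<forall>n. ?ok n (g n) \<and> (\<forall>u\<in>X n. g (Suc n) u = g n u)"
  proof (rule dependent_nat_choice)
    show "\<exists>g. ?ok 0 g" using f fc X0 by auto
    fix g n assume g: "?ok n g"
    have ns: "\<not> small (X n)" using small_mono[OF X(4)] P(3) by blast
    have "\<exists>f'\<in>E (X (Suc n)). (\<forall>u\<in>X n. f' u = g u) \<and> fully_centralized p S F (f' ` X (Suc n))"
    proof (rule extension_step[OF nc X(1,2) ns _ _ X(1,2,3)])
      fix x assume "x \<in> X (Suc n)"
      then obtain u t where ut: "u \<in> P" "t \<in> T_tors (Suc n)" "x = u \<otimes> t" using X_iff by blast
      have tT: "t \<in> T" using ut T_tors(3) by blast
      have "t \<otimes> t = t [^] p" using noncentral_p[OF nc] tT by (simp add: numeral_2_eq_2)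
      then have "t \<otimes> t \<in> T_tors n" using ut(2) tT torus_nat_pow_closed[OF tT, of p] by (simp add: T_tors_def nat_pow_pow)
      then show "\<exists>u\<in>X n. \<exists>t\<in>T. x = u \<otimes> t \<and> t \<in> X (Suc n) \<and> t \<otimes> t \<in> X n"
        using ut tT X(4,5) by blast
    qed (use g in auto)
    then show "\<exists>g'. ?ok (Suc n) g' \<and> (\<forall>u\<in>X n. g' u = g u)" using g X(4)[of n] by (metis subsetD)
  qed
  then obtain g where g: "\<And>n. g n \<in> E (X n)" "\<And>n u. u \<in> X n \<Longrightarrow> g (Suc n) u = g n u"
    "\<And>n u. u \<in> P \<Longrightarrow> g n u = f u" by metis
  have mono: "X n \<subseteq> X m" if "n \<le> m" for n m using X(3) that by (rule lift_Suc_mono_le)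
  have gmono: "g m u = g n u" if "n \<le> m" "u \<in> X n" for n m u
    using that(1)
  proof (induction rule: dec_induct)
    case (step k) then show ?case using g(2)[of u k] mono[of n k] that(2) by auto
  qed simp
  let ?U = "\<Union>n. X n"
  define h where "h = (\<lambda>u\<in>?U. g (LEAST n. u \<in> X n) u)"
  have h: "h u = g n u" if "u \<in> X n" for u n
  proof -
    have "(LEAST n. u \<in> X n) \<le> n" "u \<in> X (LEAST n. u \<in> X n)" using that by (auto intro: Least_le LeastI)
    then show ?thesis using gmono that by (auto simp: h_def)
  qed
  have "h \<in> E ?U"
  proof (rule saturation_III[of X])
    show "subgroup (X n) S" "X n \<subseteq> X (Suc n)" for n using X by auto
    show "h \<in> extensional ?U" by (simp add: h_def)
    show "restrict h (X n) \<in> E (X n)" for n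
    proof -
      have "restrict h (X n) = g n"
        using E_hom(4)[OF X(1) g(1)] by (intro extensionalityI[of _ "X n"]) (auto simp: h)
      then show ?thesis using g(1) by simp
    qed
    show "h \<in> hom (S \<downharpoonright> ?U) S"
    proof (rule homI)
      fix u assume "u \<in> carrier (S \<downharpoonright> ?U)"
      then obtain n where "u \<in> X n" by auto
      then show "h u \<in> carrier S" using h E_hom(1)[OF X(1) g(1)] by simp
    next
      fix u v assume "u \<in> carrier (S \<downharpoonright> ?U)" "v \<in> carrier (S \<downharpoonright> ?U)"
      then obtain n m where "u \<in> X n" "v \<in> X m" by auto
      then have uv: "u \<in> X (max n m)" "v \<in> X (max n m)" using mono[of n "max n m"] mono[of m "max n m"] by auto
      then show "h (u \<otimes>\<^bsub>S \<downharpoonright> ?U\<^esub> v) = h u \<otimes> h v"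
        using h[OF uv(1)] h[OF uv(2)] h[OF subgroup.m_closed[OF X(1) uv]] E_hom(2)[OF X(1) g(1) uv] by simp
    qed
  qed
  moreover have "?U = P <#> T" unfolding union_T_tors[symmetric] X_def by (auto simp: set_mult_def)
  ultimately have "h \<in> E (P <#> T)" by simp
  moreover have "h u = f u" if "u \<in> P" for u using h[of u 0] that X0 g(3) by simp
  ultimately show ?thesis by blast
qed

text \<open>When f(P) is not fully centralized, follow f by a map h onto a fully normalized
  subgroup. Both h and h f extend to the products with T, and the extensions have the same image
  because they map T onto T; the inverse of the first composed with the second extends f.\<close>

lemma extension_to_T:
  assumes nc: "noncentral" and P: "subgroup P S" "finite P" "\<not> small P" and f: "f \<in> E P"
  shows "\<exists>f'\<in>E (P <#> T). \<forall>u\<in>P. f' u = f u"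
proof -
  let ?Q = "f ` P"
  have Q: "subgroup ?Q S" by (rule E_image_subgroup[OF P(1) f])
  have Q': "finite ?Q" "\<not> small ?Q" using P(2) not_small_E(6)[OF nc P f] by auto
  obtain h where h: "h \<in> E ?Q" "fully_normalized p S F (h ` ?Q)" using fully_normalized_exists[OF Q] by blast
  have fc: "fully_centralized p S F (h ` ?Q)" by (rule fully_normalized_imp_centralized[OF h(2)])
  let ?k = "compose P h f"
  have k: "?k \<in> E P" by (rule E_compose[OF P(1) f Q h(1)]) simp
  have kim: "?k ` P = h ` ?Q" by (auto simp: compose_def image_image)
  obtain k' where k': "k' \<in> E (P <#> T)" "\<And>u. u \<in> P \<Longrightarrow> k' u = h (f u)"
    using extension_fully_centralized[OF nc P k] fc kim by (auto simp: compose_eq)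
  obtain h' where h': "h' \<in> E (?Q <#> T)" "\<And>u. u \<in> ?Q \<Longrightarrow> h' u = h u"
    using extension_fully_centralized[OF nc Q Q' h(1) fc] by blast
  note PT = XT_subgroup[OF P(1)] and QT = XT_subgroup[OF Q]
  have im: "g ` (X <#> T) = (g ` X) <#> T" if X: "subgroup X S" and g: "g \<in> E (X <#> T)" for g X
  proof -
    note XT = XT_subgroup[OF X]
    have gT: "g ` T = T" by (rule E_T(1)[OF XT(1) g XT(3)])
    have *: "g (x \<otimes> t) = g x \<otimes> g t" if "x \<in> X" "t \<in> T" for x t
      using E_hom(2)[OF XT(1) g, of x t] that XT(2,3) by blast
    show ?thesis
    proof (intro equalityI subsetI)
      fix y assume "y \<in> g ` (X <#> T)"
      then obtain x t where "x \<in> X" "t \<in> T" "y = g (x \<otimes> t)" by (auto simp: XT_iff)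
      then show "y \<in> g ` X <#> T" using * gT XT_iff by blast
    next
      fix y assume "y \<in> g ` X <#> T"
      then obtain x s where xs: "x \<in> X" "s \<in> T" "y = g x \<otimes> s" by (auto simp: XT_iff)
      then obtain t where "t \<in> T" "s = g t" using gT by blast
      then have "y = g (x \<otimes> t)" "x \<otimes> t \<in> X <#> T" using * xs XT_iff by auto
      then show "y \<in> g ` (X <#> T)" by blast
    qed
  qed
  have k'P: "k' ` P = h ` ?Q" using k'(2) by force
  have h'Q: "h' ` ?Q = h ` ?Q" using h'(2) by force
  have ims: "k' ` (P <#> T) = h' ` (?Q <#> T)"
    using im[OF P(1) k'(1)] im[OF Q h'(1)] k'P h'Q by simp
  let ?i = "restrict (inv_into (?Q <#> T) h') (h' ` (?Q <#> T))"
  have i: "?i \<in> E (h' ` (?Q <#> T))" by (rule E_inverse[OF QT(1) h'(1)])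
  have "compose (P <#> T) ?i k' \<in> E (P <#> T)"
    by (rule E_compose[OF PT(1) k'(1) E_image_subgroup[OF QT(1) h'(1)] i]) (simp add: ims)
  moreover have "compose (P <#> T) ?i k' u = f u" if u: "u \<in> P" for u
  proof -
    have fu: "f u \<in> ?Q <#> T" "u \<in> P <#> T" using u QT(2) PT(2) by auto
    have "k' u = h' (f u)" using k'(2)[OF u] h'(2) u by simp
    then show ?thesis using fu inv_into_f_f[OF E_hom(3)[OF QT(1) h'(1)] fu(1)] by (simp add: compose_eq)
  qed
  ultimately show ?thesis by blast
qed

end

section \<open>Adams operations\<close>

lemma op_iter_eq: "op_iter p f i = f ^^ (p ^ i)"
  by (induction i) (simp_all add: funpow_mult mult.commute)

locale rank_one_operation = p_local_compact_group p S F L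
  for p and S (structure) and F and L :: "('a, 'm) linking_system" +
  fixes \<iota> :: "'a set \<Rightarrow> 'm" and \<zeta> :: "nat \<Rightarrow> nat" and \<psi> :: "'a \<Rightarrow> 'a" and \<Psi> :: "'m \<Rightarrow> 'm"
  assumes rank1: "rk p S = 1"
    and liftings: "inclusion_liftings S L \<iota>"
    and operation: "unstable_adams_operation p S F L \<iota> \<zeta> \<psi> \<Psi>"
    and exhausted: "torus_exhausted p S \<psi>"
    and representatives: "fixes_representatives p S F L \<psi> \<Psi>"

sublocale rank_one_operation \<subseteq> rank_one p S F
  by unfold_locales (rule rank1)

context rank_one_operation
begin

lemma Ob_iff: "P \<in> Ob L \<longleftrightarrow> centric S F P" using objects by auto

lemma Ob_subgroup: "P \<in> Ob L \<Longrightarrow> subgroup P S" by (simp add: Ob_iff centric_def)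

lemma category_laws:
  shows "X \<in> Ob L \<Longrightarrow> Idt L X \<in> Mor L X X"
    and "X \<in> Ob L \<Longrightarrow> Y \<in> Ob L \<Longrightarrow> f \<in> Mor L X Y \<Longrightarrow> Comp L f (Idt L X) = f"
    and "X \<in> Ob L \<Longrightarrow> Y \<in> Ob L \<Longrightarrow> f \<in> Mor L X Y \<Longrightarrow> Comp L (Idt L Y) f = f"
    and "X \<in> Ob L \<Longrightarrow> Y \<in> Ob L \<Longrightarrow> Z \<in> Ob L \<Longrightarrow> f \<in> Mor L X Y \<Longrightarrow> g \<in> Mor L Y Z \<Longrightarrow> Comp L g f \<in> Mor L X Z"
    and "W \<in> Ob L \<Longrightarrow> X \<in> Ob L \<Longrightarrow> Y \<in> Ob L \<Longrightarrow> Z \<in> Ob L \<Longrightarrow> f \<in> Mor L W X \<Longrightarrow> g \<in> Mor L X Y \<Longrightarrow> h \<in> Mor L Y Z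
      \<Longrightarrow> Comp L h (Comp L g f) = Comp L (Comp L h g) f"
  using category unfolding is_category_def by simp_all

lemma S_centric: "centric S F (carrier S)"
  unfolding centric_iff
proof (intro conjI ballI)
  show "subgroup (carrier S) S" by (rule subgroup_self)
  fix f assume f: "f \<in> E (carrier S)"
  have im: "subgroup (f ` carrier S) S" by (rule E_image_subgroup[OF subgroup_self f])
  have "f ` carrier S = carrier S"
    using vol_strict[OF im subgroup_self] vol_image[OF subgroup_self f] sub_mem[OF im] by (auto simp: lex_le_def)
  then show "centralizer S (f ` carrier S) \<subseteq> f ` carrier S" by (auto simp: centralizer_def)
qed

lemma S_Ob: "carrier S \<in> Ob L" using S_centric Ob_iff by simp

lemma T_sub_S: "T \<subseteq> carrier S" by auto

lemma linking_bullet_iff: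
  "R \<in> linking_bullet_ob p S F \<longleftrightarrow> centric S F R \<and> (small R \<or> T \<subseteq> R)"
proof (cases "centric S F R")
  case True
  then have R: "subgroup R S" by (simp add: centric_def)
  have RS: "R \<subseteq> carrier S" using sub_mem[OF R] by blast
  have "R \<in> fusion_bullet_ob p S F \<longleftrightarrow> small R \<or> T \<subseteq> R"
  proof
    assume "R \<in> fusion_bullet_ob p S F"
    then obtain Y where Y: "subgroup Y S" "R = bullet p S F Y" unfolding fusion_bullet_ob_def by blast
    then have "R = (if small Y then Y else Y <#> T)" using bullet_eq sub_mem[OF Y(1)] by blast
    then show "small R \<or> T \<subseteq> R" using XT_subgroup(3)[OF Y(1)] by (cases "small Y") auto
  next
    assume "small R \<or> T \<subseteq> R"
    then have "bullet p S F R = R" using bullet_eq[OF RS] XT_eq[OF R] by auto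
    then show "R \<in> fusion_bullet_ob p S F" using R unfolding fusion_bullet_ob_def by blast
  qed
  then show ?thesis using True by (simp add: linking_bullet_ob_def)
qed (simp add: linking_bullet_ob_def)

lemma S_linking_bullet: "carrier S \<in> linking_bullet_ob p S F"
  using linking_bullet_iff S_centric T_sub_S by blast

section \<open>Lifts of conjugation maps to the linking system\<close>

lemma transporter_iff:
  assumes "subgroup P S"
  shows "g \<in> transporter S P Q \<longleftrightarrow> g \<in> carrier S \<and> cj g ` P \<subseteq> Q"
  by (auto simp: transporter_def conj_map_apply)

lemma iota: "P \<in> Ob L \<Longrightarrow> \<iota> P \<in> Mor L P (carrier S)" "P \<in> Ob L \<Longrightarrow> rho L (\<iota> P) = (\<lambda>x\<in>P. x)"
  using liftings by (auto simp: inclusion_liftings_def)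

lemma rho_hom:
  assumes "P \<in> Ob L" "Q \<in> Ob L" "\<phi> \<in> Mor L P Q"
  shows "x \<in> P \<Longrightarrow> rho L \<phi> x \<in> Q" "rho L \<phi> \<in> E P" "rho L \<phi> \<in> F P Q"
  using rho_mor[OF assms] F_hom(1)[OF Ob_subgroup Ob_subgroup] F_iff[OF Ob_subgroup Ob_subgroup] assms by blast+

lemma rho_comp_apply:
  assumes "P \<in> Ob L" "Q \<in> Ob L" "R \<in> Ob L" "\<phi> \<in> Mor L P Q" "\<chi> \<in> Mor L Q R" "x \<in> P"
  shows "rho L (Comp L \<chi> \<phi>) x = rho L \<chi> (rho L \<phi> x)"
  using rho_comp[OF assms(1-5)] assms(6) by (simp add: compose_eq)

lemma delta:
  assumes "P \<in> Ob L"
  shows "g \<in> P \<Longrightarrow> delta L P g \<in> Mor L P P" "g \<in> P \<Longrightarrow> h \<in> P \<Longrightarrow> delta L P (g \<otimes> h) = Comp L (delta L P g) (delta L P h)"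
    "g \<in> P \<Longrightarrow> x \<in> P \<Longrightarrow> rho L (delta L P g) x = cj g x"
  using delta_mon[OF assms] B[OF assms] by (auto simp: mon_def hom_def cat_aut_def cat_iso_def conj_map_apply)

lemma delta_one: "P \<in> Ob L \<Longrightarrow> delta L P \<one> = Idt L P"
proof -
  assume P: "P \<in> Ob L"
  have o: "\<one> \<in> P" by (rule subgroup.one_closed[OF Ob_subgroup[OF P]])
  let ?d = "delta L P \<one>"
  have d: "?d \<in> cat_iso L P P" using delta_mon[OF P] o by (auto simp: mon_def hom_def cat_aut_def)
  then obtain g where g: "g \<in> Mor L P P" "Comp L g ?d = Idt L P" unfolding cat_iso_def by blast
  have dM: "?d \<in> Mor L P P" by (rule delta(1)[OF P o])
  have "Comp L ?d ?d = ?d" using delta(2)[OF P o o] by simp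
  then have "Comp L g (Comp L ?d ?d) = Comp L g ?d" by simp
  then have "Comp L (Comp L g ?d) ?d = Comp L g ?d" using category_laws(5)[OF P P P P dM dM g(1)] by simp
  then show ?thesis using g(2) category_laws(3)[OF P P dM] by simp
qed

text \<open>Two candidates with the same image in \<open>F\<close> differ by an element of the center, which acts freely.\<close>

lemma iota_cancel:
  assumes P: "P \<in> Ob L" and Q: "Q \<in> Ob L" and \<phi>: "\<phi> \<in> Mor L P Q" and \<chi>: "\<chi> \<in> Mor L P Q"
    and eq: "Comp L (\<iota> Q) \<phi> = Comp L (\<iota> Q) \<chi>"
  shows "\<phi> = \<chi>"
proof -
  note i = iota[OF Q]
  have "rho L \<phi> = rho L \<chi>"
  proof (rule extensionalityI[of _ P])
    show "rho L \<phi> \<in> extensional P" "rho L \<chi> \<in> extensional P"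
      using E_hom(4)[OF Ob_subgroup[OF P]] rho_hom(2)[OF P Q] \<phi> \<chi> by blast+
    fix x assume x: "x \<in> P"
    have "rho L (\<iota> Q) (rho L \<phi> x) = rho L (\<iota> Q) (rho L \<chi> x)"
      using rho_comp_apply[OF P Q S_Ob \<phi> i(1) x] rho_comp_apply[OF P Q S_Ob \<chi> i(1) x] eq by simp
    then show "rho L \<phi> x = rho L \<chi> x" using i(2) rho_hom(1)[OF P Q \<phi> x] rho_hom(1)[OF P Q \<chi> x] by simp
  qed
  then obtain z where z: "z \<in> center S P" "\<chi> = Comp L \<phi> (delta L P z)" using A_orbits[OF P Q \<phi> \<chi>] by blast
  have zP: "z \<in> P" using z(1) by (auto simp: center_def centralizer_def)
  have "Comp L (Comp L (\<iota> Q) \<phi>) (delta L P z) = Comp L (\<iota> Q) \<phi>"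
    using category_laws(5)[OF P P Q S_Ob delta(1)[OF P zP] \<phi> i(1)] z(2) eq by simp
  then have "z = \<one>" using A_free[OF P S_Ob category_laws(4)[OF P Q S_Ob \<phi> i(1)] z(1)] by blast
  then show ?thesis using z(2) delta_one[OF P] category_laws(2)[OF P Q \<phi>] by simp
qed

abbreviation "dx \<equiv> delta_ext S L \<iota>"

text \<open>Any lift of c_g from P to Q becomes, after composition with the inclusion, equal to the
  required composite up to an element of Z(P). Correcting by that element gives existence and
  \<open>iota_cancel\<close> gives uniqueness, so the description operator in
  \<open>delta_ext\<close> is justified.\<close>

lemma dx:
  assumes P: "P \<in> Ob L" and Q: "Q \<in> Ob L" and g: "g \<in> transporter S P Q"
  shows "dx P Q g \<in> Mor L P Q" "Comp L (\<iota> Q) (dx P Q g) = Comp L (delta L (carrier S) g) (\<iota> P)"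
    "x \<in> P \<Longrightarrow> rho L (dx P Q g) x = cj g x"
    "\<phi> \<in> Mor L P Q \<Longrightarrow> Comp L (\<iota> Q) \<phi> = Comp L (delta L (carrier S) g) (\<iota> P) \<Longrightarrow> dx P Q g = \<phi>"
proof -
  note sP = Ob_subgroup[OF P] and sQ = Ob_subgroup[OF Q] and iP = iota[OF P] and iQ = iota[OF Q]
  have gS: "g \<in> carrier S" and gPQ: "\<And>x. x \<in> P \<Longrightarrow> cj g x \<in> Q" using g transporter_iff[OF sP] by auto
  let ?r = "Comp L (delta L (carrier S) g) (\<iota> P)"
  have dS: "delta L (carrier S) g \<in> Mor L (carrier S) (carrier S)" by (rule delta(1)[OF S_Ob gS])
  have r: "?r \<in> Mor L P (carrier S)" by (rule category_laws(4)[OF P S_Ob S_Ob iP(1) dS])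
  have rr: "rho L ?r x = cj g x" if "x \<in> P" for x
    using rho_comp_apply[OF P S_Ob S_Ob iP(1) dS that] iP(2) that delta(3)[OF S_Ob gS] sub_mem[OF sP that] by simp
  have "conj_map S P g \<in> F P Q" using hom_conj_subset[OF sP sQ] g unfolding hom_conj_def by blast
  then obtain \<phi>1 where \<phi>1: "\<phi>1 \<in> Mor L P Q" "rho L \<phi>1 = conj_map S P g" using A_surj[OF P Q] by (metis imageE)
  have c1: "Comp L (\<iota> Q) \<phi>1 \<in> Mor L P (carrier S)" by (rule category_laws(4)[OF P Q S_Ob \<phi>1(1) iQ(1)])
  have "rho L (Comp L (\<iota> Q) \<phi>1) = rho L ?r"
  proof (rule extensionalityI[of _ P])
    show "rho L (Comp L (\<iota> Q) \<phi>1) \<in> extensional P" "rho L ?r \<in> extensional P"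
      using E_hom(4)[OF sP] rho_hom(2)[OF P S_Ob] c1 r by blast+
    show "rho L (Comp L (\<iota> Q) \<phi>1) x = rho L ?r x" if "x \<in> P" for x
      using rho_comp_apply[OF P Q S_Ob \<phi>1(1) iQ(1) that] rr[OF that] \<phi>1(2) iQ(2) gPQ[OF that] that by (simp add: conj_map_apply)
  qed
  then obtain z where z: "z \<in> center S P" "?r = Comp L (Comp L (\<iota> Q) \<phi>1) (delta L P z)" using A_orbits[OF P S_Ob c1 r] by blast
  have zP: "z \<in> P" using z(1) by (auto simp: center_def centralizer_def)
  let ?\<phi> = "Comp L \<phi>1 (delta L P z)"
  have \<phi>: "?\<phi> \<in> Mor L P Q" by (rule category_laws(4)[OF P P Q delta(1)[OF P zP] \<phi>1(1)])
  have \<phi>eq: "Comp L (\<iota> Q) ?\<phi> = ?r" using category_laws(5)[OF P P Q S_Ob delta(1)[OF P zP] \<phi>1(1) iQ(1)] z(2) by simp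
  have uniq: "\<chi> = ?\<phi>" if "\<chi> \<in> Mor L P Q" "Comp L (\<iota> Q) \<chi> = ?r" for \<chi>
    by (rule iota_cancel[OF P Q that(1) \<phi>]) (simp add: that(2) \<phi>eq)
  have d: "dx P Q g = ?\<phi>" unfolding delta_ext_def
    by (rule the_equality, rule conjI[OF \<phi> \<phi>eq], erule conjE, rule uniq)
  show dM: "dx P Q g \<in> Mor L P Q" and deq: "Comp L (\<iota> Q) (dx P Q g) = ?r" using d \<phi> \<phi>eq by auto
  show "dx P Q g = \<chi>" if "\<chi> \<in> Mor L P Q" "Comp L (\<iota> Q) \<chi> = ?r" for \<chi> using uniq[OF that] d by simp
  show "rho L (dx P Q g) x = cj g x" if x: "x \<in> P"
    using rho_comp_apply[OF P Q S_Ob dM iQ(1) x] deq rr[OF x] iQ(2) rho_hom(1)[OF P Q dM x] by simp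
qed

lemma transporter_comp:
  assumes "subgroup P S" "subgroup Q S" "g \<in> transporter S P Q" "h \<in> transporter S Q R"
  shows "h \<otimes> g \<in> transporter S P R"
  using assms sub_mem[OF assms(1)] by (auto simp: transporter_iff conjugate_comp image_subset_iff)

lemma dx_comp:
  assumes P: "P \<in> Ob L" and Q: "Q \<in> Ob L" and R: "R \<in> Ob L"
    and g: "g \<in> transporter S P Q" and h: "h \<in> transporter S Q R"
  shows "Comp L (dx Q R h) (dx P Q g) = dx P R (h \<otimes> g)"
proof -
  have hg: "h \<otimes> g \<in> transporter S P R" by (rule transporter_comp[OF Ob_subgroup[OF P] Ob_subgroup[OF Q] g h])
  have S: "g \<in> carrier S" "h \<in> carrier S" using g h by (auto simp: transporter_def)
  note dg = dx[OF P Q g] and dh = dx[OF Q R h] and iP = iota(1)[OF P] and iQ = iota(1)[OF Q] and iR = iota(1)[OF R]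
  let ?d = "delta L (carrier S)"
  note dS = delta(1)[OF S_Ob S(1)] delta(1)[OF S_Ob S(2)]
  have "Comp L (\<iota> R) (Comp L (dx Q R h) (dx P Q g)) = Comp L (Comp L (\<iota> R) (dx Q R h)) (dx P Q g)"
    by (rule category_laws(5)[OF P Q R S_Ob dg(1) dh(1) iR])
  also have "\<dots> = Comp L (?d h) (Comp L (\<iota> Q) (dx P Q g))"
    unfolding dh(2) by (rule category_laws(5)[OF P Q S_Ob S_Ob dg(1) iQ dS(2), symmetric])
  also have "\<dots> = Comp L (?d (h \<otimes> g)) (\<iota> P)"
    unfolding dg(2) delta(2)[OF S_Ob S(2,1)] by (rule category_laws(5)[OF P S_Ob S_Ob S_Ob iP dS])
  finally show ?thesis using dx(4)[OF P R hg category_laws(4)[OF P Q R dg(1) dh(1)]] by simp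
qed

lemma dx_delta:
  assumes P: "P \<in> Ob L" and g: "g \<in> P" shows "dx P P g = delta L P g" "g \<in> transporter S P P"
proof -
  note sP = Ob_subgroup[OF P]
  have "g \<in> normalizer S P" using g subgroup_subset_normalizer[OF sP] by blast
  then show t: "g \<in> transporter S P P" using normalizer_iff[of P g] subgroup.subset[OF sP]
    by (simp add: transporter_iff[OF sP])
  show "dx P P g = delta L P g"
    by (rule dx(4)[OF P P t delta(1)[OF P g]]) (use C[OF P S_Ob iota(1)[OF P] g] iota(2)[OF P] g in simp)
qed

section \<open>Iterates of the operation on elements, subgroups and morphisms\<close>

lemma psi:
  shows "bij_betw \<psi> (carrier S) (carrier S)" "x \<in> carrier S \<Longrightarrow> y \<in> carrier S \<Longrightarrow> \<psi> (x \<otimes> y) = \<psi> x \<otimes> \<psi> y"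
    "P \<in> Ob L \<Longrightarrow> \<psi> ` P \<in> Ob L"
    "P \<in> Ob L \<Longrightarrow> Q \<in> Ob L \<Longrightarrow> \<phi> \<in> Mor L P Q \<Longrightarrow> \<Psi> \<phi> \<in> Mor L (\<psi> ` P) (\<psi> ` Q)"
    "P \<in> Ob L \<Longrightarrow> \<Psi> (Idt L P) = Idt L (\<psi> ` P)"
    "P \<in> Ob L \<Longrightarrow> Q \<in> Ob L \<Longrightarrow> R \<in> Ob L \<Longrightarrow> \<phi> \<in> Mor L P Q \<Longrightarrow> \<chi> \<in> Mor L Q R \<Longrightarrow>
       \<Psi> (Comp L \<chi> \<phi>) = Comp L (\<Psi> \<chi>) (\<Psi> \<phi>)"
    "P \<in> Ob L \<Longrightarrow> Q \<in> Ob L \<Longrightarrow> \<phi> \<in> Mor L P Q \<Longrightarrow> rho L (\<Psi> \<phi>) = conj_by \<psi> P (rho L \<phi>)"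
    "P \<in> Ob L \<Longrightarrow> Q \<in> Ob L \<Longrightarrow> g \<in> transporter S P Q \<Longrightarrow> \<Psi> (dx P Q g) = dx (\<psi> ` P) (\<psi> ` Q) (\<psi> g)"
proof -
  have op: "\<psi> \<in> iso S S" "cat_automorphism L (\<lambda>P. \<psi> ` P) \<Psi>"
    using operation unfolding unstable_adams_operation_def by blast+
  show "bij_betw \<psi> (carrier S) (carrier S)" "x \<in> carrier S \<Longrightarrow> y \<in> carrier S \<Longrightarrow> \<psi> (x \<otimes> y) = \<psi> x \<otimes> \<psi> y"
    using op(1) by (auto simp: iso_def hom_def)
  show "P \<in> Ob L \<Longrightarrow> \<psi> ` P \<in> Ob L"
    "P \<in> Ob L \<Longrightarrow> Q \<in> Ob L \<Longrightarrow> \<phi> \<in> Mor L P Q \<Longrightarrow> \<Psi> \<phi> \<in> Mor L (\<psi> ` P) (\<psi> ` Q)"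
    using op(2) unfolding cat_automorphism_def bij_betw_def by blast+
  show "P \<in> Ob L \<Longrightarrow> \<Psi> (Idt L P) = Idt L (\<psi> ` P)"
    "P \<in> Ob L \<Longrightarrow> Q \<in> Ob L \<Longrightarrow> R \<in> Ob L \<Longrightarrow> \<phi> \<in> Mor L P Q \<Longrightarrow> \<chi> \<in> Mor L Q R \<Longrightarrow>
       \<Psi> (Comp L \<chi> \<phi>) = Comp L (\<Psi> \<chi>) (\<Psi> \<phi>)"
    using op(2) unfolding cat_automorphism_def by simp_all
  show "P \<in> Ob L \<Longrightarrow> Q \<in> Ob L \<Longrightarrow> \<phi> \<in> Mor L P Q \<Longrightarrow> rho L (\<Psi> \<phi>) = conj_by \<psi> P (rho L \<phi>)"
    "P \<in> Ob L \<Longrightarrow> Q \<in> Ob L \<Longrightarrow> g \<in> transporter S P Q \<Longrightarrow> \<Psi> (dx P Q g) = dx (\<psi> ` P) (\<psi> ` Q) (\<psi> g)"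
    using operation unfolding unstable_adams_operation_def by simp_all
qed

lemma iter_hom:
  shows "x \<in> carrier S \<Longrightarrow> (\<psi> ^^ n) x \<in> carrier S"
    "x \<in> carrier S \<Longrightarrow> y \<in> carrier S \<Longrightarrow> (\<psi> ^^ n) (x \<otimes> y) = (\<psi> ^^ n) x \<otimes> (\<psi> ^^ n) y"
    "inj_on (\<psi> ^^ n) (carrier S)"
proof -
  show cl: "x \<in> carrier S \<Longrightarrow> (\<psi> ^^ n) x \<in> carrier S" for x
    by (induction n) (use psi(1) in \<open>auto simp: bij_betw_def\<close>)
  show "x \<in> carrier S \<Longrightarrow> y \<in> carrier S \<Longrightarrow> (\<psi> ^^ n) (x \<otimes> y) = (\<psi> ^^ n) x \<otimes> (\<psi> ^^ n) y"
  proof (induction n)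
    case (Suc n)
    have "(\<psi> ^^ n) x \<in> carrier S" "(\<psi> ^^ n) y \<in> carrier S" 
      using Suc.prems psi(1) by (induction n) (auto simp: bij_betw_def)
    then show ?case using Suc psi(2) by simp
  qed simp
  show "inj_on (\<psi> ^^ n) (carrier S)"
  proof -
    have "bij_betw (\<psi> ^^ n) (carrier S) (carrier S)" using psi(1) by (rule bij_betw_funpow)
    then show ?thesis by (rule bij_betw_imp_inj_on)
  qed
qed

lemma iter_inv: "x \<in> carrier S \<Longrightarrow> (\<psi> ^^ n) (inv x) = inv ((\<psi> ^^ n) x)"
  "(\<psi> ^^ n) \<one> = \<one>"
proof -
  have "(\<psi> ^^ n) \<one> \<otimes> (\<psi> ^^ n) \<one> = (\<psi> ^^ n) \<one>" using iter_hom(2)[of \<one> \<one> n] by simp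
  then show 1: "(\<psi> ^^ n) \<one> = \<one>" using iter_hom(1)[of \<one> n] by (metis l_cancel_one' one_closed)
  show "(\<psi> ^^ n) (inv x) = inv ((\<psi> ^^ n) x)" if x: "x \<in> carrier S"
  proof (rule inv_equality[symmetric])
    show "(\<psi> ^^ n) (inv x) \<otimes> (\<psi> ^^ n) x = \<one>" using iter_hom(2)[of "inv x" x n] x 1 by simp
  qed (use x iter_hom(1) in auto)
qed

lemma iter_cj: "g \<in> carrier S \<Longrightarrow> x \<in> carrier S \<Longrightarrow> (\<psi> ^^ n) (cj g x) = cj ((\<psi> ^^ n) g) ((\<psi> ^^ n) x)"
  by (simp add: conjugate_def iter_hom iter_inv)

lemma iter_Ob: "P \<in> Ob L \<Longrightarrow> (\<psi> ^^ n) ` P \<in> Ob L"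
  by (induction n) (use psi(3) in \<open>auto simp flip: image_image image_comp\<close>)

lemma iter_Mor: "P \<in> Ob L \<Longrightarrow> Q \<in> Ob L \<Longrightarrow> \<phi> \<in> Mor L P Q \<Longrightarrow> (\<Psi> ^^ n) \<phi> \<in> Mor L ((\<psi> ^^ n) ` P) ((\<psi> ^^ n) ` Q)"
proof (induction n)
  case (Suc n)
  then show ?case using psi(4)[OF iter_Ob[of P n] iter_Ob[of Q n]] by (simp add: image_image)
qed simp

lemma iter_Comp:
  assumes "P \<in> Ob L" "Q \<in> Ob L" "R \<in> Ob L" "\<phi> \<in> Mor L P Q" "\<chi> \<in> Mor L Q R"
  shows "(\<Psi> ^^ n) (Comp L \<chi> \<phi>) = Comp L ((\<Psi> ^^ n) \<chi>) ((\<Psi> ^^ n) \<phi>)"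
proof (induction n)
  case (Suc n)
  then show ?case using psi(6)[OF iter_Ob iter_Ob iter_Ob iter_Mor iter_Mor] assms by simp
qed simp

lemma iter_dx:
  assumes "P \<in> Ob L" "Q \<in> Ob L" "g \<in> transporter S P Q"
  shows "(\<Psi> ^^ n) (dx P Q g) = dx ((\<psi> ^^ n) ` P) ((\<psi> ^^ n) ` Q) ((\<psi> ^^ n) g)"
proof (induction n)
  case (Suc n)
  have g: "g \<in> carrier S" "\<And>x. x \<in> P \<Longrightarrow> cj g x \<in> Q" using assms(3) transporter_iff[OF Ob_subgroup[OF assms(1)]] by auto
  have PS: "\<And>x. x \<in> P \<Longrightarrow> x \<in> carrier S" using sub_mem[OF Ob_subgroup[OF assms(1)]] .
  have "(\<psi> ^^ n) g \<in> transporter S ((\<psi> ^^ n) ` P) ((\<psi> ^^ n) ` Q)"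
    using g PS iter_hom(1) by (auto simp: transporter_iff[OF Ob_subgroup[OF iter_Ob[OF assms(1)]]] simp flip: iter_cj)
  then show ?case using Suc psi(8)[OF iter_Ob iter_Ob] assms by (simp add: image_image)
qed simp

lemma iter_rho:
  assumes "P \<in> Ob L" "Q \<in> Ob L" "\<phi> \<in> Mor L P Q" "x \<in> P"
  shows "rho L ((\<Psi> ^^ n) \<phi>) ((\<psi> ^^ n) x) = (\<psi> ^^ n) (rho L \<phi> x)"
proof (induction n)
  case (Suc n)
  let ?P = "(\<psi> ^^ n) ` P" and ?y = "(\<psi> ^^ n) x"
  have y: "?y \<in> ?P" using assms(4) by blast
  have PS: "?P \<subseteq> carrier S" using sub_mem[OF Ob_subgroup[OF iter_Ob[OF assms(1)]]] by blast
  have "inj_on \<psi> ?P" using psi(1) PS by (meson bij_betw_imp_inj_on inj_on_subset)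
  then have "inv_into ?P \<psi> (\<psi> ?y) = ?y" using y by simp
  then show ?case
    using Suc psi(7)[OF iter_Ob iter_Ob iter_Mor, OF assms(1,2) assms(1,2,3)] y by (simp add: conj_by_def)
qed simp

abbreviation "fx i \<equiv> fixed_pts p S \<psi> i"

abbreviation "ps i \<equiv> \<psi> ^^ (p ^ i)"

lemma fx_iff: "x \<in> fx i \<longleftrightarrow> x \<in> carrier S \<and> ps i x = x"
  by (simp add: fixed_pts_def op_iter_eq)

lemma fx_subgroup: "subgroup (fx i) S"
proof (rule subgroupI)
  have "\<one> \<in> fx i" by (simp add: fx_iff iter_inv)
  then show "fx i \<noteq> {}" by blast
qed (auto simp: fx_iff iter_inv iter_hom(2))

lemma fx_mono: "i \<le> j \<Longrightarrow> fx i \<subseteq> fx j"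
proof (rule lift_Suc_mono_le[of fx])
  fix i show "fx i \<subseteq> fx (Suc i)"
  proof
    fix x assume x: "x \<in> fx i"
    have "(ps i ^^ k) x = x" for k using x by (induction k) (auto simp: fx_iff)
    then show "x \<in> fx (Suc i)" using x by (auto simp: fx_iff funpow_mult mult.commute)
  qed
qed

lemma T_fx: "T \<inter> fx i \<subset> T \<inter> fx (Suc i)" "T = (\<Union>i. T \<inter> fx i)"
  using exhausted unfolding torus_exhausted_def by blast+

lemma T_not_fx: "\<not> T \<subseteq> fx i" using T_fx(1)[of i] by blast

lemma finite_fx: "finite (fx i)" using subgroup_dichotomy[OF fx_subgroup] T_not_fx by blast

lemma reps:
  obtains \<H> M where "\<H> \<subseteq> linking_bullet_ob p S F"
    "\<And>R. R \<in> linking_bullet_ob p S F \<Longrightarrow> \<exists>P\<in>\<H>. \<exists>g\<in>carrier S. cj g ` P = R"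
    "\<And>P f. P \<in> \<H> \<Longrightarrow> f \<in> fus_iso F P P \<Longrightarrow> \<exists>\<phi>. \<phi> \<in> Mor L P P \<and> \<Psi> \<phi> = \<phi> \<and> rho L \<phi> \<in> rep_class S P P f"
    "\<And>P. P \<in> \<H> \<Longrightarrow> \<psi> ` P = P" "\<And>P i. P \<in> \<H> \<Longrightarrow> determined p S F \<psi> i P"
proof -
  obtain \<H> M where H: "conj_class_reps p S F \<H>" "\<forall>P\<in>\<H>. \<forall>R\<in>\<H>. iso_class_reps S F L P R (M P R)"
    "\<forall>P\<in>\<H>. \<psi> ` P = P" "\<forall>P\<in>\<H>. \<forall>R\<in>\<H>. \<forall>\<phi>\<in>M P R. \<Psi> \<phi> = \<phi>" "\<forall>P\<in>\<H>. \<forall>i. determined p S F \<psi> i P"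
    using representatives unfolding fixes_representatives_def by (elim exE conjE)
  show ?thesis
  proof (rule that[of \<H>])
    show "\<H> \<subseteq> linking_bullet_ob p S F" using H(1) by (simp add: conj_class_reps_def)
    show "\<exists>P\<in>\<H>. \<exists>g\<in>carrier S. cj g ` P = R" if R: "R \<in> linking_bullet_ob p S F" for R
    proof -
      obtain P g where "P \<in> \<H>" "g \<in> carrier S" "conj_map S P g ` P = R"
        using H(1) R unfolding conj_class_reps_def by metis
      moreover have "conj_map S P g ` P = cj g ` P" by (auto simp: conj_map_apply)
      ultimately show ?thesis by metis
    qed
    show "\<exists>\<phi>. \<phi> \<in> Mor L P P \<and> \<Psi> \<phi> = \<phi> \<and> rho L \<phi> \<in> rep_class S P P f"
      if Pf: "P \<in> \<H>" "f \<in> fus_iso F P P" for P f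
    proof -
      have ic: "iso_class_reps S F L P P (M P P)" using H(2) Pf(1) by blast
      then have "\<exists>!\<phi>. \<phi> \<in> M P P \<and> rho L \<phi> \<in> rep_class S P P f" using Pf(2) unfolding iso_class_reps_def by (elim conjE bspec)
      then obtain \<phi> where \<phi>: "\<phi> \<in> M P P" "rho L \<phi> \<in> rep_class S P P f" by (elim ex1E conjE)
      have "\<phi> \<in> Mor L P P" using ic \<phi>(1) unfolding iso_class_reps_def cat_iso_def by blast
      then show ?thesis using \<phi> H(4) Pf(1) by blast
    qed
    show "P \<in> \<H> \<Longrightarrow> \<psi> ` P = P" for P using H(3) by blast
    show "P \<in> \<H> \<Longrightarrow> determined p S F \<psi> i P" for P i using H(5) by blast
  qed
qed

text \<open>S is conjugate only to itself, so it is one of the chosen representatives and therefore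
  \<open>S\<^sub>i\<close>-determined. As S_i does not contain T, its bullet can only be S_i T; so
  already S_0 meets every coset of T.\<close>

lemma S_determined: "determined p S F \<psi> i (carrier S)" "fx i <#> T = carrier S"
proof -
  obtain \<H> where H: "\<H> \<subseteq> linking_bullet_ob p S F"
    "\<And>R. R \<in> linking_bullet_ob p S F \<Longrightarrow> \<exists>P\<in>\<H>. \<exists>g\<in>carrier S. cj g ` P = R"
    "\<And>P i. P \<in> \<H> \<Longrightarrow> determined p S F \<psi> i P" by (rule reps) blast
  obtain P g where P: "P \<in> \<H>" "g \<in> carrier S" "cj g ` P = carrier S" using H(2)[OF S_linking_bullet] by blast
  have PS: "P \<subseteq> carrier S"
    using H(1) P(1) linking_bullet_iff sub_mem by (metis centric_def subsetD subsetI)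
  have "carrier S \<subseteq> P"
  proof
    fix x assume x: "x \<in> carrier S"
    then have "cj g x \<in> cj g ` P" using P by simp
    then show "x \<in> P" using P(2) PS x by (auto simp: subset_eq)
  qed
  then have "P = carrier S" using PS by blast
  then show d: "determined p S F \<psi> i (carrier S)" using H(3) P(1) by blast
  have sub: "fx i \<subseteq> carrier S" using sub_mem[OF fx_subgroup] by blast
  then have "bullet p S F (fx i) = carrier S" using d by (simp add: determined_def Int_absorb1)
  then show "fx i <#> T = carrier S" using bullet_eq[OF sub] T_not_fx[of i] T_sub_S by (auto split: if_splits)
qed

text \<open>Write x = y t with y in S_0 and t in T; the fixed subgroups increase and exhaust
  T.\<close>

lemma eventually_fx: "x \<in> carrier S \<Longrightarrow> eventually (\<lambda>i. x \<in> fx i) sequentially"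
proof -
  assume "x \<in> carrier S"
  then obtain y t where yt: "y \<in> fx 0" "t \<in> T" "x = y \<otimes> t" using S_determined(2)[of 0] by (metis XT_iff)
  then obtain j where j: "t \<in> fx j" using T_fx(2) by blast
  have "x \<in> fx i" if "j \<le> i" for i
  proof -
    have "y \<in> fx i" "t \<in> fx i" using fx_mono[of 0 i] fx_mono[OF that] yt j by auto
    then show ?thesis using yt(3) subgroup.m_closed[OF fx_subgroup] by blast
  qed
  then show ?thesis by (auto simp: eventually_sequentially)
qed

text \<open>The elements of T that \<open>\<Psi>\<^sub>i\<close> fixes up to the factor z. For z =
  \<one> this is T_i; for the involution it also contains the square roots in T of elements of
  T_i.\<close>

definition twisting :: "nat \<Rightarrow> 'a \<Rightarrow> 'a set" where
  "twisting i z = {\<tau> \<in> T. ps i \<tau> = \<tau> \<or> ps i \<tau> = \<tau> \<otimes> z}"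

abbreviation "Det i \<equiv> det_bullet_ob p S F \<psi> i"

lemma Det_iff: "R \<in> Det i \<longleftrightarrow> R \<in> linking_bullet_ob p S F \<and> determined p S F \<psi> i R"
  by (simp add: det_bullet_ob_def)

lemma Det_Ob: "R \<in> Det i \<Longrightarrow> R \<in> Ob L"
  by (simp add: Det_iff linking_bullet_iff Ob_iff)

lemma S_Det: "carrier S \<in> Det i"
  using S_linking_bullet S_determined by (simp add: Det_iff)

lemma small_cj: "u \<in> carrier S \<Longrightarrow> X \<subseteq> carrier S \<Longrightarrow> small (cj u ` X) \<longleftrightarrow> small X"
  by (rule small_image_iff[of "carrier S"]) (auto simp: subgroup_self conjugate_mult inj_on_def)

lemma cj_T: "u \<in> carrier S \<Longrightarrow> cj u ` T = T"
  by (rule T_hom(1)) (auto simp: conjugate_mult inj_on_def)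

lemma bullet_cj:
  assumes u: "u \<in> carrier S" and X: "X \<subseteq> carrier S"
  shows "bullet p S F (cj u ` X) = cj u ` bullet p S F X"
proof -
  have "cj u ` (X <#> T) = cj u ` X <#> T"
  proof (intro equalityI subsetI)
    fix y assume "y \<in> cj u ` (X <#> T)"
    then obtain x t where "x \<in> X" "t \<in> T" "y = cj u (x \<otimes> t)" by (auto simp: XT_iff)
    then have "y = cj u x \<otimes> cj u t" "cj u t \<in> T" using u X by (auto simp: conjugate_mult T_conjugate subset_eq)
    then show "y \<in> cj u ` X <#> T" using \<open>x \<in> X\<close> by (auto simp: XT_iff)
  next
    fix y assume "y \<in> cj u ` X <#> T"
    then obtain x s where xs: "x \<in> X" "s \<in> T" "y = cj u x \<otimes> s" by (auto simp: XT_iff)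
    then obtain t where t: "t \<in> T" "s = cj u t" using cj_T[OF u] by (metis imageE)
    have "x \<in> carrier S" using xs X by blast
    then have "y = cj u (x \<otimes> t)" using xs t u by (simp add: conjugate_mult)
    then show "y \<in> cj u ` (X <#> T)" using xs(1) t(1) XT_iff by blast
  qed
  moreover have "cj u ` X \<subseteq> carrier S" using u X by auto
  ultimately show ?thesis using bullet_eq X small_cj[OF u X] by simp
qed

lemma centric_cj:
  assumes "centric S F R" "v \<in> carrier S" shows "centric S F (cj v ` R)"
proof -
  have R: "subgroup R S" using assms(1) by (simp add: centric_def)
  have c: "conj_map S R v \<in> E R" by (rule conj_map_in_E[OF R assms(2)])
  have im: "conj_map S R v ` R = cj v ` R" by (auto simp: conj_map_apply)
  have Q: "subgroup (cj v ` R) S" by (rule subgroup_conjugate[OF R assms(2)])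
  have "centralizer S (f ` cj v ` R) \<subseteq> f ` cj v ` R" if f: "f \<in> E (cj v ` R)" for f
  proof -
    have "compose R f (conj_map S R v) \<in> E R" by (rule E_compose[OF R c Q f]) (simp add: im)
    moreover have "compose R f (conj_map S R v) ` R = f ` cj v ` R"
      by (auto simp: compose_def conj_map_apply image_image)
    ultimately show ?thesis using assms(1) centric_iff by metis
  qed
  then show ?thesis using Q centric_iff by blast
qed

text \<open>R is conjugate to a representative P, and \<alpha> corresponds, up to an inner
  automorphism of P, to a morphism \<phi>0 fixed by \<Psi>. The lift of the twisted \<alpha> is
  \<phi>0 between two lifted conjugations. Applying \<open>\<Psi>\<^sub>i\<close> inserts
  \<open>delta L P y\<close> with y = \<one> or y = z on either side of \<phi>0; as the image of
  \<phi>0 in F fixes z, axiom (C) brings the two factors together, and z^2 = \<one> cancels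
  them.\<close>

lemma twisted_lift:
  assumes R: "R \<in> linking_bullet_ob p S F" and \<alpha>: "\<alpha> \<in> E R" "\<alpha> ` R = R"
    and z: "z \<in> R" "\<alpha> z = z" "z \<otimes> z = \<one>" "\<And>g. g \<in> carrier S \<Longrightarrow> cj g z = z"
  shows "eventually (\<lambda>i. \<forall>\<tau>\<in>twisting i z. \<exists>Q \<phi>. Q = cj (inv \<tau>) ` R \<and> Q \<in> Det i \<and> \<phi> \<in> fixed_mor p L \<Psi> i Q Q \<and>
      (\<forall>x\<in>Q. rho L \<phi> x = cj (inv \<tau>) (\<alpha> (cj \<tau> x)))) sequentially"
proof -
  obtain \<H> where H: "\<H> \<subseteq> linking_bullet_ob p S F"
    "\<And>R. R \<in> linking_bullet_ob p S F \<Longrightarrow> \<exists>P\<in>\<H>. \<exists>g\<in>carrier S. cj g ` P = R"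
    "\<And>P f. P \<in> \<H> \<Longrightarrow> f \<in> fus_iso F P P \<Longrightarrow> \<exists>\<phi>. \<phi> \<in> Mor L P P \<and> \<Psi> \<phi> = \<phi> \<and> rho L \<phi> \<in> rep_class S P P f"
    "\<And>P. P \<in> \<H> \<Longrightarrow> \<psi> ` P = P" "\<And>P i. P \<in> \<H> \<Longrightarrow> determined p S F \<psi> i P" by (rule reps) blast
  have cR: "centric S F R" using R linking_bullet_iff by blast
  then have sR: "subgroup R S" by (simp add: centric_def)
  have RS: "\<And>x. x \<in> R \<Longrightarrow> x \<in> carrier S" using sub_mem[OF sR] .
  obtain P g where P: "P \<in> \<H>" and g: "g \<in> carrier S" and gP: "cj g ` P = R" using H(2)[OF R] by blast
  have Pl: "P \<in> linking_bullet_ob p S F" using P H(1) by blast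
  then have PO: "P \<in> Ob L" using linking_bullet_iff Ob_iff by blast
  note sP = Ob_subgroup[OF PO]
  have PS: "\<And>x. x \<in> P \<Longrightarrow> x \<in> carrier S" using sub_mem[OF sP] .
  have gPR: "cj g x \<in> R" if "x \<in> P" for x using gP that by blast
  have giR: "cj (inv g) y \<in> P" if "y \<in> R" for y using that gP g PS by auto
  define \<alpha>0 where "\<alpha>0 = (\<lambda>x\<in>P. cj (inv g) (\<alpha> (cj g x)))"
  have \<alpha>R: "\<alpha> y \<in> R" if "y \<in> R" for y using \<alpha>(2) that by blast
  have "\<alpha>0 \<in> fus_iso F P P"
    unfolding fus_iso_iff[OF sP sP]
  proof
    have c: "conj_map S P g \<in> E P" "conj_map S R (inv g) \<in> E R"
      using conj_map_in_E sP sR g by auto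
    have "compose P \<alpha> (conj_map S P g) \<in> E P"
      by (rule E_compose[OF sP c(1) sR \<alpha>(1)]) (use gPR in \<open>auto simp: conj_map_apply\<close>)
    then have "compose P (conj_map S R (inv g)) (compose P \<alpha> (conj_map S P g)) \<in> E P"
      by (rule E_compose[OF sP _ sR c(2)]) (use gPR \<alpha>R in \<open>auto simp: conj_map_apply compose_eq\<close>)
    moreover have "compose P (conj_map S R (inv g)) (compose P \<alpha> (conj_map S P g)) = \<alpha>0"
      using gPR \<alpha>R by (auto simp: \<alpha>0_def compose_def conj_map_apply intro!: restrict_ext)
    ultimately show "\<alpha>0 \<in> E P" by simp
    have "\<alpha>0 ` P = cj (inv g) ` \<alpha> ` cj g ` P" by (auto simp: \<alpha>0_def image_image)
    also have "\<dots> = cj (inv g) ` cj g ` P" using gP \<alpha>(2) by simp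
    also have "\<dots> = (\<lambda>x. x) ` P" unfolding image_image by (rule image_cong) (use g PS in auto)
    finally show "\<alpha>0 ` P = P" by simp
  qed
  then obtain \<phi>0 where \<phi>0: "\<phi>0 \<in> Mor L P P" "\<Psi> \<phi>0 = \<phi>0" "rho L \<phi>0 \<in> rep_class S P P \<alpha>0" using H(3)[OF P] by blast
  \<comment> \<open>Representatives are chosen modulo Inn(P), so \<phi>0 covers \<alpha>0 only up to
    some c_k.\<close>
  then obtain k where k: "k \<in> P" "rho L \<phi>0 = compose P (conj_map S P k) \<alpha>0" by (auto simp: rep_class_def inn_def)
  have kS: "k \<in> carrier S" using k PS by blast
  have \<phi>0x: "rho L \<phi>0 x = cj k (cj (inv g) (\<alpha> (cj g x)))" if "x \<in> P" for x
    using k(2) that giR \<alpha>R gPR by (simp add: compose_eq \<alpha>0_def conj_map_apply)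
  have zS: "z \<in> carrier S" using z(1) RS by blast
  have zP: "z \<in> P" using giR[OF z(1)] z(4) g by simp
  have \<phi>0z: "rho L \<phi>0 z = z" using \<phi>0x[OF zP] z(2,4) g kS by simp
  have comm: "x \<otimes> z = z \<otimes> x" if "x \<in> carrier S" for x
    using z(4)[OF that] conjugate_fix_iff[OF that zS] by simp
  have \<phi>0_it: "(\<Psi> ^^ n) \<phi>0 = \<phi>0" for n by (induction n) (simp_all add: \<phi>0(2))
  have P_it: "(\<psi> ^^ n) ` P = P" for n
  proof (induction n)
    case (Suc n)
    then have "\<psi> ` (\<psi> ^^ n) ` P = P" using H(4)[OF P] by simp
    then show ?case by (simp add: image_image)
  qed simp
  have iz: "inv z = z" using z(3) zS inv_equality by blast
  have main: "\<exists>Q \<phi>. Q = cj (inv \<tau>) ` R \<and> Q \<in> Det i \<and> \<phi> \<in> fixed_mor p L \<Psi> i Q Q \<and>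
      (\<forall>x\<in>Q. rho L \<phi> x = cj (inv \<tau>) (\<alpha> (cj \<tau> x)))"
    if i: "g \<in> fx i" "k \<in> fx i" and \<tau>: "\<tau> \<in> twisting i z" for i \<tau>
  proof -
    have \<tau>S: "\<tau> \<in> carrier S" using \<tau> by (simp add: twisting_def)
    have "ps i \<tau> = \<tau> \<otimes> \<one> \<or> ps i \<tau> = \<tau> \<otimes> z" using \<tau> \<tau>S by (auto simp: twisting_def)
    then obtain y where y: "y = \<one> \<or> y = z" "ps i \<tau> = \<tau> \<otimes> y" by blast
    have yS: "y \<in> carrier S" and yP: "y \<in> P" and yy: "y \<otimes> y = \<one>" and iy: "inv y = y"
      and cjy: "\<And>x. x \<in> carrier S \<Longrightarrow> cj x y = y" and ycomm: "\<And>x. x \<in> carrier S \<Longrightarrow> x \<otimes> y = y \<otimes> x"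
      and ycj: "\<And>x. x \<in> carrier S \<Longrightarrow> cj y x = x" and \<phi>0y: "rho L \<phi>0 y = y"
    proof -
      show yS: "y \<in> carrier S" using y zS by auto
      show "y \<in> P" using y zP subgroup.one_closed[OF sP] by auto
      show "y \<otimes> y = \<one>" "inv y = y" using y z(3) iz by auto
      show c: "x \<in> carrier S \<Longrightarrow> x \<otimes> y = y \<otimes> x" for x using y comm by auto
      show "cj x y = y" if "x \<in> carrier S" for x using y z(4) that by auto
      show "cj y x = x" if "x \<in> carrier S" for x using c[OF that] conjugate_fix_iff[OF yS that] by simp
      show "rho L \<phi>0 y = y" using y \<phi>0z E_one[OF sP rho_hom(2)[OF PO PO \<phi>0(1)]] by auto
    qed
    \<comment> \<open>Both \<open>?v\<close> and \<open>?u\<close> conjugate P onto Q; the factor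
      \<open>inv k\<close> in \<open>?u\<close> removes the inner automorphism c_k.\<close>
    let ?v = "inv \<tau> \<otimes> g" and ?u = "inv \<tau> \<otimes> g \<otimes> inv k"
    have vS: "?v \<in> carrier S" "?u \<in> carrier S" using \<tau>S g kS by auto
    define Q where "Q = cj (inv \<tau>) ` R"
    have Qv: "Q = cj ?v ` P" unfolding Q_def gP[symmetric] image_image
      by (rule image_cong) (use \<tau>S g PS in \<open>auto simp: conjugate_comp\<close>)
    have kP: "cj (inv k) ` P = P"
    proof -
      have "inv k \<in> normalizer S P" using subgroup_subset_normalizer[OF sP] subgroup.m_inv_closed[OF sP k(1)] by blast
      then show ?thesis using normalizer_iff[of P] PS by blast
    qed
    have Qu: "Q = cj ?u ` P"
    proof -
      have "cj ?u ` P = cj ?v ` cj (inv k) ` P" unfolding image_image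
        by (rule image_cong) (use vS kS PS in \<open>auto simp: conjugate_comp\<close>)
      then show ?thesis using kP Qv by simp
    qed
    have QO: "Q \<in> Ob L" unfolding Ob_iff Q_def using centric_cj[OF cR] \<tau>S by simp
    note sQ = Ob_subgroup[OF QO]
    have tu: "?u \<in> transporter S P Q" using transporter_iff[OF sP] vS(2) Qu by blast
    have tv: "inv ?v \<in> transporter S Q P"
      unfolding transporter_iff[OF sQ] unfolding Qv using vS(1) PS by auto
    have ps_g: "ps i g = g" "ps i k = k" using i by (auto simp: fx_iff)
    have ps_it: "ps i (inv \<tau>) = y \<otimes> inv \<tau>" using iter_inv(1)[OF \<tau>S] y(2) \<tau>S yS iy by (simp add: inv_mult_group)
    have ps_v: "ps i ?v = y \<otimes> ?v" using iter_hom(2)[of "inv \<tau>" g] ps_it ps_g \<tau>S g yS by (simp add: m_assoc)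
    have ps_u: "ps i ?u = y \<otimes> ?u"
      using iter_hom(2)[of ?v "inv k"] ps_v ps_g iter_inv(1)[OF kS] vS kS yS by (simp add: m_assoc)
    \<comment> \<open>Since y is central, conjugation by \<open>ps i ?u\<close> is conjugation by
      \<open>?u\<close>.\<close>
    have ps_Q: "ps i ` Q = Q"
    proof -
      have "ps i ` Q = (\<lambda>x. cj (ps i ?u) (ps i x)) ` P" unfolding Qu image_image
        by (rule image_cong) (use iter_cj[OF vS(2)] PS in auto)
      also have "\<dots> = cj ?u ` (ps i ` P)" unfolding image_image ps_u
        by (rule image_cong) (use vS yS ycj iter_hom(1) PS in \<open>auto simp: conjugate_comp\<close>)
      finally show ?thesis using P_it Qu by simp
    qed
    let ?\<chi> = "Comp L \<phi>0 (dx Q P (inv ?v))"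
    let ?\<phi> = "Comp L (dx P Q ?u) ?\<chi>"
    note du = dx[OF PO QO tu] and dv = dx[OF QO PO tv]
    have \<chi>: "?\<chi> \<in> Mor L Q P" by (rule category_laws(4)[OF QO PO PO dv(1) \<phi>0(1)])
    have \<phi>: "?\<phi> \<in> Mor L Q Q" by (rule category_laws(4)[OF QO PO QO \<chi> du(1)])
    have rho: "rho L ?\<phi> x = cj (inv \<tau>) (\<alpha> (cj \<tau> x))" if x: "x \<in> Q" for x
    proof -
      have xS: "x \<in> carrier S" using sub_mem[OF sQ x] .
      have c1: "cj (inv ?v) x \<in> P" using tv transporter_iff[OF sQ] x by blast
      have c2: "cj g (cj (inv ?v) x) = cj \<tau> x"
        using \<tau>S g xS by (simp add: conjugate_comp[symmetric] inv_mult_group m_assoc[symmetric])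
      have c3: "cj \<tau> x \<in> R" using gPR[OF c1] c2 by simp
      have "rho L ?\<phi> x = cj ?u (rho L \<phi>0 (cj (inv ?v) x))"
        using rho_comp_apply[OF QO PO QO \<chi> du(1) x] rho_comp_apply[OF QO PO PO dv(1) \<phi>0(1) x] dv(3)[OF x]
          du(3)[OF rho_hom(1)[OF PO PO \<phi>0(1) c1]] by simp
      also have "\<dots> = cj ?u (cj k (cj (inv g) (\<alpha> (cj \<tau> x))))" using \<phi>0x[OF c1] c2 by simp
      also have "\<dots> = cj (inv \<tau>) (\<alpha> (cj \<tau> x))"
        using \<tau>S g kS RS[OF \<alpha>R[OF c3]] by (simp add: conjugate_comp)
      finally show ?thesis .
    qed
    have "(\<Psi> ^^ (p ^ i)) ?\<phi> = Comp L (dx P Q (y \<otimes> ?u)) (Comp L \<phi>0 (dx Q P (y \<otimes> inv ?v)))"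
    proof -
      have e1: "(\<Psi> ^^ (p ^ i)) (dx P Q ?u) = dx P Q (y \<otimes> ?u)" using iter_dx[OF PO QO tu] P_it ps_Q ps_u by simp
      have "ps i (inv ?v) = inv (y \<otimes> ?v)" using iter_inv(1)[OF vS(1)] ps_v by simp
      also have "\<dots> = y \<otimes> inv ?v" using yS vS iy ycomm by (simp add: inv_mult_group)
      finally have e2: "(\<Psi> ^^ (p ^ i)) (dx Q P (inv ?v)) = dx Q P (y \<otimes> inv ?v)" using iter_dx[OF QO PO tv] P_it ps_Q by simp
      show ?thesis using iter_Comp[OF QO PO QO \<chi> du(1)] iter_Comp[OF QO PO PO dv(1) \<phi>0(1)] e1 e2 \<phi>0_it by simp
    qed
    also have "dx P Q (y \<otimes> ?u) = Comp L (dx P Q ?u) (delta L P y)"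
      using dx_comp[OF PO PO QO dx_delta(2)[OF PO yP] tu] dx_delta(1)[OF PO yP] ycomm[OF vS(2)] by simp
    also have "dx Q P (y \<otimes> inv ?v) = Comp L (delta L P y) (dx Q P (inv ?v))"
      using dx_comp[OF QO PO PO tv dx_delta(2)[OF PO yP]] dx_delta(1)[OF PO yP] by simp
    also have "Comp L (Comp L (dx P Q ?u) (delta L P y)) (Comp L \<phi>0 (Comp L (delta L P y) (dx Q P (inv ?v)))) = ?\<phi>"
    proof -
      note d = delta(1)[OF PO yP]
      have "Comp L \<phi>0 (Comp L (delta L P y) (dx Q P (inv ?v))) = Comp L (Comp L \<phi>0 (delta L P y)) (dx Q P (inv ?v))"
        by (rule category_laws(5)[OF QO PO PO PO dv(1) d \<phi>0(1)])
      also have "\<dots> = Comp L (Comp L (delta L P y) \<phi>0) (dx Q P (inv ?v))" using C[OF PO PO \<phi>0(1) yP] \<phi>0y by simp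
      also have "\<dots> = Comp L (delta L P y) ?\<chi>" by (rule category_laws(5)[OF QO PO PO PO dv(1) \<phi>0(1) d, symmetric])
      finally have 1: "Comp L \<phi>0 (Comp L (delta L P y) (dx Q P (inv ?v))) = Comp L (delta L P y) ?\<chi>" .
      have 2: "Comp L (delta L P y) (Comp L (delta L P y) ?\<chi>) = ?\<chi>"
        using category_laws(5)[OF QO PO PO PO \<chi> d d] delta(2)[OF PO yP yP] yy delta_one[OF PO] category_laws(3)[OF QO PO \<chi>] by simp
      have "Comp L (Comp L (dx P Q ?u) (delta L P y)) (Comp L (delta L P y) ?\<chi>) = Comp L (dx P Q ?u) (Comp L (delta L P y) (Comp L (delta L P y) ?\<chi>))"
        by (rule category_laws(5)[OF QO PO PO QO category_laws(4)[OF QO PO PO \<chi> d] d du(1), symmetric])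
      then show ?thesis using 1 2 by simp
    qed
    finally have fixed: "?\<phi> \<in> fixed_mor p L \<Psi> i Q Q" using \<phi> by (simp add: fixed_mor_def op_iter_eq)
    have "Q \<in> Det i"
    proof -
      have PsS: "P \<subseteq> carrier S" using PS by blast
      have Qcen: "centric S F Q" using QO Ob_iff by simp
      have "small P \<or> T \<subseteq> P" using Pl linking_bullet_iff by blast
      then have "small Q \<or> T \<subseteq> Q"
        using small_cj[OF vS(2) PsS] cj_T[OF vS(2)] unfolding Qu by (metis image_mono)
      \<comment> \<open>Conjugation by \<open>?u\<close> commutes with \<open>ps i\<close> although
        \<open>?u\<close> itself need not be fixed, again because y is central.\<close>
      moreover have "Q \<inter> fx i = cj ?u ` (P \<inter> fx i)"
      proof -
        have "cj ?u x \<in> fx i \<longleftrightarrow> x \<in> fx i" if "x \<in> P" for x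
        proof -
          have xS: "x \<in> carrier S" using PS that by blast
          have "ps i (cj ?u x) = cj ?u (ps i x)"
            using iter_cj[OF vS(2) xS] ps_u vS yS ycj xS iter_hom(1)[OF xS] by (simp add: conjugate_comp)
          then show ?thesis using xS vS(2) iter_hom(1)[OF xS] by (simp add: fx_iff)
        qed
        then show ?thesis unfolding Qu by blast
      qed
      then have "bullet p S F (Q \<inter> fx i) = cj ?u ` bullet p S F (P \<inter> fx i)"
        using bullet_cj[OF vS(2), of "P \<inter> fx i"] PsS by auto
      then have "determined p S F \<psi> i Q" using H(5)[OF P, of i] Qu by (simp add: determined_def)
      ultimately show ?thesis using Qcen by (simp add: Det_iff linking_bullet_iff)
    qed
    then show ?thesis using fixed rho Q_def by blast
  qed
  show ?thesis using eventually_conj[OF eventually_fx[OF g] eventually_fx[OF kS]]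
    by (rule eventually_mono) (use main in blast)
qed

section \<open>Eventually fixed morphisms\<close>

abbreviation "FR i \<equiv> fixed_restrictions p S F L \<psi> \<Psi> i"

lemma FR_iff:
  "f \<in> FR i H K \<longleftrightarrow> (\<exists>\<phi> P R. f = restrict (rho L \<phi>) H \<and> P \<in> Det i \<and> R \<in> Det i \<and> \<phi> \<in> fixed_mor p L \<Psi> i P R \<and>
      subgroup H S \<and> H \<subseteq> P \<inter> fx i \<and> subgroup K S \<and> K \<subseteq> R \<inter> fx i \<and> rho L \<phi> ` H \<subseteq> K)"
  unfolding fixed_restrictions_def by blast

lemma fixed_mor_rho:
  assumes "P \<in> Det i" "R \<in> Det i" "\<phi> \<in> fixed_mor p L \<Psi> i P R" 
  shows "rho L \<phi> \<in> E P" "\<phi> \<in> Mor L P R" "x \<in> P \<Longrightarrow> x \<in> fx i \<Longrightarrow> rho L \<phi> x \<in> R \<inter> fx i"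
proof -
  note O = Det_Ob[OF assms(1)] Det_Ob[OF assms(2)]
  show \<phi>: "\<phi> \<in> Mor L P R" using assms(3) by (simp add: fixed_mor_def)
  then show "rho L \<phi> \<in> E P" using rho_hom(2) O by blast
  show "rho L \<phi> x \<in> R \<inter> fx i" if x: "x \<in> P" "x \<in> fx i"
  proof -
    have "rho L \<phi> x \<in> R" by (rule rho_hom(1)[OF O \<phi> x(1)])
    moreover have "ps i (rho L \<phi> x) = rho L \<phi> x"
      using iter_rho[OF O \<phi> x(1), of "p ^ i"] assms(3) x(2) by (simp add: fixed_mor_def fx_iff op_iter_eq)
    ultimately show ?thesis using sub_mem[OF Ob_subgroup[OF O(2)]] by (simp add: fx_iff)
  qed
qed

lemma FR_sub:
  assumes "f \<in> FR i H K"
  shows "subgroup H S" "subgroup K S" "H \<subseteq> fx i" "K \<subseteq> fx i" "f ` H \<subseteq> K" "f \<in> E H"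
proof -
  obtain \<phi> P R where *: "f = restrict (rho L \<phi>) H" "P \<in> Det i" "R \<in> Det i" "\<phi> \<in> fixed_mor p L \<Psi> i P R"
      "subgroup H S" "H \<subseteq> P \<inter> fx i" "subgroup K S" "K \<subseteq> R \<inter> fx i" "rho L \<phi> ` H \<subseteq> K"
    using assms unfolding FR_iff by (elim exE conjE)
  show "subgroup H S" "subgroup K S" "H \<subseteq> fx i" "K \<subseteq> fx i" "f ` H \<subseteq> K" using * by auto
  show "f \<in> E H" unfolding *(1)
    using E_restrict[OF Ob_subgroup[OF Det_Ob[OF *(2)]] fixed_mor_rho(1)[OF *(2,3,4)] *(5)] *(6) by blast
qed

lemma FR_restrict:
  assumes f: "f \<in> FR i H K" and H': "subgroup H' S" "H' \<subseteq> H"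
  shows "restrict f H' \<in> FR i H' (f ` H')"
proof -
  obtain \<phi> P R where *: "f = restrict (rho L \<phi>) H" "P \<in> Det i" "R \<in> Det i" "\<phi> \<in> fixed_mor p L \<Psi> i P R"
      "subgroup H S" "H \<subseteq> P \<inter> fx i" "subgroup K S" "K \<subseteq> R \<inter> fx i" "rho L \<phi> ` H \<subseteq> K"
    using f unfolding FR_iff by (elim exE conjE)
  have r: "restrict f H' \<in> E H'" by (rule E_restrict[OF FR_sub(1,6)[OF f] H'])
  have "subgroup (f ` H') S" using E_image_subgroup[OF H'(1) r] by (metis image_restrict_eq)
  moreover have "restrict f H' = restrict (rho L \<phi>) H'" using *(1) H'(2) by (simp add: Int_absorb1)
  moreover have "f ` H' = rho L \<phi> ` H'" using *(1) H'(2) by (intro image_cong) auto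
  moreover have "f ` H' \<subseteq> R \<inter> fx i" "H' \<subseteq> P \<inter> fx i" using FR_sub(5)[OF f] H'(2) * by blast+
  ultimately show ?thesis unfolding FR_iff using *(2-4) H'(1) by blast
qed

lemma composite_sub:
  assumes "composite (FR i) H K f"
  shows "subgroup H S" "subgroup K S" "H \<subseteq> fx i" "K \<subseteq> fx i" "f ` H \<subseteq> K" "f \<in> E H"
  using assms
proof (induction)
  case (base f H K)
  { case 1 show ?case by (rule FR_sub(1)[OF base]) }
  { case 2 show ?case by (rule FR_sub(2)[OF base]) }
  { case 3 show ?case by (rule FR_sub(3)[OF base]) }
  { case 4 show ?case by (rule FR_sub(4)[OF base]) }
  { case 5 show ?case by (rule FR_sub(5)[OF base]) }
  { case 6 show ?case by (rule FR_sub(6)[OF base]) }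
next
  case (step H K f g J)
  note g = FR_sub[OF step.hyps(2)]
  { case 1 show ?case by (rule step.IH) }
  { case 2 show ?case by (rule g(2)) }
  { case 3 show ?case by (rule step.IH) }
  { case 4 show ?case by (rule g(4)) }
  { case 5 show ?case using step.IH(5) g(5) by (auto simp: compose_def) }
  { case 6 show ?case by (rule E_compose[OF step.IH(1,6) g(1,6) step.IH(5)]) }
qed

lemma composite_restrict:
  assumes "composite (FR i) H K f" "subgroup H' S" "H' \<subseteq> H"
  shows "composite (FR i) H' (f ` H') (restrict f H')"
  using assms(1,3)
proof (induction)
  case (base f H K)
  then show ?case using FR_restrict assms(2) by (blast intro: composite.base)
next
  case (step H K f g J)
  have r: "restrict f H' \<in> E H'"
    by (rule E_restrict[OF composite_sub(1,6)[OF step.hyps(1)] assms(2) step.prems])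
  have sf: "subgroup (f ` H') S" using E_image_subgroup[OF assms(2) r] by (metis image_restrict_eq)
  have fK: "f ` H' \<subseteq> K" using composite_sub(5)[OF step.hyps(1)] step.prems by blast
  have "composite (FR i) H' (g ` f ` H') (compose H' (restrict g (f ` H')) (restrict f H'))"
    by (rule composite.step[OF step.IH[OF step.prems] FR_restrict[OF step.hyps(2) sf fK]])
  moreover have "compose H' (restrict g (f ` H')) (restrict f H') = restrict (compose H g f) H'"
    using step.prems by (auto simp: compose_def Int_absorb1 intro!: restrict_ext)
  moreover have "g ` f ` H' = compose H g f ` H'" unfolding image_image
    by (rule image_cong) (use step.prems in \<open>auto simp: compose_def\<close>)
  ultimately show ?case by (simp only:)
qed

lemma composite_trans:
  assumes "composite (FR i) K J g" "composite (FR i) H K f"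
  shows "composite (FR i) H J (compose H g f)"
  using assms
proof (induction)
  case (base g K J)
  then show ?case by (blast intro: composite.step)
next
  case (step K J g h J')
  have fK: "f \<in> H \<rightarrow> K" using composite_sub(5)[OF step.prems] by blast
  have "composite (FR i) H J' (compose H h (compose H g f))"
    by (rule composite.step[OF step.IH[OF step.prems] step.hyps(2)])
  moreover have "compose H h (compose H g f) = compose H (compose K h g) f"
    using fK by (auto simp: compose_def intro!: restrict_ext)
  ultimately show ?case by simp
qed

text \<open>S is \<open>S\<^sub>i\<close>-determined, and \<open>\<Psi>\<^sub>i\<close> fixes the
  lift \<open>delta L (carrier S) s\<close> of conjugation by a fixed element s.\<close>

lemma FR_conj:
  assumes H: "subgroup H S" "H \<subseteq> fx i" and K: "subgroup K S" "K \<subseteq> fx i" and s: "s \<in> fx i" "cj s ` H \<subseteq> K"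
  shows "restrict (cj s) H \<in> FR i H K"
proof -
  have sS: "s \<in> carrier S" using s by (simp add: fx_iff)
  have ps: "ps i s = s" using s by (simp add: fx_iff)
  let ?\<phi> = "delta L (carrier S) s"
  note d = delta[OF S_Ob]
  have bij: "bij_betw (\<psi> ^^ (p ^ i)) (carrier S) (carrier S)" by (rule bij_betw_funpow[OF psi(1)])
  have "(\<Psi> ^^ (p ^ i)) (dx (carrier S) (carrier S) s) = dx (carrier S) (carrier S) s"
    using iter_dx[OF S_Ob S_Ob dx_delta(2)[OF S_Ob sS]] bij ps by (simp add: bij_betw_def)
  then have "?\<phi> \<in> fixed_mor p L \<Psi> i (carrier S) (carrier S)"
    using d(1)[OF sS] dx_delta(1)[OF S_Ob sS] by (simp add: fixed_mor_def op_iter_eq)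
  moreover have "rho L ?\<phi> x = cj s x" if "x \<in> H" for x using d(3)[OF sS] sub_mem[OF H(1) that] by simp
  then have "restrict (cj s) H = restrict (rho L ?\<phi>) H" "rho L ?\<phi> ` H \<subseteq> K"
    using s(2) by (auto intro!: restrict_ext)
  moreover have "H \<subseteq> carrier S \<inter> fx i" "K \<subseteq> carrier S \<inter> fx i" using H K by (auto dest: sub_mem)
  ultimately show ?thesis unfolding FR_iff using S_Det H(1) K(1) by blast
qed

text \<open>The map \<open>\<tau>\<inverse> f \<tau>\<close> on \<open>\<tau>\<inverse> P \<tau> \<inter> S\<^sub>i\<close>.\<close>

definition twist_dom :: "nat \<Rightarrow> 'a \<Rightarrow> 'a set \<Rightarrow> 'a set" where
  "twist_dom i \<tau> P = {x \<in> fx i. cj \<tau> x \<in> P}"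

definition twist :: "'a \<Rightarrow> ('a \<Rightarrow> 'a) \<Rightarrow> 'a \<Rightarrow> 'a" where
  "twist \<tau> f x = cj (inv \<tau>) (f (cj \<tau> x))"

text \<open>With the exact image as target, a further map can be restricted to it and
  composed.\<close>

definition twisted_in :: "nat \<Rightarrow> 'a \<Rightarrow> ('a \<Rightarrow> 'a) \<Rightarrow> 'a set \<Rightarrow> bool" where
  "twisted_in i \<tau> f P \<longleftrightarrow>
    composite (FR i) (twist_dom i \<tau> P) (twist \<tau> f ` twist_dom i \<tau> P) (restrict (twist \<tau> f) (twist_dom i \<tau> P))"

lemma twist_dom_subgroup:
  assumes "subgroup P S" "\<tau> \<in> carrier S" shows "subgroup (twist_dom i \<tau> P) S"
proof (rule subgroupI)
  note fs = fx_subgroup[of i]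
  note fm = sub_mem[OF fs]
  show "twist_dom i \<tau> P \<subseteq> carrier S" using fm by (auto simp: twist_dom_def)
  have "\<one> \<in> twist_dom i \<tau> P" using subgroup.one_closed[OF fs] subgroup.one_closed[OF assms(1)] assms(2) by (simp add: twist_dom_def)
  then show "twist_dom i \<tau> P \<noteq> {}" by blast
  show "inv a \<in> twist_dom i \<tau> P" if "a \<in> twist_dom i \<tau> P" for a
    using that assms fm by (auto simp: twist_dom_def conjugate_inv subgroup.m_inv_closed[OF fs] subgroup.m_inv_closed[OF assms(1)])
  show "a \<otimes> b \<in> twist_dom i \<tau> P" if "a \<in> twist_dom i \<tau> P" "b \<in> twist_dom i \<tau> P" for a b
    using that assms fm by (auto simp: twist_dom_def conjugate_mult subgroup.m_closed[OF fs] subgroup.m_closed[OF assms(1)])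
qed

lemma twisted_in_cong:
  assumes "\<And>x. x \<in> P \<Longrightarrow> f x = g x" "twisted_in i \<tau> f P" shows "twisted_in i \<tau> g P"
proof -
  have e: "twist \<tau> f x = twist \<tau> g x" if "x \<in> twist_dom i \<tau> P" for x using that assms(1) by (simp add: twist_dom_def twist_def)
  have "twist \<tau> f ` twist_dom i \<tau> P = twist \<tau> g ` twist_dom i \<tau> P" by (rule image_cong) (use e in auto)
  moreover have "restrict (twist \<tau> f) (twist_dom i \<tau> P) = restrict (twist \<tau> g) (twist_dom i \<tau> P)" using e by (auto intro!: restrict_ext)
  ultimately show ?thesis using assms(2) by (simp add: twisted_in_def)
qed

lemma twisted_in_restrict:
  assumes "twisted_in i \<tau> f P" "subgroup P' S" "P' \<subseteq> P" "\<tau> \<in> carrier S"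
  shows "twisted_in i \<tau> f P'"
proof -
  have sub: "twist_dom i \<tau> P' \<subseteq> twist_dom i \<tau> P" using assms(3) by (auto simp: twist_dom_def)
  let ?h = "restrict (twist \<tau> f) (twist_dom i \<tau> P)"
  have "composite (FR i) (twist_dom i \<tau> P') (?h ` twist_dom i \<tau> P') (restrict ?h (twist_dom i \<tau> P'))"
    using composite_restrict assms(1) twist_dom_subgroup[OF assms(2,4)] sub unfolding twisted_in_def by blast
  moreover have "?h ` twist_dom i \<tau> P' = twist \<tau> f ` twist_dom i \<tau> P'" by (rule image_cong) (use sub in auto)
  moreover have "restrict ?h (twist_dom i \<tau> P') = restrict (twist \<tau> f) (twist_dom i \<tau> P')" using sub by (simp add: Int_absorb1)
  ultimately show ?thesis by (simp add: twisted_in_def)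
qed

lemma twisted_in_compose:
  assumes P: "subgroup P S" and f: "\<And>x. x \<in> P \<Longrightarrow> f x \<in> carrier S" and \<tau>: "\<tau> \<in> carrier S"
    and tf: "twisted_in i \<tau> f P" and tg: "twisted_in i \<tau> g (f ` P)"
  shows "twisted_in i \<tau> (\<lambda>x. g (f x)) P"
proof -
  let ?H = "twist_dom i \<tau> P" and ?H' = "twist_dom i \<tau> (f ` P)"
  let ?K = "twist \<tau> f ` ?H"
  have K: "subgroup ?K S" "?K \<subseteq> fx i" using composite_sub(2,4) tf unfolding twisted_in_def by blast+
  have inner: "cj \<tau> (twist \<tau> f x) = f (cj \<tau> x)" if "x \<in> ?H" for x
    using that f \<tau> by (auto simp: twist_def twist_dom_def)
  have KH: "?K \<subseteq> ?H'"
  proof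
    fix y assume "y \<in> ?K"
    then obtain x where x: "x \<in> ?H" "y = twist \<tau> f x" by blast
    then have "cj \<tau> y \<in> f ` P" using inner[OF x(1)] by (auto simp: twist_dom_def)
    then show "y \<in> ?H'" using \<open>y \<in> ?K\<close> K(2) by (auto simp: twist_dom_def)
  qed
  let ?h = "restrict (twist \<tau> g) ?H'"
  have "composite (FR i) ?K (?h ` ?K) (restrict ?h ?K)"
    using composite_restrict[OF _ K(1) KH] tg unfolding twisted_in_def by blast
  then have "composite (FR i) ?H (?h ` ?K) (compose ?H (restrict ?h ?K) (restrict (twist \<tau> f) ?H))"
    using composite_trans tf unfolding twisted_in_def by blast
  moreover have comp: "twist \<tau> g (twist \<tau> f x) = twist \<tau> (\<lambda>x. g (f x)) x" if "x \<in> ?H" for x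
    using inner[OF that] by (simp add: twist_def)
  have "compose ?H (restrict ?h ?K) (restrict (twist \<tau> f) ?H) = restrict (twist \<tau> (\<lambda>x. g (f x))) ?H"
    unfolding compose_def by (rule restrict_ext) (use KH comp in auto)
  moreover have "?h ` ?K = twist \<tau> (\<lambda>x. g (f x)) ` ?H" unfolding image_image
    by (rule image_cong) (use KH comp in auto)
  ultimately show ?thesis by (simp add: twisted_in_def)
qed

text \<open>The element \<open>z\<close> is \<open>\<one>\<close> or the involution of a noncentral torus. Twisting by \<open>\<tau>\<close> with
  \<open>\<Psi>\<^sub>i(\<tau>) = \<tau> z\<close> preserves the fixed morphisms that fix \<open>z\<close>.\<close>

definition admissible :: "'a \<Rightarrow> bool" where
  "admissible z \<longleftrightarrow> z = \<one> \<or> (noncentral \<and> z = invol)"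

lemma admissible:
  assumes "admissible z"
  shows "z \<in> T" "z \<otimes> z = \<one>" "inv z = z" "g \<in> carrier S \<Longrightarrow> cj g z = z" "z \<noteq> \<one> \<Longrightarrow> noncentral \<and> p = 2 \<and> z = invol"
  using assms invol[OF noncentral_p] noncentral_p by (auto simp: admissible_def)

text \<open>The inverse is carried along because composites of restrictions are not closed under
  inverses by definition, while conjugacy in F_i asks for isomorphisms. The bound on i precedes the
  choice of \<tau>, so one bound serves all \<tau>.\<close>

definition eventually_twisted :: "'a \<Rightarrow> ('a \<Rightarrow> 'a) \<Rightarrow> 'a set \<Rightarrow> bool" where
  "eventually_twisted z f P \<longleftrightarrow> eventually (\<lambda>i. \<forall>\<tau>\<in>twisting i z. twisted_in i \<tau> f P \<and> twisted_in i \<tau> (inv_into P f) (f ` P)) sequentially"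

lemma twisting_carrier: "\<tau> \<in> twisting i z \<Longrightarrow> \<tau> \<in> carrier S" by (simp add: twisting_def)

lemma eventually_twisted_cong:
  assumes "\<And>x. x \<in> P \<Longrightarrow> f x = g x" "eventually_twisted z f P" shows "eventually_twisted z g P"
proof -
  have im: "f ` P = g ` P" by (rule image_cong) (use assms in auto)
  have "inv_into P f = inv_into P g" using assms(1) by (auto simp: inv_into_def fun_eq_iff intro!: arg_cong[where f = Eps])
  then show ?thesis using assms(2) twisted_in_cong[of P f g] assms(1) im unfolding eventually_twisted_def by (auto elim!: eventually_mono)
qed

lemma eventually_twisted_inverse:
  assumes "inj_on f P" "eventually_twisted z f P" shows "eventually_twisted z (inv_into P f) (f ` P)"
proof -
  have 1: "inv_into P f ` f ` P = P" using assms(1) by (simp add: inv_into_image_cancel)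
  have 2: "f x = inv_into (f ` P) (inv_into P f) x" if "x \<in> P" for x
  proof -
    have "inj_on (inv_into P f) (f ` P)" by (rule inj_on_inv_into) simp
    moreover have "inv_into P f (f x) = x" using assms(1) that by simp
    ultimately show ?thesis using that by (metis imageI inv_into_f_eq)
  qed
  show ?thesis using assms(2) twisted_in_cong[of P f "inv_into (f ` P) (inv_into P f)"] 2 unfolding eventually_twisted_def 1
    by (auto elim!: eventually_mono)
qed

lemma eventually_twisted_compose:
  assumes P: "subgroup P S" and f: "f \<in> E P" and g: "g \<in> E (f ` P)" and ev: "eventually_twisted z f P" "eventually_twisted z g (f ` P)"
  shows "eventually_twisted z (\<lambda>x. g (f x)) P"
proof -
  let ?Q = "f ` P"
  have Q: "subgroup ?Q S" by (rule E_image_subgroup[OF P f])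
  have fP: "inj_on f P" "\<And>x. x \<in> P \<Longrightarrow> f x \<in> carrier S" using E_hom[OF P f] by auto
  have gQ: "inj_on g ?Q" using E_hom(3)[OF Q g] .
  have R: "subgroup (g ` ?Q) S" by (rule E_image_subgroup[OF Q g])
  have im: "(\<lambda>x. g (f x)) ` P = g ` ?Q" by (simp add: image_image)
  have ig: "inv_into ?Q g ` g ` ?Q = ?Q" using gQ by (simp add: inv_into_image_cancel)
  have inj: "inj_on (\<lambda>x. g (f x)) P" using comp_inj_on[OF fP(1) gQ] by (simp add: comp_def)
  have inv: "inv_into P f (inv_into ?Q g y) = inv_into P (\<lambda>x. g (f x)) y" if y: "y \<in> g ` ?Q" for y
  proof -
    obtain x where x: "x \<in> P" "y = g (f x)" using y by blast
    then show ?thesis using fP(1) gQ inv_into_f_f[OF inj x(1)] by simp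
  qed
  have "eventually (\<lambda>i. (\<forall>\<tau>\<in>twisting i z. twisted_in i \<tau> f P \<and> twisted_in i \<tau> (inv_into P f) ?Q) \<and>
      (\<forall>\<tau>\<in>twisting i z. twisted_in i \<tau> g ?Q \<and> twisted_in i \<tau> (inv_into ?Q g) (g ` ?Q))) sequentially"
    using ev unfolding eventually_twisted_def by (rule eventually_conj)
  then show ?thesis unfolding eventually_twisted_def
  proof (rule eventually_mono, intro ballI conjI)
    fix i \<tau> assume a: "(\<forall>\<tau>\<in>twisting i z. twisted_in i \<tau> f P \<and> twisted_in i \<tau> (inv_into P f) ?Q) \<and>
      (\<forall>\<tau>\<in>twisting i z. twisted_in i \<tau> g ?Q \<and> twisted_in i \<tau> (inv_into ?Q g) (g ` ?Q))" and \<tau>: "\<tau> \<in> twisting i z"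
    note \<tau>S = twisting_carrier[OF \<tau>]
    show "twisted_in i \<tau> (\<lambda>x. g (f x)) P" by (rule twisted_in_compose[OF P fP(2) \<tau>S]) (use a \<tau> in auto)
    have "twisted_in i \<tau> (\<lambda>y. inv_into P f (inv_into ?Q g y)) (g ` ?Q)"
      by (rule twisted_in_compose[OF R _ \<tau>S]) (use a \<tau> ig sub_mem[OF Q] in \<open>auto simp: inv_into_into\<close>)
    then have "twisted_in i \<tau> (inv_into P (\<lambda>x. g (f x))) (g ` ?Q)" by (rule twisted_in_cong[rotated]) (rule inv)
    then show "twisted_in i \<tau> (inv_into P (\<lambda>x. g (f x))) ((\<lambda>x. g (f x)) ` P)" unfolding im .
  qed
qed

lemma eventually_twisted_extend:
  assumes P: "subgroup P S" "subgroup P' S" "P \<subseteq> P'" and g: "g \<in> E P'" "\<And>x. x \<in> P \<Longrightarrow> g x = f x" and ev: "eventually_twisted z g P'"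
  shows "eventually_twisted z f P"
proof -
  have im: "g ` P = f ` P" by (rule image_cong) (use g in auto)
  have rg: "restrict g P \<in> E P" by (rule E_restrict[OF P(2) g(1) P(1,3)])
  have sf: "subgroup (f ` P) S" using E_image_subgroup[OF P(1) rg] im by simp
  have inj: "inj_on g P'" by (rule E_hom(3)[OF P(2) g(1)])
  then have injf: "inj_on f P" using g(2) P(3) by (metis inj_on_cong inj_on_subset)
  have inv: "inv_into P' g y = inv_into P f y" if y: "y \<in> f ` P" for y
  proof -
    obtain x where x: "x \<in> P" "y = f x" using y by blast
    then have "x \<in> P'" "y = g x" using P(3) g(2) by auto
    then show ?thesis using inv_into_f_f[OF inj] inv_into_f_f[OF injf x(1)] x by simp
  qed
  have sub: "f ` P \<subseteq> g ` P'" using im P(3) by blast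
  show ?thesis using ev unfolding eventually_twisted_def
  proof (rule eventually_mono, intro ballI conjI)
    fix i \<tau> assume a: "\<forall>\<tau>\<in>twisting i z. twisted_in i \<tau> g P' \<and> twisted_in i \<tau> (inv_into P' g) (g ` P')" and \<tau>: "\<tau> \<in> twisting i z"
    note \<tau>S = twisting_carrier[OF \<tau>]
    have "twisted_in i \<tau> g P" using twisted_in_restrict a \<tau> P(1,3) \<tau>S by blast
    then show "twisted_in i \<tau> f P" using twisted_in_cong g(2) by blast
    have "twisted_in i \<tau> (inv_into P' g) (f ` P)" using twisted_in_restrict a \<tau> sf sub \<tau>S by blast
    then show "twisted_in i \<tau> (inv_into P f) (f ` P)" using twisted_in_cong inv by blast
  qed
qed

lemma eventually_twisted_base:
  assumes z: "admissible z" and R: "R \<in> linking_bullet_ob p S F" and \<alpha>: "\<alpha> \<in> E R" "\<alpha> ` R = R" "z \<in> R" "\<alpha> z = z"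
  shows "eventually_twisted z \<alpha> R"
proof -
  have sR: "subgroup R S" using R linking_bullet_iff by (simp add: centric_def)
  have one: "eventually (\<lambda>i. \<forall>\<tau>\<in>twisting i z. twisted_in i \<tau> \<beta> R) sequentially" if \<beta>: "\<beta> \<in> E R" "\<beta> ` R = R" "\<beta> z = z" for \<beta>

  proof (rule eventually_mono[OF twisted_lift[OF R \<beta>(1,2) \<alpha>(3) \<beta>(3) admissible(2)[OF z]]])
    show "cj g z = z" if "g \<in> carrier S" for g using admissible(4)[OF z that] .
  next
    fix i assume a: "\<forall>\<tau>\<in>twisting i z. \<exists>Q \<phi>. Q = cj (inv \<tau>) ` R \<and> Q \<in> Det i \<and> \<phi> \<in> fixed_mor p L \<Psi> i Q Q \<and>
      (\<forall>x\<in>Q. rho L \<phi> x = cj (inv \<tau>) (\<beta> (cj \<tau> x)))"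
    show "\<forall>\<tau>\<in>twisting i z. twisted_in i \<tau> \<beta> R"
    proof
    fix \<tau> assume \<tau>: "\<tau> \<in> twisting i z"
    note \<tau>S = twisting_carrier[OF \<tau>]
    obtain Q \<phi> where Q: "Q = cj (inv \<tau>) ` R" "Q \<in> Det i" "\<phi> \<in> fixed_mor p L \<Psi> i Q Q"
      "\<forall>x\<in>Q. rho L \<phi> x = cj (inv \<tau>) (\<beta> (cj \<tau> x))" using bspec[OF a \<tau>] by (elim exE conjE)
    let ?H = "twist_dom i \<tau> R"
    have H: "subgroup ?H S" "?H \<subseteq> Q \<inter> fx i"
    proof -
      show "subgroup ?H S" by (rule twist_dom_subgroup[OF sR \<tau>S])
      show "?H \<subseteq> Q \<inter> fx i"
      proof
        fix x assume x: "x \<in> ?H"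
        then have "x \<in> carrier S" "cj \<tau> x \<in> R" by (auto simp: twist_dom_def fx_iff)
        then have "x \<in> Q" unfolding Q(1) using \<tau>S by (metis conjugate_cancel(1) imageI)
        then show "x \<in> Q \<inter> fx i" using x by (simp add: twist_dom_def)
      qed
    qed
    have e: "rho L \<phi> x = twist \<tau> \<beta> x" if "x \<in> ?H" for x using Q(4) H(2) that unfolding twist_def by blast
    have im: "rho L \<phi> ` ?H = twist \<tau> \<beta> ` ?H" by (rule image_cong) (use e in auto)
    have sub: "twist \<tau> \<beta> ` ?H \<subseteq> Q \<inter> fx i"
      unfolding im[symmetric] using fixed_mor_rho(3)[OF Q(2,2,3)] H(2) by blast
    have rE: "restrict (rho L \<phi>) ?H \<in> E ?H"
      using E_restrict[OF Ob_subgroup[OF Det_Ob[OF Q(2)]] fixed_mor_rho(1)[OF Q(2,2,3)] H(1)] H(2) by blast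
    have sK: "subgroup (twist \<tau> \<beta> ` ?H) S" using E_image_subgroup[OF H(1) rE] im by (metis image_restrict_eq)
    have "restrict (twist \<tau> \<beta>) ?H = restrict (rho L \<phi>) ?H" using e by (auto intro!: restrict_ext)
    then have "restrict (twist \<tau> \<beta>) ?H \<in> FR i ?H (twist \<tau> \<beta> ` ?H)"
      unfolding FR_iff using Q(2,3) H sK sub im by blast
    then show "twisted_in i \<tau> \<beta> R" unfolding twisted_in_def by (rule composite.base)
    qed
  qed
  have inj: "inj_on \<alpha> R" by (rule E_hom(3)[OF sR \<alpha>(1)])
  let ?i = "restrict (inv_into R \<alpha>) R"
  have "?i \<in> E R" using E_inverse[OF sR \<alpha>(1)] \<alpha>(2) by simp
  moreover have "?i ` R = R" using inv_into_image_cancel[OF inj, of R] \<alpha>(2) by simp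
  moreover have "?i z = z" using inv_into_f_f[OF inj \<alpha>(3)] \<alpha>(3,4) by simp
  ultimately have "eventually (\<lambda>i. \<forall>\<tau>\<in>twisting i z. twisted_in i \<tau> ?i R) sequentially" by (rule one)
  then have inv: "eventually (\<lambda>i. \<forall>\<tau>\<in>twisting i z. twisted_in i \<tau> (inv_into R \<alpha>) R) sequentially"
    by (rule eventually_mono) (use twisted_in_cong[of R ?i "inv_into R \<alpha>"] in auto)
  show ?thesis unfolding eventually_twisted_def \<alpha>(2)
    using eventually_conj[OF one[OF \<alpha>(1,2,4)] inv] by (rule eventually_mono) blast
qed

text \<open>Inherited by all larger subgroups. For admissible z, a relevant P that does not contain
  T occurs only with a noncentral torus, where morphisms on finite subgroups that are not small
  extend to the product with T.\<close>

definition relevant :: "'a \<Rightarrow> 'a set \<Rightarrow> bool" where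
  "relevant z P \<longleftrightarrow> subgroup P S \<and> z \<in> P \<and> (T \<subseteq> P \<or> z \<noteq> \<one>)"

lemma fixes_z_normalizer:
  assumes "admissible z" "relevant z P" "g \<in> E (normalizer S P)" shows "g z = z"
proof (cases "z = \<one>")
  case True
  have "P \<subseteq> carrier S" using assms(2) sub_mem by (auto simp: relevant_def)
  then show ?thesis using E_one[OF subgroup_normalizer assms(3)] True by simp
next
  case False
  then have a: "p = 2" "z = invol" using admissible(5)[OF assms(1)] by blast+
  have "subgroup P S" "z \<in> P" using assms(2) by (simp_all add: relevant_def)
  then show ?thesis unfolding a(2) using involution_fixed[OF a(1)] assms(3) by blast
qed

definition small_card_bound :: nat where
  "small_card_bound = (SOME N. \<forall>X. subgroup X S \<longrightarrow> small X \<longrightarrow> card X \<le> N)"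

lemma small_card_bound: "subgroup X S \<Longrightarrow> small X \<Longrightarrow> card X \<le> small_card_bound"
proof -
  obtain B where B: "finite B" "\<forall>X. subgroup X S \<longrightarrow> small X \<longrightarrow> X \<inter> T \<subseteq> B" using small_bounded by blast
  have "\<forall>X. subgroup X S \<longrightarrow> small X \<longrightarrow> card X \<le> card B * torus_index"
  proof (intro allI impI)
    fix X assume X: "subgroup X S" "small X"
    then have XB: "X \<inter> T \<subseteq> B" using B(2) by blast
    have "card X \<le> card (X \<inter> T) * torus_index" by (rule card_subgroup_le(2)[OF X(1) finite_subset[OF XB B(1)]])
    also have "\<dots> \<le> card B * torus_index" using card_mono[OF B(1) XB] by simp
    finally show "card X \<le> card B * torus_index" .
  qed
  then have "\<forall>X. subgroup X S \<longrightarrow> small X \<longrightarrow> card X \<le> small_card_bound" unfolding small_card_bound_def by (rule someI)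
  then show "subgroup X S \<Longrightarrow> small X \<Longrightarrow> card X \<le> small_card_bound" by blast
qed

text \<open>The induction parameter of Alperin's theorem, which drops on passing to a normalizer.\<close>

definition depth :: "'a set \<Rightarrow> nat" where
  "depth P = (if T \<subseteq> P then torus_index - card ((\<lambda>x. T #> x) ` P) else if small P then Suc (Suc torus_index) + (small_card_bound - card P) else Suc torus_index)"

text \<open>The cases of \<open>depth\<close> have disjoint ranges: at most
  \<open>torus_index\<close> if T is in P, one more if P is neither small nor contains T, and above
  that for small P. In the first and the last range a larger subgroup has smaller depth. The middle
  value is constant; such P are left to the extension to P T.\<close>

lemma depth_less:
  assumes P: "subgroup P S" "T \<subseteq> P \<or> small P" and k: "k \<in> E P" and Y: "subgroup Y S" "k ` P \<subseteq> Y" "k ` P \<noteq> Y"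
  shows "depth Y < depth P"
proof -
  let ?Q = "k ` P"
  have Q: "subgroup ?Q S" by (rule E_image_subgroup[OF P(1) k])
  show ?thesis
  proof (cases "T \<subseteq> P")
    case True
    then have TQ: "T \<subseteq> ?Q" using E_T(1)[OF P(1) k] by blast
    then have TY: "T \<subseteq> Y" using Y by blast
    have "card ((\<lambda>x. T #> x) ` ?Q) = card ((\<lambda>x. T #> x) ` P)"
      using vol_image[OF P(1) k] vol_T(2)[OF P(1) True] vol_T(2)[OF Q TQ] by simp
    moreover have "\<not> lex_le (vol Y) (vol ?Q)" using vol_strict[OF Q Y(1,2)] Y(3) by blast
    then have "card ((\<lambda>x. T #> x) ` ?Q) < card ((\<lambda>x. T #> x) ` Y)"
      using vol_T(2)[OF Y(1) TY] vol_T(2)[OF Q TQ] by (auto simp: lex_le_def)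
    moreover have "card ((\<lambda>x. T #> x) ` Y) \<le> torus_index" by (rule card_T_cosets_le[OF subgroup.subset[OF Y(1)]])
    ultimately show ?thesis using True TY by (simp add: depth_def)
  next
    case False
    then have sm: "small P" and fin: "finite P" using P subgroup_dichotomy by blast+
    show ?thesis
    proof (cases "T \<subseteq> Y \<or> \<not> small Y")
      case True then show ?thesis using False sm by (auto simp: depth_def)
    next
      case smY: False
      then have finY: "finite Y" using subgroup_dichotomy Y(1) by blast
      have "card ?Q < card Y" using Y finY by (simp add: psubset_card_mono psubsetI)
      then have "card P < card Y" using E_hom(3)[OF P(1) k] by (simp add: card_image)
      then show ?thesis using smY False sm small_card_bound[OF Y(1)] by (auto simp: depth_def)
    qed
  qed
qed

text \<open>Alperin's fusion theorem: \<open>f\<close> is \<open>h\<inverse> \<alpha> g\<close>, where \<open>g\<close>, \<open>h\<close> extend to normalizers and \<open>\<alpha>\<close> is an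
  automorphism of a fully normalized subgroup, which extends as well unless that subgroup is centric.\<close>

theorem eventually_in_fusion_i:
  assumes z: "admissible z" and P: "relevant z P" and f: "f \<in> E P" "f z = z"
  shows "eventually_twisted z f P"
  using P f
proof (induction "depth P" arbitrary: P f rule: less_induct)
  case less
  have P: "subgroup P S" "z \<in> P" "T \<subseteq> P \<or> z \<noteq> \<one>" using less.prems(1) by (auto simp: relevant_def)
  note f = less.prems(2,3)
  have PS: "P \<subseteq> carrier S" by (rule subgroup.subset[OF P(1)])
  have goodI: "relevant z Y" if "subgroup Y S" "P \<subseteq> Y" for Y using that P by (auto simp: relevant_def)
  \<comment> \<open>A subgroup that is neither small nor contains T is not its own bullet, so there
    is no fixed representative for it; its morphisms are first extended to the product with T, where
    the induction hypothesis applies.\<close>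
  have ext_T: "eventually_twisted z g X" if X: "subgroup X S" "z \<in> X" "\<not> T \<subseteq> X" "\<not> small X" and g: "g \<in> E X" "g z = z"
    and d: "depth (X <#> T) < depth P" and zn: "z \<noteq> \<one>" for X g
  proof -
    have "finite X" using subgroup_dichotomy X by blast
    then obtain g' where g': "g' \<in> E (X <#> T)" "\<forall>u\<in>X. g' u = g u"
      using extension_to_T[of X g] admissible(5)[OF z zn] X g by blast
    note XT = XT_subgroup[OF X(1)]
    have "relevant z (X <#> T)" using XT X(2) by (auto simp: relevant_def)
    then have "eventually_twisted z g' (X <#> T)" using less.hyps[OF d] g' g(2) X(2) by simp
    then show ?thesis using eventually_twisted_extend[OF X(1) XT(1,2) g'(1)] g'(2) by blast
  qed
  have dT: "depth (X <#> T) \<le> torus_index" if "subgroup X S" for X using XT_subgroup(3)[OF that] by (simp add: depth_def)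
  consider "P = carrier S" | "P \<noteq> carrier S" "\<not> T \<subseteq> P" "\<not> small P" | "P \<noteq> carrier S" "T \<subseteq> P \<or> small P" by blast
  then show ?case
  proof cases
    \<comment> \<open>For P = S no larger normalizer is available, but f is an automorphism of S,
      which is an object of \<open>L\<^sup>\<bullet>\<close>.\<close>
    case 1
    have "f ` P = P" using vol_strict[OF E_image_subgroup[OF P(1) f(1)] subgroup_self]
      vol_image[OF P(1) f(1)] 1 subgroup.subset[OF E_image_subgroup[OF P(1) f(1)]] by (auto simp: lex_le_def)
    then show ?thesis using eventually_twisted_base[OF z _ f(1)] S_linking_bullet 1 P(2) f(2) by simp
  next
    case 2
    have "depth (P <#> T) < depth P" using dT[OF P(1)] 2 by (simp add: depth_def)
    then show ?thesis using ext_T[OF P(1,2) 2(2,3) f] P(3) 2(2) by blast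
  next
    case 3
    note PD = 3(2)
    obtain k where k: "k \<in> E P" "fully_normalized p S F (k ` P)" using fully_normalized_exists[OF P(1)] by blast
    let ?R = "k ` P"
    have R: "subgroup ?R S" by (rule E_image_subgroup[OF P(1) k(1)])
    obtain g where g: "g \<in> E (normalizer S P)" "g ` P = ?R" using E_extend_normalizer[OF P(1) k] by blast
    note sNP = subgroup_normalizer[OF PS] and PN = subgroup_subset_normalizer[OF P(1)]
    let ?Q = "f ` P"
    have Q: "subgroup ?Q S" by (rule E_image_subgroup[OF P(1) f(1)])
    have QS: "?Q \<subseteq> carrier S" by (rule subgroup.subset[OF Q])
    have gQ: "relevant z ?Q" unfolding relevant_def using Q P(2,3) f(2) E_T(1)[OF P(1) f(1)] by (metis image_eqI image_mono)
    let ?fi = "restrict (inv_into P f) ?Q"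
    have fi: "?fi \<in> E ?Q" by (rule E_inverse[OF P(1) f(1)])
    have injf: "inj_on f P" by (rule E_hom(3)[OF P(1) f(1)])
    have fiQ: "?fi ` ?Q = P" using injf by (simp add: inv_into_image_cancel)
    \<comment> \<open>P and f(P) are sent to the same fully normalized subgroup R, so that h f g^-1
      becomes an automorphism of R.\<close>
    let ?k' = "compose ?Q k ?fi"
    have k': "?k' \<in> E ?Q" by (rule E_compose[OF Q fi P(1) k(1)]) (simp only: fiQ order.refl)
    have "?k' ` ?Q = k ` (?fi ` ?Q)" by (auto simp: compose_def image_image)
    then have k'Q: "?k' ` ?Q = ?R" by (simp only: fiQ)
    have fn': "fully_normalized p S F (?k' ` ?Q)" using k(2) k'Q by simp
    obtain h where h: "h \<in> E (normalizer S ?Q)" "h ` ?Q = ?R" using E_extend_normalizer[OF Q k' fn'] k'Q by metis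
    note sNQ = subgroup_normalizer[OF QS] and QN = subgroup_subset_normalizer[OF Q]
    have gz: "g z = z" by (rule fixes_z_normalizer[OF z less.prems(1) g(1)])
    have hz: "h z = z" by (rule fixes_z_normalizer[OF z gQ h(1)])
    have id: "(\<lambda>x\<in>P. x) \<in> E P" "(\<lambda>x\<in>P. x) ` P = P" using inclusion_in_F[OF P(1) subgroup_self PS] by auto
    have dNP: "depth (normalizer S P) < depth P"
      by (rule depth_less[OF P(1) PD id(1) sNP]) (use PN id normalizer_grows[OF P(1) 3(1)] in auto)
    have QnS: "?Q \<noteq> carrier S"
    proof
      assume "?Q = carrier S"
      then have "vol (carrier S) = vol P" using vol_image[OF P(1) f(1)] by simp
      then show False using vol_strict[OF P(1) subgroup_self PS] 3(1) by (simp add: lex_le_def)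
    qed
    have dNQ: "depth (normalizer S ?Q) < depth P"
      by (rule depth_less[OF P(1) PD f(1) sNQ QN]) (use normalizer_grows[OF Q QnS] in auto)
    have "eventually_twisted z g (normalizer S P)" by (rule less.hyps[OF dNP goodI[OF sNP PN] g(1) gz])
    then have EvgP: "eventually_twisted z g P" using eventually_twisted_extend[OF P(1) sNP PN g(1)] by blast
    have "relevant z (normalizer S ?Q)" using gQ sNQ QN unfolding relevant_def by blast
    then have "eventually_twisted z h (normalizer S ?Q)" by (rule less.hyps[OF dNQ _ h(1) hz])
    then have EvhQ: "eventually_twisted z h ?Q" using eventually_twisted_extend[OF Q sNQ QN h(1)] by blast
    let ?g = "restrict g P" and ?h = "restrict h ?Q"
    have g1: "?g \<in> E P" "?g ` P = ?R" using E_restrict[OF sNP g(1) P(1) PN] g(2) by auto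
    have h1: "?h \<in> E ?Q" "?h ` ?Q = ?R" using E_restrict[OF sNQ h(1) Q QN] h(2) by (simp, simp only: image_restrict_eq)
    have injg: "inj_on g P" "inj_on ?g P" using E_hom(3)[OF P(1) g1(1)] E_hom(3)[OF sNP g(1)] PN inj_on_subset by blast+
    have injh: "inj_on h ?Q" using E_hom(3)[OF sNQ h(1)] QN inj_on_subset by blast
    let ?gi = "restrict (inv_into P ?g) ?R"
    have gi: "?gi \<in> E ?R" using E_inverse[OF P(1) g1(1)] g1(2) by simp
    have giR: "?gi ` ?R = P" using inv_into_image_cancel[OF injg(2), of P] g1(2) by simp
    have gig: "?gi (g x) = x" if "x \<in> P" for x
      using inv_into_f_f[OF injg(2) that] that g(2) by auto
    define \<alpha> where "\<alpha> = compose ?R ?h (compose ?R f ?gi)"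
    have fgi: "compose ?R f ?gi \<in> E ?R" by (rule E_compose[OF R gi P(1) f(1)]) (simp only: giR order.refl)
    have fgiR: "compose ?R f ?gi ` ?R = ?Q"
    proof -
      have "compose ?R f ?gi ` ?R = f ` ?gi ` ?R" by (auto simp: compose_def image_image)
      then show ?thesis using giR by simp
    qed
    have \<alpha>: "\<alpha> \<in> E ?R" unfolding \<alpha>_def by (rule E_compose[OF R fgi Q h1(1)]) (simp only: fgiR order.refl)
    have \<alpha>R: "\<alpha> ` ?R = ?R"
    proof -
      have "\<alpha> ` ?R = ?h ` (compose ?R f ?gi ` ?R)" by (auto simp: \<alpha>_def compose_def image_image)
      then show ?thesis using fgiR h1(2) by (simp only:)
    qed
    have \<alpha>g: "\<alpha> (g x) = h (f x)" if x: "x \<in> P" for x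
    proof -
      have "g x \<in> ?R" using g(2) x by blast
      then show ?thesis using gig[OF x] x by (simp add: \<alpha>_def compose_eq)
    qed
    have zR: "z \<in> ?R" using g(2) gz P(2) by (metis imageI)
    have \<alpha>z: "\<alpha> z = z" using \<alpha>g[OF P(2)] gz f(2) hz by simp
    have TR: "T \<subseteq> ?R" if "T \<subseteq> P" using E_T(1)[OF P(1) k(1) that] that by blast
    have goodR: "relevant z ?R" using R zR P(3) TR by (auto simp: relevant_def)
    have RS: "?R \<subseteq> carrier S" by (rule subgroup.subset[OF R])
    have eventually_twisted\<alpha>: "eventually_twisted z \<alpha> ?R"
    proof (cases "centric S F ?R")
      case True
      show ?thesis
      proof (cases "small ?R \<or> T \<subseteq> ?R")
        case ok: True
        then have "?R \<in> linking_bullet_ob p S F" using True linking_bullet_iff by blast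
        then show ?thesis using eventually_twisted_base[OF z _ \<alpha> \<alpha>R zR \<alpha>z] by blast
      next
        case no: False
        then have "\<not> T \<subseteq> P" using TR by blast
        then have "depth (?R <#> T) < depth P" using dT[OF R] PD by (simp add: depth_def)
        then show ?thesis using ext_T[OF R zR _ _ \<alpha> \<alpha>z] no P(3) \<open>\<not> T \<subseteq> P\<close> by blast
      qed
    next
      case False
      \<comment> \<open>An element c of C_S(R) outside R belongs to the extension group of \<alpha>,
        with \<one> as its counterpart; so \<alpha> extends to a strictly larger subgroup.\<close>
      obtain c where c: "c \<in> centralizer S ?R" "c \<notin> ?R" using noncentric_fully_normalized[OF k(2) False] by blast
      have fc: "fully_centralized p S F (\<alpha> ` ?R)" using fully_normalized_imp_centralized[OF k(2)] \<alpha>R by simp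
      obtain N \<alpha>' where N: "subgroup N S"
        "\<And>x. x \<in> N \<longleftrightarrow> x \<in> normalizer S ?R \<and> (\<exists>y\<in>normalizer S (\<alpha> ` ?R). \<forall>u\<in>?R. \<alpha> (cj x u) = cj y (\<alpha> u))"
        and \<alpha>': "\<alpha>' \<in> E N" "\<And>u. u \<in> ?R \<Longrightarrow> \<alpha>' u = \<alpha> u"
        using E_extension_domain[OF R \<alpha> fc] by metis
      have RN: "?R \<subseteq> N"
      proof
        fix x assume x: "x \<in> ?R"
        then have "\<alpha> x \<in> normalizer S (\<alpha> ` ?R)" using \<alpha>R subgroup_subset_normalizer[OF R] by (metis imageI subsetD)
        then show "x \<in> N" unfolding N(2) using E_conjugate(2)[OF R \<alpha> x] subgroup_subset_normalizer[OF R] x by blast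
      qed
      have "\<alpha> (cj c u) = cj \<one> (\<alpha> u)" if "u \<in> ?R" for u
      proof -
        have "cj c u = u" using c(1) centralizer_iff[OF RS] that by blast
        then show ?thesis using E_hom(1)[OF R \<alpha> that] by simp
      qed
      moreover have "\<one> \<in> normalizer S (\<alpha> ` ?R)" using subgroup.one_closed[OF subgroup_normalizer[OF RS]] \<alpha>R by simp
      ultimately have cN: "c \<in> N" unfolding N(2) using c(1) centralizer_subset_normalizer[OF RS] by blast
      have "depth N < depth P" by (rule depth_less[OF P(1) PD k(1) N(1) RN]) (use cN c(2) in blast)
      moreover have "relevant z N" using goodR N(1) RN by (auto simp: relevant_def)
      ultimately have "eventually_twisted z \<alpha>' N" using less.hyps \<alpha>'(1) \<alpha>'(2)[OF zR] \<alpha>z by simp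
      then show ?thesis using eventually_twisted_extend[OF R N(1) RN \<alpha>'(1)] \<alpha>'(2) by blast
    qed
    have EvgP': "eventually_twisted z ?g P" using EvgP by (rule eventually_twisted_cong[rotated]) simp
    have Ev1: "eventually_twisted z (\<lambda>x. \<alpha> (?g x)) P" by (rule eventually_twisted_compose[OF P(1) g1(1) _ EvgP']) (use \<alpha> eventually_twisted\<alpha> g1(2) in simp_all)
    have EvhQ': "eventually_twisted z ?h ?Q" using EvhQ by (rule eventually_twisted_cong[rotated]) simp
    have "eventually_twisted z (inv_into ?Q ?h) ?R" using eventually_twisted_inverse[OF E_hom(3)[OF Q h1(1)] EvhQ'] h1(2) by (simp only:)
    then have Ev2: "eventually_twisted z (restrict (inv_into ?Q ?h) ?R) ?R" by (rule eventually_twisted_cong[rotated]) simp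
    let ?c = "compose P \<alpha> ?g"
    have c: "?c \<in> E P" by (rule E_compose[OF P(1) g1(1) R \<alpha>]) (simp only: g1(2) order.refl)
    have cP: "?c ` P = ?R"
    proof -
      have "?c ` P = \<alpha> ` ?g ` P" by (auto simp: compose_def image_image)
      then show ?thesis using g1(2) \<alpha>R by (simp only:)
    qed
    have Evc: "eventually_twisted z ?c P" using Ev1 by (rule eventually_twisted_cong[rotated]) (simp add: compose_eq)
    have hi: "restrict (inv_into ?Q ?h) ?R \<in> E ?R" using E_inverse[OF Q h1(1)] h1(2) by (simp only:)
    have "eventually_twisted z (\<lambda>x. restrict (inv_into ?Q ?h) ?R (?c x)) P"
      by (rule eventually_twisted_compose[OF P(1) c _ Evc]) (simp_all only: cP hi Ev2)
    then show ?thesis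
    proof (rule eventually_twisted_cong[rotated])
      fix x assume x: "x \<in> P"
      have fx: "f x \<in> ?Q" using x by blast
      have "?c x = ?h (f x)" using \<alpha>g[OF x] x fx by (simp add: compose_eq)
      moreover have "?h (f x) \<in> ?R" using h1(2) fx by blast
      ultimately show "restrict (inv_into ?Q ?h) ?R (?c x) = f x"
        using inv_into_f_f[OF E_hom(3)[OF Q h1(1)] fx] by simp
    qed
  qed
qed

section \<open>Approximation\<close>

abbreviation "Si i \<equiv> S \<downharpoonright> fx i"

abbreviation "Fi i \<equiv> fusion_i p S F L \<psi> \<Psi> i"

lemma Fi_iff: "f \<in> Fi i H K \<longleftrightarrow> composite (FR i) H K f"
  by (simp add: fusion_i_def)

lemma group_Si: "group (Si i)" using fx_subgroup subgroup_imp_group by blast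

lemma Si_subgroup_iff: "subgroup H (Si i) \<longleftrightarrow> subgroup H S \<and> H \<subseteq> fx i"
proof
  assume H: "subgroup H (Si i)"
  then show "subgroup H S \<and> H \<subseteq> fx i" using incl_subgroup[OF fx_subgroup] subgroup.subset[OF H] by auto
next
  assume "subgroup H S \<and> H \<subseteq> fx i"
  then show "subgroup H (Si i)" using subgroup_incl fx_subgroup by blast
qed

lemma conjugate_Si: "s \<in> fx i \<Longrightarrow> conjugate (Si i) s x = cj s x"
  by (simp add: conjugate_def m_inv_consistent[OF fx_subgroup])

lemma centralizer_Si: "centralizer (Si i) K = centralizer S K \<inter> fx i"
  using sub_mem[OF fx_subgroup] by (auto simp: centralizer_def)

text \<open>Centricity in F_i in terms of a pair of mutually inverse composites, the form in which
  \<open>eventually_twisted\<close> supplies conjugates.\<close>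

lemma centric_Si:
  assumes "centric (Si i) (Fi i) H"
  shows "subgroup H S" "H \<subseteq> fx i"
    "composite (FR i) H K f \<Longrightarrow> composite (FR i) K H g \<Longrightarrow> (\<And>x. x \<in> H \<Longrightarrow> g (f x) = x) \<Longrightarrow> (\<And>y. y \<in> K \<Longrightarrow> f (g y) = y)
      \<Longrightarrow> centralizer S K \<inter> fx i \<subseteq> K"
    "centralizer S H \<inter> fx i \<subseteq> H"
proof -
  show H: "subgroup H S" "H \<subseteq> fx i" using assms Si_subgroup_iff by (auto simp: centric_def)
  have main: "centralizer S K \<inter> fx i \<subseteq> K"
    if "composite (FR i) H K f" "composite (FR i) K H g" "\<And>x. x \<in> H \<Longrightarrow> g (f x) = x" "\<And>y. y \<in> K \<Longrightarrow> f (g y) = y" for K f g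
  proof -
    have "f \<in> fus_iso (Fi i) H K"
      unfolding fus_iso_def Fi_iff using that by (auto simp: compose_def intro!: restrict_ext bexI[of _ g] simp: Fi_iff)
    moreover have "subgroup K (Si i)" using composite_sub(2,4)[OF that(1)] Si_subgroup_iff by blast
    ultimately have "K \<in> fus_conj (Si i) (Fi i) H" by (auto simp: fus_conj_def)
    then have "centralizer (Si i) K = center (Si i) K" using assms by (simp add: centric_def)
    moreover have "center (Si i) K \<subseteq> K" by (auto simp: center_def centralizer_def)
    ultimately show ?thesis by (simp add: centralizer_Si)
  qed
  then show "composite (FR i) H K f \<Longrightarrow> composite (FR i) K H g \<Longrightarrow> (\<And>x. x \<in> H \<Longrightarrow> g (f x) = x) \<Longrightarrow> (\<And>y. y \<in> K \<Longrightarrow> f (g y) = y)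
      \<Longrightarrow> centralizer S K \<inter> fx i \<subseteq> K" by blast
  have one: "\<one> \<in> fx i" by (rule subgroup.one_closed[OF fx_subgroup])
  have "cj \<one> ` H \<subseteq> H" using sub_mem[OF H(1)] by auto
  then have c: "composite (FR i) H H (restrict (cj \<one>) H)"
    by (intro composite.base FR_conj H one)
  show "centralizer S H \<inter> fx i \<subseteq> H" by (rule main[OF c c]) (use sub_mem[OF H(1)] in auto)
qed

text \<open>Twisting by \<tau> turns an element c of C_S(R) outside R into \<tau>^-1 c \<tau>, which
  is fixed whenever c is, centralizes the image of the trace of P under the twisted isomorphism, and
  does not lie in it.\<close>

lemma eventually_not_centric:
  assumes z: "admissible z" and P: "relevant z P" and nc: "\<not> centric S F P"
  shows "eventually (\<lambda>i. \<forall>\<tau>\<in>twisting i z. \<not> centric (Si i) (Fi i) (twist_dom i \<tau> P)) sequentially"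
proof -
  have sP: "subgroup P S" "z \<in> P" using P by (auto simp: relevant_def)
  have PS: "P \<subseteq> carrier S" by (rule subgroup.subset[OF sP(1)])
  obtain k where k: "k \<in> E P" "fully_normalized p S F (k ` P)" using fully_normalized_exists[OF sP(1)] by blast
  let ?R = "k ` P"
  have R: "subgroup ?R S" by (rule E_image_subgroup[OF sP(1) k(1)])
  have RS: "?R \<subseteq> carrier S" by (rule subgroup.subset[OF R])
  \<comment> \<open>The isomorphism onto R is taken from N_S(P) instead of k, since morphisms on the
    normalizer fix z.\<close>
  obtain g0 where g0: "g0 \<in> E (normalizer S P)" "g0 ` P = ?R" using E_extend_normalizer[OF sP(1) k] by blast
  have PN: "P \<subseteq> normalizer S P" by (rule subgroup_subset_normalizer[OF sP(1)])
  define g where "g = restrict g0 P"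
  have g: "g \<in> E P" unfolding g_def by (rule E_restrict[OF subgroup_normalizer[OF PS] g0(1) sP(1) PN])
  have gR: "g ` P = ?R" using g0(2) by (simp add: g_def)
  have gz: "g z = z" using fixes_z_normalizer[OF z P g0(1)] sP(2) by (simp add: g_def)
  have ginj: "inj_on g P" by (rule E_hom(3)[OF sP(1) g])
  have eventually_twisted: "eventually_twisted z g P" by (rule eventually_in_fusion_i[OF z P g gz])
  have "\<not> centric S F ?R"
  proof
    assume cR: "centric S F ?R"
    have "centralizer S (f ` P) \<subseteq> f ` P" if f: "f \<in> E P" for f
    proof -
      let ?i = "restrict (inv_into P k) ?R"
      have i: "?i \<in> E ?R" by (rule E_inverse[OF sP(1) k(1)])
      have iR: "?i ` ?R = P" using E_hom(3)[OF sP(1) k(1)] by (simp add: inv_into_image_cancel)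
      have "compose ?R f ?i \<in> E ?R" by (rule E_compose[OF R i sP(1) f]) (simp only: iR order.refl)
      moreover have "compose ?R f ?i ` ?R = f ` (?i ` ?R)" by (auto simp: compose_def image_image)
      ultimately show ?thesis using cR unfolding centric_iff iR by metis
    qed
    then show False using nc sP(1) centric_iff by blast
  qed
  then obtain c where c: "c \<in> centralizer S ?R" "c \<notin> ?R" using noncentric_fully_normalized[OF k(2)] by blast
  have cS: "c \<in> carrier S" using c(1) centralizer_iff[OF RS] by blast
  note adm = admissible[OF z]
  have zS: "z \<in> carrier S" using adm(1) by simp
  have zc: "cj z x = x" if "x \<in> carrier S" for x
    using adm(4)[OF that] conjugate_fix_iff[OF that zS] conjugate_fix_iff[OF zS that] by simp
  show ?thesis using eventually_conj[OF eventually_twisted[unfolded eventually_twisted_def] eventually_fx[OF cS]]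
  proof (rule eventually_mono, intro ballI notI)
    fix i \<tau>
    assume a: "(\<forall>\<tau>\<in>twisting i z. twisted_in i \<tau> g P \<and> twisted_in i \<tau> (inv_into P g) (g ` P)) \<and> c \<in> fx i"
      and \<tau>: "\<tau> \<in> twisting i z" and cen: "centric (Si i) (Fi i) (twist_dom i \<tau> P)"
    note \<tau>S = twisting_carrier[OF \<tau>]
    let ?H = "twist_dom i \<tau> P" and ?H' = "twist_dom i \<tau> ?R"
    let ?K = "twist \<tau> g ` ?H"
    have 1: "composite (FR i) ?H ?K (restrict (twist \<tau> g) ?H)" using a \<tau> by (simp add: twisted_in_def)
    have 2: "composite (FR i) ?H' (twist \<tau> (inv_into P g) ` ?H') (restrict (twist \<tau> (inv_into P g)) ?H')"
      using a \<tau> gR by (simp add: twisted_in_def)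
    have K: "subgroup ?K S" "?K \<subseteq> fx i" using composite_sub(2,4)[OF 1] by auto
    have inner: "cj \<tau> (twist \<tau> g x) = g (cj \<tau> x)" if "x \<in> ?H" for x
      using that E_hom(1)[OF sP(1) g] \<tau>S by (auto simp: twist_def twist_dom_def)
    have KH: "?K \<subseteq> ?H'"
    proof
      fix y assume y: "y \<in> ?K"
      then obtain x where x: "x \<in> ?H" "y = twist \<tau> g x" by blast
      then have "cj \<tau> y \<in> ?R" using inner[OF x(1)] gR by (auto simp: twist_dom_def)
      then show "y \<in> ?H'" using y K(2) by (auto simp: twist_dom_def)
    qed
    have recover: "twist \<tau> (inv_into P g) (twist \<tau> g x) = x" if x: "x \<in> ?H" for x
    proof -
      have "cj \<tau> x \<in> P" "x \<in> carrier S" using x by (auto simp: twist_dom_def fx_iff)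
      then show ?thesis using inner[OF x] ginj \<tau>S by (simp add: twist_def)
    qed
    let ?h = "restrict (restrict (twist \<tau> (inv_into P g)) ?H') ?K"
    have h: "?h (twist \<tau> g x) = x" if "x \<in> ?H" for x using that KH recover by auto
    have "restrict (twist \<tau> (inv_into P g)) ?H' ` ?K = ?H"
    proof -
      have "restrict (twist \<tau> (inv_into P g)) ?H' ` ?K = (\<lambda>x. x) ` ?H" unfolding image_image
        by (rule image_cong) (use KH recover in auto)
      then show ?thesis by simp
    qed
    then have 3: "composite (FR i) ?K ?H ?h" using composite_restrict[OF 2 K(1) KH] by simp
    have sub: "centralizer S ?K \<inter> fx i \<subseteq> ?K"
      
    proof (rule centric_Si(3)[OF cen 1 3])
      show "?h (restrict (twist \<tau> g) ?H x) = x" if "x \<in> ?H" for x using h[OF that] that by (simp only: restrict_apply')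
      show "restrict (twist \<tau> g) ?H (?h y) = y" if y: "y \<in> ?K" for y
      proof -
        obtain x where x: "x \<in> ?H" "y = twist \<tau> g x" using y by blast
        have "?h y = x" using h[OF x(1)] x(2) by (simp only:)
        then show ?thesis using x by (simp only: restrict_apply')
      qed
    qed
    let ?y = "cj (inv \<tau>) c"
    \<comment> \<open>\<open>\<Psi>\<^sub>i\<close> changes \<tau> at most by the central factor z,
      which conjugation does not see.\<close>
    have "ps i ?y = ?y"
    proof -
      have "ps i \<tau> = \<tau> \<or> ps i \<tau> = \<tau> \<otimes> z" using \<tau> by (simp add: twisting_def)
      moreover have "inv (\<tau> \<otimes> z) = z \<otimes> inv \<tau>" using \<tau>S zS adm(3) by (simp add: inv_mult_group)
      ultimately have "ps i (inv \<tau>) = inv \<tau> \<or> ps i (inv \<tau>) = z \<otimes> inv \<tau>" using iter_inv(1)[OF \<tau>S] by auto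
      then have "cj (ps i (inv \<tau>)) c = cj (inv \<tau>) c" using zc \<tau>S cS zS by (auto simp: conjugate_comp)
      then show ?thesis using iter_cj[of "inv \<tau>" c] \<tau>S cS a by (simp add: fx_iff)
    qed
    then have yfx: "?y \<in> fx i" using \<tau>S cS by (simp add: fx_iff)
    have KS: "?K \<subseteq> carrier S" by (rule subgroup.subset[OF K(1)])
    have "cj ?y v = v" if v: "v \<in> ?K" for v
    proof -
      have r: "cj \<tau> v \<in> ?R" "v \<in> carrier S" using KH v KS by (auto simp: twist_dom_def)
      have "cj \<tau> (cj ?y v) = cj (cj \<tau> ?y) (cj \<tau> v)" using \<tau>S cS r(2) by (simp add: conjugate_def conjugate_mult[unfolded conjugate_def] m_assoc inv_mult_group inv_solve_left)
      also have "\<dots> = cj c (cj \<tau> v)" using \<tau>S cS by simp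
      also have "\<dots> = cj \<tau> v" using c(1) centralizer_iff[OF RS] r(1) by blast
      finally show ?thesis using \<tau>S cS r(2) by simp
    qed
    then have "?y \<in> centralizer S ?K" using centralizer_iff[OF KS] \<tau>S cS by simp
    then have "?y \<in> ?K" using sub yfx by blast
    then have "cj \<tau> ?y \<in> ?R" using KH by (auto simp: twist_dom_def)
    then show False using c(2) \<tau>S cS by simp
  qed
qed

text \<open>An object of \<open>L\<^sup>\<bullet>\<close> that contains a set that is not small is
  itself not small, so it contains T, and the restricted morphism is defined on the product with T.
  Smallness is invariant under the extended maps, so this applies to every factor of the
  composite.\<close>

lemma composite_extends_to_T:
  assumes "composite (FR i) H K f" "\<not> small H"
  shows "\<exists>f'\<in>E (H <#> T). \<forall>x\<in>H. f' x = f x"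
  using assms
proof (induction)
  case (base f H K)
  obtain \<phi> P R where *: "f = restrict (rho L \<phi>) H" "P \<in> Det i" "R \<in> Det i" "\<phi> \<in> fixed_mor p L \<Psi> i P R"
      "subgroup H S" "H \<subseteq> P \<inter> fx i" "subgroup K S" "K \<subseteq> R \<inter> fx i" "rho L \<phi> ` H \<subseteq> K"
    using base(1) unfolding FR_iff by (elim exE conjE)
  have sP: "subgroup P S" by (rule Ob_subgroup[OF Det_Ob[OF *(2)]])
  have "T \<subseteq> P" using *(2,6) base(2) small_mono[of H P] by (auto simp: Det_iff linking_bullet_iff)
  then have HP: "H <#> T \<subseteq> P" using XT_least[OF sP] *(6) by blast
  have "restrict (rho L \<phi>) (H <#> T) \<in> E (H <#> T)"
    by (rule E_restrict[OF sP fixed_mor_rho(1)[OF *(2-4)] XT_subgroup(1)[OF *(5)] HP])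
  moreover have "restrict (rho L \<phi>) (H <#> T) x = f x" if "x \<in> H" for x
  proof -
    have "x \<in> H <#> T" using that XT_subgroup(2)[OF *(5)] by blast
    then show ?thesis using that *(1) by simp
  qed
  ultimately show ?case by blast
next
  case (step H K f g J)
  obtain f' where f': "f' \<in> E (H <#> T)" "\<forall>x\<in>H. f' x = f x" using step.IH step.prems by blast
  have sH: "subgroup H S" by (rule composite_sub(1)[OF step.hyps(1)])
  note HT = XT_subgroup[OF sH]
  obtain \<phi> P R where *: "g = restrict (rho L \<phi>) K" "P \<in> Det i" "R \<in> Det i" "\<phi> \<in> fixed_mor p L \<Psi> i P R"
      "subgroup K S" "K \<subseteq> P \<inter> fx i" "subgroup J S" "J \<subseteq> R \<inter> fx i" "rho L \<phi> ` K \<subseteq> J"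
    using step.hyps(2) unfolding FR_iff by (elim exE conjE)
  have sP: "subgroup P S" by (rule Ob_subgroup[OF Det_Ob[OF *(2)]])
  have fK: "f' ` H \<subseteq> K" using composite_sub(5)[OF step.hyps(1)] f'(2) by auto
  have "small (f' ` H) \<longleftrightarrow> small H"
    by (rule small_image_iff[OF HT(1,3,2)]) (use E_hom[OF HT(1) f'(1)] in auto)
  then have "\<not> small P" using step.prems small_mono[of "f' ` H" P] fK *(6) by blast
  then have TP: "T \<subseteq> P" using *(2) by (auto simp: Det_iff linking_bullet_iff)
  have "f' ` (H <#> T) \<subseteq> P"
  proof
    fix y assume "y \<in> f' ` (H <#> T)"
    then obtain x t where xt: "x \<in> H" "t \<in> T" "y = f' (x \<otimes> t)" by (auto simp: XT_iff)
    have m: "x \<in> H <#> T" "t \<in> H <#> T" using xt HT by blast+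
    have "y = f' x \<otimes> f' t" using E_hom(2)[OF HT(1) f'(1) m] xt(3) by simp
    moreover have "f' x \<in> P" using fK *(6) xt(1) by blast
    moreover have "f' t \<in> P" using E_T(4)[OF HT(1) f'(1) HT(3) xt(2)] TP by blast
    ultimately show "y \<in> P" using subgroup.m_closed[OF sP] by simp
  qed
  then have "compose (H <#> T) (rho L \<phi>) f' \<in> E (H <#> T)"
    by (rule E_compose[OF HT(1) f'(1) sP fixed_mor_rho(1)[OF *(2-4)]])
  moreover have "compose (H <#> T) (rho L \<phi>) f' x = compose H g f x" if "x \<in> H" for x
  proof -
    have "x \<in> H <#> T" "f x \<in> K" using that HT(2) composite_sub(5)[OF step.hyps(1)] by blast+
    then show ?thesis using that f'(2) *(1) by (simp add: compose_eq)
  qed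
  ultimately show ?case by blast
qed

lemma conj_map_Si: "s \<in> fx i \<Longrightarrow> conj_map (Si i) H s = restrict (cj s) H"
  by (simp add: conj_map_def conjugate_def m_inv_consistent[OF fx_subgroup] fun_eq_iff restrict_def)

lemma aut_fusion_Fi:
  assumes H: "subgroup H S" "H \<subseteq> fx i" shows "aut_fusion (Si i) (Fi i) H"
proof (intro aut_fusion.intro aut_fusion_axioms.intro group_Si)
  show "subgroup H (Si i)" using H Si_subgroup_iff by blast
  show "f \<in> extensional H" if "f \<in> Fi i H H" for f
    using that E_hom(4)[OF H(1)] composite_sub(6) by (auto simp: Fi_iff)
  show "f x \<in> H" if "f \<in> Fi i H H" "x \<in> H" for f x
    using that composite_sub(5)[of i H H f] by (auto simp: Fi_iff)
  show "f (x \<otimes>\<^bsub>Si i\<^esub> y) = f x \<otimes>\<^bsub>Si i\<^esub> f y" if "f \<in> Fi i H H" "x \<in> H" "y \<in> H" for f x y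
    using that E_hom(2)[OF H(1) composite_sub(6)] by (auto simp: Fi_iff)
  show "compose H g f \<in> Fi i H H" if "f \<in> Fi i H H" "g \<in> Fi i H H" for f g
    using that composite_trans by (auto simp: Fi_iff)
  show "conj_map (Si i) H x \<in> Fi i H H" if x: "x \<in> H" for x
  proof -
    have xf: "x \<in> fx i" using x H(2) by blast
    have "cj x ` H \<subseteq> H" using subgroup_subset_normalizer[OF H(1)] x normalizer_iff[OF subgroup.subset[OF H(1)]] by blast
    then show ?thesis unfolding conj_map_Si[OF xf] Fi_iff by (intro composite.base FR_conj H xf)
  qed
qed

text \<open>The \<open>p\<close>-subgroup of outer automorphisms induced by \<open>N\<^bsub>HT\<^esub>(H)\<close> is normal, because morphisms of
  \<open>\<F>\<^sub>i\<close> defined on \<open>H\<close> extend to \<open>H T\<close>.\<close>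

lemma p_core_nontrivial:
  assumes cen: "centric (Si i) (Fi i) H" and ns: "\<not> small H" and TH: "\<not> T \<inter> fx i \<subseteq> H"
  shows "out_conj (Si i) (Fi i) H \<inter> p_core p (fus_out (Si i) (Fi i) H) \<noteq> {\<one>\<^bsub>fus_out (Si i) (Fi i) H\<^esub>}"
proof -
  note H = centric_Si(1,2)[OF cen]
  have HS: "H \<subseteq> carrier S" by (rule subgroup.subset[OF H(1)])
  have finH: "finite H" using H(2) finite_fx finite_subset by blast
  interpret A: aut_fusion "Si i" "Fi i" H by (rule aut_fusion_Fi[OF H])
  interpret O: group "fus_out (Si i) (Fi i) H" by (rule A.group_fus_out)
  let ?I = "inn (Si i) H"
  interpret I: normal ?I A.A by (rule A.inn_normal)
  note HT = XT_subgroup[OF H(1)]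
  have finA: "finite (carrier A.A)"
  proof (rule finite_subset)
    show "carrier A.A \<subseteq> H \<rightarrow>\<^sub>E H" using A.A_mem(2,3) by (auto simp: PiE_def)
    show "finite (H \<rightarrow>\<^sub>E H)" by (rule finite_PiE) (use finH in auto)
  qed
  then have finO: "finite (carrier (fus_out (Si i) (Fi i) H))" by (simp add: fus_out_def carrier_FactGroup)
  define \<Phi> where "\<Phi> x = restrict (cj x) H" for x
  \<comment> \<open>N is not confined to S_i, because the extension \<beta> below preserves HT but
    need not respect S_i; in exchange, membership of the induced map in F_i becomes a
    condition.\<close>
  define N where "N = {x \<in> H <#> T. x \<in> normalizer S H \<and> \<Phi> x \<in> carrier A.A}"
  have \<Phi>_ap: "u \<in> H \<Longrightarrow> \<Phi> x u = cj x u" for u x by (simp add: \<Phi>_def)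
  have NS: "x \<in> carrier S" "u \<in> H \<Longrightarrow> cj x u \<in> H" if "x \<in> N" for x u
    using that normalizer_iff[OF HS] by (auto simp: N_def)
  have \<Phi>m: "\<Phi> (x \<otimes> y) = \<Phi> x \<otimes>\<^bsub>A.A\<^esub> \<Phi> y" if xy: "x \<in> N" "y \<in> N" for x y
  proof (rule extensionalityI[of _ H])
    have "\<Phi> x \<otimes>\<^bsub>A.A\<^esub> \<Phi> y \<in> carrier A.A" using xy by (simp add: N_def)
    then show "\<Phi> x \<otimes>\<^bsub>A.A\<^esub> \<Phi> y \<in> extensional H" by (rule A.A_mem(2))
    show "\<Phi> (x \<otimes> y) u = (\<Phi> x \<otimes>\<^bsub>A.A\<^esub> \<Phi> y) u" if u: "u \<in> H" for u
      using u xy NS HS by (auto simp: A.A_mult \<Phi>_ap conjugate_comp subset_eq)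
  qed (simp add: \<Phi>_def)
  have sN: "subgroup N S"
  proof (rule subgroupI)
    show "N \<subseteq> carrier S" using NS by blast
    have "\<Phi> \<one> = \<one>\<^bsub>A.A\<^esub>" using HS by (auto simp: \<Phi>_def fus_aut_def intro!: restrict_ext)
    then have "\<one> \<in> N" using subgroup.one_closed[OF HT(1)] subgroup.one_closed[OF subgroup_normalizer[OF HS]] by (simp add: N_def)
    then show "N \<noteq> {}" by blast
    show "inv x \<in> N" if x: "x \<in> N" for x
    proof -
      have xA: "\<Phi> x \<in> carrier A.A" using x by (simp add: N_def)
      have ix: "inv x \<in> H <#> T" "inv x \<in> normalizer S H"
        using x subgroup.m_inv_closed[OF HT(1)] subgroup.m_inv_closed[OF subgroup_normalizer[OF HS]] by (auto simp: N_def)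
      have "\<Phi> (inv x) = inv\<^bsub>A.A\<^esub> \<Phi> x"
      proof (rule extensionalityI[of _ H])
        show "inv\<^bsub>A.A\<^esub> \<Phi> x \<in> extensional H" using A.A_mem(2) xA by simp
        show "\<Phi> (inv x) u = (inv\<^bsub>A.A\<^esub> \<Phi> x) u" if u: "u \<in> H" for u
        proof -
          let ?v = "(inv\<^bsub>A.A\<^esub> \<Phi> x) u"
          have v: "?v \<in> H" using A.A_mem(3)[OF A.A.inv_closed[OF xA] u] .
          have "cj x ?v = u" using A.A_mem(5)[OF xA u] \<Phi>_ap[OF v] by simp
          then have "cj (inv x) u = ?v" using NS(1)[OF x] v HS by (metis conjugate_cancel(1) subsetD)
          then show ?thesis using \<Phi>_ap[OF u] by simp
        qed
      qed (simp add: \<Phi>_def)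
      then show ?thesis using ix xA by (simp add: N_def)
    qed
    show "x \<otimes> y \<in> N" if xy: "x \<in> N" "y \<in> N" for x y
      using xy \<Phi>m[OF xy] subgroup.m_closed[OF HT(1)] subgroup.m_closed[OF subgroup_normalizer[OF HS]] by (simp add: N_def)
  qed
  have hom: "\<Phi> \<in> hom (S \<downharpoonright> N) A.A" by (rule homI) (use \<Phi>m in \<open>auto simp: N_def\<close>)
  let ?X = "(\<lambda>x. ?I #>\<^bsub>A.A\<^esub> \<Phi> x) ` N"
  have tors: "\<exists>n. x [^]\<^bsub>S \<downharpoonright> N\<^esub> (p ^ n) = \<one>\<^bsub>S \<downharpoonright> N\<^esub>" if "x \<in> carrier (S \<downharpoonright> N)" for x
    using S_torsion NS that by (simp add: nat_pow_consistent[symmetric])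
  obtain k where X: "subgroup ?X (fus_out (Si i) (Fi i) H)" "card ?X = p ^ k"
    using A.image_in_fus_out[OF prime finO subgroup_imp_group[OF sN] hom tors] by auto
  have "?X \<lhd> fus_out (Si i) (Fi i) H"
  proof (rule O.normal_invI[OF X(1)])
    fix a y assume a: "a \<in> carrier (fus_out (Si i) (Fi i) H)" and "y \<in> ?X"
    then obtain x where x: "x \<in> N" "y = ?I #>\<^bsub>A.A\<^esub> \<Phi> x" by blast
    obtain \<alpha> where \<alpha>: "\<alpha> \<in> carrier A.A" "a = ?I #>\<^bsub>A.A\<^esub> \<alpha>" using a by (auto simp: fus_out_def carrier_FactGroup)
    have xA: "\<Phi> x \<in> carrier A.A" using x by (simp add: N_def)
    have "composite (FR i) H H \<alpha>" using A.A_mem(1)[OF \<alpha>(1)] Fi_iff by blast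
    then obtain \<beta> where \<beta>: "\<beta> \<in> E (H <#> T)" "\<forall>u\<in>H. \<beta> u = \<alpha> u" using composite_extends_to_T ns by blast
    have xHT: "x \<in> H <#> T" using x by (simp add: N_def)
    let ?b = "\<alpha> \<otimes>\<^bsub>A.A\<^esub> \<Phi> x \<otimes>\<^bsub>A.A\<^esub> inv\<^bsub>A.A\<^esub> \<alpha>"
    have bA: "?b \<in> carrier A.A" using \<alpha>(1) xA by simp
    have \<beta>S: "\<beta> x \<in> carrier S" by (rule E_hom(1)[OF HT(1) \<beta>(1) xHT])
    \<comment> \<open>Conjugating c_x by \<alpha> gives conjugation by \<beta>(x), which is again an
      element of HT.\<close>
    have cj\<beta>: "cj (\<beta> x) (\<alpha> v) = \<alpha> (cj x v)" if v: "v \<in> H" for v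
      using E_conjugate(2)[OF HT(1) \<beta>(1) xHT, of v] v HT(2) \<beta>(2) NS(2)[OF x(1) v] by auto
    have b: "?b u = cj (\<beta> x) u" if u: "u \<in> H" for u
    proof -
      let ?v = "(inv\<^bsub>A.A\<^esub> \<alpha>) u"
      have v: "?v \<in> H" using A.A_mem(3)[OF A.A.inv_closed[OF \<alpha>(1)] u] .
      have "?b u = \<alpha> (cj x ?v)" using u v by (simp add: A.A_mult \<Phi>_ap)
      also have "\<dots> = cj (\<beta> x) u" using cj\<beta>[OF v] A.A_mem(5)[OF \<alpha>(1) u] by simp
      finally show ?thesis .
    qed
    have be: "\<Phi> (\<beta> x) = ?b"
      by (rule extensionalityI[of _ H]) (use A.A_mem(2)[OF bA] b in \<open>auto simp: \<Phi>_def\<close>)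
    have "\<beta> x \<in> N"
    proof -
      have "\<beta> x \<in> H <#> T"
      proof -
        obtain u t where ut: "u \<in> H" "t \<in> T" "x = u \<otimes> t" using xHT XT_iff by blast
        have m: "u \<in> H <#> T" "t \<in> H <#> T" using ut HT by blast+
        have "\<beta> x = \<alpha> u \<otimes> \<beta> t" using E_hom(2)[OF HT(1) \<beta>(1) m] ut \<beta>(2) by simp
        then show ?thesis using XT_iff A.A_mem(3)[OF \<alpha>(1) ut(1)] E_T(4)[OF HT(1) \<beta>(1) HT(3) ut(2)] by blast
      qed
      moreover have "\<beta> x \<in> normalizer S H"
      proof -
        have "cj (\<beta> x) ` H \<subseteq> H" using b A.A_mem(3)[OF bA] by force
        moreover have "inj_on (cj (\<beta> x)) H" by (rule inj_on_conjugate[OF \<beta>S HS])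
        ultimately have "cj (\<beta> x) ` H = H" using finH endo_inj_surj by blast
        then show ?thesis using normalizer_iff[OF HS] \<beta>S by blast
      qed
      ultimately show ?thesis using be bA by (simp add: N_def)
    qed
    moreover have "a \<otimes>\<^bsub>fus_out (Si i) (Fi i) H\<^esub> y \<otimes>\<^bsub>fus_out (Si i) (Fi i) H\<^esub> inv\<^bsub>fus_out (Si i) (Fi i) H\<^esub> a = ?I #>\<^bsub>A.A\<^esub> ?b"
      using \<alpha> xA a x(2) unfolding fus_out_def by (simp add: I.inv_FactGroup I.rcos_inv I.rcos_sum)
    ultimately show "a \<otimes>\<^bsub>fus_out (Si i) (Fi i) H\<^esub> y \<otimes>\<^bsub>fus_out (Si i) (Fi i) H\<^esub> inv\<^bsub>fus_out (Si i) (Fi i) H\<^esub> a \<in> ?X"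
      using be by (metis imageI)
  qed
  then have core: "?X \<subseteq> p_core p (fus_out (Si i) (Fi i) H)" by (rule O.normal_p_subgroup_in_p_core[OF prime finO _ X(2)])
  \<comment> \<open>A nontrivial class comes from the finite p-group HT \<inter> S_i: H is proper in
    it because T_i is not in H, so its normalizer there is larger than H.\<close>
  let ?M = "(H <#> T) \<inter> fx i"
  have sM: "subgroup ?M S" by (rule subgroups_Inter_pair[OF HT(1) fx_subgroup])
  have finM: "finite ?M" using finite_fx by simp
  interpret M: group "S \<downharpoonright> ?M" by (rule subgroup_imp_group[OF sM])
  obtain j where j: "order (S \<downharpoonright> ?M) = p ^ j" using card_finite_subgroup[OF sM finM] by (auto simp: order_def)
  have "H \<subseteq> ?M" using HT(2) H(2) by blast
  then have "subgroup H (S \<downharpoonright> ?M)" by (rule subgroup_incl[OF H(1) sM])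
  moreover have "H \<noteq> carrier (S \<downharpoonright> ?M)" using TH HT(3) by auto
  ultimately have "\<exists>g\<in>carrier (S \<downharpoonright> ?M) - H. \<forall>x\<in>H. g \<otimes>\<^bsub>S \<downharpoonright> ?M\<^esub> x \<otimes>\<^bsub>S \<downharpoonright> ?M\<^esub> inv\<^bsub>S \<downharpoonright> ?M\<^esub> g \<in> H"
    by (rule M.p_group_normalizer_grows[OF prime j])
  then obtain g where g: "g \<in> ?M" "g \<notin> H" "\<forall>x\<in>H. cj g x \<in> H"
    using m_inv_consistent[OF sM] by (auto simp: conjugate_def)
  have gS: "g \<in> carrier S" using sub_mem[OF sM g(1)] .
  have gf: "g \<in> fx i" using g(1) by blast
  have cjg: "cj g ` H = H"
    using endo_inj_surj[OF finH _ inj_on_conjugate[OF gS HS]] g(3) by blast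
  have gN: "g \<in> normalizer S H" using normalizer_iff[OF HS] gS cjg by blast
  have ig: "inv g \<in> fx i" "cj (inv g) ` H = H"
    using gf gN subgroup.m_inv_closed[OF fx_subgroup] subgroup.m_inv_closed[OF subgroup_normalizer[OF HS] gN] normalizer_iff[OF HS] by blast+
  have "\<Phi> g \<in> carrier A.A"
  proof -
    have "restrict (cj g) H \<in> Fi i H H" "restrict (cj (inv g)) H \<in> Fi i H H"
      unfolding Fi_iff using cjg ig gf H by (auto intro!: composite.base FR_conj)
    moreover have "compose H (restrict (cj (inv g)) H) (restrict (cj g) H) = (\<lambda>x\<in>H. x)"
      "compose H (restrict (cj g) H) (restrict (cj (inv g)) H) = (\<lambda>x\<in>H. x)"
      using cjg ig(2) gS HS by (auto simp: compose_def subset_eq intro!: restrict_ext)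
    ultimately show ?thesis by (auto simp: \<Phi>_def fus_aut_def fus_iso_def)
  qed
  then have gX: "?I #>\<^bsub>A.A\<^esub> \<Phi> g \<in> ?X" using g(1) gN by (simp add: N_def)
  have "H \<subseteq> carrier (Si i)" using H(2) by simp
  then have "g \<in> normalizer (Si i) H"
    using group.normalizer_iff[OF group_Si] gf cjg conjugate_Si[OF gf] by auto
  then have out: "?I #>\<^bsub>A.A\<^esub> \<Phi> g \<in> out_conj (Si i) (Fi i) H"
    unfolding out_conj_def aut_conj_def \<Phi>_def conj_map_Si[OF gf, symmetric] by (intro imageI)
  have "?I #>\<^bsub>A.A\<^esub> \<Phi> g \<noteq> \<one>\<^bsub>fus_out (Si i) (Fi i) H\<^esub>"
  proof
    assume "?I #>\<^bsub>A.A\<^esub> \<Phi> g = \<one>\<^bsub>fus_out (Si i) (Fi i) H\<^esub>"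
    then have "?I #>\<^bsub>A.A\<^esub> \<Phi> g = ?I" by (simp add: fus_out_def)
    then have "\<Phi> g \<in> ?I" using A.A.rcos_self[OF \<open>\<Phi> g \<in> carrier A.A\<close> I.is_subgroup] by simp
    then obtain h where h: "h \<in> H" "\<Phi> g = conj_map (Si i) H h" by (auto simp: inn_def)
    have hf: "h \<in> fx i" "h \<in> carrier S" using h H(2) HS by blast+
    have eq: "cj g u = cj h u" if "u \<in> H" for u
      using h(2) that unfolding conj_map_Si[OF hf(1)] \<Phi>_def by (metis restrict_apply')
    \<comment> \<open>If g acts on H like some h in H, then h^-1 g centralizes H inside S_i, hence
      lies in H by centricity, and so does g.\<close>
    have "cj (inv h \<otimes> g) u = u" if "u \<in> H" for u
      using eq[OF that] that HS hf gS by (auto simp: conjugate_comp subset_eq)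
    then have "inv h \<otimes> g \<in> centralizer S H" using centralizer_iff[OF HS] hf gS by simp
    moreover have "inv h \<otimes> g \<in> fx i" using hf gf by (simp add: subgroup.m_closed[OF fx_subgroup] subgroup.m_inv_closed[OF fx_subgroup])
    ultimately have "inv h \<otimes> g \<in> H" using centric_Si(4)[OF cen] by blast
    then have "h \<otimes> (inv h \<otimes> g) \<in> H" using subgroup.m_closed[OF H(1) h(1)] by blast
    then show False using g(2) hf gS by (simp add: m_assoc[symmetric])
  qed
  then show ?thesis using gX core out by blast
qed

section \<open>Finiteness of the list of subgroups to be tested\<close>

lemma T_roots_finite:
  assumes "finite D" shows "finite {t \<in> T. t [^] q \<in> D}"
proof -
  have "finite {t \<in> T. t [^] q = d}" for d
  proof (cases "\<exists>t0\<in>T. t0 [^] q = d")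
    case True
    then obtain t0 where t0: "t0 \<in> T" "t0 [^] q = d" by blast
    have "{t \<in> T. t [^] q = d} \<subseteq> (\<lambda>u. t0 \<otimes> u) ` {u \<in> T. u [^] q = \<one>}"
    proof
      fix t assume t: "t \<in> {t \<in> T. t [^] q = d}"
      have "(inv t0 \<otimes> t) [^] q = inv t0 [^] q \<otimes> t [^] q"
        using t t0 torus_commute by (intro pow_mult_distrib) auto
      moreover have "inv t0 [^] q = inv d" using nat_pow_inv[OF T_mem[OF t0(1)], of q] t0(2) by metis
      moreover have "d \<in> carrier S" using t0 T_mem nat_pow_closed by metis
      ultimately have "(inv t0 \<otimes> t) [^] q = \<one>" using t by simp
      moreover have "t = t0 \<otimes> (inv t0 \<otimes> t)" using t t0 by (simp add: m_assoc[symmetric])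
      moreover have "inv t0 \<otimes> t \<in> T"
        using t t0 subgroup.m_closed[OF torus_subgroup] subgroup.m_inv_closed[OF torus_subgroup] by simp
      ultimately show "t \<in> (\<lambda>u. t0 \<otimes> u) ` {u \<in> T. u [^] q = \<one>}" by (metis (mono_tags, lifting) imageI mem_Collect_eq)
    qed
    then show ?thesis using T_torsion_finite[OF q_props(1)] finite_subset by blast
  next
    case False
    then have "{t \<in> T. t [^] q = d} = {}" by blast
    then show ?thesis by (simp only: finite.emptyI)
  qed
  then have "finite (\<Union>d\<in>D. {t \<in> T. t [^] q = d})" using assms by blast
  moreover have "{t \<in> T. t [^] q \<in> D} = (\<Union>d\<in>D. {t \<in> T. t [^] q = d})" by blast
  ultimately show ?thesis by simp
qed

lemma fx0_T: "x \<in> carrier S \<Longrightarrow> \<exists>y\<in>fx 0. \<exists>t\<in>T. x = y \<otimes> t"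
  using S_determined(2)[of 0] XT_iff by metis

text \<open>Write x = y t with y in the finite group S_0 and t in T. As x centralizes T, the
  elements y and t commute, so x^q = y^q t^q. This leaves finitely many values of t^q, hence
  finitely many t.\<close>

lemma finite_centralizing_roots:
  assumes B: "finite B" "B \<subseteq> T" shows "finite {x \<in> carrier S. centralizes_T x \<and> x [^] q \<in> B}"
proof -
  let ?D = "\<Union>y\<in>fx 0. (\<lambda>b. inv (y [^] q) \<otimes> b) ` B"
  let ?R = "{t \<in> T. t [^] q \<in> ?D}"
  have "finite ?D" using finite_fx B(1) by blast
  then have fR: "finite ?R" by (rule T_roots_finite)
  have "{x \<in> carrier S. centralizes_T x \<and> x [^] q \<in> B} \<subseteq> (\<lambda>(y, t). y \<otimes> t) ` (fx 0 \<times> ?R)"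
  proof
    fix x assume x: "x \<in> {x \<in> carrier S. centralizes_T x \<and> x [^] q \<in> B}"
    then obtain y t where yt: "y \<in> fx 0" "t \<in> T" "x = y \<otimes> t" using fx0_T by blast
    have yS: "y \<in> carrier S" using yt by (simp add: fx_iff)
    have "cj x t = t" using x yt by (simp add: centralizes_T_def)
    then have "cj y t = t" using yt yS T_conj_trivial by (simp add: conjugate_comp)
    then have "y \<otimes> t = t \<otimes> y" using conjugate_fix_iff yS yt by simp
    then have "x [^] q = y [^] q \<otimes> t [^] q" unfolding yt(3) using yt(2) yS by (intro pow_mult_distrib) simp_all
    then have "t [^] q = inv (y [^] q) \<otimes> x [^] q" using yS yt by (simp add: m_assoc[symmetric])
    then have "t [^] q \<in> ?D" using x yt(1) by blast
    then show "x \<in> (\<lambda>(y, t). y \<otimes> t) ` (fx 0 \<times> ?R)" using yt by force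
  qed
  then show ?thesis using fR finite_fx finite_subset by blast
qed

text \<open>Such a subgroup is determined by its image in the finite group S/T.\<close>

lemma finite_T_supergroups: "finite {P. subgroup P S \<and> T \<subseteq> P}"
proof -
  have "inj_on (\<lambda>P. (\<lambda>x. T #> x) ` P) {P. subgroup P S \<and> T \<subseteq> P}"
  proof (rule inj_onI)
    fix P Q assume P: "P \<in> {P. subgroup P S \<and> T \<subseteq> P}" and Q: "Q \<in> {P. subgroup P S \<and> T \<subseteq> P}"
      and eq: "(\<lambda>x. T #> x) ` P = (\<lambda>x. T #> x) ` Q"
    have sub: "A \<subseteq> B" if A: "subgroup A S" and B: "subgroup B S" "T \<subseteq> B"
      and AB: "(\<lambda>x. T #> x) ` A = (\<lambda>x. T #> x) ` B" for A B
    proof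
      fix x assume x: "x \<in> A"
      then obtain y where y: "y \<in> B" "T #> x = T #> y" using AB by blast
      have S: "x \<in> carrier S" "y \<in> carrier S" using sub_mem A B x y by blast+
      then have "x \<otimes> inv y \<in> B" using T_coset_eq_iff y(2) B(2) by blast
      then have "x \<otimes> inv y \<otimes> y \<in> B" using subgroup.m_closed[OF B(1)] y(1) by blast
      then show "x \<in> B" using S by (simp add: m_assoc)
    qed
    show "P = Q" using sub[of P Q] sub[of Q P] P Q eq by blast
  qed
  moreover have "(\<lambda>P. (\<lambda>x. T #> x) ` P) ` {P. subgroup P S \<and> T \<subseteq> P} \<subseteq> Pow ((\<lambda>x. T #> x) ` carrier S)"
    using sub_mem by blast
  ultimately show ?thesis using finite_T_cosets by (meson finite_Pow_iff finite_imageD finite_subset)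
qed

lemma iter_T: "t \<in> T \<Longrightarrow> (\<psi> ^^ n) t \<in> T"
proof -
  have "(\<psi> ^^ n) ` T = T"
    by (rule T_hom(1)) (auto intro: iter_hom(1,2) inj_on_subset[OF iter_hom(3)])
  then show "t \<in> T \<Longrightarrow> (\<psi> ^^ n) t \<in> T" by blast
qed

lemma in_linking_i:
  assumes H: "subgroup H S" "H \<subseteq> fx i" and R: "R \<in> Det i" "R \<inter> fx i = H"
  shows "H \<in> Ob (linking_i p S F L \<psi> \<Psi> i)"
proof -
  have "H \<in> det_traces p S F \<psi> i" unfolding det_traces_def using R by blast
  then show ?thesis using H Si_subgroup_iff by (auto simp: linking_i_def)
qed

text \<open>Conjugating an element of \<open>H\<close> that inverts \<open>T\<close> into a fixed finite set confines \<open>H\<close> to finitely many subgroups.\<close>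

lemma small_conjugate_bounded:
  assumes B: "\<forall>X. subgroup X S \<longrightarrow> small X \<longrightarrow> X \<inter> T \<subseteq> B"
    and H: "subgroup H S" "H \<subseteq> fx i" "small H" and h: "h \<in> H" "\<not> centralizes_T h"
  defines "C \<equiv> {x \<in> carrier S. centralizes_T x \<and> x [^] q \<in> B}"
  shows "\<exists>\<tau>\<in>twisting i invol. cj \<tau> ` H \<subseteq> C \<union> (\<lambda>(c, y). c \<otimes> inv y) ` (C \<times> fx 0)"
proof -
  have hS: "h \<in> carrier S" using sub_mem[OF H(1) h(1)] .
  have p2: "p = 2" and ih: "inverts_T h" using centralizes_or_inverts[OF hS] h(2) by auto
  obtain y t where yt: "y \<in> fx 0" "t \<in> T" "h = y \<otimes> t" using fx0_T[OF hS] by blast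
  have yS: "y \<in> carrier S" using yt(1) by (simp add: fx_iff)
  have iy: "inverts_T y"
  proof -
    have "cj y s = inv s" if s: "s \<in> T" for s
    proof -
      have "cj h s = cj y (cj t s)" using yt yS s by (simp add: conjugate_comp)
      then show ?thesis using ih s yt T_conj_trivial by (simp add: inverts_T_def)
    qed
    then show ?thesis by (simp add: inverts_T_def)
  qed
  \<comment> \<open>Conjugation by \<tau> multiplies the inverting element h = t^-1 y by \<tau>^2; a
    square root of t therefore moves h to y, which lies in S_0.\<close>
  obtain \<tau> where \<tau>: "\<tau> \<in> T" "\<tau> [^] p = t" using torus_p_divisible1[OF yt(2)] by blast
  have tt: "\<tau> \<otimes> \<tau> = t" using \<tau> p2 by (simp add: numeral_2_eq_2)
  have \<tau>S: "\<tau> \<in> carrier S" using \<tau> by simp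
  have yfi: "y \<in> fx i" using fx_mono[of 0 i] yt(1) by blast
  have tfi: "t \<in> fx i"
  proof -
    have "t = inv y \<otimes> h" using yt yS by (simp add: m_assoc[symmetric])
    then show ?thesis using yfi h(1) H(2) subgroup.m_closed[OF fx_subgroup] subgroup.m_inv_closed[OF fx_subgroup] by blast
  qed
  have "\<tau> \<in> twisting i invol"
  proof -
    \<comment> \<open>The defect of \<tau> from being fixed has trivial square, because \<tau>^2 = t
      is fixed.\<close>
    let ?s = "inv \<tau> \<otimes> ps i \<tau>"
    have psT: "ps i \<tau> \<in> T" by (rule iter_T[OF \<tau>(1)])
    have sT: "?s \<in> T" using psT \<tau>(1) by simp
    have "ps i \<tau> \<otimes> ps i \<tau> = \<tau> \<otimes> \<tau>" using iter_hom(2)[OF \<tau>S \<tau>S, of "p ^ i"] tt tfi by (simp add: fx_iff)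
    moreover have "?s \<otimes> ?s = (inv \<tau> \<otimes> inv \<tau>) \<otimes> (ps i \<tau> \<otimes> ps i \<tau>)"
      using psT \<tau>(1) torus_commute[of "ps i \<tau>" "inv \<tau>"] by (simp add: m_assoc) (metis T_inv T_mem T_mult m_assoc)
    ultimately have "?s \<otimes> ?s = \<one>" using \<tau>S by (simp add: m_assoc) (simp add: m_assoc[symmetric])
    then have "?s = \<one> \<or> ?s = invol" using invol(3)[OF p2 sT] by blast
    moreover have "ps i \<tau> = \<tau> \<otimes> ?s" using psT \<tau>S by (simp add: m_assoc[symmetric])
    ultimately show ?thesis using \<tau>(1) \<tau>S by (auto simp: twisting_def)
  qed
  moreover have "cj \<tau> ` H \<subseteq> C \<union> (\<lambda>(c, y). c \<otimes> inv y) ` (C \<times> fx 0)"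
  proof
    let ?H = "cj \<tau> ` H"
    have sH: "subgroup ?H S" by (rule subgroup_conjugate[OF H(1) \<tau>S])
    have "small ?H" using small_cj[OF \<tau>S subgroup.subset[OF H(1)]] H(3) by blast
    then have HB: "?H \<inter> T \<subseteq> B" using B sH by blast
    have inC: "x \<in> C" if x: "x \<in> ?H" "centralizes_T x" for x
    proof -
      have xS: "x \<in> carrier S" using sub_mem[OF sH x(1)] .
      have "x [^] q \<in> ?H" using cyc_subset[OF sH x(1)] by (auto simp: cyc_def)
      then have "x [^] q \<in> B" using HB q_props(2)[OF xS] by blast
      then show ?thesis using x xS by (simp add: C_def)
    qed
    have "h = inv t \<otimes> y"
    proof -
      have "cj y t = inv t" using iy yt(2) by (simp add: inverts_T_def)
      then have "y \<otimes> t = inv t \<otimes> y" using yS yt(2) inv_solve_right'[of "inv t" "y \<otimes> t" y] by (simp add: conjugate_def)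
      then show ?thesis using yt(3) by simp
    qed
    then have "cj \<tau> h = y" using conj_by_T(2)[OF \<tau>(1) hS ih] tt yt(2) yS by (simp add: m_assoc[symmetric])
    then have yH: "y \<in> ?H" using h(1) by blast
    fix x assume x: "x \<in> ?H"
    have xS: "x \<in> carrier S" using sub_mem[OF sH x] .
    show "x \<in> C \<union> (\<lambda>(c, y). c \<otimes> inv y) ` (C \<times> fx 0)"
    proof (cases "centralizes_T x")
      case True then show ?thesis using inC[OF x] by blast
    next
      case False
      \<comment> \<open>The product of the two inverting elements x and y centralizes T, so x is
        y^-1 up to a factor in \<open>C\<close>.\<close>
      then have "inverts_T x" using centralizes_or_inverts[OF xS] by blast
      then have "centralizes_T (x \<otimes> y)" using centralizes_mult[OF xS yS _ iy] by blast
      then have "x \<otimes> y \<in> C" using inC subgroup.m_closed[OF sH x yH] by blast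
      moreover have "x = x \<otimes> y \<otimes> inv y" using xS yS by (simp add: m_assoc)
      ultimately have "x = (\<lambda>(c, y). c \<otimes> inv y) (x \<otimes> y, y)" "(x \<otimes> y, y) \<in> C \<times> fx 0" using yt(1) by (simp only: prod.case, blast)
      then show ?thesis by blast
    qed
  qed
  ultimately show ?thesis by blast
qed

lemma eventually_T_not_subset:
  assumes "finite B" shows "eventually (\<lambda>i. \<not> T \<inter> fx i \<subseteq> B) sequentially"
proof -
  have "\<not> T \<subseteq> B" using T_infinite assms by (metis finite_subset)
  then obtain t where t: "t \<in> T" "t \<notin> B" by blast
  show ?thesis using eventually_fx[OF T_mem[OF t(1)]] by (rule eventually_mono) (use t in blast)
qed

theorem approximates: "approximates_by_finite p S F L \<psi> \<Psi>"
proof -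
  obtain B where B: "finite B" "B \<subseteq> T" "\<forall>X. subgroup X S \<longrightarrow> small X \<longrightarrow> X \<inter> T \<subseteq> B" using small_bounded by blast
  define C where "C = {x \<in> carrier S. centralizes_T x \<and> x [^] q \<in> B}"
  define Y where "Y = C \<union> (\<lambda>(c, y). c \<otimes> inv y) ` (C \<times> fx 0)"
  have finY: "finite Y" using finite_centralizing_roots[OF B(1,2)] finite_fx unfolding Y_def C_def by blast
  \<comment> \<open>The case z = \<one>, for the subgroups HT; it will be used with \<tau> =
    \<one>.\<close>
  have E1: "eventually (\<lambda>i. \<forall>P\<in>{P. subgroup P S \<and> T \<subseteq> P}. \<not> centric S F P \<longrightarrow>
      (\<forall>\<tau>\<in>twisting i \<one>. \<not> centric (Si i) (Fi i) (twist_dom i \<tau> P))) sequentially"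
  proof (rule eventually_ball_finite[OF finite_T_supergroups], intro ballI)
    fix P assume P: "P \<in> {P. subgroup P S \<and> T \<subseteq> P}"
    then have "relevant \<one> P" by (auto simp: relevant_def subgroup.one_closed)
    moreover have "admissible \<one>" by (simp add: admissible_def)
    ultimately show "eventually (\<lambda>i. \<not> centric S F P \<longrightarrow> (\<forall>\<tau>\<in>twisting i \<one>. \<not> centric (Si i) (Fi i) (twist_dom i \<tau> P))) sequentially"
      using eventually_not_centric[of \<one> P] by (cases "centric S F P") auto
  qed
  \<comment> \<open>The case of the involution, for the conjugates \<tau> H \<tau>^-1 of small H,
    which lie in the finite set \<open>Y\<close>.\<close>
  have E2: "eventually (\<lambda>i. noncentral \<longrightarrow> invol \<in> fx i \<and> (\<forall>P\<in>{P. subgroup P S \<and> P \<subseteq> Y \<and> invol \<in> P}. \<not> centric S F P \<longrightarrow>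
      (\<forall>\<tau>\<in>twisting i invol. \<not> centric (Si i) (Fi i) (twist_dom i \<tau> P)))) sequentially"
  proof (cases noncentral)
    case True
    note iv = invol[OF noncentral_p[OF True]]
    have fin: "finite {P. subgroup P S \<and> P \<subseteq> Y \<and> invol \<in> P}"
      by (rule finite_subset[of _ "Pow Y"]) (use finY in auto)
    have "eventually (\<lambda>i. \<forall>P\<in>{P. subgroup P S \<and> P \<subseteq> Y \<and> invol \<in> P}. \<not> centric S F P \<longrightarrow>
        (\<forall>\<tau>\<in>twisting i invol. \<not> centric (Si i) (Fi i) (twist_dom i \<tau> P))) sequentially"
    proof (rule eventually_ball_finite[OF fin], intro ballI)
      fix P assume P: "P \<in> {P. subgroup P S \<and> P \<subseteq> Y \<and> invol \<in> P}"
      then have "relevant invol P" using iv(2) by (auto simp: relevant_def)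
      moreover have "admissible invol" using True by (simp add: admissible_def)
      ultimately show "eventually (\<lambda>i. \<not> centric S F P \<longrightarrow> (\<forall>\<tau>\<in>twisting i invol. \<not> centric (Si i) (Fi i) (twist_dom i \<tau> P))) sequentially"
        using eventually_not_centric[of invol P] by (cases "centric S F P") auto
    qed
    then show ?thesis using eventually_conj[OF eventually_fx[OF T_mem[OF iv(1)]]] True by simp
  qed simp
  have "eventually (\<lambda>i. \<forall>H. centric (Si i) (Fi i) H \<and> H \<notin> Ob (linking_i p S F L \<psi> \<Psi> i) \<longrightarrow>
      (\<exists>K\<in>fus_conj (Si i) (Fi i) H. out_conj (Si i) (Fi i) K \<inter> p_core p (fus_out (Si i) (Fi i) K) \<noteq> {\<one>\<^bsub>fus_out (Si i) (Fi i) K\<^esub>})) sequentially"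
    using eventually_conj[OF E1 eventually_conj[OF E2 eventually_T_not_subset[OF B(1)]]]
  proof (rule eventually_mono, intro allI impI)
    fix i H
    assume ev: "(\<forall>P\<in>{P. subgroup P S \<and> T \<subseteq> P}. \<not> centric S F P \<longrightarrow> (\<forall>\<tau>\<in>twisting i \<one>. \<not> centric (Si i) (Fi i) (twist_dom i \<tau> P))) \<and>
      (noncentral \<longrightarrow> invol \<in> fx i \<and> (\<forall>P\<in>{P. subgroup P S \<and> P \<subseteq> Y \<and> invol \<in> P}. \<not> centric S F P \<longrightarrow>
        (\<forall>\<tau>\<in>twisting i invol. \<not> centric (Si i) (Fi i) (twist_dom i \<tau> P)))) \<and> \<not> T \<inter> fx i \<subseteq> B"
      and HH: "centric (Si i) (Fi i) H \<and> H \<notin> Ob (linking_i p S F L \<psi> \<Psi> i)"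
    have cen: "centric (Si i) (Fi i) H" and nOb: "H \<notin> Ob (linking_i p S F L \<psi> \<Psi> i)" using HH by auto
    note H = centric_Si(1,2)[OF cen]
    have HS: "H \<subseteq> carrier S" by (rule subgroup.subset[OF H(1)])
    have "\<not> small H"
    proof
      assume sm: "small H"
      have ncH: "\<not> centric S F H"
      proof
        assume cH: "centric S F H"
        have "bullet p S F H = H" using bullet_eq[OF HS] sm by simp
        moreover have HI: "H \<inter> fx i = H" using H(2) by blast
        ultimately have "H \<in> Det i" using cH sm by (simp add: Det_iff linking_bullet_iff determined_def)
        then show False using in_linking_i[OF H _ HI] nOb by blast
      qed
      have "\<not> (\<forall>h\<in>H. centralizes_T h)"
      proof
        assume c: "\<forall>h\<in>H. centralizes_T h"
        have "T \<subseteq> centralizer S H"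
        proof
          fix t assume t: "t \<in> T"
          then have "cj t h = h" if "h \<in> H" for h using conj_by_T(1)[OF t] c HS that by blast
          then show "t \<in> centralizer S H" using centralizer_iff[OF HS] t by simp
        qed
        then have "T \<inter> fx i \<subseteq> H \<inter> T" using centric_Si(4)[OF cen] by blast
        then show False using B(3) H(1) sm ev by blast
      qed
      then obtain h where h: "h \<in> H" "\<not> centralizes_T h" by blast
      have nc: "noncentral" using h HS unfolding noncentral_def by blast
      note iv = invol[OF noncentral_p[OF nc]]
      obtain \<tau> where \<tau>: "\<tau> \<in> twisting i invol" "cj \<tau> ` H \<subseteq> Y"
        using small_conjugate_bounded[OF B(3) H sm h] unfolding Y_def C_def by blast
      note \<tau>S = twisting_carrier[OF \<tau>(1)]
      have ivS: "invol \<in> carrier S" using iv(1) by simp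
      \<comment> \<open>The involution is central in S and lies in S_i for large i, so centricity of
        H in F_i puts it into H.\<close>
      have "invol \<in> H"
      proof -
        have "cj invol x = x" if "x \<in> H" for x
        proof -
          have xS: "x \<in> carrier S" using that HS by blast
          show ?thesis using iv(6)[OF xS] conjugate_fix_iff[OF xS ivS] conjugate_fix_iff[OF ivS xS] by simp
        qed
        then have "invol \<in> centralizer S H" using centralizer_iff[OF HS] ivS by simp
        then show ?thesis using centric_Si(4)[OF cen] ev nc by blast
      qed
      then have "invol \<in> cj \<tau> ` H" using iv(6)[OF \<tau>S] by force
      moreover have sH: "subgroup (cj \<tau> ` H) S" by (rule subgroup_conjugate[OF H(1) \<tau>S])
      moreover have "\<not> centric S F (cj \<tau> ` H)"
      proof
        assume "centric S F (cj \<tau> ` H)"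
        then have "centric S F (cj (inv \<tau>) ` cj \<tau> ` H)" using centric_cj \<tau>S by simp
        moreover have "cj (inv \<tau>) ` cj \<tau> ` H = (\<lambda>x. x) ` H" unfolding image_image
          by (rule image_cong) (use \<tau>S HS in auto)
        ultimately show False using ncH by simp
      qed
      ultimately have "\<not> centric (Si i) (Fi i) (twist_dom i \<tau> (cj \<tau> ` H))" using ev nc \<tau> by blast
      moreover have "twist_dom i \<tau> (cj \<tau> ` H) = H"
      proof -
        have "x \<in> H" if "x \<in> carrier S" "cj \<tau> x \<in> cj \<tau> ` H" for x
        proof -
          obtain y where "y \<in> H" "cj \<tau> x = cj \<tau> y" using \<open>cj \<tau> x \<in> cj \<tau> ` H\<close> by blast
          then show ?thesis using \<tau>S HS that(1) by (auto simp: subset_eq)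
        qed
        then show ?thesis using H(2) by (auto simp: twist_dom_def fx_iff)
      qed
      ultimately show False using cen by simp
    qed
    moreover have "\<not> T \<inter> fx i \<subseteq> H"
    proof
      assume TH: "T \<inter> fx i \<subseteq> H"
      note HT = XT_subgroup[OF H(1)]
      have HI: "(H <#> T) \<inter> fx i = H"
      proof (intro equalityI subsetI)
        fix x assume x: "x \<in> (H <#> T) \<inter> fx i"
        then obtain u t where ut: "u \<in> H" "t \<in> T" "x = u \<otimes> t" by (auto simp: XT_iff)
        have uS: "u \<in> carrier S" "u \<in> fx i" using ut HS H(2) by blast+
        have "t = inv u \<otimes> x" using ut uS by (simp add: m_assoc[symmetric])
        then have "t \<in> fx i" using uS x by (simp add: subgroup.m_closed[OF fx_subgroup] subgroup.m_inv_closed[OF fx_subgroup])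
        then show "x \<in> H" using TH ut subgroup.m_closed[OF H(1)] by blast
      qed (use HT(2) H(2) in auto)
      have "centric S F (H <#> T)"
      proof (rule ccontr)
        assume "\<not> centric S F (H <#> T)"
        moreover have "\<one> \<in> twisting i \<one>" by (simp add: twisting_def iter_inv(2))
        ultimately have "\<not> centric (Si i) (Fi i) (twist_dom i \<one> (H <#> T))" using ev HT(1,3) by blast
        moreover have "twist_dom i \<one> (H <#> T) = (H <#> T) \<inter> fx i" by (auto simp: twist_dom_def fx_iff)
        ultimately show False using cen HI by simp
      qed
      then have "H <#> T \<in> Det i"
        using HT(3) HI bullet_eq[OF HS] \<open>\<not> small H\<close> by (simp add: Det_iff linking_bullet_iff determined_def)
      then show False using in_linking_i[OF H _ HI] nOb by blast
    qed
    ultimately have "out_conj (Si i) (Fi i) H \<inter> p_core p (fus_out (Si i) (Fi i) H) \<noteq> {\<one>\<^bsub>fus_out (Si i) (Fi i) H\<^esub>}"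
      by (rule p_core_nontrivial[OF cen])
    moreover have "H \<in> fus_conj (Si i) (Fi i) H"
    proof -
      interpret A: aut_fusion "Si i" "Fi i" H by (rule aut_fusion_Fi[OF H])
      show ?thesis using A.id_in A.P by (auto simp: fus_conj_def)
    qed
    ultimately show "\<exists>K\<in>fus_conj (Si i) (Fi i) H. out_conj (Si i) (Fi i) K \<inter> p_core p (fus_out (Si i) (Fi i) K) \<noteq> {\<one>\<^bsub>fus_out (Si i) (Fi i) K\<^esub>}"
      by blast
  qed
  then show ?thesis unfolding approximates_by_finite_def eventually_sequentially Let_def .
qed

end

theorem theoremB:
  fixes p :: nat
    and S :: "('a, 'b) monoid_scheme"
    and F :: "'a fusion"
    and L :: "('a, 'm) linking_system"
    and \<iota> :: "'a set \<Rightarrow> 'm"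
    and \<zeta> :: "nat \<Rightarrow> nat"
    and \<psi> :: "'a \<Rightarrow> 'a"
    and \<Psi> :: "'m \<Rightarrow> 'm"
  assumes "p_local_compact_group p S F L"
    and "rk p S = 1"
    and "inclusion_liftings S L \<iota>"
    and "unstable_adams_operation p S F L \<iota> \<zeta> \<psi> \<Psi>"
    and "torus_exhausted p S \<psi>"
    and "fixes_representatives p S F L \<psi> \<Psi>"
  shows "approximates_by_finite p S F L \<psi> \<Psi>"
proof -
  interpret rank_one_operation p S F L \<iota> \<zeta> \<psi> \<Psi>
    by (intro rank_one_operation.intro rank_one_operation_axioms.intro assms)
  show ?thesis by (rule approximates)
qed

end
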